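(* Let $(\eta)=\{\eta_n\}_{n=0}^\infty$ be a sequence of complex numbers. (a) If $1<p<\infty$ and $\mathcal R_{(\eta)}\in\mathcal B(H^p)$, then $$M_p(r,F_{(\eta)}')=O\left(\frac{\log\frac{1}{1-r}}{(1-r)^{1-\frac1p}}\right),\quad\text{as } r\to 1.$$ (b) If $1<p\le 2$ and $F_{(\eta)}\in\Lambda^p_{1/p}$, then $\mathcal R_{(\eta)}\in\mathcal B(H^p)$. (c) If $2<p<\infty$ and $F_{(\eta)}\in\Lambda^q_{1/q}$ for some $q\in(2,p)$, then $\mathcal R_{(\eta)}\in\mathcal B(H^p)$. (d) $\mathcal R_{(\eta)}\in\mathcal B(H^2)$ if and only if $F_{(\eta)}\in\Lambda^2_{1/2}$.
   Context: $\mathbb D$ is the open unit disc in $\mathbb C$, and $\mathrm{Hol}(\mathbb D)$ is the space of analytic functions in $\mathbb D$. For $f\in \mathrm{Hol}(\mathbb D)$, $0<r<1$, $0<p<\infty$, $M_p(r,f)=\left(\frac1{2\pi}\int_0^{2\pi}|f(re^{it})|^p\,dt\right)^{1/p}$. The Hardy space $H^p$ consists of those $f\in\mathrm{Hol}(\mathbb D)$ with $\|f\|_{H^p}=\sup_{0<r<1}M_p(r,f)<\infty$. Rhaly operator: for a complex sequence $(\eta)=\{\eta_n\}_{n=0}^\infty$ and $f(z)=\sum_{n=0}^\infty a_nz^n\in\mathrm{Hol}(\mathbb D)$, formally $\mathcal R_{(\eta)}(f)(z)=\sum_{n=0}^\infty\eta_n\left(\sum_{k=0}^na_k\right)z^n$,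 whenever the right-hand side defines an analytic function in $\mathbb D$. If the power series $\sum\eta_nz^n$ defines an analytic function in $\mathbb D$, set $F_{(\eta)}(z)=\sum_{n=0}^\infty\eta_nz^n$. (On a subspace of $\mathrm{Hol}(\mathbb D)$ containing the constants, $\mathcal R_{(\eta)}$ is well defined into $\mathrm{Hol}(\mathbb D)$ if and only if this power series defines an analytic function in $\mathbb D$; a hypothesis such as $F_{(\eta)}\in X$ includes that it does.) For Banach spaces $X,Y$, $\mathcal B(X,Y)$ denotes the continuous linear operators from $X$ into $Y$, and $\mathcal B(X)=\mathcal B(X,X)$. The notation $\mathcal R_{(\eta)}\in\mathcal B(X,Y)$ means that $\mathcal R_{(\eta)}$ is well defined on $X$, maps $X$ into $Y$, and is bounded. Mean Lipschitz spaces: for $1\le p<\infty$ and $f$ with boundary values $f(e^{i\theta})$ a.e., $\omega_p(\delta,f)=\sup_{0<|t|\le\delta}\left(\frac1{2\pi}\int_{-\pi}^{\pi}|f(e^{i(\theta+t)})-f(e^{i\theta})|^p\,d\theta\right)^{1/p}$. For $0<\alpha\le1$, $\Lambda^p_\alpha$ is the space of $f\in H^p$ with $\omega_p(\delta,f)=O(\delta^\alpha)$ as $\delta\to0$; equivalently (Hardy–Littlewood), $f\in\mathrm{Hol}(\mathbb D)$ with $M_p(r,f')=O((1-r)^{\alpha-1})$ as $r\to1$. *)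

theory Defs
  imports "HOL-Complex_Analysis.Complex_Analysis" "HOL-Library.Landau_Symbols"
begin

text \<open>
  Functions on the unit disc are represented by total functions of type
  \<^typ>\<open>complex \<Rightarrow> complex\<close>; none of the notions below depends on the values outside
  \<^term>\<open>ball (0::complex) 1\<close>.
\<close>

definition integral_mean :: "real \<Rightarrow> real \<Rightarrow> (complex \<Rightarrow> complex) \<Rightarrow> real" where
  "integral_mean p r f =
     (1 / (2 * pi) *
       (LINT t:{0..2*pi}|lebesgue. cmod (f (complex_of_real r * cis t)) powr p)) powr (1 / p)"

definition hardy_space :: "real \<Rightarrow> (complex \<Rightarrow> complex) set" where
  "hardy_space p =
     {f. f holomorphic_on ball 0 1 \<and> bdd_above ((\<lambda>r. integral_mean p r f) ` {0<..<1})}"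

definition hardy_norm :: "real \<Rightarrow> (complex \<Rightarrow> complex) \<Rightarrow> real" where
  "hardy_norm p f = (SUP r\<in>{0<..<1}. integral_mean p r f)"

definition boundary_value :: "(complex \<Rightarrow> complex) \<Rightarrow> real \<Rightarrow> complex" where
  "boundary_value f \<theta> = Lim (at_left 1) (\<lambda>r::real. f (complex_of_real r * cis \<theta>))"

definition has_boundary_values :: "(complex \<Rightarrow> complex) \<Rightarrow> bool" where
  "has_boundary_values f \<longleftrightarrow>
     (AE \<theta> in lebesgue.
        ((\<lambda>r::real. f (complex_of_real r * cis \<theta>)) \<longlongrightarrow> boundary_value f \<theta>) (at_left 1))"

text \<open>
  If \<open>f\<close> lies in \<open>H\<^sup>p\<close> and has radial limits almost everywhere, the integrals below are finite and
  the supremum is that of a bounded set (Fatou's lemma puts the boundary function in \<open>L\<^sup>p\<close>), so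
  neither the integral nor the supremum takes a default value.
\<close>

definition mean_modulus :: "real \<Rightarrow> real \<Rightarrow> (complex \<Rightarrow> complex) \<Rightarrow> real" where
  "mean_modulus p \<delta> f =
     (SUP t\<in>{t. 0 < \<bar>t\<bar> \<and> \<bar>t\<bar> \<le> \<delta>}.
        (1 / (2 * pi) *
          (LINT \<theta>:{-pi..pi}|lebesgue.
             cmod (boundary_value f (\<theta> + t) - boundary_value f \<theta>) powr p)) powr (1 / p))"

text \<open>
  Functions in \<open>H\<^sup>p\<close> have radial limits almost everywhere by Fatou's theorem, so the second
  conjunct does not restrict the space; it makes explicit that \<^const>\<open>boundary_value\<close> is meaningful.
\<close>

definition mean_lipschitz :: "real \<Rightarrow> real \<Rightarrow> (complex \<Rightarrow> complex) set" where
  "mean_lipschitz p \<alpha> =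
     {f \<in> hardy_space p. has_boundary_values f \<and>
        (\<lambda>\<delta>. mean_modulus p \<delta> f) \<in> O[at_right 0](\<lambda>\<delta>. \<delta> powr \<alpha>)}"

text \<open>
  A power series defines an analytic function in the disc iff its radius of convergence is at
  least 1.
\<close>

definition analytic_in_disc :: "complex fps \<Rightarrow> bool" where
  "analytic_in_disc A \<longleftrightarrow> fps_conv_radius A \<ge> 1"

definition rhaly_fps :: "(nat \<Rightarrow> complex) \<Rightarrow> (complex \<Rightarrow> complex) \<Rightarrow> complex fps" where
  "rhaly_fps \<eta> f = Abs_fps (\<lambda>n. \<eta> n * (\<Sum>k\<le>n. fps_nth (fps_expansion f 0) k))"

definition rhaly :: "(nat \<Rightarrow> complex) \<Rightarrow> (complex \<Rightarrow> complex) \<Rightarrow> complex \<Rightarrow> complex" where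
  "rhaly \<eta> f = eval_fps (rhaly_fps \<eta> f)"

definition symbol_fun :: "(nat \<Rightarrow> complex) \<Rightarrow> complex \<Rightarrow> complex" where
  "symbol_fun \<eta> = eval_fps (Abs_fps \<eta>)"

text \<open>Linearity is required only on the disc, since functions are identified there.\<close>

definition hardy_operator ::
    "real \<Rightarrow> ((complex \<Rightarrow> complex) \<Rightarrow> complex \<Rightarrow> complex) \<Rightarrow> bool" where
  "hardy_operator p T \<longleftrightarrow>
     (\<forall>f\<in>hardy_space p. T f \<in> hardy_space p) \<and>
     (\<forall>f\<in>hardy_space p. \<forall>g\<in>hardy_space p. \<forall>z\<in>ball 0 1.
        T (\<lambda>w. f w + g w) z = T f z + T g z) \<and>
     (\<forall>f\<in>hardy_space p. \<forall>c. \<forall>z\<in>ball 0 1. T (\<lambda>w. c * f w) z = c * T f z) \<and>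
     (\<exists>C. \<forall>f\<in>hardy_space p. hardy_norm p (T f) \<le> C * hardy_norm p f)"

definition rhaly_bounded :: "real \<Rightarrow> (nat \<Rightarrow> complex) \<Rightarrow> bool" where
  "rhaly_bounded p \<eta> \<longleftrightarrow>
     (\<forall>f\<in>hardy_space p. analytic_in_disc (rhaly_fps \<eta> f)) \<and> hardy_operator p (rhaly \<eta>)"

definition symbol_in :: "(nat \<Rightarrow> complex) \<Rightarrow> (complex \<Rightarrow> complex) set \<Rightarrow> bool" where
  "symbol_in \<eta> X \<longleftrightarrow> analytic_in_disc (Abs_fps \<eta>) \<and> symbol_fun \<eta> \<in> X"

end

theory Submission
  imports Defs
begin

text \<open>
  Let \<open>F\<close> be the symbol, \<open>G z = f z / (1 - z)\<close>, \<open>D = z d/dz\<close> and \<open>h = rhaly \<eta> f\<close>. The coefficients of \<open>G\<close> are the partial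
  sums of those of \<open>f\<close>, so \<open>h\<close> is the Hadamard product of \<open>F\<close> and \<open>G\<close>: a convolution over circles.
  Poisson's formula and Hilbert's inequality show that the \<open>L\<^sup>1\<close> mean \<open>\<Gamma> \<rho>\<close> of \<open>G\<close> over the circle of radius
  \<open>\<rho>\<close> satisfies \<open>\<integral> \<Gamma> \<rho> ^ p d\<rho> \<le> C * hardy_norm p f ^ p\<close>. The Lipschitz condition on \<open>F\<close> means that the \<open>q\<close>-th mean of
  \<open>F'\<close> over the circle of radius \<open>r\<close> is at most \<open>C * (1 - r) powr (1 / q - 1)\<close> (Hardy--Littlewood).

  For \<open>p \<le> 2\<close> let \<open>H\<close> be a dilation of \<open>h\<close>, corrected by a multiple of \<open>D h\<close> so that its radial derivative contains only
  \<open>D (D h)\<close>. In the derivative of the \<open>p\<close>-th power mean of \<open>H\<close>, one \<open>D\<close> can be moved onto \<open>\<bar>H\<bar> ^ (p - 2) * cnj H\<close>, a Hoelder function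
  of \<open>H\<close> of exponent \<open>p - 1 \<le> 1\<close>; the result is bounded by \<open>C * \<Gamma> \<rho> ^ p\<close> and can be integrated.

  For \<open>p > q\<close>, \<open>\<bar>h\<bar>\<close> is dominated by the integral over \<open>\<rho>\<close> of the convolutions of \<open>\<bar>D F\<bar>\<close> and \<open>\<bar>G\<bar>\<close>. Since the estimate
  for \<open>F'\<close> self-improves to all exponents \<open>s \<ge> q\<close>, these positive functions can be measured in exponents on either
  side of \<open>p\<close>, which makes them almost orthogonal.

  Conversely, testing the operator on \<open>(1 - z) * \<rho> z / (1 - \<rho> z)\<^sup>2\<close> gives the estimate for \<open>F'\<close> with \<open>q = p\<close>, even without the
  logarithm, and integrating \<open>F'\<close> recovers the Lipschitz condition.
\<close>

section \<open>Integration over the circle\<close>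

text \<open>Let \<open>m \<rho>\<close> denote the bound for the \<open>p\<close>-th mean of
  \<open>D h\<close> on the circle of radius \<open>\<rho>^2\<close> that Young's inequality gives
  in the case \<open>q = p\<close>: it is
  \<open>C * (1 - \<rho>) powr (1 / p - 1) * \<Gamma> \<rho>\<close>, where only the
  \<open>p\<close>-th power of \<Gamma> is known to be integrable. Integrating it along the radius
  with Hoelder's inequality would require \<open>1 / (1 - \<rho>)\<close> to be integrable, so the
  plain argument fails by a logarithm. The two boundedness proofs are two ways around this. For
  \<open>p \<le> 2\<close> the cancellation in the \<open>p\<close>-th power mean is kept; the
  corrector carries a factor of size \<open>1 - \<rho>\<close>, and the resulting
  \<open>(1 - \<rho>) powr (p - 1) * m \<rho> powr p\<close> is exactly a multiple of
  \<open>\<Gamma> \<rho> powr p\<close>. For \<open>q < p\<close> moduli are taken at once, and the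
  gap between \<open>1 / q\<close> and \<open>1 / p\<close> buys a power of decay that beats the
  logarithm. The radius \<open>\<rho>^2\<close> arises because a Hadamard product of two series at
  radius \<rho> lives at radius \<open>\<rho>^2\<close>; going inwards once more, to
  \<open>\<rho>^4\<close>, pays for a second derivative.\<close>

definition circ :: "real measure" where
  "circ = density lborel (\<lambda>t. ennreal (indicator {-pi..pi} t / (2 * pi)))"

lemma sets_circ [simp, measurable_cong]: "sets circ = sets borel"
  by (simp add: circ_def)

lemma space_circ [simp]: "space circ = UNIV"
  by (simp add: circ_def)

lemma nn_integral_circ:
  assumes [measurable]: "f \<in> borel_measurable borel"
  shows "(\<integral>\<^sup>+t. f t \<partial>circ) = ennreal (1 / (2 * pi)) * (\<integral>\<^sup>+t. f t * indicator {-pi..pi} t \<partial>lborel)"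
proof -
  have "(\<integral>\<^sup>+t. f t \<partial>circ) = (\<integral>\<^sup>+t. ennreal (1 / (2 * pi)) * (f t * indicator {-pi..pi} t) \<partial>lborel)"
    unfolding circ_def
    by (subst nn_integral_density) (auto intro!: nn_integral_cong simp: mult_ac split: split_indicator)
  then show ?thesis by (simp add: nn_integral_cmult)
qed

lemma emeasure_circ_UNIV: "emeasure circ UNIV = 1"
proof -
  have "emeasure circ UNIV = (\<integral>\<^sup>+t. 1 \<partial>circ)" by simp
  also have "\<dots> = ennreal (1 / (2 * pi)) * (\<integral>\<^sup>+t. indicator {-pi..pi} t \<partial>lborel)"
    by (subst nn_integral_circ) auto
  also have "\<dots> = 1"
    by (simp add: ennreal_mult[symmetric] flip: ennreal_1)
  finally show ?thesis .
qed

interpretation circ: finite_measure circ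
  by standard (simp add: emeasure_circ_UNIV)

lemma measure_circ_UNIV [simp]: "measure circ UNIV = 1"
  by (simp add: measure_def emeasure_circ_UNIV)

lemma AE_circ_lborel:
  assumes "AE t in lborel. P t"
  shows "AE t in circ. P t"
  unfolding circ_def using assms by (subst AE_density) auto

lemma AE_circ_range: "AE t in circ. \<bar>t\<bar> \<le> pi"
proof -
  have "0 < 1 / (2 * pi)" by simp
  then show ?thesis unfolding circ_def
    by (subst AE_density) (auto split: split_indicator)
qed

lemma AE_circ_nonzero: "AE t in circ. t \<noteq> 0"
  by (intro AE_circ_lborel AE_lborel_singleton)

lemma integrable_circ_continuous:
  fixes f :: "real \<Rightarrow> 'a::{banach, second_countable_topology}"
  assumes "continuous_on UNIV f"
  shows "integrable circ f"
proof -
  have [measurable]: "f \<in> borel_measurable borel"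
    using assms by (rule borel_measurable_continuous_onI)
  have "integrable lborel (\<lambda>x. indicator {-pi..pi} x *\<^sub>R f x)"
    by (intro borel_integrable_compact) (use assms continuous_on_subset in auto)
  then have "integrable lborel (\<lambda>x. (1 / (2 * pi)) *\<^sub>R (indicator {-pi..pi} x *\<^sub>R f x))"
    by (rule integrable_scaleR_right)
  then show ?thesis
    unfolding circ_def by (subst integrable_density) (auto simp: field_simps)
qed

lemma integral_circ:
  fixes f :: "real \<Rightarrow> 'a::{banach, second_countable_topology}"
  assumes [measurable]: "f \<in> borel_measurable borel"
  shows "(LINT t|circ. f t) = (1 / (2 * pi)) *\<^sub>R (LINT t:{-pi..pi}|lborel. f t)"
proof -
  have "(LINT t|circ. f t) = (LINT t|lborel. (1 / (2 * pi)) *\<^sub>R (indicator {-pi..pi} t *\<^sub>R f t))"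
    unfolding circ_def by (subst integral_density) (auto intro!: Bochner_Integration.integral_cong)
  then show ?thesis by (simp only: set_lebesgue_integral_def integral_scaleR_right)
qed

section \<open>Periodicity and translation invariance on the circle\<close>

text \<open>Half-open windows can be cut and glued without overlap. If two windows start at most one
  period apart, they differ by two pieces that are translates of each other by
  \<open>2 * pi\<close>; whole periods are then added one at a time to reach any other
  start.\<close>

lemma nn_integral_period:
  fixes f :: "real \<Rightarrow> ennreal"
  assumes [measurable]: "f \<in> borel_measurable borel"
    and per: "\<And>x. f (x + 2 * pi) = f x"
  shows "(\<integral>\<^sup>+x. f x * indicator {a..a + 2 * pi} x \<partial>lborel) =
         (\<integral>\<^sup>+x. f x * indicator {b..b + 2 * pi} x \<partial>lborel)"
proof -
  define I where "I A = (\<integral>\<^sup>+x. f x * indicator A x \<partial>lborel)" for A :: "real set"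
  have shift: "I {c + 2 * pi..<d + 2 * pi} = I {c..<d}" for c d
  proof -
    have "I {c + 2 * pi..<d + 2 * pi} =
        (\<integral>\<^sup>+x. f (2 * pi + 1 * x) * indicator {c + 2 * pi..<d + 2 * pi} (2 * pi + 1 * x) \<partial>lborel)"
      unfolding I_def by (subst nn_integral_real_affine[where c = 1 and t = "2 * pi"]) auto
    also have "\<dots> = I {c..<d}"
      unfolding I_def using per
      by (intro nn_integral_cong) (auto simp: add.commute split: split_indicator)
    finally show ?thesis .
  qed
  have split: "I {c..<e} = I {c..<d} + I {d..<e}" if "c \<le> d" "d \<le> e" for c d e
  proof -
    have "I {c..<e} = (\<integral>\<^sup>+x. f x * indicator {c..<d} x + f x * indicator {d..<e} x \<partial>lborel)"
      unfolding I_def using that by (intro nn_integral_cong) (auto split: split_indicator)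
    then show ?thesis unfolding I_def by (simp add: nn_integral_add)
  qed
  have close: "I {c..<c + 2 * pi} = (\<integral>\<^sup>+x. f x * indicator {c..c + 2 * pi} x \<partial>lborel)" for c
    unfolding I_def
    by (intro nn_integral_cong_AE eventually_mono[OF AE_lborel_singleton[of "c + 2 * pi"]])
       (auto split: split_indicator)
  have step: "I {c..<c + 2 * pi} = I {d..<d + 2 * pi}" if "c \<le> d" "d \<le> c + 2 * pi" for c d
    using split[of c d "c + 2 * pi"] split[of d "c + 2 * pi" "d + 2 * pi"] shift[of c d] that
    by (simp add: add.commute)
  have nat: "I {c..<c + 2 * pi} = I {c + 2 * pi * real n..<c + 2 * pi * real n + 2 * pi}" for c n
  proof (induction n)
    case (Suc n)
    then show ?case
      using step[of "c + 2 * pi * real n" "c + 2 * pi * real (Suc n)"] by (simp add: algebra_simps)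
  qed simp
  have le: "I {c..<c + 2 * pi} = I {d..<d + 2 * pi}" if "c \<le> d" for c d
  proof -
    \<comment> \<open>\<open>n\<close> counts the whole periods between \<open>c\<close> and
      \<open>d\<close>; the remaining offset is less than one period, which \<open>step\<close> can
      handle.\<close>
    define n where "n = nat \<lfloor>(d - c) / (2 * pi)\<rfloor>"
    have "real n = of_int \<lfloor>(d - c) / (2 * pi)\<rfloor>" using that unfolding n_def by simp
    then have "real n \<le> (d - c) / (2 * pi)" "(d - c) / (2 * pi) < real n + 1" by linarith+
    then have "c + 2 * pi * real n \<le> d" "d \<le> c + 2 * pi * real n + 2 * pi"
      by (auto simp: field_simps)
    then show ?thesis using nat[of c n] step[of "c + 2 * pi * real n" d] by simp
  qed
  have "I {a..<a + 2 * pi} = I {b..<b + 2 * pi}"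
    using le[of a b] le[of b a] linear[of a b] by metis
  then show ?thesis by (simp add: close)
qed

lemma nn_integral_circ_shift:
  fixes f :: "real \<Rightarrow> ennreal"
  assumes [measurable]: "f \<in> borel_measurable borel" and per: "\<And>x. f (x + 2 * pi) = f x"
  shows "(\<integral>\<^sup>+x. f (x + t) \<partial>circ) = (\<integral>\<^sup>+x. f x \<partial>circ)"
proof -
  have "(\<integral>\<^sup>+x. f (x + t) * indicator {-pi..pi} x \<partial>lborel) =
      (\<integral>\<^sup>+x. f x * indicator {t - pi..t - pi + 2 * pi} x \<partial>lborel)"
    by (subst nn_integral_real_affine[where c = 1 and t = t and f = "\<lambda>x. f x * indicator {t - pi..t - pi + 2 * pi} x"])
       (auto intro!: nn_integral_cong simp: add.commute split: split_indicator)
  also have "\<dots> = (\<integral>\<^sup>+x. f x * indicator {-pi..-pi + 2 * pi} x \<partial>lborel)"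
    by (rule nn_integral_period) (use per in auto)
  finally show ?thesis by (simp add: nn_integral_circ)
qed

text \<open>Positive and negative part are nonnegative periodic functions, to which the
  extended-real version applies.\<close>

lemma integral_circ_shift_real:
  fixes f :: "real \<Rightarrow> real"
  assumes cont: "continuous_on UNIV f" and per: "\<And>x. f (x + 2 * pi) = f x"
  shows "(LINT x|circ. f (x + t)) = (LINT x|circ. f x)"
proof -
  have [measurable]: "f \<in> borel_measurable borel"
    using cont by (rule borel_measurable_continuous_onI)
  have int: "integrable circ f" "integrable circ (\<lambda>x. f (x + t))"
    by (intro integrable_circ_continuous cont continuous_on_compose2[OF cont] continuous_intros; simp)+
  have pos: "(LINT x|circ. max 0 (g (x + t))) = (LINT x|circ. max 0 (g x))"
    if [measurable]: "g \<in> borel_measurable borel" and "\<And>x. g (x + 2 * pi) = g x" for g :: "real \<Rightarrow> real"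
    using nn_integral_circ_shift[of "\<lambda>x. ennreal (max 0 (g x))" t] that
    by (simp add: integral_eq_nn_integral)
  have eq: "(LINT x|circ. g x) = (LINT x|circ. max 0 (g x)) - (LINT x|circ. max 0 (- g x))"
    if "integrable circ g" for g :: "real \<Rightarrow> real"
  proof -
    have "(LINT x|circ. g x) = (LINT x|circ. max 0 (g x) - max 0 (- g x))"
      by (intro Bochner_Integration.integral_cong) auto
    then show ?thesis using that by simp
  qed
  show ?thesis
    using eq[OF int(1)] eq[OF int(2)] pos[of f] pos[of "\<lambda>x. - f x"] per by simp
qed

lemma integral_circ_shift:
  fixes f :: "real \<Rightarrow> complex"
  assumes cont: "continuous_on UNIV f" and per: "\<And>x. f (x + 2 * pi) = f x"
  shows "(LINT x|circ. f (x + t)) = (LINT x|circ. f x)"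
proof -
  have int: "integrable circ f" "integrable circ (\<lambda>x. f (x + t))"
    by (intro integrable_circ_continuous cont continuous_on_compose2[OF cont] continuous_intros; simp)+
  show ?thesis
    using int integral_circ_shift_real[of "\<lambda>x. Re (f x)" t] integral_circ_shift_real[of "\<lambda>x. Im (f x)" t] per
    by (intro complex_eqI) (auto simp flip: integral_Re integral_Im intro!: continuous_intros cont)
qed

text \<open>A bound for the \<open>L\<^sup>p\<close> norm on the circle; avoids powers of extended reals.\<close>

definition Lp_le :: "real \<Rightarrow> (real \<Rightarrow> 'a::real_normed_vector) \<Rightarrow> real \<Rightarrow> bool" where
  "Lp_le p u B \<longleftrightarrow> 0 \<le> B \<and> (\<integral>\<^sup>+t. ennreal (norm (u t) powr p) \<partial>circ) \<le> ennreal (B powr p)"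

lemma Lp_le_mono:
  assumes "Lp_le p u B" "AE t in circ. norm (v t) \<le> norm (u t)" "B \<le> C" "0 < p"
  shows "Lp_le p v C"
proof -
  have "(\<integral>\<^sup>+t. ennreal (norm (v t) powr p) \<partial>circ) \<le> (\<integral>\<^sup>+t. ennreal (norm (u t) powr p) \<partial>circ)"
    by (intro nn_integral_mono_AE eventually_mono[OF assms(2)] ennreal_leI powr_mono2) (use assms in auto)
  also have "\<dots> \<le> ennreal (B powr p)" using assms by (auto simp: Lp_le_def)
  also have "\<dots> \<le> ennreal (C powr p)"
    by (intro ennreal_leI powr_mono2) (use assms in \<open>auto simp: Lp_le_def\<close>)
  finally show ?thesis using assms by (auto simp: Lp_le_def)
qed

lemma Lp_le_const:
  assumes "AE t in circ. norm (u t) \<le> B" "0 \<le> B" "0 < p"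
  shows "Lp_le p u B"
proof -
  have "(\<integral>\<^sup>+t. ennreal (norm (u t) powr p) \<partial>circ) \<le> (\<integral>\<^sup>+t. ennreal (B powr p) \<partial>circ)"
    by (intro nn_integral_mono_AE eventually_mono[OF assms(1)] ennreal_leI powr_mono2) (use assms in auto)
  then show ?thesis using assms by (simp add: Lp_le_def emeasure_circ_UNIV)
qed

lemma Lp_le_cmult:
  fixes u :: "real \<Rightarrow> 'a::real_normed_vector"
  assumes "Lp_le p u B" "AE t in circ. norm (v t) \<le> c * norm (u t)" "0 \<le> c" "0 < p"
    and [measurable]: "(\<lambda>t. norm (u t)) \<in> borel_measurable borel"
  shows "Lp_le p v (c * B)"
proof -
  have "(\<integral>\<^sup>+t. ennreal (norm (v t) powr p) \<partial>circ) \<le>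
      (\<integral>\<^sup>+t. ennreal (c powr p) * ennreal (norm (u t) powr p) \<partial>circ)"
  proof (intro nn_integral_mono_AE eventually_mono[OF assms(2)])
    fix t assume "norm (v t) \<le> c * norm (u t)"
    then have "norm (v t) powr p \<le> (c * norm (u t)) powr p" using assms by (intro powr_mono2) auto
    then show "ennreal (norm (v t) powr p) \<le> ennreal (c powr p) * ennreal (norm (u t) powr p)"
      using assms by (simp add: powr_mult ennreal_mult[symmetric])
  qed
  also have "\<dots> = ennreal (c powr p) * (\<integral>\<^sup>+t. ennreal (norm (u t) powr p) \<partial>circ)"
    by (rule nn_integral_cmult) auto
  also have "\<dots> \<le> ennreal (c powr p) * ennreal (B powr p)"
    using assms by (intro mult_left_mono) (auto simp: Lp_le_def)
  finally show ?thesis using assms by (auto simp: Lp_le_def powr_mult ennreal_mult)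
qed

lemma powr_add_le:
  fixes a b p :: real
  assumes "0 \<le> a" "0 \<le> b" "0 < p"
  shows "(a + b) powr p \<le> 2 powr p * (a powr p + b powr p)"
proof -
  have "(a + b) powr p \<le> (2 * max a b) powr p" using assms by (intro powr_mono2) auto
  also have "\<dots> = 2 powr p * max a b powr p" using assms by (simp add: powr_mult)
  also have "\<dots> \<le> 2 powr p * (a powr p + b powr p)"
    by (intro mult_left_mono) (auto simp: max_def)
  finally show ?thesis .
qed

text \<open>The factor 4 is \<open>2 * 2\<close>: one 2 comes from \<open>powr_add_le\<close>, the
  other from merging \<open>A powr p + B powr p\<close> into \<open>2 * (A + B) powr p\<close>,
  which is at most \<open>2 powr p * (A + B) powr p\<close> because \<open>1 \<le> p\<close>. Such a
  crude triangle inequality suffices for estimates up to constants.\<close>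

lemma Lp_le_add:
  fixes u :: "real \<Rightarrow> 'a::real_normed_vector" and v :: "real \<Rightarrow> 'b::real_normed_vector"
    and w :: "real \<Rightarrow> 'c::real_normed_vector"
  assumes "Lp_le p u A" "Lp_le p v B" "AE t in circ. norm (w t) \<le> norm (u t) + norm (v t)" "1 \<le> p"
    and [measurable]: "(\<lambda>t. norm (u t)) \<in> borel_measurable borel" "(\<lambda>t. norm (v t)) \<in> borel_measurable borel"
  shows "Lp_le p w (4 * (A + B))"
proof -
  have A: "0 \<le> A" "0 \<le> B" using assms by (auto simp: Lp_le_def)
  have "(\<integral>\<^sup>+t. ennreal (norm (w t) powr p) \<partial>circ) \<le>
      (\<integral>\<^sup>+t. ennreal (2 powr p) * (ennreal (norm (u t) powr p) + ennreal (norm (v t) powr p)) \<partial>circ)"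
  proof (intro nn_integral_mono_AE eventually_mono[OF assms(3)])
    fix t assume "norm (w t) \<le> norm (u t) + norm (v t)"
    then have "norm (w t) powr p \<le> (norm (u t) + norm (v t)) powr p" using assms by (intro powr_mono2) auto
    also have "\<dots> \<le> 2 powr p * (norm (u t) powr p + norm (v t) powr p)"
      using assms by (intro powr_add_le) auto
    finally show "ennreal (norm (w t) powr p) \<le>
       ennreal (2 powr p) * (ennreal (norm (u t) powr p) + ennreal (norm (v t) powr p))"
      by (simp add: ennreal_mult[symmetric] flip: ennreal_plus)
  qed
  also have "\<dots> = ennreal (2 powr p) * ((\<integral>\<^sup>+t. ennreal (norm (u t) powr p) \<partial>circ) +
      (\<integral>\<^sup>+t. ennreal (norm (v t) powr p) \<partial>circ))"
    by (simp add: nn_integral_cmult nn_integral_add)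
  also have "\<dots> \<le> ennreal (2 powr p) * (ennreal (A powr p) + ennreal (B powr p))"
    using assms by (intro mult_left_mono add_mono) (auto simp: Lp_le_def)
  also have "\<dots> = ennreal (2 powr p * (A powr p + B powr p))"
    by (simp add: ennreal_mult[symmetric] flip: ennreal_plus)
  also have "\<dots> \<le> ennreal ((4 * (A + B)) powr p)"
  proof (intro ennreal_leI)
    have "A powr p + B powr p \<le> (A + B) powr p + (A + B) powr p"
      using A assms by (intro add_mono powr_mono2) auto
    also have "\<dots> \<le> 2 powr p * (A + B) powr p"
      using powr_mono[of 1 p 2] assms(4) by (simp add: mult_right_mono)
    finally have "2 powr p * (A powr p + B powr p) \<le> 2 powr p * (2 powr p * (A + B) powr p)"
      by (intro mult_left_mono) auto
    also have "\<dots> = (4 * (A + B)) powr p" using A powr_mult[of 2 2 p] by (simp add: powr_mult distrib_left[symmetric] del: distrib_left_numeral)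
    finally show "2 powr p * (A powr p + B powr p) \<le> (4 * (A + B)) powr p" .
  qed
  finally show ?thesis using A by (simp add: Lp_le_def)
qed

lemma Lp_le_shift:
  fixes u :: "real \<Rightarrow> 'a::real_normed_vector"
  assumes "Lp_le p u B" "\<And>x. u (x + 2 * pi) = u x"
    and [measurable]: "(\<lambda>t. norm (u t)) \<in> borel_measurable borel"
  shows "Lp_le p (\<lambda>x. u (x + t)) B"
  using nn_integral_circ_shift[of "\<lambda>x. ennreal (norm (u x) powr p)" t] assms
  by (simp add: Lp_le_def)

section \<open>The inequalities of Hoelder and Minkowski\<close>

text \<open>Young's inequality is integrated after normalising by numbers \<open>a > A\<close> and
  \<open>b > B\<close>, which then decrease to \<open>A\<close> and \<open>B\<close>. The strict
  inequalities keep the normalisation legitimate when \<open>A\<close> or \<open>B\<close> is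
  0.\<close>

lemma nn_holder:
  fixes f g :: "'a \<Rightarrow> real"
  assumes pq: "1 < p" "1 / p + 1 / q = 1"
    and [measurable]: "f \<in> borel_measurable M" "g \<in> borel_measurable M"
    and nn: "\<And>x. 0 \<le> f x" "\<And>x. 0 \<le> g x"
    and A: "(\<integral>\<^sup>+x. ennreal (f x powr p) \<partial>M) \<le> ennreal (A powr p)" "0 \<le> A"
    and B: "(\<integral>\<^sup>+x. ennreal (g x powr q) \<partial>M) \<le> ennreal (B powr q)" "0 \<le> B"
  shows "(\<integral>\<^sup>+x. ennreal (f x * g x) \<partial>M) \<le> ennreal (A * B)"
proof -
  have "1 / q = (p - 1) / p" using pq by (simp add: field_simps)
  then have qe: "q = p / (p - 1)" by (metis inverse_divide inverse_eq_divide inverse_inverse_eq)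
  have q: "1 < q" unfolding qe using pq by simp
  have gen: "(\<integral>\<^sup>+x. ennreal (f x * g x) \<partial>M) \<le> ennreal (a * b)" if "A < a" "B < b" for a b
  proof -
    have ab: "0 < a" "0 < b" using that A B by auto
    have "(\<integral>\<^sup>+x. ennreal (f x * g x) \<partial>M) \<le>
       (\<integral>\<^sup>+x. ennreal (a * b / (p * a powr p)) * ennreal (f x powr p) +
              ennreal (a * b / (q * b powr q)) * ennreal (g x powr q) \<partial>M)"
    proof (intro nn_integral_mono)
      fix x
      have "f x / a * (g x / b) \<le> (f x / a) powr p / p + (g x / b) powr q / q"
        using pq q nn ab by (intro Youngs_inequality) auto
      then have "f x / a * (g x / b) * (a * b) \<le> ((f x / a) powr p / p + (g x / b) powr q / q) * (a * b)"
        using ab by (intro mult_right_mono) auto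
      then have "f x * g x \<le> a * b / (p * a powr p) * f x powr p + a * b / (q * b powr q) * g x powr q"
        using ab nn by (simp add: powr_divide field_simps)
      then show "ennreal (f x * g x) \<le> ennreal (a * b / (p * a powr p)) * ennreal (f x powr p) +
              ennreal (a * b / (q * b powr q)) * ennreal (g x powr q)"
        using ab pq q by (simp add: ennreal_mult[symmetric] ennreal_leI flip: ennreal_plus)
    qed
    also have "\<dots> = ennreal (a * b / (p * a powr p)) * (\<integral>\<^sup>+x. ennreal (f x powr p) \<partial>M) +
              ennreal (a * b / (q * b powr q)) * (\<integral>\<^sup>+x. ennreal (g x powr q) \<partial>M)"
      by (simp add: nn_integral_add nn_integral_cmult)
    also have "\<dots> \<le> ennreal (a * b / (p * a powr p)) * ennreal (a powr p) +
              ennreal (a * b / (q * b powr q)) * ennreal (b powr q)"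
      using that A B pq q by (intro add_mono mult_left_mono order_trans[OF A(1)] order_trans[OF B(1)] ennreal_leI powr_mono2) auto
    also have "\<dots> = ennreal (a * b / p + a * b / q)"
      using ab pq q by (simp add: ennreal_mult[symmetric] flip: ennreal_plus)
    also have "a * b / p + a * b / q = a * b * (1 / p + 1 / q)" by (simp add: field_simps)
    finally show ?thesis using pq by simp
  qed
  have "((\<lambda>e. ennreal ((A + e) * (B + e))) \<longlongrightarrow> ennreal ((A + 0) * (B + 0))) (at_right (0::real))"
    by (intro tendsto_intros)
  moreover have "eventually (\<lambda>e. (\<integral>\<^sup>+x. ennreal (f x * g x) \<partial>M) \<le> ennreal ((A + e) * (B + e))) (at_right (0::real))"
    using gen by (auto simp: eventually_at_filter)
  ultimately show ?thesis
    by (intro tendsto_lowerbound[where F = "at_right (0::real)"]) auto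
qed

text \<open>Hoelder's inequality for the splitting of \<phi> into
  \<open>W powr ((1 - p) / p) * \<phi>\<close> and \<open>W powr (1 / q)\<close> with conjugate
  exponents \<open>p\<close> and \<open>q\<close>. The positive weight is free: Minkowski's
  inequality takes a majorant of the norms of the sections, Hilbert's inequality a Schur
  weight.\<close>

lemma powr_integral_le:
  fixes W \<phi> :: "'a \<Rightarrow> real"
  assumes p: "1 < p" and [measurable]: "W \<in> borel_measurable M" "\<phi> \<in> borel_measurable M"
    and nn: "AE x in M. 0 < W x" "\<And>x. 0 \<le> \<phi> x"
    and K: "(\<integral>\<^sup>+x. ennreal (W x) \<partial>M) \<le> ennreal K" "0 < K"
    and \<Phi>: "ennreal \<Phi> \<le> (\<integral>\<^sup>+x. ennreal (\<phi> x) \<partial>M)" "0 \<le> \<Phi>"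
  shows "ennreal (\<Phi> powr p) \<le> ennreal (K powr (p - 1)) * (\<integral>\<^sup>+x. ennreal (W x powr (1 - p) * \<phi> x powr p) \<partial>M)"
proof (cases "(\<integral>\<^sup>+x. ennreal (W x powr (1 - p) * \<phi> x powr p) \<partial>M)")
  case (real s)
  define q where "q = p / (p - 1)"
  have pq: "1 / p + 1 / q = 1" using p by (simp add: q_def field_simps)
  have q: "1 < q" using p by (simp add: q_def)
  have "ennreal \<Phi> \<le> (\<integral>\<^sup>+x. ennreal (\<phi> x) \<partial>M)" by fact
  also have "\<dots> \<le> (\<integral>\<^sup>+x. ennreal ((\<bar>W x\<bar> powr ((1 - p) / p) * \<phi> x) * \<bar>W x\<bar> powr (1 / q)) \<partial>M)"
  proof (intro nn_integral_mono_AE eventually_mono[OF nn(1)] ennreal_leI)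
    fix x assume "0 < W x"
    have "(1 - p) / p + 1 / q = 0" using p by (simp add: q_def field_simps)
    then have "W x powr ((1 - p) / p) * W x powr (1 / q) = 1"
      using \<open>0 < W x\<close> by (simp flip: powr_add)
    then show "\<phi> x \<le> \<bar>W x\<bar> powr ((1 - p) / p) * \<phi> x * \<bar>W x\<bar> powr (1 / q)"
      using \<open>0 < W x\<close> by (simp add: mult_ac)
  qed
  also have "\<dots> \<le> ennreal (s powr (1 / p) * K powr (1 / q))"
  proof (rule nn_holder[OF p pq])
    have "(\<integral>\<^sup>+x. ennreal ((\<bar>W x\<bar> powr ((1 - p) / p) * \<phi> x) powr p) \<partial>M) =
       (\<integral>\<^sup>+x. ennreal (W x powr (1 - p) * \<phi> x powr p) \<partial>M)"
      using p nn(2) by (intro nn_integral_cong_AE eventually_mono[OF nn(1)]) (auto simp: powr_mult powr_powr)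
    then show "(\<integral>\<^sup>+x. ennreal ((\<bar>W x\<bar> powr ((1 - p) / p) * \<phi> x) powr p) \<partial>M) \<le> ennreal ((s powr (1 / p)) powr p)"
      using real p by (simp add: powr_powr)
    have "(\<integral>\<^sup>+x. ennreal ((\<bar>W x\<bar> powr (1 / q)) powr q) \<partial>M) = (\<integral>\<^sup>+x. ennreal (W x) \<partial>M)"
      using q by (intro nn_integral_cong_AE eventually_mono[OF nn(1)]) (auto simp: powr_powr)
    then show "(\<integral>\<^sup>+x. ennreal ((\<bar>W x\<bar> powr (1 / q)) powr q) \<partial>M) \<le> ennreal ((K powr (1 / q)) powr q)"
      using K q by (simp add: powr_powr)
  qed (use nn in auto)
  finally have "\<Phi> \<le> s powr (1 / p) * K powr (1 / q)" by (simp add: ennreal_le_iff)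
  then have "\<Phi> powr p \<le> (s powr (1 / p) * K powr (1 / q)) powr p"
    using \<Phi> p by (intro powr_mono2) auto
  also have "\<dots> = K powr (p - 1) * s"
    using p real K by (simp add: powr_mult powr_powr q_def mult.commute)
  finally show ?thesis
    using real by (simp add: ennreal_mult[symmetric] ennreal_leI)
next
  case top
  then show ?thesis using K by (simp add: ennreal_mult_top)
qed

text \<open>Duality is avoided: with \<open>W x\<close> a majorant of the norm of
  \<open>\<phi> x\<close>, the weighted bound \<open>powr_integral_le\<close> and Fubini leave
  \<open>W powr (1 - p) * W powr p = W\<close>, whose integral is at most \<open>K\<close>. Together
  with the prefactor \<open>K powr (p - 1)\<close> this is \<open>K powr p\<close>.\<close>

lemma minkowski_integral:
  fixes \<phi> :: "'a \<Rightarrow> 'b \<Rightarrow> real" and W :: "'a \<Rightarrow> real"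
  assumes p: "1 < p" and sf: "sigma_finite_measure M" "sigma_finite_measure N"
    and [measurable]: "W \<in> borel_measurable M" "(\<lambda>(x, y). \<phi> x y) \<in> borel_measurable (M \<Otimes>\<^sub>M N)"
    and nn: "AE x in M. 0 < W x" "\<And>x y. 0 \<le> \<phi> x y"
    and K: "(\<integral>\<^sup>+x. ennreal (W x) \<partial>M) \<le> ennreal K" "0 < K"
    and W: "AE x in M. (\<integral>\<^sup>+y. ennreal (\<phi> x y powr p) \<partial>N) \<le> ennreal (W x powr p)"
    and \<Phi>: "AE y in N. ennreal (\<Phi> y) \<le> (\<integral>\<^sup>+x. ennreal (\<phi> x y) \<partial>M)" "\<And>y. 0 \<le> \<Phi> y"
  shows "(\<integral>\<^sup>+y. ennreal (\<Phi> y powr p) \<partial>N) \<le> ennreal (K powr p)"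
proof -
  interpret M: sigma_finite_measure M by fact
  interpret N: sigma_finite_measure N by fact
  interpret P: pair_sigma_finite M N ..
  have \<phi>2: "(\<lambda>x. \<phi> x y) \<in> borel_measurable M" if "y \<in> space N" for y
    using measurable_compose[OF measurable_Pair2'[OF that], of "\<lambda>(x, y). \<phi> x y"] assms(5) by simp
  have "(\<integral>\<^sup>+y. ennreal (\<Phi> y powr p) \<partial>N) \<le>
     (\<integral>\<^sup>+y. ennreal (K powr (p - 1)) * (\<integral>\<^sup>+x. ennreal (W x powr (1 - p) * \<phi> x y powr p) \<partial>M) \<partial>N)"
    by (intro nn_integral_mono_AE, rule AE_mp[OF \<Phi>(1)], intro AE_I2 impI powr_integral_le p nn K \<Phi> \<phi>2) auto
  also have "\<dots> = ennreal (K powr (p - 1)) * (\<integral>\<^sup>+y. (\<integral>\<^sup>+x. ennreal (W x powr (1 - p) * \<phi> x y powr p) \<partial>M) \<partial>N)"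
    by (rule nn_integral_cmult) measurable
  also have "(\<integral>\<^sup>+y. (\<integral>\<^sup>+x. ennreal (W x powr (1 - p) * \<phi> x y powr p) \<partial>M) \<partial>N) =
     (\<integral>\<^sup>+x. (\<integral>\<^sup>+y. ennreal (W x powr (1 - p)) * ennreal (\<phi> x y powr p) \<partial>N) \<partial>M)"
    by (subst P.Fubini') (auto simp: ennreal_mult)
  also have "\<dots> = (\<integral>\<^sup>+x. ennreal (W x powr (1 - p)) * (\<integral>\<^sup>+y. ennreal (\<phi> x y powr p) \<partial>N) \<partial>M)"
    by (intro nn_integral_cong nn_integral_cmult) measurable
  also have "\<dots> \<le> (\<integral>\<^sup>+x. ennreal (W x) \<partial>M)"
  proof (intro nn_integral_mono_AE, rule AE_mp[OF W], rule AE_mp[OF nn(1)], intro AE_I2 impI)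
    fix x assume 1: "0 < W x" "(\<integral>\<^sup>+y. ennreal (\<phi> x y powr p) \<partial>N) \<le> ennreal (W x powr p)"
    then have "ennreal (W x powr (1 - p)) * (\<integral>\<^sup>+y. ennreal (\<phi> x y powr p) \<partial>N) \<le>
      ennreal (W x powr (1 - p)) * ennreal (W x powr p)"
      by (intro mult_left_mono) auto
    also have "\<dots> = ennreal (W x)" using 1 by (simp add: ennreal_mult[symmetric] flip: powr_add)
    finally show "ennreal (W x powr (1 - p)) * (\<integral>\<^sup>+y. ennreal (\<phi> x y powr p) \<partial>N) \<le> ennreal (W x)" .
  qed
  also have "\<dots> \<le> ennreal K" by fact
  finally have "(\<integral>\<^sup>+y. ennreal (\<Phi> y powr p) \<partial>N) \<le> ennreal (K powr (p - 1)) * ennreal K"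
    by (simp add: mult_left_mono)
  also have "\<dots> = ennreal (K powr p)"
    using K by (simp add: ennreal_mult[symmetric] powr_diff)
  finally show ?thesis .
qed

section \<open>Kernel estimates\<close>

lemma borel_measurable_cis [measurable]: "cis \<in> borel_measurable borel"
  by (intro borel_measurable_continuous_onI continuous_intros)

lemma cmod_one_minus_cis: "cmod (1 - cis t) = 2 * \<bar>sin (t / 2)\<bar>"
proof -
  have "(cmod (1 - cis t))\<^sup>2 = (1 - cos t)\<^sup>2 + (sin t)\<^sup>2"
    by (simp add: cmod_power2)
  also have "\<dots> = 2 - 2 * cos t"
    using sin_cos_squared_add[of t] by (simp add: power2_eq_square algebra_simps)
  also have "\<dots> = (2 * \<bar>sin (t / 2)\<bar>)\<^sup>2"
    using cos_double_sin[of "t / 2"] by (simp add: power2_eq_square algebra_simps)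
  finally show ?thesis by (rule power2_eq_imp_eq) auto
qed

text \<open>With \<open>x = t / 2\<close> one has \<open>\<bar>x\<bar> \<le> 2\<close>, so the cubic
  Taylor remainder of the sine is at most \<open>2 / 3 * \<bar>x\<bar>\<close>, and a third of
  \<open>\<bar>x\<bar>\<close> is left for \<open>\<bar>sin x\<bar>\<close>.\<close>

lemma abs_le_cis_diff:
  assumes "\<bar>t\<bar> \<le> pi"
  shows "\<bar>t\<bar> \<le> 3 * cmod (1 - cis t)"
proof -
  define x where "x = t / 2"
  have x: "\<bar>x\<bar> \<le> 2" using assms pi_half_less_two unfolding x_def by simp
  have "\<bar>sin x - x\<bar> \<le> \<bar>x\<bar> ^ 3 / 6"
    using Maclaurin_sin_bound[of x 3] by (simp add: eval_nat_numeral sin_coeff_def)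
  also have "\<dots> = \<bar>x\<bar>\<^sup>2 * (\<bar>x\<bar> / 6)" by (simp add: power3_eq_cube power2_eq_square)
  also have "\<dots> \<le> 2\<^sup>2 * (\<bar>x\<bar> / 6)"
    using x by (intro mult_right_mono power_mono) auto
  finally have "\<bar>sin x - x\<bar> \<le> 2 / 3 * \<bar>x\<bar>" by simp
  then have "\<bar>x\<bar> \<le> 3 * \<bar>sin x\<bar>" by linarith
  then show ?thesis unfolding cmod_one_minus_cis x_def by simp
qed

lemma one_minus_le_cmod:
  assumes "0 \<le> r"
  shows "1 - r \<le> cmod (1 - of_real r * cis t)"
  using norm_triangle_ineq2[of 1 "of_real r * cis t"] assms by (simp add: norm_mult)

lemma cis_diff_le_radial:
  assumes "0 \<le> r" "r \<le> 1"
  shows "cmod (1 - cis t) \<le> 2 * cmod (1 - of_real r * cis t)"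
proof -
  have "cmod (1 - cis t) \<le> cmod (1 - of_real r * cis t) + cmod (of_real r * cis t - cis t)"
    using norm_triangle_ineq[of "1 - of_real r * cis t" "of_real r * cis t - cis t"] by simp
  also have "of_real r * cis t - cis t = of_real (r - 1) * cis t" by (simp add: algebra_simps)
  also have "cmod \<dots> = 1 - r" using assms by (simp add: norm_mult del: of_real_diff)
  finally show ?thesis using one_minus_le_cmod[of r t] assms by simp
qed

text \<open>\<open>7 = 3 * 2 + 1\<close>: the angular part uses \<open>abs_le_cis_diff\<close> and
  \<open>cis_diff_le_radial\<close>, the radial part \<open>one_minus_le_cmod\<close>. The kernel
  integrals below thereby reduce to power integrals in
  \<open>\<bar>t\<bar> + (1 - r)\<close>.\<close>

lemma radial_kernel_ge:
  assumes "0 \<le> r" "r \<le> 1" "\<bar>t\<bar> \<le> pi"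
  shows "\<bar>t\<bar> + (1 - r) \<le> 7 * cmod (1 - of_real r * cis t)"
  using abs_le_cis_diff[OF assms(3)] cis_diff_le_radial[OF assms(1,2), of t]
    one_minus_le_cmod[OF assms(1), of t] by linarith

text \<open>The half-line is cut at \<open>x = y\<close>. Below it the denominator is at least
  \<open>y powr b\<close>, above it at least \<open>x powr b\<close>; \<open>a > -1\<close> makes
  the first piece finite at 0 and \<open>b > a + 1\<close> the second at infinity. The two summands
  of the constant are these two pieces.\<close>

lemma nn_integral_powr_ratio:
  fixes a b y :: real
  assumes "-1 < a" "a + 1 < b" "0 < y"
  shows "(\<integral>\<^sup>+x. ennreal (x powr a / (x + y) powr b) * indicator {0..} x \<partial>lborel) \<le>
     ennreal ((1 / (a + 1) + 1 / (b - a - 1)) * y powr (a - b + 1))"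
proof -
  have "(\<integral>\<^sup>+x. ennreal (x powr a / (x + y) powr b) * indicator {0..} x \<partial>lborel) \<le>
     (\<integral>\<^sup>+x. ennreal (y powr (- b)) * (ennreal (x powr a) * indicator {0..y} x) +
        ennreal (x powr (a - b)) * indicator {y..} x \<partial>lborel)"
  proof (intro nn_integral_mono)
    fix x
    have 1: "x powr a / (x + y) powr b \<le> y powr (- b) * x powr a" if "0 \<le> x"
    proof -
      have "y powr b \<le> (x + y) powr b" using assms that by (intro powr_mono2) auto
      then have "x powr a / (x + y) powr b \<le> x powr a / y powr b"
        using assms that by (intro divide_left_mono) auto
      then show ?thesis by (simp add: powr_minus field_simps)
    qed
    have 2: "x powr a / (x + y) powr b \<le> x powr (a - b)" if "y \<le> x"
    proof -
      have "x powr b \<le> (x + y) powr b" using assms that by (intro powr_mono2) auto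
      then have "x powr a / (x + y) powr b \<le> x powr a / x powr b"
        using assms that by (intro divide_left_mono) auto
      then show ?thesis by (simp add: powr_diff)
    qed
    show "ennreal (x powr a / (x + y) powr b) * indicator {0..} x \<le>
      ennreal (y powr (- b)) * (ennreal (x powr a) * indicator {0..y} x) +
        ennreal (x powr (a - b)) * indicator {y..} x"
    proof (cases "0 \<le> x \<and> x \<le> y")
      case True
      then have "ennreal (x powr a / (x + y) powr b) \<le> ennreal (y powr (- b)) * ennreal (x powr a)"
        using 1 by (simp add: ennreal_mult[symmetric] ennreal_leI)
      then show ?thesis using True by (simp add: add_increasing2)
    next
      case False
      then show ?thesis using 2 assms
        by (auto simp: ennreal_leI split: split_indicator)
    qed
  qed
  also have "\<dots> = ennreal (y powr (- b)) * (\<integral>\<^sup>+x. ennreal (x powr a) * indicator {0..y} x \<partial>lborel) +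
     (\<integral>\<^sup>+x. ennreal (x powr (a - b)) * indicator {y..} x \<partial>lborel)"
    by (simp add: nn_integral_add nn_integral_cmult)
  also have "(\<integral>\<^sup>+x. ennreal (x powr a) * indicator {0..y} x \<partial>lborel) = ennreal (y powr (a + 1) / (a + 1))"
    using assms by (intro nn_integral_has_integral_lebesgue' has_integral_powr_from_0) auto
  also have "(\<integral>\<^sup>+x. ennreal (x powr (a - b)) * indicator {y..} x \<partial>lborel) =
     ennreal (- (y powr (a - b + 1)) / (a - b + 1))"
    using assms by (intro nn_integral_has_integral_lebesgue' has_integral_powr_to_inf) auto
  also have "ennreal (y powr (- b)) * ennreal (y powr (a + 1) / (a + 1)) +
     ennreal (- (y powr (a - b + 1)) / (a - b + 1)) =
     ennreal ((1 / (a + 1) + 1 / (b - a - 1)) * y powr (a - b + 1))"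
  proof -
    have "y powr (- b) * (y powr (a + 1) / (a + 1)) + - (y powr (a - b + 1)) / (a - b + 1) =
       (1 / (a + 1) + 1 / (b - a - 1)) * y powr (a - b + 1)"
    proof -
      have "y powr (- b) * y powr (a + 1) = y powr (a - b + 1)"
        using assms by (simp flip: powr_add add: algebra_simps)
      moreover have "- (y powr (a - b + 1)) / (a - b + 1) = y powr (a - b + 1) / (b - a - 1)"
        using assms by (simp add: field_simps)
      ultimately show ?thesis by (simp add: field_simps)
    qed
    moreover have "0 \<le> - (y powr (a - b + 1)) / (a - b + 1)"
      using assms by (simp add: divide_nonneg_neg divide_nonpos_neg)
    moreover have "0 \<le> y powr (a + 1) / (a + 1)" using assms by simp
    ultimately show ?thesis
      by (metis ennreal_mult ennreal_plus mult_nonneg_nonneg powr_ge_zero)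
  qed
  finally show ?thesis .
qed

text \<open>By \<open>radial_kernel_ge\<close> the circle integral is at most a multiple of two
  copies of the half-line integral with \<open>y = 1 - r\<close>, one for each sign of the
  angle.\<close>

lemma circ_kernel:
  fixes a b :: real
  assumes "-1 < a" "a + 1 < b"
  obtains C where "0 < C"
    "\<And>r. 0 \<le> r \<Longrightarrow> r < 1 \<Longrightarrow>
      (\<integral>\<^sup>+t. ennreal (\<bar>t\<bar> powr a / cmod (1 - of_real r * cis t) powr b) \<partial>circ) \<le>
      ennreal (C * (1 - r) powr (a - b + 1))"
proof -
  define K where "K = (1 / (a + 1) + 1 / (b - a - 1))"
  have K: "0 < K" using assms unfolding K_def by (intro add_pos_pos) auto
  show ?thesis
  proof (rule that[of "7 powr b * K"])
    show "0 < 7 powr b * K" using K by simp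
    fix r :: real assume r: "0 \<le> r" "r < 1"
    define h where "h x = ennreal (x powr a / (x + (1 - r)) powr b) * indicator {0..} x" for x :: real
    have [measurable]: "h \<in> borel_measurable borel" unfolding h_def by measurable
    have h: "(\<integral>\<^sup>+x. h x \<partial>lborel) \<le> ennreal (K * (1 - r) powr (a - b + 1))"
      using nn_integral_powr_ratio[OF assms, of "1 - r"] r unfolding h_def K_def by simp
    have h2: "(\<integral>\<^sup>+x. h (- x) \<partial>lborel) = (\<integral>\<^sup>+x. h x \<partial>lborel)"
      using nn_integral_real_affine[of h "-1" 0] by simp
    have "(\<integral>\<^sup>+t. ennreal (\<bar>t\<bar> powr a / cmod (1 - of_real r * cis t) powr b) * indicator {-pi..pi} t \<partial>lborel) \<le>
       (\<integral>\<^sup>+t. ennreal (7 powr b) * (h t + h (- t)) \<partial>lborel)"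
    proof (intro nn_integral_mono)
      fix t
      show "ennreal (\<bar>t\<bar> powr a / cmod (1 - of_real r * cis t) powr b) * indicator {-pi..pi} t \<le>
        ennreal (7 powr b) * (h t + h (- t))"
      proof (cases "\<bar>t\<bar> \<le> pi")
        case True
        have pos: "0 < cmod (1 - of_real r * cis t)"
          using one_minus_le_cmod[of r t] r by linarith
        have "(\<bar>t\<bar> + (1 - r)) powr b \<le> (7 * cmod (1 - of_real r * cis t)) powr b"
          using radial_kernel_ge[of r t] r True assms by (intro powr_mono2) auto
        also have "\<dots> = 7 powr b * cmod (1 - of_real r * cis t) powr b" by (simp add: powr_mult)
        finally have "\<bar>t\<bar> powr a / cmod (1 - of_real r * cis t) powr b \<le>
           7 powr b * (\<bar>t\<bar> powr a / (\<bar>t\<bar> + (1 - r)) powr b)"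
        proof -
          assume *: "(\<bar>t\<bar> + (1 - r)) powr b \<le> 7 powr b * cmod (1 - of_real r * cis t) powr b"
          have "0 < (\<bar>t\<bar> + (1 - r)) powr b" using r by simp
          then have "1 / cmod (1 - of_real r * cis t) powr b \<le> 7 powr b / (\<bar>t\<bar> + (1 - r)) powr b"
            using * pos by (simp add: field_simps)
          from mult_left_mono[OF this, of "\<bar>t\<bar> powr a"] show ?thesis by (simp add: field_simps)
        qed
        then have "ennreal (\<bar>t\<bar> powr a / cmod (1 - of_real r * cis t) powr b) \<le>
          ennreal (7 powr b) * ennreal (\<bar>t\<bar> powr a / (\<bar>t\<bar> + (1 - r)) powr b)"
          by (simp add: ennreal_mult[symmetric] ennreal_leI)
        also have "ennreal (\<bar>t\<bar> powr a / (\<bar>t\<bar> + (1 - r)) powr b) \<le> h t + h (- t)"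
          unfolding h_def by (cases "0 \<le> t") (auto simp: add_increasing add_increasing2)
        finally show ?thesis using True by (simp add: mult_left_mono indicator_def abs_le_iff)
      next
        case False
        then have "t \<notin> {-pi..pi}" by auto
        then show ?thesis by simp
      qed
    qed
    also have "\<dots> = ennreal (7 powr b) * ((\<integral>\<^sup>+x. h x \<partial>lborel) + (\<integral>\<^sup>+x. h (- x) \<partial>lborel))"
      by (simp add: nn_integral_cmult nn_integral_add)
    also have "\<dots> \<le> ennreal (7 powr b) * (ennreal (K * (1 - r) powr (a - b + 1)) + ennreal (K * (1 - r) powr (a - b + 1)))"
      unfolding h2 by (intro mult_left_mono add_mono h) auto
    also have "\<dots> = ennreal (2 * (7 powr b * K) * (1 - r) powr (a - b + 1))"
      using K by (simp add: ennreal_mult[symmetric] flip: ennreal_plus)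
    finally have "(\<integral>\<^sup>+t. ennreal (\<bar>t\<bar> powr a / cmod (1 - of_real r * cis t) powr b) \<partial>circ) \<le>
       ennreal (1 / (2 * pi)) * ennreal (2 * (7 powr b * K) * (1 - r) powr (a - b + 1))"
      by (subst nn_integral_circ) (auto intro!: mult_left_mono)
    also have "\<dots> = ennreal (1 / pi * (7 powr b * K * (1 - r) powr (a - b + 1)))"
      using K by (simp add: ennreal_mult[symmetric])
    also have "\<dots> \<le> ennreal (1 * (7 powr b * K * (1 - r) powr (a - b + 1)))"
      using K pi_gt3 by (intro ennreal_leI mult_right_mono) auto
    finally show "(\<integral>\<^sup>+t. ennreal (\<bar>t\<bar> powr a / cmod (1 - of_real r * cis t) powr b) \<partial>circ) \<le>
      ennreal (7 powr b * K * (1 - r) powr (a - b + 1))" by simp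
  qed
qed

lemma circ_kernel0:
  fixes b :: real
  assumes "1 < b"
  obtains C where "0 < C"
    "\<And>r. 0 \<le> r \<Longrightarrow> r < 1 \<Longrightarrow>
      (\<integral>\<^sup>+t. ennreal (1 / cmod (1 - of_real r * cis t) powr b) \<partial>circ) \<le> ennreal (C * (1 - r) powr (1 - b))"
proof -
  obtain C where C: "0 < C" "\<And>r. 0 \<le> r \<Longrightarrow> r < 1 \<Longrightarrow>
      (\<integral>\<^sup>+t. ennreal (\<bar>t\<bar> powr 0 / cmod (1 - of_real r * cis t) powr b) \<partial>circ) \<le>
      ennreal (C * (1 - r) powr (0 - b + 1))"
    using circ_kernel[of 0 b] assms by auto
  have "(\<integral>\<^sup>+t. ennreal (1 / cmod (1 - of_real r * cis t) powr b) \<partial>circ) =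
    (\<integral>\<^sup>+t. ennreal (\<bar>t\<bar> powr 0 / cmod (1 - of_real r * cis t) powr b) \<partial>circ)" for r
    \<comment> \<open>Since \<open>0 powr 0 = 0\<close>, the two integrands differ at
      \<open>t = 0\<close> and agree only almost everywhere.\<close>
    by (intro nn_integral_cong_AE eventually_mono[OF AE_circ_nonzero]) auto
  with C show ?thesis by (intro that[of C]) (auto simp: add.commute)
qed

text \<open>The counterpart of \<open>circ_kernel\<close> with the roles exchanged: the distance
  \<open>1 - r\<close> is integrated and the fixed angle \<open>\<bar>t\<bar>\<close> is the scale
  \<open>y\<close>. Schur's test uses both.\<close>

lemma radial_kernel:
  fixes a b :: real
  assumes "-1 < a" "a + 1 < b"
  obtains C where "0 < C"
    "\<And>t. t \<noteq> 0 \<Longrightarrow> \<bar>t\<bar> \<le> pi \<Longrightarrow>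
      (\<integral>\<^sup>+r. ennreal ((1 - r) powr a / cmod (1 - of_real r * cis t) powr b) * indicator {0..<1} r \<partial>lborel) \<le>
      ennreal (C * \<bar>t\<bar> powr (a - b + 1))"
proof -
  define K where "K = (1 / (a + 1) + 1 / (b - a - 1))"
  have K: "0 < K" using assms unfolding K_def by (intro add_pos_pos) auto
  show ?thesis
  proof (rule that[of "7 powr b * K"])
    show "0 < 7 powr b * K" using K by simp
    fix t :: real assume t: "t \<noteq> 0" "\<bar>t\<bar> \<le> pi"
    define h where "h x = ennreal (x powr a / (x + \<bar>t\<bar>) powr b) * indicator {0..} x" for x :: real
    have [measurable]: "h \<in> borel_measurable borel" unfolding h_def by measurable
    have h: "(\<integral>\<^sup>+x. h x \<partial>lborel) \<le> ennreal (K * \<bar>t\<bar> powr (a - b + 1))"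
      using nn_integral_powr_ratio[OF assms, of "\<bar>t\<bar>"] t unfolding h_def K_def by simp
    have h2: "(\<integral>\<^sup>+x. h (1 - x) \<partial>lborel) = (\<integral>\<^sup>+x. h x \<partial>lborel)"
      using nn_integral_real_affine[of h "-1" 1] by simp
    have "(\<integral>\<^sup>+r. ennreal ((1 - r) powr a / cmod (1 - of_real r * cis t) powr b) * indicator {0..<1} r \<partial>lborel) \<le>
       (\<integral>\<^sup>+r. ennreal (7 powr b) * h (1 - r) \<partial>lborel)"
    proof (intro nn_integral_mono)
      fix r :: real
      show "ennreal ((1 - r) powr a / cmod (1 - of_real r * cis t) powr b) * indicator {0..<1} r \<le>
        ennreal (7 powr b) * h (1 - r)"
      proof (cases "0 \<le> r \<and> r < 1")
        case True
        then have r: "0 \<le> r" "r < 1" by auto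
        have pos: "0 < cmod (1 - of_real r * cis t)"
          using one_minus_le_cmod[of r t] r by linarith
        have *: "((1 - r) + \<bar>t\<bar>) powr b \<le> (7 * cmod (1 - of_real r * cis t)) powr b"
          using radial_kernel_ge[of r t] r t assms by (intro powr_mono2) auto
        have "0 < ((1 - r) + \<bar>t\<bar>) powr b" using r t by simp
        then have "1 / cmod (1 - of_real r * cis t) powr b \<le> 7 powr b / ((1 - r) + \<bar>t\<bar>) powr b"
          using * pos by (simp add: field_simps powr_mult)
        from mult_left_mono[OF this, of "(1 - r) powr a"]
        have "(1 - r) powr a / cmod (1 - of_real r * cis t) powr b \<le>
           7 powr b * ((1 - r) powr a / ((1 - r) + \<bar>t\<bar>) powr b)" by (simp add: field_simps)
        then show ?thesis using True
          by (simp add: h_def ennreal_mult[symmetric] ennreal_leI)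
      qed auto
    qed
    also have "\<dots> = ennreal (7 powr b) * (\<integral>\<^sup>+x. h x \<partial>lborel)"
      unfolding h2[symmetric] by (simp add: nn_integral_cmult)
    also have "\<dots> \<le> ennreal (7 powr b) * ennreal (K * \<bar>t\<bar> powr (a - b + 1))"
      by (intro mult_left_mono h) auto
    also have "\<dots> = ennreal (7 powr b * K * \<bar>t\<bar> powr (a - b + 1))"
      using K by (simp add: ennreal_mult[symmetric] mult_ac)
    finally show "(\<integral>\<^sup>+r. ennreal ((1 - r) powr a / cmod (1 - of_real r * cis t) powr b) * indicator {0..<1} r \<partial>lborel) \<le>
       ennreal (7 powr b * K * \<bar>t\<bar> powr (a - b + 1))" .
  qed
qed

section \<open>Fourier pairing and integral formulas\<close>

text \<open>A shift by \<open>pi / n\<close> leaves the mean unchanged and turns the character into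
  its negative, so the mean is 0.\<close>

lemma integral_circ_cis: "(LINT t|circ. cis (of_int n * t)) = (if n = 0 then 1 else 0)"
proof (cases "n = 0")
  case False
  have per: "cis (of_int n * (t + 2 * pi)) = cis (of_int n * t)" for t
  proof -
    have "cis (of_int n * (t + 2 * pi)) = cis (of_int n * t) * cis (2 * pi * of_int n)"
      by (simp add: cis_mult algebra_simps)
    then show ?thesis by simp
  qed
  have "(LINT t|circ. cis (of_int n * t)) = (LINT t|circ. cis (of_int n * (t + pi / of_int n)))"
    by (rule integral_circ_shift[symmetric]) (use per in \<open>auto intro!: continuous_intros\<close>)
  also have "\<dots> = (LINT t|circ. - cis (of_int n * t))"
    using False by (intro Bochner_Integration.integral_cong) (auto simp: distrib_left cis_mult[symmetric])
  finally show ?thesis using False by simp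
qed simp

lemma integral_circ_power_series:
  fixes a :: "nat \<Rightarrow> complex"
  assumes "summable (\<lambda>n. norm (a n))" and cont: "continuous_on UNIV A"
  shows "(LINT t|circ. (\<Sum>n. a n * cis t ^ n) * A t) = (\<Sum>n. a n * (LINT t|circ. cis t ^ n * A t))"
    and "summable (\<lambda>n. a n * (LINT t|circ. cis t ^ n * A t))"
proof -
  define f where "f n t = a n * (cis t ^ n * A t)" for n t
  have cont': "continuous_on UNIV (f n)" for n
    unfolding f_def by (intro continuous_intros cont)
  have nA: "integrable circ (\<lambda>t. norm (A t))"
    by (intro integrable_circ_continuous continuous_intros cont)
  have nf: "norm (f n t) = norm (a n) * norm (A t)" for n t
    by (simp add: f_def norm_mult norm_power)
  have 1: "integrable circ (f n)" for n by (intro integrable_circ_continuous cont')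
  have 2: "AE t in circ. summable (\<lambda>n. norm (f n t))"
    unfolding nf by (intro AE_I2 summable_mult2 assms)
  have 3: "summable (\<lambda>n. LINT t|circ. norm (f n t))"
    unfolding nf using nA by (simp add: summable_mult2 assms(1))
  have eq: "(LINT t|circ. f n t) = a n * (LINT t|circ. cis t ^ n * A t)" for n
    unfolding f_def by simp
  have sm: "summable (\<lambda>n. a n * cis t ^ n)" for t
    by (rule summable_norm_cancel) (use assms in \<open>simp add: norm_mult norm_power\<close>)
  show "(LINT t|circ. (\<Sum>n. a n * cis t ^ n) * A t) = (\<Sum>n. a n * (LINT t|circ. cis t ^ n * A t))"
    using integral_suminf[OF 1 2 3] unfolding eq
    by (simp add: f_def mult.assoc suminf_mult2[OF sm])
  show "summable (\<lambda>n. a n * (LINT t|circ. cis t ^ n * A t))"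
    using summable_integral[OF 1 2 3] unfolding eq .
qed

lemma continuous_on_power_series_circle:
  fixes a :: "nat \<Rightarrow> complex"
  assumes "summable (\<lambda>n. norm (a n))"
  shows "continuous_on (cball 0 1) (\<lambda>z. \<Sum>n. a n * z ^ n)"
proof -
  have "uniform_limit (cball 0 1) (\<lambda>N z. \<Sum>n<N. a n * z ^ n) (\<lambda>z. \<Sum>n. a n * z ^ n) sequentially"
  proof (rule Weierstrass_m_test[OF _ assms])
    fix n :: nat and z :: complex assume "z \<in> cball 0 1"
    then show "norm (a n * z ^ n) \<le> norm (a n)"
      by (simp add: norm_mult norm_power mult_left_le power_le_one)
  qed
  then show ?thesis
    by (rule uniform_limit_theorem[rotated]) (auto intro!: always_eventually continuous_intros)
qed

lemma continuous_on_power_series_cis: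
  fixes a :: "nat \<Rightarrow> complex"
  assumes "summable (\<lambda>n. norm (a n))" "continuous_on S f"
  shows "continuous_on S (\<lambda>x. \<Sum>n. a n * cis (f x) ^ n)"
  by (rule continuous_on_compose2[OF continuous_on_power_series_circle[OF assms(1)]])
     (auto intro!: continuous_intros assms)

text \<open>Termwise integration leaves only equal indices. This bilinear form of Parseval's
  identity takes the place of contour integration: the formulas of Cauchy, Poisson and Hadamard are
  derived from it.\<close>

lemma fourier_pairing:
  fixes a b :: "nat \<Rightarrow> complex"
  assumes a: "summable (\<lambda>n. norm (a n))" and b: "summable (\<lambda>n. norm (b n))"
  shows "(LINT t|circ. (\<Sum>n. a n * cis t ^ n) * (\<Sum>n. b n * cis (- t) ^ n)) = (\<Sum>n. a n * b n)"
proof -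
  have c: "(LINT t|circ. cis t ^ n * (\<Sum>m. b m * cis (- t) ^ m)) = b n" for n
  proof -
    define B where "B t = (\<Sum>m. b m * cis t ^ m) * cis (- t) ^ n" for t
    \<comment> \<open>Reflection brings the series with negative frequencies into the form of
      \<open>integral_circ_power_series\<close>, which integrates series in
      \<open>cis t\<close>.\<close>
    have neg: "(LINT t|circ. B (- t)) = (LINT t|circ. B t)" if "continuous_on UNIV B"
    proof -
      have [measurable]: "B \<in> borel_measurable borel" by (intro borel_measurable_continuous_onI that)
      have "(LINT t|lborel. indicator {-pi..pi} t *\<^sub>R B t) = (LINT t|lborel. indicator {-pi..pi} (- t) *\<^sub>R B (- t))"
        using lborel_integral_real_affine[of "-1" "\<lambda>t. indicator {-pi..pi} t *\<^sub>R B t" 0] by simp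
      moreover have "indicator {-pi..pi} (- t) = (indicator {-pi..pi} t :: real)" for t
        by (auto split: split_indicator)
      ultimately show ?thesis by (simp add: integral_circ set_lebesgue_integral_def)
    qed
    have "(LINT t|circ. cis t ^ n * (\<Sum>m. b m * cis (- t) ^ m)) = (LINT t|circ. B (- t))"
      by (simp add: B_def mult.commute)
    also have "\<dots> = (LINT t|circ. B t)" 
      by (rule neg) (auto simp: B_def intro!: continuous_intros continuous_on_power_series_cis b)
    also have "\<dots> = (\<Sum>m. b m * (LINT t|circ. cis t ^ m * cis (- t) ^ n))"
      unfolding B_def by (rule integral_circ_power_series[OF b]) (intro continuous_intros)
    also have "\<dots> = (\<Sum>m. b m * (if m = n then 1 else 0))"
    proof -
      have "cis t ^ m * cis (- t) ^ n = cis (of_int (int m - int n) * t)" for t :: real and m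
        by (simp only: Complex.DeMoivre cis_mult) (rule arg_cong[where f = cis], simp add: algebra_simps)
      then show ?thesis by (simp only: integral_circ_cis) (intro suminf_cong, simp)
    qed
    also have "\<dots> = b n"
      using sums_single[of n "\<lambda>m. b m"] by (simp add: sums_iff if_distrib cong: if_cong)
    finally show ?thesis .
  qed
  show ?thesis
    by (subst integral_circ_power_series[OF a])
       (auto simp: c intro!: continuous_intros continuous_on_power_series_cis b)
qed

text \<open>Nonnegative frequencies never cancel, so only the constant terms meet. In
  \<open>deriv_formula\<close> this shows that the half of the kernel added for symmetry contributes
  nothing.\<close>

lemma fourier_pairing_pos:
  fixes a b :: "nat \<Rightarrow> complex"
  assumes a: "summable (\<lambda>n. norm (a n))" and b: "summable (\<lambda>n. norm (b n))"
  shows "(LINT t|circ. (\<Sum>n. a n * cis t ^ n) * (\<Sum>n. b n * cis t ^ n)) = a 0 * b 0"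
proof -
  have c: "(LINT t|circ. cis t ^ n * (\<Sum>m. b m * cis t ^ m)) = (if n = 0 then b 0 else 0)" for n
  proof -
    have "(LINT t|circ. (\<Sum>m. b m * cis t ^ m) * cis t ^ n) = (\<Sum>m. b m * (LINT t|circ. cis t ^ m * cis t ^ n))"
      by (rule integral_circ_power_series[OF b]) (intro continuous_intros)
    also have "\<dots> = (\<Sum>m. b m * (if m = 0 then if n = 0 then 1 else 0 else 0))"
    proof -
      have "cis t ^ m * cis t ^ n = cis (of_int (int m + int n) * t)" for t :: real and m
        by (simp only: Complex.DeMoivre cis_mult) (rule arg_cong[where f = cis], simp add: algebra_simps)
      then show ?thesis by (simp only: integral_circ_cis) (intro suminf_cong, auto)
    qed
    also have "\<dots> = (if n = 0 then b 0 else 0)"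
      using sums_single[of 0 "\<lambda>m. b m"] by (simp add: sums_iff if_distrib cong: if_cong)
    finally show ?thesis by (simp add: mult.commute)
  qed
  have "(\<Sum>n. a n * (if n = 0 then b 0 else 0)) = a 0 * b 0"
    using sums_single[of 0 "\<lambda>m. a m * b 0"] by (simp add: sums_iff if_distrib cong: if_cong)
  then show ?thesis
    by (subst integral_circ_power_series[OF a])
       (auto simp: c intro!: continuous_intros continuous_on_power_series_cis b)
qed

section \<open>The formulas of Cauchy and Poisson\<close>

text \<open>The Cauchy kernel is the geometric series with coefficients \<open>z ^ n\<close>;
  pairing it with the Taylor series of \<open>g\<close> returns the value of that series at
  \<open>z\<close>.\<close>

lemma cauchy_circ:
  assumes g: "g holomorphic_on ball 0 R" "1 < R" and z: "cmod z < 1"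
  shows "(LINT t|circ. g (cis t) / (1 - z * cis (- t))) = g z"
proof -
  define a where "a n = fps_nth (fps_expansion g 0) n" for n
  have R: "ereal R \<le> fps_conv_radius (fps_expansion g 0)"
    using conv_radius_fps_expansion[of g 0 "ereal R"] g by simp
  have ev: "g w = (\<Sum>n. a n * w ^ n)" if "cmod w < R" for w
    using eval_fps_expansion[of g 0 "ereal R" w] g that by (simp add: a_def eval_fps_def)
  have "ereal (norm (1::complex)) < fps_conv_radius (fps_expansion g 0)"
    using R g by (metis ereal_less_eq(3) less_le_trans not_le norm_one ereal_less(2) less_ereal.simps(1))
  from norm_summable_fps[OF this] have sa: "summable (\<lambda>n. norm (a n))" by (simp add: a_def)
  have sb: "summable (\<lambda>n. norm (z ^ n))" using z by (simp add: norm_power summable_geometric)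
  have b: "(\<Sum>n. z ^ n * cis (- t) ^ n) = 1 / (1 - z * cis (- t))" for t
    using z by (subst power_mult_distrib[symmetric], intro suminf_geometric) (simp add: norm_mult)
  have "(LINT t|circ. g (cis t) / (1 - z * cis (- t))) =
      (LINT t|circ. (\<Sum>n. a n * cis t ^ n) * (\<Sum>n. z ^ n * cis (- t) ^ n))"
    using g by (intro Bochner_Integration.integral_cong) (auto simp: b ev)
  also have "\<dots> = (\<Sum>n. a n * z ^ n)" by (rule fourier_pairing[OF sa sb])
  also have "\<dots> = g z" using z g by (intro ev[symmetric]) auto
  finally show ?thesis .
qed

lemma continuous_on_circle:
  assumes "g holomorphic_on ball 0 R" "1 < R"
  shows "continuous_on UNIV (\<lambda>t. g (cis t))"
  by (rule continuous_on_compose2[OF holomorphic_on_imp_continuous_on[OF assms(1)]])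
     (use assms in \<open>auto intro!: continuous_intros\<close>)

text \<open>Cauchy's formula for \<open>f w / (1 - cnj z w)\<close> at \<open>w = z\<close> is Poisson's formula.\<close>

lemma poisson_circ:
  assumes g: "g holomorphic_on ball 0 R" "1 < R" and z: "cmod z < 1"
  shows "(LINT t|circ. of_real ((1 - (cmod z)\<^sup>2) / (cmod (1 - z * cis (- t)))\<^sup>2) * g (cis t)) = g z"
proof -
  \<comment> \<open>The zero of \<open>1 - cnj z * w\<close> has modulus
    \<open>1 / cmod z > 1\<close>, so a radius not exceeding it but above 1 keeps \<open>h\<close>
    holomorphic past the closed disc.\<close>
  define R' where "R' = (if z = 0 then R else min R (1 / cmod z))"
  have R': "1 < R'" "R' \<le> R" using g z by (auto simp: R'_def)
  define h where "h w = g w / (1 - cnj z * w)" for w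
  have nz: "1 - cnj z * w \<noteq> 0" if "cmod w < R'" for w
  proof
    assume "1 - cnj z * w = 0"
    then have *: "cnj z * w = 1" by simp
    then have "cmod z * cmod w = 1" by (metis complex_mod_cnj norm_mult norm_one)
    moreover have "z \<noteq> 0" using * by auto
    ultimately show False using that by (auto simp: R'_def field_simps)
  qed
  have h: "h holomorphic_on ball 0 R'" unfolding h_def
    using R' nz by (intro holomorphic_intros holomorphic_on_subset[OF g(1)]) auto
  have eq: "h (cis t) / (1 - z * cis (- t)) = of_real (1 / (cmod (1 - z * cis (- t)))\<^sup>2) * g (cis t)" for t
  proof -
    have "cnj (1 - z * cis (- t)) = 1 - cnj z * cis t" by (simp add: cis_cnj)
    then have "(1 - cnj z * cis t) * (1 - z * cis (- t)) = of_real ((cmod (1 - z * cis (- t)))\<^sup>2)"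
      by (metis complex_norm_square mult.commute)
    then show ?thesis unfolding h_def
      by (metis (no_types, lifting) divide_divide_eq_left of_real_1 of_real_divide times_divide_eq_left mult_1)
  qed
  have "(LINT t|circ. of_real ((1 - (cmod z)\<^sup>2) / (cmod (1 - z * cis (- t)))\<^sup>2) * g (cis t)) =
     (LINT t|circ. of_real (1 - (cmod z)\<^sup>2) * (h (cis t) / (1 - z * cis (- t))))"
    unfolding eq by (intro Bochner_Integration.integral_cong) auto
  also have "\<dots> = of_real (1 - (cmod z)\<^sup>2) * h z"
    by (simp only: integral_mult_right_zero cauchy_circ[OF h R'(1) z])
  also have "\<dots> = g z"
  proof -
    have "cnj z * z = of_real ((cmod z)\<^sup>2)" by (metis complex_norm_square mult.commute)
    then show ?thesis unfolding h_def using nz[of z] z R' 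
      by (simp add: field_simps)
  qed
  finally show ?thesis .
qed

lemma cmod_one_minus_cis_diff:
  "cmod (1 - of_real k * cis t * cis (- s)) = cmod (1 - of_real k * cis (t - s))"
  by (simp add: cis_mult mult.assoc)

text \<open>Dilating by \<open>R\<close> makes the function holomorphic past the closed disc, so
  Poisson's formula applies; the kernel is positive, hence the modulus passes inside. Radius
  \<open>k * R\<close> is thus compared with radius \<open>R\<close>.\<close>

lemma poisson_le:
  assumes f: "f holomorphic_on ball 0 1" and k: "0 \<le> k" "k < 1" and R: "0 < R" "R < 1"
  shows "ennreal (cmod (f (of_real (k * R) * cis t))) \<le>
    (\<integral>\<^sup>+s. ennreal ((1 - k\<^sup>2) / (cmod (1 - of_real k * cis (t - s)))\<^sup>2 * cmod (f (of_real R * cis s))) \<partial>circ)"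
proof -
  define g where "g w = f (of_real R * w)" for w
  have g: "g holomorphic_on ball 0 (1 / R)"
    unfolding g_def using R
    by (intro holomorphic_on_compose_gen[OF _ f, unfolded o_def] holomorphic_intros)
       (auto simp: norm_mult field_simps)
  have R1: "1 < 1 / R" using R by simp
  define K where "K s = (1 - k\<^sup>2) / (cmod (1 - of_real k * cis (t - s)))\<^sup>2" for s
  have Kpos: "0 \<le> K s" for s using k by (simp add: K_def power_le_one)
  have nz: "1 - of_real k * cis s \<noteq> 0" for s
    using one_minus_le_cmod[of k s] k by auto
  have cont: "continuous_on UNIV (\<lambda>s. of_real (K s) * g (cis s))"
    unfolding K_def using nz by (intro continuous_intros continuous_on_circle[OF g R1]) auto
  have "f (of_real (k * R) * cis t) = g (of_real k * cis t)"
    by (simp add: g_def mult_ac)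
  also have "\<dots> = (LINT s|circ. of_real (K s) * g (cis s))"
    using poisson_circ[OF g R1, of "of_real k * cis t"] k
    by (simp add: norm_mult K_def cmod_one_minus_cis_diff)
  finally have "ennreal (cmod (f (of_real (k * R) * cis t))) \<le> (\<integral>\<^sup>+s. norm (of_real (K s) * g (cis s)) \<partial>circ)"
    using integral_norm_bound_ennreal[OF integrable_circ_continuous[OF cont]] by simp
  moreover have "norm (of_real (K s) * g (cis s)) = K s * cmod (f (of_real R * cis s))" for s
    using Kpos[of s] by (simp add: norm_mult g_def)
  ultimately show ?thesis by (simp only: K_def)
qed

text \<open>Poisson's formula for the constant function 1.\<close>

lemma poisson_kernel_integral:
  assumes k: "0 \<le> k" "k < 1"
  shows "(\<integral>\<^sup>+s. ennreal ((1 - k\<^sup>2) / (cmod (1 - of_real k * cis s))\<^sup>2) \<partial>circ) = 1"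
proof -
  define K where "K s = (1 - k\<^sup>2) / (cmod (1 - of_real k * cis s))\<^sup>2" for s
  have Kpos: "0 \<le> K s" for s using k by (simp add: K_def power_le_one)
  have nz: "1 - of_real k * cis s \<noteq> 0" for s
    using one_minus_le_cmod[of k s] k by auto
  have cont: "continuous_on UNIV K"
    unfolding K_def using nz by (intro continuous_intros) auto
  have sym: "cmod (1 - of_real k * cis (- s)) = cmod (1 - of_real k * cis s)" for s
  proof -
    have "1 - of_real k * cis (- s) = cnj (1 - of_real k * cis s)" by (simp add: cis_cnj)
    then show ?thesis by (simp only: complex_mod_cnj)
  qed
  have "(LINT t|circ. complex_of_real (K t)) = 1"
    using poisson_circ[of "\<lambda>_. 1" 2 "of_real k"] k by (simp add: norm_mult K_def sym)
  then have "complex_of_real (LINT t|circ. K t) = 1" by (simp only: integral_complex_of_real)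
  then have "(LINT t|circ. K t) = 1" by (simp only: of_real_eq_1_iff)
  moreover have "(\<integral>\<^sup>+s. ennreal (K s) \<partial>circ) = ennreal (LINT t|circ. K t)"
    by (rule nn_integral_eq_integral) (use Kpos cont in \<open>auto intro: integrable_circ_continuous\<close>)
  ultimately show ?thesis by (simp add: K_def)
qed

text \<open>The boundary kernel that produces the derivative, symmetrised so that it decays like
  \<open>1 / \<bar>\<tau>\<bar> ^ 3\<close> away from the diagonal.\<close>

definition deriv_kernel :: "real \<Rightarrow> real \<Rightarrow> complex" where
  "deriv_kernel s \<tau> = - 2 * \<i> * of_real ((1 - s\<^sup>2) * sin \<tau> / cmod (1 - of_real s * cis \<tau>) ^ 4)"

text \<open>The first term alone is the kernel that differentiates a power series; near the boundary
  it decays only like \<open>1 / \<tau>^2\<close>. Subtracting its conjugate makes the numerator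
  collapse to \<open>(1 - s^2) * (cnj w - w)\<close>, a multiple of \<open>sin \<tau>\<close>, over
  a fourth power.\<close>

lemma deriv_kernel_eq:
  assumes s: "0 \<le> s" "s < 1"
  shows "deriv_kernel s \<tau> = cis (- \<tau>) / (1 - of_real s * cis (- \<tau>))\<^sup>2 - cis \<tau> / (1 - of_real s * cis \<tau>)\<^sup>2"
proof -
  define w where "w = cis \<tau>"
  define D where "D = 1 - of_real s * w"
  have w: "w * cnj w = 1" by (simp add: w_def cis_cnj cis_mult)
  have D0: "D \<noteq> 0" using one_minus_le_cmod[of s \<tau>] s by (auto simp: D_def w_def)
  have "D * cnj D = of_real ((cmod D)\<^sup>2)" by (metis complex_norm_square)
  then have n4: "D\<^sup>2 * (cnj D)\<^sup>2 = of_real (cmod D ^ 4)"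
    by (simp add: power_mult_distrib[symmetric] flip: of_real_power power_mult)
  have cD: "cnj D = 1 - of_real s * cnj w" by (simp add: D_def)
  have num: "cnj w * D\<^sup>2 - w * (cnj D)\<^sup>2 = (1 - of_real (s\<^sup>2)) * (cnj w - w)"
  proof -
    have "cnj w * D\<^sup>2 - w * (cnj D)\<^sup>2 =
      cnj w - w + of_real (s\<^sup>2) * (w * cnj w) * (w - cnj w)"
      unfolding D_def cD[unfolded D_def] by (simp add: power2_eq_square algebra_simps)
    then show ?thesis by (simp add: w algebra_simps)
  qed
  have dif: "cnj w - w = - 2 * \<i> * of_real (sin \<tau>)"
    by (simp add: w_def complex_eq_iff)
  have "cnj w / (cnj D)\<^sup>2 - w / D\<^sup>2 = (cnj w * D\<^sup>2 - w * (cnj D)\<^sup>2) / (D\<^sup>2 * (cnj D)\<^sup>2)"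
    using D0 by (simp add: field_simps)
  also have "\<dots> = deriv_kernel s \<tau>"
    unfolding num dif n4 by (simp add: deriv_kernel_def D_def w_def)
  finally show ?thesis unfolding cD D_def w_def by (simp add: cis_cnj)
qed

text \<open>The half of the kernel with negative frequencies multiplies the coefficient
  \<open>d n\<close> by \<open>n * s ^ (n - 1)\<close>; the other half pairs to
  \<open>a 0 * b 0\<close>, and \<open>b 0 = 0\<close>. At \<open>n = 0\<close> the truncated
  exponent \<open>n - 1\<close> is harmless because of the factor \<open>n\<close>.\<close>

lemma deriv_formula:
  fixes d :: "nat \<Rightarrow> complex"
  assumes d: "summable (\<lambda>n. norm (d n))" and s: "0 \<le> s" "s < 1"
  shows "(LINT \<tau>|circ. (\<Sum>n. d n * cis (\<theta> + \<tau>) ^ n) * deriv_kernel s \<tau>) =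
    (\<Sum>n. of_nat n * d n * of_real s ^ (n - 1) * cis \<theta> ^ n)"
proof -
  define a where "a n = d n * cis \<theta> ^ n" for n
  define b :: "nat \<Rightarrow> complex" where "b n = of_nat n * of_real s ^ (n - 1)" for n
  have sa: "summable (\<lambda>n. norm (a n))" using d by (simp add: a_def norm_mult norm_power)
  have bs: "(\<lambda>n. b n * w ^ n) sums (w / (1 - of_real s * w)\<^sup>2)" if "cmod w \<le> 1" for w :: complex
  proof -
    have "cmod (of_real s * w) \<le> s * 1" using s that unfolding norm_mult by (intro mult_mono) auto
    then have "cmod (of_real s * w) < 1" using s by simp
    from sums_mult[OF geometric_deriv_sums[OF this], of w]
    have "(\<lambda>n. b (Suc n) * w ^ Suc n) sums (w / (1 - of_real s * w)\<^sup>2)"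
      by (simp add: b_def power_mult_distrib mult_ac)
    then show ?thesis by (subst (asm) sums_Suc_iff) (simp add: b_def)
  qed
  have sb: "summable (\<lambda>n. norm (b n))"
  proof -
    have "norm (b n) = norm (of_nat n * s ^ (n - 1))" for n using s by (simp add: b_def norm_mult norm_power)
    moreover have "summable (\<lambda>n. of_nat (Suc n) * s ^ n)"
      using geometric_deriv_sums[of s] s by (simp add: sums_iff)
    then have "summable (\<lambda>n. of_nat n * s ^ (n - 1))" by (subst summable_Suc_iff[symmetric]) simp
    ultimately show ?thesis using s by simp
  qed
  have A: "(\<Sum>n. d n * cis (\<theta> + \<tau>) ^ n) = (\<Sum>n. a n * cis \<tau> ^ n)" for \<tau>
    by (simp add: a_def cis_mult[symmetric] power_mult_distrib mult_ac)
  have eq: "(\<Sum>n. d n * cis (\<theta> + \<tau>) ^ n) * deriv_kernel s \<tau> =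
     (\<Sum>n. a n * cis \<tau> ^ n) * (\<Sum>n. b n * cis (- \<tau>) ^ n) - (\<Sum>n. a n * cis \<tau> ^ n) * (\<Sum>n. b n * cis \<tau> ^ n)" for \<tau>
    unfolding A deriv_kernel_eq[OF s] using bs[of "cis \<tau>"] bs[of "cis (- \<tau>)"]
    by (simp add: sums_iff algebra_simps)
  have "(LINT \<tau>|circ. (\<Sum>n. d n * cis (\<theta> + \<tau>) ^ n) * deriv_kernel s \<tau>) = (\<Sum>n. a n * b n) - a 0 * b 0"
    unfolding eq fourier_pairing[OF sa sb, symmetric] fourier_pairing_pos[OF sa sb, symmetric]
    by (intro Bochner_Integration.integral_diff integrable_circ_continuous continuous_intros
        continuous_on_power_series_cis sa sb)
  then show ?thesis by (simp add: a_def b_def mult_ac)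
qed

lemma norm_deriv_kernel_le:
  assumes "0 \<le> s" "s < 1"
  shows "norm (deriv_kernel s \<tau>) \<le> 4 * (1 - s) * (\<bar>\<tau>\<bar> / cmod (1 - of_real s * cis \<tau>) powr 4)"
proof -
  have pos: "0 < cmod (1 - of_real s * cis \<tau>)" using one_minus_le_cmod[of s \<tau>] assms by linarith
  have "1 - s\<^sup>2 = (1 + s) * (1 - s)" by (simp add: power2_eq_square algebra_simps)
  also have "\<dots> \<le> 2 * (1 - s)" using assms by (intro mult_right_mono) auto
  finally have 1: "1 - s\<^sup>2 \<le> 2 * (1 - s)" .
  have 0: "0 \<le> 1 - s\<^sup>2" using assms by (simp add: power_le_one)
  have "norm (deriv_kernel s \<tau>) = 2 * ((1 - s\<^sup>2) * \<bar>sin \<tau>\<bar> / cmod (1 - of_real s * cis \<tau>) ^ 4)"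
    using 0 unfolding deriv_kernel_def by (simp add: norm_mult norm_divide norm_power abs_mult del: of_real_diff of_real_power)
  also have "\<dots> \<le> 2 * ((2 * (1 - s)) * \<bar>\<tau>\<bar> / cmod (1 - of_real s * cis \<tau>) ^ 4)"
    using 0 1 assms abs_sin_x_le_abs_x[of \<tau>]
    by (intro mult_left_mono divide_right_mono mult_mono) auto
  also have "cmod (1 - of_real s * cis \<tau>) ^ 4 = cmod (1 - of_real s * cis \<tau>) powr 4"
    using pos powr_realpow[of "cmod (1 - of_real s * cis \<tau>)" 4] by simp
  finally show ?thesis by (simp add: mult_ac)
qed

lemma continuous_on_deriv_kernel:
  assumes "0 \<le> s" "s < 1"
  shows "continuous_on A (deriv_kernel s)"
proof -
  have "1 - of_real s * cis \<tau> \<noteq> 0" for \<tau> using one_minus_le_cmod[of s \<tau>] assms by auto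
  then show ?thesis unfolding deriv_kernel_def by (intro continuous_intros) auto
qed

text \<open>This is the derivative formula for a constant function. Mean zero later permits
  replacing a function by its increments under the integral.\<close>

lemma integral_deriv_kernel:
  assumes "0 \<le> s" "s < 1"
  shows "(LINT \<tau>|circ. deriv_kernel s \<tau>) = 0"
proof -
  have "(\<Sum>n. (if n = 0 then 1 else 0 :: complex) * w ^ n) = 1" for w :: complex
  proof -
    have "(\<lambda>n. (if n = 0 then 1 else 0 :: complex) * w ^ n) = (\<lambda>n. if n = 0 then w ^ n else 0)" by auto
    then show ?thesis using sums_single[of 0 "\<lambda>m. w ^ m"] by (simp add: sums_iff)
  qed
  moreover have "(\<Sum>n. of_nat n * (if n = 0 then 1 else 0 :: complex) * of_real s ^ (n - 1) * cis 0 ^ n) = 0"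
    by (subst suminf_zero[symmetric], intro suminf_cong) auto
  moreover have "summable (\<lambda>n. norm (if n = (0::nat) then 1 else 0 :: complex))"
    by (rule summable_finite[of "{0}"]) auto
  ultimately show ?thesis
    using deriv_formula[OF _ assms, of "\<lambda>n. if n = 0 then 1 else 0" 0] by simp
qed

text \<open>Each factor carries \<open>\<rho> ^ n\<close> and the pairing keeps equal indices only,
  so the product of the coefficients appears at the squared radius.\<close>

lemma hadamard_formula:
  fixes a b :: "nat \<Rightarrow> complex"
  assumes "summable (\<lambda>n. norm (a n) * \<rho> ^ n)" "summable (\<lambda>n. norm (b n) * \<rho> ^ n)" "0 \<le> \<rho>"
  shows "(LINT t|circ. (\<Sum>n. b n * (of_real \<rho> * cis (\<theta> - t)) ^ n) * (\<Sum>n. a n * (of_real \<rho> * cis t) ^ n)) =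
    (\<Sum>n. a n * b n * (of_real (\<rho>\<^sup>2) * cis \<theta>) ^ n)"
proof -
  have sa: "summable (\<lambda>n. norm (a n * of_real \<rho> ^ n))"
    using assms by (simp add: norm_mult norm_power)
  have sb: "summable (\<lambda>n. norm (b n * of_real \<rho> ^ n * cis \<theta> ^ n))"
    using assms by (simp add: norm_mult norm_power)
  have "(LINT t|circ. (\<Sum>n. b n * (of_real \<rho> * cis (\<theta> - t)) ^ n) * (\<Sum>n. a n * (of_real \<rho> * cis t) ^ n)) =
     (LINT t|circ. (\<Sum>n. (a n * of_real \<rho> ^ n) * cis t ^ n) * (\<Sum>n. (b n * of_real \<rho> ^ n * cis \<theta> ^ n) * cis (- t) ^ n))"
    by (intro Bochner_Integration.integral_cong)
       (auto simp: power_mult_distrib mult_ac cis_mult[symmetric] diff_conv_add_uminus simp del: add_uminus_conv_diff)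
  also have "\<dots> = (\<Sum>n. (a n * of_real \<rho> ^ n) * (b n * of_real \<rho> ^ n * cis \<theta> ^ n))"
    by (rule fourier_pairing[OF sa sb])
  also have "\<dots> = (\<Sum>n. a n * b n * (of_real (\<rho>\<^sup>2) * cis \<theta>) ^ n)"
    by (intro suminf_cong) (simp add: power_mult_distrib power2_eq_square mult_ac)
  finally show ?thesis .
qed

lemma Lp_le_L1:
  fixes u :: "real \<Rightarrow> 'a::real_normed_vector"
  assumes "Lp_le p u B" "1 < p" and [measurable]: "(\<lambda>t. norm (u t)) \<in> borel_measurable borel"
  shows "(\<integral>\<^sup>+t. ennreal (norm (u t)) \<partial>circ) \<le> ennreal B"
proof -
  have "(\<integral>\<^sup>+t. ennreal (norm (u t) * 1) \<partial>circ) \<le> ennreal (B * 1)"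
    by (rule nn_holder[where q = "p / (p - 1)" and p = p])
       (use assms in \<open>auto simp: Lp_le_def emeasure_circ_UNIV field_simps\<close>)
  then show ?thesis by simp
qed

text \<open>Outside the disc the function may be arbitrary, so joint measurability in radius and
  angle is only available after the cut-off by the indicator.\<close>

lemma measurable_polar:
  fixes f :: "complex \<Rightarrow> 'a::{real_normed_vector, second_countable_topology}"
  assumes "continuous_on (ball 0 1) f"
  shows "(\<lambda>x. indicator {0..<1} (fst x) *\<^sub>R f (of_real (fst x) * cis (snd x)))
     \<in> borel_measurable (borel \<Otimes>\<^sub>M borel)"
proof -
  have "continuous_on ({0..<1} \<times> UNIV) (\<lambda>x. f (of_real (fst x) * cis (snd x)))"
    by (rule continuous_on_compose2[OF assms]) (auto intro!: continuous_intros simp: norm_mult)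
  moreover have "({0..<1} \<times> UNIV :: (real \<times> real) set) \<in> sets borel"
    by (simp add: borel_prod[symmetric])
  ultimately have "(\<lambda>x. indicator ({0..<1} \<times> UNIV) x *\<^sub>R f (of_real (fst x) * cis (snd x))) \<in> borel_measurable borel"
    by (rule borel_measurable_continuous_on_indicator[rotated])
  also have "(\<lambda>x::real \<times> real. indicator ({0..<1} \<times> UNIV) x *\<^sub>R f (of_real (fst x) * cis (snd x))) =
     (\<lambda>x. indicator {0..<1} (fst x) *\<^sub>R f (of_real (fst x) * cis (snd x)))"
    by (auto simp: fun_eq_iff split: split_indicator)
  finally show ?thesis by (simp add: borel_prod)
qed

lemma one_minus_cis_nonzero:
  assumes "0 \<le> k" "k < 1"
  shows "1 - complex_of_real k * cis t \<noteq> 0"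
  using one_minus_le_cmod[of k t] assms by auto

text \<open>The triangle inequality gives \<open>d r s \<le> d r t + 2 * d k (t - s)\<close>. After
  multiplication by the Poisson kernel the mixed term with \<open>2 / (d k (t - s) * d r t)\<close>
  is split into a sum of two squares, each of which is bounded by a Poisson kernel. The resulting
  bound \<open>2 * P k (t - s) + P r t\<close> has mean 3, the constant.\<close>

lemma poisson_kernel_convolution:
  assumes r: "0 \<le> r" "r \<le> k" "k < 1"
  shows "(\<integral>\<^sup>+t. ennreal ((1 - k\<^sup>2) / (cmod (1 - of_real k * cis (t - s)))\<^sup>2 / cmod (1 - of_real r * cis t)) \<partial>circ)
    \<le> ennreal (3 / cmod (1 - of_real r * cis s))"
proof -
  define P where "P k t = (1 - k\<^sup>2) / (cmod (1 - of_real k * cis t))\<^sup>2" for k t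
  define d where "d k t = cmod (1 - of_real k * cis t)" for k t
  have dpos: "0 < d k t" "0 < d r t" for t
    using one_minus_cis_nonzero[of k t] one_minus_cis_nonzero[of r t] r by (auto simp: d_def)
  have k2: "0 \<le> 1 - k\<^sup>2" using r by (simp add: power_le_one)
  have kr: "1 - k\<^sup>2 \<le> 1 - r\<^sup>2" using r by (simp add: power_mono)
  have Ppos: "0 \<le> P k t" "0 \<le> P r t" for t using k2 kr by (auto simp: P_def)
  have P: "P k t = (1 - k\<^sup>2) / (d k t)\<^sup>2" "P r t = (1 - r\<^sup>2) / (d r t)\<^sup>2" for t by (auto simp: P_def d_def)
  have [measurable]: "P k \<in> borel_measurable borel" for k unfolding P_def by measurable
  have pt: "P k (t - s) / d r t \<le> (2 * P k (t - s) + P r t) * (1 / d r s)" for t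
  proof -
    have "d r s \<le> d r t + cmod (of_real r * cis t - of_real r * cis s)"
      unfolding d_def using norm_triangle_ineq[of "1 - of_real r * cis t" "of_real r * cis t - of_real r * cis s"] by simp
    also have "of_real r * cis t - of_real r * cis s = - of_real r * cis s * (1 - cis (t - s))"
      by (simp add: algebra_simps cis_mult)
    also have "cmod \<dots> = r * cmod (1 - cis (t - s))" using r by (simp add: norm_mult)
    also have "\<dots> \<le> 1 * (2 * d k (t - s))"
      unfolding d_def using r cis_diff_le_radial[of k "t - s"] by (intro mult_mono) auto
    finally have 1: "d r s \<le> d r t + 2 * d k (t - s)" by simp
    have "P k (t - s) * d r s / d r t \<le> P k (t - s) * (d r t + 2 * d k (t - s)) / d r t"
      using dpos[of t] Ppos by (intro divide_right_mono mult_left_mono 1) auto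
    also have "\<dots> = P k (t - s) + (1 - k\<^sup>2) * (2 * (1 / d k (t - s)) * (1 / d r t))"
      using dpos(1)[of "t - s"] dpos(2)[of t] unfolding P by (simp add: field_simps power2_eq_square)
    also have "2 * (1 / d k (t - s)) * (1 / d r t) \<le> (1 / d k (t - s))\<^sup>2 + (1 / d r t)\<^sup>2"
      by (rule sum_squares_bound)
    also have "P k (t - s) + (1 - k\<^sup>2) * ((1 / d k (t - s))\<^sup>2 + (1 / d r t)\<^sup>2) =
        2 * P k (t - s) + (1 - k\<^sup>2) / (d r t)\<^sup>2"
      unfolding P by (simp add: field_simps)
    also have "(1 - k\<^sup>2) / (d r t)\<^sup>2 \<le> P r t" unfolding P using kr by (intro divide_right_mono) auto
    finally have "P k (t - s) * d r s / d r t \<le> 2 * P k (t - s) + P r t" using k2 by (simp add: mult_left_mono)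
    then show ?thesis using dpos(2)[of s] by (simp add: field_simps)
  qed
  have per: "P k (t + 2 * pi) = P k t" for t by (simp add: P_def cis_mult[symmetric])
  have "(\<integral>\<^sup>+t. ennreal (P k (t - s) / d r t) \<partial>circ) \<le>
     (\<integral>\<^sup>+t. (2 * ennreal (P k (t - s)) + ennreal (P r t)) * ennreal (1 / d r s) \<partial>circ)"
  proof (intro nn_integral_mono)
    fix t
    have "ennreal (P k (t - s) / d r t) \<le> ennreal ((2 * P k (t - s) + P r t) * (1 / d r s))"
      by (intro ennreal_leI pt)
    also have "\<dots> = (2 * ennreal (P k (t - s)) + ennreal (P r t)) * ennreal (1 / d r s)"
    proof -
      have "ennreal (2 * P k (t - s) + P r t) = 2 * ennreal (P k (t - s)) + ennreal (P r t)"
        using Ppos by (simp add: ennreal_mult)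
      moreover have "ennreal ((2 * P k (t - s) + P r t) * (1 / d r s)) = ennreal (2 * P k (t - s) + P r t) * ennreal (1 / d r s)"
        using Ppos dpos(2)[of s] by (intro ennreal_mult) auto
      ultimately show ?thesis by simp
    qed
    finally show "ennreal (P k (t - s) / d r t) \<le> (2 * ennreal (P k (t - s)) + ennreal (P r t)) * ennreal (1 / d r s)" .
  qed
  also have "\<dots> = (2 * (\<integral>\<^sup>+t. ennreal (P k (t - s)) \<partial>circ) + (\<integral>\<^sup>+t. ennreal (P r t) \<partial>circ)) * ennreal (1 / d r s)"
    by (simp add: nn_integral_multc nn_integral_add nn_integral_cmult)
  also have "(\<integral>\<^sup>+t. ennreal (P k (t - s)) \<partial>circ) = (\<integral>\<^sup>+t. ennreal (P k t) \<partial>circ)"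
    using nn_integral_circ_shift[of "\<lambda>t. ennreal (P k t)" "- s"] per by simp
  also have "(\<integral>\<^sup>+t. ennreal (P k t) \<partial>circ) = 1"
    unfolding P_def using r by (intro poisson_kernel_integral) auto
  also have "(\<integral>\<^sup>+t. ennreal (P r t) \<partial>circ) = 1"
    unfolding P_def using r by (intro poisson_kernel_integral) auto
  also have "(2 * 1 + 1) * ennreal (1 / d r s) = ennreal (3 / d r s)"
  proof -
    have "(2 * 1 + 1 :: ennreal) = ennreal 3" by simp
    then have "(2 * 1 + 1) * ennreal (1 / d r s) = ennreal 3 * ennreal (1 / d r s)" by simp
    also have "\<dots> = ennreal (3 * (1 / d r s))"
      using dpos(2)[of s] by (intro ennreal_mult[symmetric]) auto
    finally show ?thesis by simp
  qed
  finally show ?thesis unfolding P_def d_def .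
qed

section \<open>Hilbert's inequality\<close>

text \<open>The \<open>L\<^sup>1\<close> mean of \<open>f z / (1 - z)\<close>; the indicator makes it measurable in the radius.\<close>

definition cesaro_mean :: "(complex \<Rightarrow> complex) \<Rightarrow> real \<Rightarrow> real" where
  "cesaro_mean f r = (LINT t|circ. indicator {0..<1} r *\<^sub>R
     (cmod (f (of_real r * cis t)) / cmod (1 - of_real r * cis t)))"

lemma continuous_on_quotient_ball:
  assumes "f holomorphic_on ball 0 1"
  shows "continuous_on (ball 0 1) (\<lambda>z. cmod (f z) / cmod (1 - z))"
  using holomorphic_on_imp_continuous_on[OF assms] by (intro continuous_intros) auto

lemma borel_measurable_cesaro_mean:
  assumes f: "f holomorphic_on ball 0 1"
  shows "cesaro_mean f \<in> borel_measurable borel"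
  unfolding cesaro_mean_def
  using measurable_polar[OF continuous_on_quotient_ball[OF f]]
  by (intro circ.borel_measurable_lebesgue_integral) (simp add: split_beta)

lemma cesaro_mean_nonneg: "0 \<le> cesaro_mean f r"
  unfolding cesaro_mean_def by (intro integral_nonneg_AE AE_I2) auto

lemma continuous_on_circle_radius:
  fixes f :: "complex \<Rightarrow> 'a::topological_space"
  assumes "continuous_on (ball 0 1) f" "0 \<le> r" "r < 1"
  shows "continuous_on UNIV (\<lambda>t. f (of_real r * cis t))"
  by (rule continuous_on_compose2[OF assms(1)]) (use assms in \<open>auto intro!: continuous_intros simp: norm_mult\<close>)

lemma ennreal_cesaro_mean:
  assumes f: "f holomorphic_on ball 0 1" and r: "0 \<le> r" "r < 1"
  shows "ennreal (cesaro_mean f r) =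
    (\<integral>\<^sup>+t. ennreal (cmod (f (of_real r * cis t)) / cmod (1 - of_real r * cis t)) \<partial>circ)"
proof -
  have "cesaro_mean f r = (LINT t|circ. cmod (f (of_real r * cis t)) / cmod (1 - of_real r * cis t))"
    using r by (simp add: cesaro_mean_def)
  then show ?thesis
    using continuous_on_circle_radius[OF continuous_on_quotient_ball[OF f] r]
    by (simp add: nn_integral_eq_integral integrable_circ_continuous)
qed

text \<open>For Schur's test the boundary data must not vary with \<open>r\<close>. Poisson's
  formula expresses \<open>f\<close> on the circle of radius \<open>r\<close> by its values on the
  fixed circle of radius \<open>R\<close>; Fubini moves the Poisson kernel onto
  \<open>1 / d\<close>, where \<open>poisson_kernel_convolution\<close> absorbs it.\<close>

lemma cesaro_mean_le_boundary:
  assumes f: "f holomorphic_on ball 0 1" and r: "0 \<le> r" "r < R" "R < 1"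
  shows "ennreal (cesaro_mean f r) \<le>
    (\<integral>\<^sup>+s. ennreal (3 * cmod (f (of_real R * cis s)) / cmod (1 - of_real r * cis s)) \<partial>circ)"
proof -
  \<comment> \<open>\<open>R < 1\<close> gives \<open>r \<le> k\<close>, as
    \<open>poisson_kernel_convolution\<close> demands.\<close>
  define k where "k = r / R"
  have k: "0 \<le> k" "k < 1" "r \<le> k" "k * R = r" "0 < R"
    using r by (auto simp: k_def field_simps mult_left_le_one_le)
  define P where "P t = (1 - k\<^sup>2) / (cmod (1 - of_real k * cis t))\<^sup>2" for t
  define d where "d t = cmod (1 - of_real r * cis t)" for t
  define \<phi> where "\<phi> s = cmod (f (of_real R * cis s))" for s
  have Ppos: "0 \<le> P t" for t using k by (simp add: P_def power_le_one)
  have [measurable]: "P \<in> borel_measurable borel" "d \<in> borel_measurable borel"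
    unfolding P_def d_def by measurable
  have [measurable]: "\<phi> \<in> borel_measurable borel" unfolding \<phi>_def
    using r k by (intro borel_measurable_continuous_onI continuous_intros
        continuous_on_circle_radius[OF holomorphic_on_imp_continuous_on[OF f]]) auto
  interpret P: pair_sigma_finite circ circ ..
  have "ennreal (cesaro_mean f r) = (\<integral>\<^sup>+t. ennreal (cmod (f (of_real r * cis t))) * ennreal (1 / d t) \<partial>circ)"
    using r by (subst ennreal_cesaro_mean[OF f]) (auto simp: d_def ennreal_mult[symmetric])
  also have "\<dots> \<le> (\<integral>\<^sup>+t. (\<integral>\<^sup>+s. ennreal (P (t - s) * \<phi> s) \<partial>circ) * ennreal (1 / d t) \<partial>circ)"
    using poisson_le[OF f k(1,2) k(5) r(3)]
    by (intro nn_integral_mono mult_right_mono) (simp_all only: k(4) P_def \<phi>_def zero_le)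
  also have "\<dots> = (\<integral>\<^sup>+t. (\<integral>\<^sup>+s. ennreal (P (t - s) * \<phi> s) * ennreal (1 / d t) \<partial>circ) \<partial>circ)"
    by (intro nn_integral_cong nn_integral_multc[symmetric]) measurable
  also have "\<dots> = (\<integral>\<^sup>+s. (\<integral>\<^sup>+t. ennreal (P (t - s) * \<phi> s) * ennreal (1 / d t) \<partial>circ) \<partial>circ)"
    by (rule P.Fubini') measurable
  also have "\<dots> = (\<integral>\<^sup>+s. ennreal (\<phi> s) * (\<integral>\<^sup>+t. ennreal (P (t - s) / d t) \<partial>circ) \<partial>circ)"
  proof (intro nn_integral_cong)
    fix s
    have "(\<integral>\<^sup>+t. ennreal (P (t - s) * \<phi> s) * ennreal (1 / d t) \<partial>circ) =
       (\<integral>\<^sup>+t. ennreal (\<phi> s) * ennreal (P (t - s) / d t) \<partial>circ)"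
      using Ppos by (intro nn_integral_cong) (auto simp: ennreal_mult[symmetric] \<phi>_def d_def mult_ac)
    also have "\<dots> = ennreal (\<phi> s) * (\<integral>\<^sup>+t. ennreal (P (t - s) / d t) \<partial>circ)"
      by (rule nn_integral_cmult) measurable
    finally show "(\<integral>\<^sup>+t. ennreal (P (t - s) * \<phi> s) * ennreal (1 / d t) \<partial>circ) =
      ennreal (\<phi> s) * (\<integral>\<^sup>+t. ennreal (P (t - s) / d t) \<partial>circ)" .
  qed
  also have "\<dots> \<le> (\<integral>\<^sup>+s. ennreal (\<phi> s) * ennreal (3 / d s) \<partial>circ)"
    unfolding P_def d_def using r k
    by (intro nn_integral_mono mult_left_mono poisson_kernel_convolution) auto
  also have "\<dots> = (\<integral>\<^sup>+s. ennreal (3 * \<phi> s / d s) \<partial>circ)"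
    by (intro nn_integral_cong) (auto simp: ennreal_mult[symmetric] \<phi>_def d_def mult_ac)
  finally show ?thesis unfolding \<phi>_def d_def .
qed

text \<open>Hilbert's inequality, by Schur's test with the weight \<open>\<bar>t\<bar> powr (- 1 / p)\<close>.\<close>

lemma cesaro_mean_Lp:
  fixes p :: real
  assumes p: "1 < p"
  obtains C where "0 < C"
    "\<And>f N R. f holomorphic_on ball 0 1 \<Longrightarrow> 0 < R \<Longrightarrow> R < 1 \<Longrightarrow>
       Lp_le p (\<lambda>t. f (of_real R * cis t)) N \<Longrightarrow>
       (\<integral>\<^sup>+r. ennreal (cesaro_mean f r powr p) * indicator {0..<R} r \<partial>lborel) \<le> ennreal ((C * N) powr p)"
proof -
  have a1: "-1 < - 1 / p" "- 1 / p + 1 < 1" using p by (auto simp: field_simps)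
  have a2: "-1 < - (p - 1) / p" "- (p - 1) / p + 1 < 1" using p by (auto simp: field_simps)
  obtain C1 where C1: "0 < C1" "\<And>r. 0 \<le> r \<Longrightarrow> r < 1 \<Longrightarrow>
      (\<integral>\<^sup>+t. ennreal (\<bar>t\<bar> powr (- 1 / p) / cmod (1 - of_real r * cis t) powr 1) \<partial>circ) \<le>
      ennreal (C1 * (1 - r) powr (- 1 / p - 1 + 1))"
    using circ_kernel[OF a1] by blast
  obtain C2 where C2: "0 < C2" "\<And>t. t \<noteq> 0 \<Longrightarrow> \<bar>t\<bar> \<le> pi \<Longrightarrow>
      (\<integral>\<^sup>+r. ennreal ((1 - r) powr (- (p - 1) / p) / cmod (1 - of_real r * cis t) powr 1) * indicator {0..<1} r \<partial>lborel) \<le>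
      ennreal (C2 * \<bar>t\<bar> powr (- (p - 1) / p - 1 + 1))"
    using radial_kernel[OF a2] by blast
  \<comment> \<open>\<open>C1\<close> enters with the power \<open>p - 1\<close> from the weighted
    Hoelder bound, \<open>C2\<close> from the radial integral, and 3 from the reduction to the
    circle of radius \<open>R\<close>.\<close>
  define C where "C = (C1 powr (p - 1) * C2) powr (1 / p) * 3"
  have C: "0 < C" "C powr p = C1 powr (p - 1) * C2 * 3 powr p" 
    using C1 C2 p by (auto simp: C_def powr_mult powr_powr)
  show ?thesis
  proof (rule that[OF C(1)])
    fix f N R assume f: "f holomorphic_on ball 0 1" and R: "0 < R" "R < (1::real)"
      and N: "Lp_le p (\<lambda>t. f (of_real R * cis t)) N"
    define \<phi> where "\<phi> s = 3 * cmod (f (of_real R * cis s))" for s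
    define d where "d r s = cmod (1 - of_real r * cis s)" for r s
    define e where "e = (p - 1) / p"
    have me: "- (p - 1) / p = - e" by (simp only: e_def minus_divide_left)
    have cont: "continuous_on UNIV (\<lambda>s. cmod (f (of_real R * cis s)))"
      using R by (intro continuous_intros
        continuous_on_circle_radius[OF holomorphic_on_imp_continuous_on[OF f]]) auto
    have [measurable]: "\<phi> \<in> borel_measurable borel" unfolding \<phi>_def
      by (intro borel_measurable_continuous_onI continuous_intros cont)
    have [measurable]: "(\<lambda>x. d (fst x) (snd x)) \<in> borel_measurable (borel \<Otimes>\<^sub>M borel)"
      "d r \<in> borel_measurable borel" for r
      unfolding d_def by measurable
    have N0: "0 \<le> N" using N by (simp add: Lp_le_def)
    have dpos: "0 < d r s" if "0 \<le> r" "r < 1" for r s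
      using one_minus_cis_nonzero[OF that] by (auto simp: d_def)
    have \<phi>N: "(\<integral>\<^sup>+s. ennreal (\<phi> s powr p) \<partial>circ) \<le> ennreal ((3 * N) powr p)"
    proof -
      have "Lp_le p \<phi> (3 * N)"
        by (rule Lp_le_cmult[OF N]) (use p cont in \<open>auto simp: \<phi>_def intro: borel_measurable_continuous_onI\<close>)
      then show ?thesis by (simp add: Lp_le_def \<phi>_def)
    qed
    define J where "J r = (\<integral>\<^sup>+s. ennreal (\<phi> s powr p * \<bar>s\<bar> powr e / d r s) \<partial>circ)" for r
    have Jm [measurable]: "J \<in> borel_measurable borel"
      unfolding J_def by (intro circ.borel_measurable_nn_integral) (unfold d_def, measurable)
    have step: "ennreal (cesaro_mean f r powr p) \<le> ennreal (C1 powr (p - 1) * (1 - r) powr (- e)) * J r"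
      if r: "0 \<le> r" "r < R" for r
    proof -
      have r1: "r < 1" using r R by simp
      have d0: "0 < d r s" for s using dpos r r1 by auto
      \<comment> \<open>The Schur weight is \<open>\<bar>s\<bar> powr (- 1 / p) / d r s\<close>; by
        \<open>circ_kernel\<close> its integral is at most
        \<open>C1 * (1 - r) powr (- 1 / p)\<close>, and the power \<open>p - 1\<close> of this is
        the prefactor.\<close>
      have "ennreal (cesaro_mean f r powr p) \<le> ennreal ((C1 * (1 - r) powr (- 1 / p)) powr (p - 1)) *
         (\<integral>\<^sup>+s. ennreal ((\<bar>s\<bar> powr (- 1 / p) / d r s) powr (1 - p) * (\<phi> s / d r s) powr p) \<partial>circ)"
      proof (rule powr_integral_le[OF p])
        show "AE s in circ. 0 < \<bar>s\<bar> powr (- 1 / p) / d r s"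
          using d0 by (intro eventually_mono[OF AE_circ_nonzero]) auto
        show "0 \<le> \<phi> s / d r s" for s using d0[of s] by (simp add: \<phi>_def)
        show "(\<integral>\<^sup>+s. ennreal (\<bar>s\<bar> powr (- 1 / p) / d r s) \<partial>circ) \<le> ennreal (C1 * (1 - r) powr (- 1 / p))"
        proof -
          have "d r s powr 1 = d r s" for s using d0[of s] by simp
          then show ?thesis using C1(2)[of r] r r1 by (simp add: d_def)
        qed
        show "0 < C1 * (1 - r) powr (- 1 / p)" using C1 r1 by simp
        show "ennreal (cesaro_mean f r) \<le> (\<integral>\<^sup>+s. ennreal (\<phi> s / d r s) \<partial>circ)"
          unfolding \<phi>_def d_def by (rule cesaro_mean_le_boundary[OF f]) (use r R in auto)
        show "0 \<le> cesaro_mean f r" by (rule cesaro_mean_nonneg)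
      qed measurable
      also have "(C1 * (1 - r) powr (- 1 / p)) powr (p - 1) = C1 powr (p - 1) * (1 - r) powr (- e)"
        using C1 r1 p by (simp add: powr_mult powr_powr e_def)
      also have "(\<integral>\<^sup>+s. ennreal ((\<bar>s\<bar> powr (- 1 / p) / d r s) powr (1 - p) * (\<phi> s / d r s) powr p) \<partial>circ) = J r"
        unfolding J_def
      proof (intro nn_integral_cong_AE eventually_mono[OF AE_circ_nonzero])
        fix s :: real assume "s \<noteq> 0"
        have "(\<bar>s\<bar> powr (- 1 / p) / d r s) powr (1 - p) * (\<phi> s / d r s) powr p =
           (\<bar>s\<bar> powr (- 1 / p)) powr (1 - p) * \<phi> s powr p / (d r s powr (1 - p) * d r s powr p)"
          using d0[of s] by (simp add: powr_divide \<phi>_def)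
        also have "d r s powr (1 - p) * d r s powr p = d r s"
          using d0[of s] by (simp flip: powr_add)
        also have "(\<bar>s\<bar> powr (- 1 / p)) powr (1 - p) = \<bar>s\<bar> powr e"
        proof -
          have "- 1 / p * (1 - p) = e" using p by (simp add: e_def field_simps)
          then show ?thesis by (simp only: powr_powr)
        qed
        finally show "ennreal ((\<bar>s\<bar> powr (- 1 / p) / d r s) powr (1 - p) * (\<phi> s / d r s) powr p) =
           ennreal (\<phi> s powr p * \<bar>s\<bar> powr e / d r s)" by (simp add: mult_ac)
      qed
      finally show ?thesis .
    qed
    interpret pair_sigma_finite lborel circ ..
    have "(\<integral>\<^sup>+r. ennreal (cesaro_mean f r powr p) * indicator {0..<R} r \<partial>lborel) \<le>
       (\<integral>\<^sup>+r. ennreal (C1 powr (p - 1) * (1 - r) powr (- e)) * indicator {0..<1} r * J r \<partial>lborel)"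
      using step R by (intro nn_integral_mono) (auto split: split_indicator)
    also have "\<dots> = (\<integral>\<^sup>+r. (\<integral>\<^sup>+s. ennreal (C1 powr (p - 1) * (1 - r) powr (- e)) * indicator {0..<1} r *
        ennreal (\<phi> s powr p * \<bar>s\<bar> powr e / d r s) \<partial>circ) \<partial>lborel)"
      unfolding J_def by (intro nn_integral_cong nn_integral_cmult[symmetric]) measurable
    also have "\<dots> = (\<integral>\<^sup>+s. (\<integral>\<^sup>+r. ennreal (C1 powr (p - 1) * (1 - r) powr (- e)) * indicator {0..<1} r *
        ennreal (\<phi> s powr p * \<bar>s\<bar> powr e / d r s) \<partial>lborel) \<partial>circ)"
      by (rule Fubini'[symmetric]) (unfold d_def, measurable)
    also have "\<dots> = (\<integral>\<^sup>+s. ennreal (C1 powr (p - 1) * \<phi> s powr p * \<bar>s\<bar> powr e) *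
        (\<integral>\<^sup>+r. ennreal ((1 - r) powr (- e) / d r s) * indicator {0..<1} r \<partial>lborel) \<partial>circ)"
    proof (intro nn_integral_cong)
      fix s
      have "(\<integral>\<^sup>+r. ennreal (C1 powr (p - 1) * (1 - r) powr (- e)) * indicator {0..<1} r *
        ennreal (\<phi> s powr p * \<bar>s\<bar> powr e / d r s) \<partial>lborel) =
        (\<integral>\<^sup>+r. ennreal (C1 powr (p - 1) * \<phi> s powr p * \<bar>s\<bar> powr e) * (ennreal ((1 - r) powr (- e) / d r s) * indicator {0..<1} r) \<partial>lborel)"
        using dpos by (intro nn_integral_cong)
          (auto simp: ennreal_mult[symmetric] mult_ac less_imp_le split: split_indicator)
      also have "\<dots> = ennreal (C1 powr (p - 1) * \<phi> s powr p * \<bar>s\<bar> powr e) *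
        (\<integral>\<^sup>+r. ennreal ((1 - r) powr (- e) / d r s) * indicator {0..<1} r \<partial>lborel)"
        by (rule nn_integral_cmult) (simp add: d_def)
      finally show "(\<integral>\<^sup>+r. ennreal (C1 powr (p - 1) * (1 - r) powr (- e)) * indicator {0..<1} r *
        ennreal (\<phi> s powr p * \<bar>s\<bar> powr e / d r s) \<partial>lborel) = \<dots>" .
    qed
    also have "\<dots> \<le> (\<integral>\<^sup>+s. ennreal (C1 powr (p - 1) * C2) * ennreal (\<phi> s powr p) \<partial>circ)"
    proof (intro nn_integral_mono_AE, rule AE_mp[OF AE_circ_nonzero], rule AE_mp[OF AE_circ_range], intro AE_I2 impI)
      fix s :: real assume s: "\<bar>s\<bar> \<le> pi" "s \<noteq> 0"
      have "(\<integral>\<^sup>+r. ennreal ((1 - r) powr (- e) / d r s) * indicator {0..<1} r \<partial>lborel) =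
        (\<integral>\<^sup>+r. ennreal ((1 - r) powr (- (p - 1) / p) / cmod (1 - of_real r * cis s) powr 1) * indicator {0..<1} r \<partial>lborel)"
      proof (intro nn_integral_cong)
        show "ennreal ((1 - r) powr (- e) / d r s) * indicator {0..<1} r =
            ennreal ((1 - r) powr (- (p - 1) / p) / cmod (1 - of_real r * cis s) powr 1) * indicator {0..<1} r" for r
          unfolding d_def me by (simp only: powr_one[OF norm_ge_zero])
      qed
      \<comment> \<open>The radial integral reproduces \<open>\<bar>s\<bar> powr (- e)\<close>,
        which cancels the factor \<open>\<bar>s\<bar> powr e\<close> left by the weight; only the
        \<open>p\<close>-th power of the values of \<open>f\<close> remains.\<close>
      also have "\<dots> \<le> ennreal (C2 * \<bar>s\<bar> powr (- e))"
        using C2(2)[OF s(2,1)] unfolding me by simp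
      finally have "ennreal (C1 powr (p - 1) * \<phi> s powr p * \<bar>s\<bar> powr e) *
        (\<integral>\<^sup>+r. ennreal ((1 - r) powr (- e) / d r s) * indicator {0..<1} r \<partial>lborel) \<le>
        ennreal (C1 powr (p - 1) * \<phi> s powr p * \<bar>s\<bar> powr e) * ennreal (C2 * \<bar>s\<bar> powr (- e))"
        by (intro mult_left_mono) auto
      also have "\<dots> = ennreal (C1 powr (p - 1) * C2 * \<phi> s powr p * (\<bar>s\<bar> powr e * \<bar>s\<bar> powr (- e)))"
        using C1 C2 by (simp add: ennreal_mult[symmetric] mult_ac)
      also have "\<bar>s\<bar> powr e * \<bar>s\<bar> powr (- e) = 1" using s by (simp flip: powr_add)
      finally show "ennreal (C1 powr (p - 1) * \<phi> s powr p * \<bar>s\<bar> powr e) *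
        (\<integral>\<^sup>+r. ennreal ((1 - r) powr (- e) / d r s) * indicator {0..<1} r \<partial>lborel) \<le>
        ennreal (C1 powr (p - 1) * C2) * ennreal (\<phi> s powr p)"
        using C2 by (simp add: ennreal_mult[symmetric])
    qed
    also have "\<dots> = ennreal (C1 powr (p - 1) * C2) * (\<integral>\<^sup>+s. ennreal (\<phi> s powr p) \<partial>circ)"
      by (rule nn_integral_cmult) measurable
    also have "\<dots> \<le> ennreal (C1 powr (p - 1) * C2) * ennreal ((3 * N) powr p)"
      by (intro mult_left_mono \<phi>N) auto
    also have "\<dots> = ennreal ((C * N) powr p)"
      using C N0 C2 by (simp add: ennreal_mult[symmetric] powr_mult mult_ac)
    finally show "(\<integral>\<^sup>+r. ennreal (cesaro_mean f r powr p) * indicator {0..<R} r \<partial>lborel) \<le> ennreal ((C * N) powr p)" .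
  qed
qed

lemma cesaro_mean_le:
  assumes f: "f holomorphic_on ball 0 1" and r: "0 \<le> r" "r < 1" and p: "1 < p"
    and N: "Lp_le p (\<lambda>t. f (of_real r * cis t)) N"
  shows "cesaro_mean f r \<le> N / (1 - r)"
proof -
  have cont: "continuous_on UNIV (\<lambda>t. f (of_real r * cis t))"
    by (rule continuous_on_circle_radius[OF holomorphic_on_imp_continuous_on[OF f] r])
  have [measurable]: "(\<lambda>t. cmod (f (of_real r * cis t))) \<in> borel_measurable borel"
    by (intro borel_measurable_continuous_onI continuous_intros cont)
  have N0: "0 \<le> N" using N by (simp add: Lp_le_def)
  have "ennreal (cesaro_mean f r) \<le> (\<integral>\<^sup>+t. ennreal (1 / (1 - r)) * ennreal (cmod (f (of_real r * cis t))) \<partial>circ)"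
    unfolding ennreal_cesaro_mean[OF f r]
  proof (intro nn_integral_mono)
    fix t
    have "cmod (f (of_real r * cis t)) / cmod (1 - of_real r * cis t) \<le> cmod (f (of_real r * cis t)) / (1 - r)"
      using one_minus_le_cmod[of r t] r by (intro divide_left_mono mult_pos_pos) auto
    then show "ennreal (cmod (f (of_real r * cis t)) / cmod (1 - of_real r * cis t)) \<le>
      ennreal (1 / (1 - r)) * ennreal (cmod (f (of_real r * cis t)))"
      using r by (simp add: ennreal_mult[symmetric] ennreal_leI)
  qed
  also have "\<dots> = ennreal (1 / (1 - r)) * (\<integral>\<^sup>+t. ennreal (cmod (f (of_real r * cis t))) \<partial>circ)"
    by (rule nn_integral_cmult) measurable
  also have "\<dots> \<le> ennreal (1 / (1 - r)) * ennreal N"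
    by (intro mult_left_mono Lp_le_L1[OF N p]) auto
  also have "\<dots> = ennreal (N / (1 - r))" using r N0 by (simp add: ennreal_mult[symmetric])
  finally show ?thesis using r N0 by (simp add: ennreal_le_iff)
qed

section \<open>Hardy spaces and mean Lipschitz spaces\<close>

text \<open>Passes from the mean over \<open>{0..2*pi}\<close> with respect to the completed measure
  to the Borel measure \<open>circ\<close> on a symmetric window; periodicity accounts for the
  change of window.\<close>

lemma integral_mean_powr:
  assumes cont: "continuous_on UNIV (\<lambda>t. f (of_real r * cis t))" and p: "0 < p"
  shows "ennreal (integral_mean p r f powr p) = (\<integral>\<^sup>+t. ennreal (cmod (f (of_real r * cis t)) powr p) \<partial>circ)"
proof -
  define g where "g t = cmod (f (of_real r * cis t)) powr p" for t
  have "continuous_on UNIV g" unfolding g_def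
    using p by (intro continuous_on_powr' continuous_intros cont) auto
  then have [measurable]: "g \<in> borel_measurable borel" and int: "integrable circ g"
    by (auto intro: borel_measurable_continuous_onI integrable_circ_continuous)
  have g0: "0 \<le> g t" for t by (simp add: g_def)
  have per: "g (t + 2 * pi) = g t" for t by (simp add: g_def cis_mult[symmetric])
  define I where "I = (\<integral>\<^sup>+t. ennreal (g t) * indicator {0..2 * pi} t \<partial>lborel)"
  have "I = (\<integral>\<^sup>+t. ennreal (g t) * indicator {-pi..pi} t \<partial>lborel)"
    unfolding I_def using nn_integral_period[of "\<lambda>t. ennreal (g t)" 0 "-pi"] per by simp
  then have c: "(\<integral>\<^sup>+t. ennreal (g t) \<partial>circ) = ennreal (1 / (2 * pi)) * I"
    by (simp add: nn_integral_circ)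
  have E: "(\<integral>\<^sup>+t. ennreal (g t) \<partial>circ) = ennreal (LINT t|circ. g t)"
    using int g0 by (intro nn_integral_eq_integral) auto
  have "(LINT t:{0..2*pi}|lebesgue. g t) = (LINT t|lborel. indicator {0..2*pi} t *\<^sub>R g t)"
    unfolding set_lebesgue_integral_def by (intro integral_completion) auto
  also have "\<dots> = enn2real (\<integral>\<^sup>+t. ennreal (indicator {0..2*pi} t *\<^sub>R g t) \<partial>lborel)"
    by (intro integral_eq_nn_integral) (auto simp: g0)
  also have "(\<integral>\<^sup>+t. ennreal (indicator {0..2*pi} t *\<^sub>R g t) \<partial>lborel) = I"
    unfolding I_def by (intro nn_integral_cong) (auto split: split_indicator)
  finally have "1 / (2 * pi) * (LINT t:{0..2*pi}|lebesgue. g t) = enn2real (ennreal (1 / (2 * pi)) * I)"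
    by (simp add: enn2real_mult)
  then have "1 / (2 * pi) * (LINT t:{0..2*pi}|lebesgue. g t) = (LINT t|circ. g t)"
    unfolding c[symmetric] E by (simp add: integral_nonneg_AE g0)
  then have "integral_mean p r f powr p = (LINT t|circ. g t)"
    using p unfolding integral_mean_def g_def[symmetric] by (simp add: powr_powr integral_nonneg_AE g0)
  then show ?thesis using E by (simp add: g_def)
qed

lemma integral_mean_nonneg: "0 \<le> integral_mean p r f"
  by (simp add: integral_mean_def)

lemma Lp_le_integral_mean:
  assumes "continuous_on UNIV (\<lambda>t. f (of_real r * cis t))" "0 < p"
  shows "Lp_le p (\<lambda>t. f (of_real r * cis t)) (integral_mean p r f)"
  using integral_mean_powr[OF assms] by (simp add: Lp_le_def integral_mean_nonneg)

lemma integral_mean_le: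
  assumes "continuous_on UNIV (\<lambda>t. f (of_real r * cis t))" "0 < p"
    and "Lp_le p (\<lambda>t. f (of_real r * cis t)) B"
  shows "integral_mean p r f \<le> B"
proof -
  have "integral_mean p r f powr p \<le> B powr p"
    using integral_mean_powr[OF assms(1,2)] assms(3) by (metis Lp_le_def ennreal_le_iff powr_ge_zero)
  then show ?thesis
    using assms powr_less_mono2[of p B "integral_mean p r f"] by (auto simp: Lp_le_def not_le[symmetric])
qed

lemma hardy_norm_Lp_le:
  assumes f: "f \<in> hardy_space p" and "0 < r" "r < 1" "0 < p"
  shows "Lp_le p (\<lambda>t. f (of_real r * cis t)) (hardy_norm p f)"
proof -
  have h: "f holomorphic_on ball 0 1" using f by (simp add: hardy_space_def)
  have 1: "Lp_le p (\<lambda>t. f (of_real r * cis t)) (integral_mean p r f)"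
    using assms by (intro Lp_le_integral_mean continuous_on_circle_radius holomorphic_on_imp_continuous_on[OF h]) auto
  have 2: "integral_mean p r f \<le> hardy_norm p f"
    unfolding hardy_norm_def using f assms by (intro cSUP_upper) (auto simp: hardy_space_def)
  show ?thesis by (rule Lp_le_mono[OF 1 _ 2 \<open>0 < p\<close>]) simp
qed

lemma hardy_spaceI:
  assumes h: "f holomorphic_on ball 0 1" and p: "0 < p"
    and N: "\<And>r. 0 < r \<Longrightarrow> r < 1 \<Longrightarrow> Lp_le p (\<lambda>t. f (of_real r * cis t)) N"
  shows "f \<in> hardy_space p" "hardy_norm p f \<le> N"
proof -
  have *: "integral_mean p r f \<le> N" if "0 < r" "r < 1" for r
    using that p by (intro integral_mean_le N continuous_on_circle_radius holomorphic_on_imp_continuous_on[OF h]) auto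
  then show "f \<in> hardy_space p" using h by (auto simp: hardy_space_def intro!: bdd_aboveI)
  show "hardy_norm p f \<le> N" unfolding hardy_norm_def
    using * dense[of 0 "1::real"] by (intro cSUP_least) auto
qed

lemma hardy_norm_nonneg:
  assumes "f \<in> hardy_space p" "0 < p"
  shows "0 \<le> hardy_norm p f"
  using hardy_norm_Lp_le[OF assms(1), of "1 / 2"] assms by (simp add: Lp_le_def)

section \<open>Limits in the mean and boundary functions\<close>

text \<open>Fatou's lemma along the sequence.\<close>

lemma Lp_le_limit:
  fixes u :: "nat \<Rightarrow> real \<Rightarrow> 'a::real_normed_vector"
  assumes [measurable]: "\<And>n. (\<lambda>t. norm (u n t)) \<in> borel_measurable borel"
    and lim: "AE t in circ. (\<lambda>n. u n t) \<longlonglongrightarrow> v t" and B: "\<And>n. Lp_le p (u n) B" and p: "0 < p"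
  shows "Lp_le p v B"
proof -
  have "(\<integral>\<^sup>+t. ennreal (norm (v t) powr p) \<partial>circ) = (\<integral>\<^sup>+t. liminf (\<lambda>n. ennreal (norm (u n t) powr p)) \<partial>circ)"
  proof (intro nn_integral_cong_AE eventually_mono[OF lim])
    fix t assume "(\<lambda>n. u n t) \<longlonglongrightarrow> v t"
    then have "(\<lambda>n. ennreal (norm (u n t) powr p)) \<longlonglongrightarrow> ennreal (norm (v t) powr p)"
      using p by (intro tendsto_ennrealI tendsto_powr' tendsto_norm) auto
    then show "ennreal (norm (v t) powr p) = liminf (\<lambda>n. ennreal (norm (u n t) powr p))"
      by (intro lim_imp_Liminf[symmetric]) auto
  qed
  also have "\<dots> \<le> liminf (\<lambda>n. \<integral>\<^sup>+t. ennreal (norm (u n t) powr p) \<partial>circ)"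
    by (intro nn_integral_liminf) measurable
  also have "\<dots> \<le> limsup (\<lambda>n. \<integral>\<^sup>+t. ennreal (norm (u n t) powr p) \<partial>circ)"
    by (intro Liminf_le_Limsup) auto
  also have "\<dots> \<le> ennreal (B powr p)"
    using B by (intro Limsup_bounded) (auto simp: Lp_le_def)
  finally show ?thesis using B by (auto simp: Lp_le_def)
qed

text \<open>Boundedness in \<open>L\<^sup>p\<close> with \<open>p > 1\<close> gives uniform integrability.\<close>

lemma Lp_bounded_imp_L1_convergence:
  fixes u :: "nat \<Rightarrow> real \<Rightarrow> complex"
  assumes [measurable]: "\<And>n. u n \<in> borel_measurable borel" "v \<in> borel_measurable borel"
    and lim: "AE t in circ. (\<lambda>n. u n t) \<longlonglongrightarrow> v t" and B: "\<And>n. Lp_le p (u n) B" and p: "1 < p" and e: "0 < e"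
  shows "eventually (\<lambda>n. (\<integral>\<^sup>+t. ennreal (cmod (u n t - v t)) \<partial>circ) \<le> ennreal e) sequentially"
proof -
  have v: "Lp_le p v B"
    by (rule Lp_le_limit[OF _ lim B]) (use p in \<open>auto\<close>)
  define X where "X n t = cmod (u n t - v t)" for n t
  have [measurable]: "X n \<in> borel_measurable borel" for n unfolding X_def by measurable
  have X: "Lp_le p (X n) (4 * (B + B))" for n
    by (rule Lp_le_add[OF B[of n] v]) (use p in \<open>auto simp: X_def norm_triangle_ineq4\<close>)
  define K where "K = (4 * (B + B)) powr p + 1"
  have K: "0 < K" by (simp add: K_def add_nonneg_pos)
  \<comment> \<open>The truncation level is chosen so that the excess above \<open>M\<close>, at
    most \<open>X n t powr p / M powr (p - 1)\<close>, has integral at most \<open>e / 2\<close>.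
    The 1 in \<open>K\<close> keeps \<open>M\<close> positive.\<close>
  define M where "M = (2 * K / e) powr (1 / (p - 1))"
  have M: "0 < M" "M powr (p - 1) = 2 * K / e" using K e p by (auto simp: M_def powr_powr)
  have split: "X n t \<le> min (X n t) M + X n t powr p / M powr (p - 1)" for n t
  proof (cases "X n t \<le> M")
    case False
    then have "M powr (p - 1) \<le> X n t powr (p - 1)" using M p by (intro powr_mono2) auto
    then have "X n t * M powr (p - 1) \<le> X n t * X n t powr (p - 1)"
      using False M by (intro mult_left_mono) auto
    also have "\<dots> = X n t powr p" using False M by (simp add: powr_diff)
    finally have "X n t \<le> X n t powr p / M powr (p - 1)" using M(1) by (simp add: field_simps)
    moreover have "0 \<le> min (X n t) M" using M(1) False by auto
    ultimately show ?thesis by linarith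
  qed auto
  have X0: "0 \<le> X n t" for n t by (simp add: X_def)
  have "(\<lambda>n. \<integral>\<^sup>+t. ennreal (min (X n t) M) \<partial>circ) \<longlonglongrightarrow> (\<integral>\<^sup>+t. 0 \<partial>circ)"
  proof (rule nn_integral_dominated_convergence[where w = "\<lambda>_. ennreal M"])
    show "AE t in circ. (\<lambda>n. ennreal (min (X n t) M)) \<longlonglongrightarrow> 0"
    proof (intro eventually_mono[OF lim])
      fix t assume "(\<lambda>n. u n t) \<longlonglongrightarrow> v t"
      then have "(\<lambda>n. X n t) \<longlonglongrightarrow> 0" unfolding X_def by (simp add: LIM_zero tendsto_norm_zero)
      then have "(\<lambda>n. min (X n t) M) \<longlonglongrightarrow> min 0 M" by (intro tendsto_intros)
      then show "(\<lambda>n. ennreal (min (X n t) M)) \<longlonglongrightarrow> 0"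
        using M by (auto simp: min_def simp flip: ennreal_0 intro!: tendsto_ennrealI)
    qed
  qed (auto intro!: AE_I2 ennreal_leI simp: emeasure_circ_UNIV)
  then have "(\<lambda>n. \<integral>\<^sup>+t. ennreal (min (X n t) M) \<partial>circ) \<longlonglongrightarrow> 0" by simp
  then have "eventually (\<lambda>n. (\<integral>\<^sup>+t. ennreal (min (X n t) M) \<partial>circ) < ennreal (e / 2)) sequentially"
    using e by (intro order_tendstoD) auto
  then show ?thesis
  proof eventually_elim
    case (elim n)
    have "(\<integral>\<^sup>+t. ennreal (X n t) \<partial>circ) \<le> (\<integral>\<^sup>+t. ennreal (min (X n t) M) +
       ennreal (1 / M powr (p - 1)) * ennreal (X n t powr p) \<partial>circ)"
    proof (intro nn_integral_mono)
      fix t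
      have "ennreal (X n t) \<le> ennreal (min (X n t) M + X n t powr p / M powr (p - 1))"
        by (intro ennreal_leI split)
      also have "\<dots> = ennreal (min (X n t) M) + ennreal (1 / M powr (p - 1)) * ennreal (X n t powr p)"
      proof -
        have "0 \<le> min (X n t) M" "0 \<le> X n t powr p / M powr (p - 1)" using X0[of n t] M(1) by auto
        moreover have "ennreal (X n t powr p / M powr (p - 1)) = ennreal (1 / M powr (p - 1)) * ennreal (X n t powr p)"
          by (simp add: ennreal_mult[symmetric])
        ultimately show ?thesis by (simp only: ennreal_plus)
      qed
      finally show "ennreal (X n t) \<le> \<dots>" .
    qed
    also have "\<dots> = (\<integral>\<^sup>+t. ennreal (min (X n t) M) \<partial>circ) +
       ennreal (1 / M powr (p - 1)) * (\<integral>\<^sup>+t. ennreal (X n t powr p) \<partial>circ)"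
      by (simp add: nn_integral_add nn_integral_cmult)
    also have "\<dots> \<le> ennreal (e / 2) + ennreal (1 / M powr (p - 1)) * ennreal K"
    proof (intro add_mono mult_left_mono)
      have "(\<integral>\<^sup>+t. ennreal (X n t powr p) \<partial>circ) \<le> ennreal ((4 * (B + B)) powr p)"
        using X[of n] X0 by (simp add: Lp_le_def)
      also have "\<dots> \<le> ennreal K" by (intro ennreal_leI) (simp add: K_def)
      finally show "(\<integral>\<^sup>+t. ennreal (X n t powr p) \<partial>circ) \<le> ennreal K" .
    qed (use elim in auto)
    also have "\<dots> = ennreal e"
      unfolding M(2) using K e by (simp add: ennreal_mult[symmetric] flip: ennreal_plus)
    finally show ?case by (simp add: X_def)
  qed
qed

lemma AE_lborel_shift:
  fixes P :: "real \<Rightarrow> bool"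
  assumes "AE x in lborel. P x"
  shows "AE x in lborel. P (x + t)"
proof -
  obtain N where N: "N \<in> null_sets lborel" "{x. \<not> P x} \<subseteq> N"
    using assms by (auto simp: eventually_ae_filter)
  have [measurable]: "N \<in> sets borel" using N by auto
  have "AE x in lborel. x \<notin> N" using N by (intro AE_not_in)
  then have "AE x in lborel. t + 1 * x \<notin> N"
    by (intro AE_borel_affine) (auto simp: pred_def)
  then show ?thesis using N(2) by (auto simp: add.commute)
qed

text \<open>Puts the definition of the space into a form fit for integration: a Borel measurable
  periodic boundary function, and a modulus bound with one constant for all increments up to
  \<open>pi\<close> instead of small ones only.\<close>

lemma mean_lipschitzD:
  fixes p \<alpha> :: real
  assumes p: "1 < p" and \<alpha>: "0 < \<alpha>" and F: "F \<in> mean_lipschitz p \<alpha>"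
  obtains B M C where
    "B \<in> borel_measurable borel" "\<And>\<theta>. B (\<theta> + 2 * pi) = B \<theta>"
    "AE \<theta> in circ. (\<lambda>n. F (of_real (1 - 1 / (real n + 2)) * cis \<theta>)) \<longlonglongrightarrow> B \<theta>"
    "Lp_le p B M" "0 < C"
    "\<And>t. t \<noteq> 0 \<Longrightarrow> \<bar>t\<bar> \<le> pi \<Longrightarrow> Lp_le p (\<lambda>\<theta>. B (\<theta> + t) - B \<theta>) (C * \<bar>t\<bar> powr \<alpha>)"
proof -
  have H: "F \<in> hardy_space p" and bv: "has_boundary_values F"
    and O: "(\<lambda>\<delta>. mean_modulus p \<delta> F) \<in> O[at_right 0](\<lambda>\<delta>. \<delta> powr \<alpha>)"
    using F by (auto simp: mean_lipschitz_def)
  have h: "F holomorphic_on ball 0 1" using H by (simp add: hardy_space_def)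
  define R where "R n = 1 - 1 / (real n + 2)" for n :: nat
  have R: "0 < R n" "R n < 1" for n by (auto simp: R_def field_simps)
  have Rlim: "filterlim R (at_left 1) sequentially"
  proof -
    have "(\<lambda>n. inverse (real (Suc (Suc n)))) \<longlonglongrightarrow> 0"
      by (rule LIMSEQ_Suc[OF LIMSEQ_inverse_real_of_nat])
    then have "(\<lambda>n. 1 - inverse (real (Suc (Suc n)))) \<longlonglongrightarrow> 1 - 0" by (intro tendsto_intros)
    then have "R \<longlonglongrightarrow> 1" unfolding R_def by (simp add: inverse_eq_divide add.commute)
    then show ?thesis using R R(2)[THEN less_imp_neq] by (auto simp: filterlim_at)
  qed
  \<comment> \<open>A limit along one fixed sequence of radii is Borel measurable, which is not
    apparent for \<open>boundary_value\<close>; the two agree almost everywhere.\<close>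
  define B where "B \<theta> = lim (\<lambda>n. F (of_real (R n) * cis \<theta>))" for \<theta>
  have cont: "continuous_on UNIV (\<lambda>\<theta>. F (of_real (R n) * cis \<theta>))" for n
    using R[of n] by (intro continuous_on_circle_radius holomorphic_on_imp_continuous_on h) auto
  have m [measurable]: "(\<lambda>\<theta>. F (of_real (R n) * cis \<theta>)) \<in> borel_measurable borel" for n
    by (rule borel_measurable_continuous_onI[OF cont])
  have Bm [measurable]: "B \<in> borel_measurable borel" unfolding B_def by measurable
  have per: "B (\<theta> + 2 * pi) = B \<theta>" for \<theta> by (simp add: B_def cis_mult[symmetric])
  have bv': "AE \<theta> in lborel. ((\<lambda>r. F (of_real r * cis \<theta>)) \<longlongrightarrow> boundary_value F \<theta>) (at_left 1)"
    using bv by (simp add: has_boundary_values_def AE_completion_iff)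
  have lim0: "(\<lambda>n. F (of_real (R n) * cis \<theta>)) \<longlonglongrightarrow> B \<theta> \<and> boundary_value F \<theta> = B \<theta>"
    if "((\<lambda>r. F (of_real r * cis \<theta>)) \<longlongrightarrow> boundary_value F \<theta>) (at_left 1)" for \<theta>
    using filterlim_compose[OF that Rlim] by (auto simp: B_def limI)
  have lim: "AE \<theta> in circ. (\<lambda>n. F (of_real (R n) * cis \<theta>)) \<longlonglongrightarrow> B \<theta>"
    by (rule AE_circ_lborel, rule eventually_mono[OF bv']) (use lim0 in blast)
  have beq: "AE \<theta> in lborel. boundary_value F \<theta> = B \<theta>"
    by (rule eventually_mono[OF bv']) (use lim0 in blast)
  define M where "M = hardy_norm p F"
  have M: "Lp_le p (\<lambda>\<theta>. F (of_real (R n) * cis \<theta>)) M" for n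
    unfolding M_def using H R p by (intro hardy_norm_Lp_le) auto
  have BM: "Lp_le p B M"
    by (rule Lp_le_limit[OF _ lim M]) (use p in auto)
  have M0: "0 \<le> M" using BM by (simp add: Lp_le_def)
  define D where "D t \<theta> = cmod (B (\<theta> + t) - B \<theta>) powr p" for t \<theta>
  have [measurable]: "D t \<in> borel_measurable borel" for t unfolding D_def by measurable
  have rough: "Lp_le p (\<lambda>\<theta>. B (\<theta> + t) - B \<theta>) (8 * M)" for t
  proof -
    have "Lp_le p (\<lambda>\<theta>. B (\<theta> + t) - B \<theta>) (4 * (M + M))"
      by (rule Lp_le_add[OF Lp_le_shift[OF BM, of t] BM]) (use per p in \<open>auto simp: norm_triangle_ineq4\<close>)
    then show ?thesis by simp
  qed
  have D: "(\<integral>\<^sup>+\<theta>. ennreal (D t \<theta>) \<partial>circ) \<le> ennreal ((8 * M) powr p)" for t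
    using rough[of t] by (simp add: Lp_le_def D_def)
  define T where "T t = (1 / (2 * pi) * (LINT \<theta>:{-pi..pi}|lebesgue.
     cmod (boundary_value F (\<theta> + t) - boundary_value F \<theta>) powr p)) powr (1 / p)" for t
  have T: "ennreal (T t powr p) = (\<integral>\<^sup>+\<theta>. ennreal (D t \<theta>) \<partial>circ)" for t
  proof -
    have ae: "AE \<theta> in lborel. boundary_value F (\<theta> + t) = B (\<theta> + t) \<and> boundary_value F \<theta> = B \<theta>"
      using AE_lborel_shift[OF beq, of t] beq by auto
    define g where "g \<theta> = indicator {-pi..pi} \<theta> *\<^sub>R D t \<theta>" for \<theta>
    define g' where "g' \<theta> = indicator {-pi..pi} \<theta> *\<^sub>R
       cmod (boundary_value F (\<theta> + t) - boundary_value F \<theta>) powr p" for \<theta>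
    have gb [measurable]: "g \<in> borel_measurable borel" unfolding g_def by measurable
    have gl: "g \<in> borel_measurable lebesgue" by (rule measurable_completion) simp
    have aeg: "AE \<theta> in lebesgue. g \<theta> = g' \<theta>"
      using ae by (intro AE_completion) (auto simp: g_def g'_def D_def)
    have "(LINT \<theta>:{-pi..pi}|lebesgue. cmod (boundary_value F (\<theta> + t) - boundary_value F \<theta>) powr p) =
       (LINT \<theta>|lebesgue. g' \<theta>)" by (simp add: set_lebesgue_integral_def g'_def)
    \<comment> \<open>\<open>g'\<close> becomes measurable through its equality almost everywhere
      with the Borel function \<open>g\<close>, because the measure is complete.\<close>
    also have "\<dots> = (LINT \<theta>|lebesgue. g \<theta>)"
      using aeg by (intro integral_cong_AE borel_measurable_AE[OF gl aeg] gl) auto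
    also have "\<dots> = (LINT \<theta>|lborel. g \<theta>)" by (intro integral_completion) auto
    also have "\<dots> = enn2real (\<integral>\<^sup>+\<theta>. ennreal (g \<theta>) \<partial>lborel)"
      by (intro integral_eq_nn_integral) (auto simp: g_def D_def)
    also have "(\<integral>\<^sup>+\<theta>. ennreal (g \<theta>) \<partial>lborel) = (\<integral>\<^sup>+\<theta>. ennreal (D t \<theta>) * indicator {-pi..pi} \<theta> \<partial>lborel)"
      by (intro nn_integral_cong) (auto simp: g_def split: split_indicator)
    finally have "1 / (2 * pi) * (LINT \<theta>:{-pi..pi}|lebesgue. cmod (boundary_value F (\<theta> + t) - boundary_value F \<theta>) powr p)
       = enn2real (\<integral>\<^sup>+\<theta>. ennreal (D t \<theta>) \<partial>circ)"
      by (simp add: nn_integral_circ enn2real_mult)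
    then have "T t powr p = enn2real (\<integral>\<^sup>+\<theta>. ennreal (D t \<theta>) \<partial>circ)"
      using p by (simp add: T_def powr_powr)
    then show ?thesis using D[of t] by (simp add: ennreal_enn2real_if) (metis ennreal_neq_top neq_top_trans)
  qed
  have T0: "0 \<le> T t" for t by (simp add: T_def)
  have TM: "T t \<le> 8 * M" for t
  proof -
    have "T t powr p \<le> (8 * M) powr p" using D[of t] T[of t] by (metis ennreal_le_iff powr_ge_zero)
    then show ?thesis using powr_less_mono2[of p "8 * M" "T t"] p M0 by (auto simp: not_le[symmetric])
  qed
  \<comment> \<open>\<open>t\<close> itself belongs to the set of increments for
    \<open>\<delta> = \<bar>t\<bar>\<close>. The crude bound \<open>8 * M\<close> shows that the
    supremum is that of a bounded set.\<close>
  have mm: "T t \<le> mean_modulus p \<bar>t\<bar> F" if "t \<noteq> 0" for t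
    unfolding mean_modulus_def T_def[symmetric]
    using that TM by (intro cSUP_upper bdd_aboveI[where M = "8 * M"]) auto
  obtain c where c: "0 < c" "eventually (\<lambda>\<delta>. norm (mean_modulus p \<delta> F) \<le> c * norm (\<delta> powr \<alpha>)) (at_right 0)"
    using landau_o.bigE[OF O] by blast
  obtain \<delta>0 where \<delta>0: "0 < \<delta>0" "\<And>\<delta>. 0 < \<delta> \<Longrightarrow> \<delta> < \<delta>0 \<Longrightarrow> norm (mean_modulus p \<delta> F) \<le> c * norm (\<delta> powr \<alpha>)"
    using c(2) by (auto simp: eventually_at_right[OF zero_less_one])
  \<comment> \<open>For \<open>\<bar>t\<bar> \<ge> \<delta>0\<close> the crude bound
    \<open>8 * M\<close> is enough, because there
    \<open>(\<bar>t\<bar> / \<delta>0) powr \<alpha> \<ge> 1\<close>.\<close>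
  define C where "C = c + 8 * M / \<delta>0 powr \<alpha>"
  have C: "0 < C" using c \<delta>0 M0 by (simp add: C_def add_pos_nonneg)
  have TC: "T t \<le> C * \<bar>t\<bar> powr \<alpha>" if "t \<noteq> 0" for t
  proof (cases "\<bar>t\<bar> < \<delta>0")
    case True
    have "T t \<le> c * \<bar>t\<bar> powr \<alpha>" using mm[OF that] \<delta>0(2)[of "\<bar>t\<bar>"] that True by auto
    also have "\<dots> \<le> C * \<bar>t\<bar> powr \<alpha>" using M0 \<delta>0 by (intro mult_right_mono) (auto simp: C_def)
    finally show ?thesis .
  next
    case False
    then have "\<delta>0 powr \<alpha> \<le> \<bar>t\<bar> powr \<alpha>" using \<alpha> \<delta>0 by (intro powr_mono2) auto
    then have "8 * M * \<delta>0 powr \<alpha> \<le> 8 * M * \<bar>t\<bar> powr \<alpha>" using M0 by (intro mult_left_mono) auto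
    then have "8 * M \<le> 8 * M / \<delta>0 powr \<alpha> * \<bar>t\<bar> powr \<alpha>" using \<delta>0 by (simp add: field_simps)
    also have "\<dots> \<le> C * \<bar>t\<bar> powr \<alpha>" using c by (intro mult_right_mono) (auto simp: C_def)
    finally show ?thesis using TM[of t] by simp
  qed
  have fin: "Lp_le p (\<lambda>\<theta>. B (\<theta> + t) - B \<theta>) (C * \<bar>t\<bar> powr \<alpha>)" if "t \<noteq> 0" for t
  proof -
    have "(\<integral>\<^sup>+\<theta>. ennreal (D t \<theta>) \<partial>circ) \<le> ennreal ((C * \<bar>t\<bar> powr \<alpha>) powr p)"
      unfolding T[symmetric] using TC[OF that] T0 p by (intro ennreal_leI powr_mono2) auto
    then show ?thesis using C by (simp add: Lp_le_def D_def)
  qed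
  show ?thesis
    by (rule that[OF Bm per lim[unfolded R_def] BM C fin])
qed

lemma holomorphic_fps_ball:
  assumes g: "g holomorphic_on ball 0 R" and z: "cmod z < R"
  shows "summable (\<lambda>n. norm (fps_nth (fps_expansion g 0) n * z ^ n))"
    and "g z = eval_fps (fps_expansion g 0) z"
    and "deriv g z = eval_fps (fps_deriv (fps_expansion g 0)) z"
proof -
  define A where "A = fps_expansion g 0"
  have R: "ereal R \<le> fps_conv_radius A"
    unfolding A_def using conv_radius_fps_expansion[of g 0 "ereal R"] g by simp
  have ev: "g w = eval_fps A w" if "cmod w < R" for w
    using eval_fps_expansion[of g 0 "ereal R" w] g that by (simp add: A_def)
  have z': "ereal (cmod z) < fps_conv_radius A" using z by (intro less_le_trans[OF _ R]) simp
  show "summable (\<lambda>n. norm (fps_nth (fps_expansion g 0) n * z ^ n))"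
    using norm_summable_fps[OF z'] by (simp add: A_def)
  show "g z = eval_fps (fps_expansion g 0) z" using ev z by (simp add: A_def)
  have "(eval_fps A has_field_derivative eval_fps (fps_deriv A) z) (at z)"
    by (rule has_field_derivative_eval_fps[OF z'])
  then have "(g has_field_derivative eval_fps (fps_deriv A) z) (at z)"
    by (rule has_field_derivative_transform_within_open[of _ _ _ "ball 0 R"]) (use z ev in auto)
  then show "deriv g z = eval_fps (fps_deriv (fps_expansion g 0)) z"
    by (simp add: DERIV_imp_deriv A_def)
qed

text \<open>The series of \<open>deriv_formula\<close> contains \<open>cis \<theta> ^ n\<close>, one
  power more than the series of the derivative; hence the factor
  \<open>cis \<theta>\<close>.\<close>

lemma deriv_formula_holomorphic:
  assumes g: "g holomorphic_on ball 0 R" "1 < R" and s: "0 \<le> s" "s < 1"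
  shows "(LINT \<tau>|circ. g (cis (\<theta> + \<tau>)) * deriv_kernel s \<tau>) = cis \<theta> * deriv g (of_real s * cis \<theta>)"
proof -
  define a where "a n = fps_nth (fps_expansion g 0) n" for n
  have sa: "summable (\<lambda>n. norm (a n))"
    using holomorphic_fps_ball(1)[OF g(1), of 1] g by (simp add: a_def)
  have ev: "g w = (\<Sum>n. a n * w ^ n)" if "cmod w < R" for w
    using holomorphic_fps_ball(2)[OF g(1) that] by (simp add: a_def eval_fps_def)
  define z where "z = of_real s * cis \<theta>"
  have z: "cmod z < R" using s g by (simp add: z_def norm_mult)
  have "ereal (cmod z) < fps_conv_radius (fps_deriv (fps_expansion g 0))"
  proof -
    have "ereal R \<le> fps_conv_radius (fps_expansion g 0)"
      using conv_radius_fps_expansion[of g 0 "ereal R"] g by simp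
    also have "\<dots> \<le> fps_conv_radius (fps_deriv (fps_expansion g 0))"
      by (rule fps_conv_radius_deriv)
    finally have R': "ereal R \<le> fps_conv_radius (fps_deriv (fps_expansion g 0))" .
    have "ereal (cmod z) < ereal R" using z by simp
    then show ?thesis using R' by (rule less_le_trans)
  qed
  from sums_mult[OF sums_eval_fps[OF this], of "cis \<theta>"]
  have "(\<lambda>n. of_nat (Suc n) * a (Suc n) * of_real s ^ (Suc n - 1) * cis \<theta> ^ Suc n) sums (cis \<theta> * deriv g z)"
    unfolding holomorphic_fps_ball(3)[OF g(1) z]
    by (simp add: a_def z_def power_mult_distrib mult_ac)
  then have "(\<lambda>n. of_nat n * a n * of_real s ^ (n - 1) * cis \<theta> ^ n) sums (cis \<theta> * deriv g z)"
    by (subst (asm) sums_Suc_iff) simp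
  then show ?thesis
    using deriv_formula[OF sa s, of \<theta>] ev[of "cis _"] g by (simp add: sums_iff z_def)
qed

text \<open>The powers of the scale \<open>1 - s\<close> add up to
  \<open>1 + (\<beta> + 1) - 4 + 1 = \<beta> - 1\<close>. The symmetrised kernel allows
  \<open>\<beta> < 2\<close>, whereas a kernel of order \<open>1 / \<tau>^2\<close> would allow only
  \<open>\<beta> < 1\<close>; the order \<open>\<beta> = p - 1\<close> used below reaches 1 at
  \<open>p = 2\<close>, where the weaker kernel would cost a logarithm.\<close>

lemma deriv_kernel_moment:
  fixes \<beta> :: real
  assumes \<beta>: "0 \<le> \<beta>" "\<beta> < 2"
  obtains C where "0 < C"
    "\<And>s. 0 \<le> s \<Longrightarrow> s < 1 \<Longrightarrow>
      (\<integral>\<^sup>+\<tau>. ennreal (4 * (1 - s) * (\<bar>\<tau>\<bar> / cmod (1 - of_real s * cis \<tau>) powr 4) * \<bar>\<tau>\<bar> powr \<beta>) \<partial>circ)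
        \<le> ennreal (C * (1 - s) powr (\<beta> - 1))"
proof -
  have a: "-1 < \<beta> + 1" "\<beta> + 1 + 1 < 4" using \<beta> by auto
  obtain C where C: "0 < C" "\<And>r. 0 \<le> r \<Longrightarrow> r < 1 \<Longrightarrow>
      (\<integral>\<^sup>+t. ennreal (\<bar>t\<bar> powr (\<beta> + 1) / cmod (1 - of_real r * cis t) powr 4) \<partial>circ) \<le>
      ennreal (C * (1 - r) powr (\<beta> + 1 - 4 + 1))"
    using circ_kernel[OF a] by blast
  show ?thesis
  proof (rule that[of "4 * C"])
    show "0 < 4 * C" using C by simp
    fix s :: real assume s: "0 \<le> s" "s < 1"
    have "(\<integral>\<^sup>+\<tau>. ennreal (4 * (1 - s) * (\<bar>\<tau>\<bar> / cmod (1 - of_real s * cis \<tau>) powr 4) * \<bar>\<tau>\<bar> powr \<beta>) \<partial>circ) =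
      (\<integral>\<^sup>+\<tau>. ennreal (4 * (1 - s)) * ennreal (\<bar>\<tau>\<bar> powr (\<beta> + 1) / cmod (1 - of_real s * cis \<tau>) powr 4) \<partial>circ)"
    proof (intro nn_integral_cong)
      fix \<tau> :: real
      have "\<bar>\<tau>\<bar> * \<bar>\<tau>\<bar> powr \<beta> = \<bar>\<tau>\<bar> powr (\<beta> + 1)" by (cases "\<tau> = 0") (auto simp: powr_add)
      then have "4 * (1 - s) * (\<bar>\<tau>\<bar> / cmod (1 - of_real s * cis \<tau>) powr 4) * \<bar>\<tau>\<bar> powr \<beta> =
        4 * (1 - s) * (\<bar>\<tau>\<bar> powr (\<beta> + 1) / cmod (1 - of_real s * cis \<tau>) powr 4)"
        by (simp add: mult_ac)
      then show "ennreal (4 * (1 - s) * (\<bar>\<tau>\<bar> / cmod (1 - of_real s * cis \<tau>) powr 4) * \<bar>\<tau>\<bar> powr \<beta>) =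
        ennreal (4 * (1 - s)) * ennreal (\<bar>\<tau>\<bar> powr (\<beta> + 1) / cmod (1 - of_real s * cis \<tau>) powr 4)"
        using s by (simp only:) (rule ennreal_mult, auto)
    qed
    also have "\<dots> = ennreal (4 * (1 - s)) * (\<integral>\<^sup>+\<tau>. ennreal (\<bar>\<tau>\<bar> powr (\<beta> + 1) / cmod (1 - of_real s * cis \<tau>) powr 4) \<partial>circ)"
      by (rule nn_integral_cmult) measurable
    also have "\<dots> \<le> ennreal (4 * (1 - s)) * ennreal (C * (1 - s) powr (\<beta> + 1 - 4 + 1))"
      by (intro mult_left_mono C s) auto
    also have "\<dots> = ennreal (4 * C * ((1 - s) * (1 - s) powr (\<beta> - 2)))"
      using s C by (simp add: ennreal_mult[symmetric] mult_ac)
    also have "(1 - s) * (1 - s) powr (\<beta> - 2) = (1 - s) powr (\<beta> - 1)"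
      using s powr_add[of "1 - s" 1 "\<beta> - 2"] by simp
    finally show "(\<integral>\<^sup>+\<tau>. ennreal (4 * (1 - s) * (\<bar>\<tau>\<bar> / cmod (1 - of_real s * cis \<tau>) powr 4) * \<bar>\<tau>\<bar> powr \<beta>) \<partial>circ)
        \<le> ennreal (4 * C * (1 - s) powr (\<beta> - 1))" .
  qed
qed

text \<open>The direction of the Hardy--Littlewood theorem from modulus to derivative: the
  derivative at radius \<open>s\<close> is an integral of the increments
  \<open>B (\<theta> + \<tau>) - B \<theta>\<close> against the kernel, and Minkowski's inequality
  turns their bound \<open>C * \<bar>\<tau>\<bar> powr \<alpha>\<close> into the moment of order
  \<alpha> of the kernel.\<close>

lemma lipschitz_deriv_bound:
  fixes p \<alpha> :: real
  assumes p: "1 < p" and \<alpha>: "0 < \<alpha>" "\<alpha> < 2" and F: "F \<in> mean_lipschitz p \<alpha>"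
  obtains C where "0 < C"
    "\<And>s. 0 \<le> s \<Longrightarrow> s < 1 \<Longrightarrow> Lp_le p (\<lambda>\<theta>. deriv F (of_real s * cis \<theta>)) (C * (1 - s) powr (\<alpha> - 1))"
proof -
  have h: "F holomorphic_on ball 0 1" using F by (simp add: mean_lipschitz_def hardy_space_def)
  have H: "F \<in> hardy_space p" using F by (simp add: mean_lipschitz_def)
  obtain B M C where Bm [measurable]: "B \<in> borel_measurable borel" and per: "\<And>\<theta>. B (\<theta> + 2 * pi) = B \<theta>"
    and lim: "AE \<theta> in circ. (\<lambda>n. F (of_real (1 - 1 / (real n + 2)) * cis \<theta>)) \<longlonglongrightarrow> B \<theta>"
    and BM: "Lp_le p B M" and C: "0 < C"
    and om: "\<And>t. t \<noteq> 0 \<Longrightarrow> \<bar>t\<bar> \<le> pi \<Longrightarrow> Lp_le p (\<lambda>\<theta>. B (\<theta> + t) - B \<theta>) (C * \<bar>t\<bar> powr \<alpha>)"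
    by (rule mean_lipschitzD[OF p \<alpha>(1) F], rule that; assumption)
  obtain K where K: "0 < K" "\<And>s. 0 \<le> s \<Longrightarrow> s < 1 \<Longrightarrow>
      (\<integral>\<^sup>+\<tau>. ennreal (4 * (1 - s) * (\<bar>\<tau>\<bar> / cmod (1 - of_real s * cis \<tau>) powr 4) * \<bar>\<tau>\<bar> powr \<alpha>) \<partial>circ)
        \<le> ennreal (K * (1 - s) powr (\<alpha> - 1))"
    using deriv_kernel_moment[of \<alpha>] \<alpha> by auto
  define R where "R n = 1 - 1 / (real n + 2)" for n :: nat
  have R: "0 < R n" "R n < 1" for n by (auto simp: R_def field_simps)
  have R1: "R \<longlonglongrightarrow> 1"
  proof -
    have "(\<lambda>n. inverse (real (Suc (Suc n)))) \<longlonglongrightarrow> 0"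
      by (rule LIMSEQ_Suc[OF LIMSEQ_inverse_real_of_nat])
    then have "(\<lambda>n. 1 - inverse (real (Suc (Suc n)))) \<longlonglongrightarrow> 1 - 0" by (intro tendsto_intros)
    then show ?thesis unfolding R_def by (simp add: inverse_eq_divide add.commute)
  qed
  define u where "u n \<theta> = F (of_real (R n) * cis \<theta>)" for n \<theta>
  have ucont: "continuous_on A (u n)" for n A
    unfolding u_def using R[of n]
    by (intro continuous_on_subset[OF continuous_on_circle_radius] holomorphic_on_imp_continuous_on h) auto
  have um [measurable]: "u n \<in> borel_measurable borel" for n
    by (rule borel_measurable_continuous_onI[OF ucont])
  have uM: "Lp_le p (u n) (hardy_norm p F)" for n
    unfolding u_def using H R p by (intro hardy_norm_Lp_le) auto
  have uper: "u n (\<theta> + 2 * pi) = u n \<theta>" for n \<theta> by (simp add: u_def cis_mult[symmetric])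
  have L1: "eventually (\<lambda>n. (\<integral>\<^sup>+t. ennreal (cmod (u n t - B t)) \<partial>circ) \<le> ennreal e) sequentially" if "0 < e" for e
    by (rule Lp_bounded_imp_L1_convergence[OF um Bm lim[folded R_def, folded u_def] uM p that])
  have BI: "integrable circ (\<lambda>\<tau>. B (\<theta> + \<tau>))" for \<theta>
  proof (rule integrableI_bounded)
    have "(\<integral>\<^sup>+\<tau>. ennreal (norm (B (\<tau> + \<theta>))) \<partial>circ) \<le> ennreal M"
      by (rule Lp_le_L1[OF Lp_le_shift[OF BM per] p]) measurable
    then show "(\<integral>\<^sup>+\<tau>. ennreal (norm (B (\<theta> + \<tau>))) \<partial>circ) < \<infinity>"
      by (simp add: add.commute le_less_trans)
  qed measurable
  \<comment> \<open>The dilations by \<open>R n\<close> are holomorphic past the closed disc, so the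
    formula holds for them. As \<open>s\<close> is fixed, the kernel is bounded, and convergence of
    the dilations to \<open>B\<close> in the mean suffices for the limit.\<close>
  have formula: "cis \<theta> * deriv F (of_real s * cis \<theta>) = (LINT \<tau>|circ. (B (\<theta> + \<tau>) - B \<theta>) * deriv_kernel s \<tau>)"
    if s: "0 \<le> s" "s < 1" for s \<theta>
  proof -
    have kcont: "continuous_on UNIV (deriv_kernel s)" by (rule continuous_on_deriv_kernel[OF s])
    have [measurable]: "deriv_kernel s \<in> borel_measurable borel"
      by (rule borel_measurable_continuous_onI[OF kcont])
    have kb: "norm (deriv_kernel s \<tau>) \<le> 2 / (1 - s) ^ 4" for \<tau>
    proof -
      have "\<bar>(1 - s\<^sup>2) * sin \<tau>\<bar> \<le> 1 * 1"
        unfolding abs_mult using s by (intro mult_mono) (auto simp: power_le_one)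
      moreover have "(1 - s) ^ 4 \<le> cmod (1 - of_real s * cis \<tau>) ^ 4"
        using s one_minus_le_cmod by (intro power_mono) auto
      ultimately have "\<bar>(1 - s\<^sup>2) * sin \<tau>\<bar> / cmod (1 - of_real s * cis \<tau>) ^ 4 \<le> 1 / (1 - s) ^ 4"
        using s by (intro frac_le) auto
      moreover have "norm (deriv_kernel s \<tau>) = 2 * (\<bar>(1 - s\<^sup>2) * sin \<tau>\<bar> / cmod (1 - of_real s * cis \<tau>) ^ 4)"
        unfolding deriv_kernel_def norm_mult norm_of_real by (simp add: abs_divide)
      ultimately show ?thesis by simp
    qed
    have kint: "integrable circ (\<lambda>\<tau>. w \<tau> * deriv_kernel s \<tau>)"
      if "integrable circ w" for w
    proof (rule Bochner_Integration.integrable_bound[OF integrable_mult_right[OF that, of "of_real (2 / (1 - s) ^ 4)"]])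
      show "AE x in circ. norm (w x * deriv_kernel s x) \<le> norm (complex_of_real (2 / (1 - s) ^ 4) * w x)"
      proof (intro AE_I2)
        fix x
        have "norm (w x) * norm (deriv_kernel s x) \<le> norm (w x) * (2 / (1 - s) ^ 4)"
          by (intro mult_left_mono kb) auto
        also have "2 / (1 - s) ^ 4 = norm (complex_of_real (2 / (1 - s) ^ 4))"
          using s by (simp only: norm_of_real) simp
        finally show "norm (w x * deriv_kernel s x) \<le> norm (complex_of_real (2 / (1 - s) ^ 4) * w x)"
          by (simp only: norm_mult mult.commute)
      qed
    qed (use that in measurable)
    define A where "A n = of_real (R n) * cis \<theta> * deriv F (of_real (R n * s) * cis \<theta>)" for n
    have A: "A n = (LINT \<tau>|circ. u n (\<theta> + \<tau>) * deriv_kernel s \<tau>)" for n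
    proof -
      define g where "g w = F (of_real (R n) * w)" for w
      have g: "g holomorphic_on ball 0 (1 / R n)"
        unfolding g_def using R[of n]
        by (intro holomorphic_on_compose_gen[OF _ h, unfolded o_def] holomorphic_intros)
           (auto simp: norm_mult field_simps)
      have R1: "1 < 1 / R n" using R[of n] by simp
      define z where "z = of_real s * cis \<theta>"
      have "cmod (of_real (R n) * z) < 1"
      proof -
        have "R n * s \<le> 1 * s" using R[of n] s by (intro mult_right_mono) auto
        then show ?thesis using R[of n] s by (simp add: z_def norm_mult)
      qed
      then have "(F has_field_derivative deriv F (of_real (R n) * z)) (at (of_real (R n) * z))"
        by (intro holomorphic_derivI[OF h]) auto
      then have "((\<lambda>w. F (of_real (R n) * w)) has_field_derivative deriv F (of_real (R n) * z) * of_real (R n)) (at z)"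
        by (rule DERIV_chain2) (auto intro!: derivative_eq_intros)
      then have "deriv g z = deriv F (of_real (R n) * z) * of_real (R n)"
        unfolding g_def by (rule DERIV_imp_deriv)
      then show ?thesis
        using deriv_formula_holomorphic[OF g R1 s, of \<theta>] by (simp add: A_def g_def u_def z_def mult_ac)
    qed
    define A0 where "A0 = (LINT \<tau>|circ. B (\<theta> + \<tau>) * deriv_kernel s \<tau>)"
    have "A \<longlonglongrightarrow> A0"
    proof (rule tendstoI)
      fix e :: real assume "0 < e"
      define e' where "e' = e / 2 / (2 / (1 - s) ^ 4)"
      have e': "0 < e'" using \<open>0 < e\<close> s by (simp add: e'_def)
      show "eventually (\<lambda>n. dist (A n) A0 < e) sequentially"
        using L1[OF e']
      proof eventually_elim
        case (elim n)
        have ui: "integrable circ (\<lambda>\<tau>. u n (\<theta> + \<tau>))"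
          by (intro integrable_circ_continuous continuous_on_compose2[OF ucont[of UNIV]] continuous_intros) auto
        have "A n - A0 = (LINT \<tau>|circ. (u n (\<theta> + \<tau>) - B (\<theta> + \<tau>)) * deriv_kernel s \<tau>)"
          unfolding A A0_def left_diff_distrib
          by (intro Bochner_Integration.integral_diff[symmetric] kint ui BI)
        also have "ennreal (norm \<dots>) \<le> (\<integral>\<^sup>+\<tau>. norm ((u n (\<theta> + \<tau>) - B (\<theta> + \<tau>)) * deriv_kernel s \<tau>) \<partial>circ)"
          by (intro integral_norm_bound_ennreal kint Bochner_Integration.integrable_diff ui BI)
        also have "\<dots> \<le> (\<integral>\<^sup>+\<tau>. ennreal (2 / (1 - s) ^ 4) * ennreal (cmod (u n (\<tau> + \<theta>) - B (\<tau> + \<theta>))) \<partial>circ)"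
          using s by (intro nn_integral_mono)
            (simp add: ennreal_mult[symmetric] norm_mult add.commute mult.commute[of "2 / _"] mult_left_mono[OF kb] ennreal_leI
              del: times_divide_eq_right times_divide_eq_left)
        also have "\<dots> = ennreal (2 / (1 - s) ^ 4) * (\<integral>\<^sup>+\<tau>. ennreal (cmod (u n (\<tau> + \<theta>) - B (\<tau> + \<theta>))) \<partial>circ)"
          by (rule nn_integral_cmult) measurable
        also have "(\<integral>\<^sup>+\<tau>. ennreal (cmod (u n (\<tau> + \<theta>) - B (\<tau> + \<theta>))) \<partial>circ) = (\<integral>\<^sup>+\<tau>. ennreal (cmod (u n \<tau> - B \<tau>)) \<partial>circ)"
          by (rule nn_integral_circ_shift[where f = "\<lambda>\<tau>. ennreal (cmod (u n \<tau> - B \<tau>))"]) (auto simp: uper per)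
        also have "ennreal (2 / (1 - s) ^ 4) * \<dots> \<le> ennreal (2 / (1 - s) ^ 4) * ennreal e'"
          by (intro mult_left_mono elim) auto
        also have "\<dots> = ennreal (e / 2)" using e' s by (simp add: ennreal_mult[symmetric] e'_def)
        finally have "norm (A n - A0) \<le> e / 2" using \<open>0 < e\<close> by (simp add: ennreal_le_iff)
        then show ?case using \<open>0 < e\<close> by (simp add: dist_norm)
      qed
    qed
    moreover have "A \<longlonglongrightarrow> of_real 1 * cis \<theta> * deriv F (of_real (1 * s) * cis \<theta>)"
    proof -
      have "isCont (deriv F) (of_real (1 * s) * cis \<theta>)"
        using s by (intro continuous_on_interior[OF holomorphic_on_imp_continuous_on[OF holomorphic_deriv[OF h]]]) (auto simp: norm_mult)
      moreover have "(\<lambda>n. of_real (R n * s) * cis \<theta>) \<longlonglongrightarrow> of_real (1 * s) * cis \<theta>"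
        by (intro tendsto_intros R1)
      ultimately have "(\<lambda>n. deriv F (of_real (R n * s) * cis \<theta>)) \<longlonglongrightarrow> deriv F (of_real (1 * s) * cis \<theta>)"
        by (rule isCont_tendsto_compose)
      then show ?thesis unfolding A_def by (intro tendsto_intros R1)
    qed
    ultimately have "cis \<theta> * deriv F (of_real s * cis \<theta>) = A0"
      using LIMSEQ_unique by fastforce
    \<comment> \<open>The kernel has mean zero, so the constant \<open>B \<theta>\<close> may be
      subtracted.\<close>
    also have "A0 = (LINT \<tau>|circ. (B (\<theta> + \<tau>) - B \<theta>) * deriv_kernel s \<tau>)"
    proof -
      have "(LINT \<tau>|circ. (B (\<theta> + \<tau>) - B \<theta>) * deriv_kernel s \<tau>) =
        A0 - (LINT \<tau>|circ. B \<theta> * deriv_kernel s \<tau>)"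
        unfolding A0_def left_diff_distrib
        by (intro Bochner_Integration.integral_diff kint BI) simp
      then show ?thesis by (simp add: integral_deriv_kernel[OF s])
    qed
    finally show ?thesis .
  qed
  show ?thesis
  proof (rule that[of "C * K"])
    show "0 < C * K" using C K by simp
    fix s :: real assume s: "0 \<le> s" "s < 1"
    define W0 where "W0 \<tau> = 4 * (1 - s) * (\<bar>\<tau>\<bar> / cmod (1 - of_real s * cis \<tau>) powr 4)" for \<tau>
    have [measurable]: "W0 \<in> borel_measurable borel" unfolding W0_def by measurable
    have W0: "0 < W0 \<tau>" if "\<tau> \<noteq> 0" for \<tau>
      using s that one_minus_cis_nonzero[OF s, of \<tau>] unfolding W0_def by simp
    have W0': "0 \<le> W0 \<tau>" for \<tau> using s by (simp add: W0_def)
    have "(\<integral>\<^sup>+\<theta>. ennreal (cmod (deriv F (of_real s * cis \<theta>)) powr p) \<partial>circ)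
      \<le> ennreal ((C * K * (1 - s) powr (\<alpha> - 1)) powr p)"
    proof (rule minkowski_integral[OF p circ.sigma_finite_measure_axioms circ.sigma_finite_measure_axioms,
          where W = "\<lambda>\<tau>. C * (W0 \<tau> * \<bar>\<tau>\<bar> powr \<alpha>)" and \<phi> = "\<lambda>\<tau> \<theta>. W0 \<tau> * cmod (B (\<theta> + \<tau>) - B \<theta>)"])
      show "AE \<tau> in circ. 0 < C * (W0 \<tau> * \<bar>\<tau>\<bar> powr \<alpha>)"
        using W0 C by (intro eventually_mono[OF AE_circ_nonzero]) auto
      have "(\<integral>\<^sup>+\<tau>. ennreal (C * (W0 \<tau> * \<bar>\<tau>\<bar> powr \<alpha>)) \<partial>circ) = ennreal C * (\<integral>\<^sup>+\<tau>. ennreal (W0 \<tau> * \<bar>\<tau>\<bar> powr \<alpha>) \<partial>circ)"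
        using C W0' by (subst nn_integral_cmult[symmetric]) (auto simp: ennreal_mult)
      also have "\<dots> \<le> ennreal C * ennreal (K * (1 - s) powr (\<alpha> - 1))"
        unfolding W0_def by (intro mult_left_mono K s) auto
      finally show "(\<integral>\<^sup>+\<tau>. ennreal (C * (W0 \<tau> * \<bar>\<tau>\<bar> powr \<alpha>)) \<partial>circ) \<le> ennreal (C * K * (1 - s) powr (\<alpha> - 1))"
        using C K by (simp add: ennreal_mult[symmetric] mult_ac)
      show "0 < C * K * (1 - s) powr (\<alpha> - 1)" using C K s by simp
      show "AE \<tau> in circ. (\<integral>\<^sup>+\<theta>. ennreal ((W0 \<tau> * cmod (B (\<theta> + \<tau>) - B \<theta>)) powr p) \<partial>circ)
         \<le> ennreal ((C * (W0 \<tau> * \<bar>\<tau>\<bar> powr \<alpha>)) powr p)"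
      proof (rule AE_mp[OF AE_circ_nonzero], rule AE_mp[OF AE_circ_range], intro AE_I2 impI)
        fix \<tau> :: real assume \<tau>: "\<bar>\<tau>\<bar> \<le> pi" "\<tau> \<noteq> 0"
        have "Lp_le p (\<lambda>\<theta>. W0 \<tau> * cmod (B (\<theta> + \<tau>) - B \<theta>)) (W0 \<tau> * (C * \<bar>\<tau>\<bar> powr \<alpha>))"
          by (rule Lp_le_cmult[OF om[OF \<tau>(2,1)]]) (use W0' p in \<open>auto simp: abs_mult\<close>)
        then show "(\<integral>\<^sup>+\<theta>. ennreal ((W0 \<tau> * cmod (B (\<theta> + \<tau>) - B \<theta>)) powr p) \<partial>circ)
         \<le> ennreal ((C * (W0 \<tau> * \<bar>\<tau>\<bar> powr \<alpha>)) powr p)"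
          using W0' by (simp add: Lp_le_def abs_mult mult_ac)
      qed
      show "AE \<theta> in circ. ennreal (cmod (deriv F (of_real s * cis \<theta>)))
        \<le> (\<integral>\<^sup>+\<tau>. ennreal (W0 \<tau> * cmod (B (\<theta> + \<tau>) - B \<theta>)) \<partial>circ)"
      proof (intro AE_I2)
        fix \<theta>
        have kcont: "continuous_on UNIV (deriv_kernel s)" by (rule continuous_on_deriv_kernel[OF s])
        have [measurable]: "deriv_kernel s \<in> borel_measurable borel"
          by (rule borel_measurable_continuous_onI[OF kcont])
        define I where "I = (LINT \<tau>|circ. (B (\<theta> + \<tau>) - B \<theta>) * deriv_kernel s \<tau>)"
        have "cmod (deriv F (of_real s * cis \<theta>)) = cmod I"
          using formula[OF s, of \<theta>] by (metis I_def norm_cis norm_mult mult_1)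
        \<comment> \<open>If the integrand were not integrable, the Bochner integral would be 0 by
          convention, so the bound holds in either case.\<close>
        also have "ennreal (cmod I) \<le> (\<integral>\<^sup>+\<tau>. norm ((B (\<theta> + \<tau>) - B \<theta>) * deriv_kernel s \<tau>) \<partial>circ)"
          unfolding I_def
          by (cases "integrable circ (\<lambda>\<tau>. (B (\<theta> + \<tau>) - B \<theta>) * deriv_kernel s \<tau>)")
             (auto simp: not_integrable_integral_eq intro: integral_norm_bound_ennreal)
        also have "\<dots> \<le> (\<integral>\<^sup>+\<tau>. ennreal (W0 \<tau> * cmod (B (\<theta> + \<tau>) - B \<theta>)) \<partial>circ)"
        proof (intro nn_integral_mono ennreal_leI)
          fix \<tau>
          have "norm (deriv_kernel s \<tau>) \<le> W0 \<tau>" using norm_deriv_kernel_le[OF s] by (simp add: W0_def)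
          then show "norm ((B (\<theta> + \<tau>) - B \<theta>) * deriv_kernel s \<tau>) \<le> W0 \<tau> * cmod (B (\<theta> + \<tau>) - B \<theta>)"
            unfolding norm_mult by (subst mult.commute) (rule mult_right_mono, simp_all)
        qed
        finally show "ennreal (cmod (deriv F (of_real s * cis \<theta>)))
          \<le> (\<integral>\<^sup>+\<tau>. ennreal (W0 \<tau> * cmod (B (\<theta> + \<tau>) - B \<theta>)) \<partial>circ)" .
      qed
    qed (auto simp: W0')
    then show "Lp_le p (\<lambda>\<theta>. deriv F (of_real s * cis \<theta>)) (C * K * (1 - s) powr (\<alpha> - 1))"
      using C K by (simp add: Lp_le_def)
  qed
qed

section \<open>Convolutions and differences in \<open>L\<^sup>p\<close>\<close>

text \<open>Here \<open>W\<close> may vanish. It is replaced by \<open>W + e\<close>, whose integral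
  grows by \<open>e\<close> times the total mass, and \<open>e\<close> tends to 0; this is where
  finiteness of the measure enters. The 1 in \<open>1 + c\<close> keeps the bound positive.\<close>

lemma minkowski_integral_finite:
  fixes \<phi> :: "'a \<Rightarrow> 'b \<Rightarrow> real" and W :: "'a \<Rightarrow> real"
  assumes p: "1 < p" and fin: "finite_measure M" and sf: "sigma_finite_measure N"
    and [measurable]: "W \<in> borel_measurable M" "(\<lambda>(x, y). \<phi> x y) \<in> borel_measurable (M \<Otimes>\<^sub>M N)"
    and nn: "\<And>x. 0 \<le> W x" "\<And>x y. 0 \<le> \<phi> x y"
    and K: "(\<integral>\<^sup>+x. ennreal (W x) \<partial>M) \<le> ennreal K" "0 \<le> K"
    and W: "AE x in M. (\<integral>\<^sup>+y. ennreal (\<phi> x y powr p) \<partial>N) \<le> ennreal (W x powr p)"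
    and \<Phi>: "AE y in N. ennreal (\<Phi> y) \<le> (\<integral>\<^sup>+x. ennreal (\<phi> x y) \<partial>M)" "\<And>y. 0 \<le> \<Phi> y"
  shows "(\<integral>\<^sup>+y. ennreal (\<Phi> y powr p) \<partial>N) \<le> ennreal (K powr p)"
proof -
  interpret M: finite_measure M by fact
  define c where "c = measure M (space M)"
  have c: "0 \<le> c" by (simp add: c_def)
  have gen: "(\<integral>\<^sup>+y. ennreal (\<Phi> y powr p) \<partial>N) \<le> ennreal ((K + e * (1 + c)) powr p)" if "0 < e" for e
  proof (rule minkowski_integral[OF p M.sigma_finite_measure_axioms sf, where W = "\<lambda>x. W x + e"])
    show "AE x in M. 0 < W x + e" using nn that by (auto simp: add_nonneg_pos)
    have "(\<integral>\<^sup>+x. ennreal (W x + e) \<partial>M) = (\<integral>\<^sup>+x. ennreal (W x) \<partial>M) + ennreal (e * c)"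
      using nn that by (simp add: nn_integral_add c_def M.emeasure_eq_measure ennreal_mult)
    also have "\<dots> \<le> ennreal K + ennreal (e * c)" by (intro add_mono K) auto
    also have "\<dots> = ennreal (K + e * c)" using K c that by simp
    also have "\<dots> \<le> ennreal (K + e * (1 + c))" using that by (intro ennreal_leI) (simp add: algebra_simps)
    finally show "(\<integral>\<^sup>+x. ennreal (W x + e) \<partial>M) \<le> ennreal (K + e * (1 + c))" .
    show "0 < K + e * (1 + c)" using K c that by (simp add: add_nonneg_pos)
    show "AE x in M. (\<integral>\<^sup>+y. ennreal (\<phi> x y powr p) \<partial>N) \<le> ennreal ((W x + e) powr p)"
    proof (rule eventually_mono[OF W])
      fix x assume "(\<integral>\<^sup>+y. ennreal (\<phi> x y powr p) \<partial>N) \<le> ennreal (W x powr p)"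
      also have "\<dots> \<le> ennreal ((W x + e) powr p)"
        using nn that p by (intro ennreal_leI powr_mono2) auto
      finally show "(\<integral>\<^sup>+y. ennreal (\<phi> x y powr p) \<partial>N) \<le> ennreal ((W x + e) powr p)" .
    qed
  qed (use nn \<Phi> in auto)
  have "((\<lambda>e. ennreal ((K + e * (1 + c)) powr p)) \<longlongrightarrow> ennreal ((K + 0 * (1 + c)) powr p)) (at_right 0)"
    using p K c by (intro tendsto_ennrealI tendsto_powr' tendsto_intros) (auto simp: eventually_at_filter)
  moreover have "eventually (\<lambda>e. (\<integral>\<^sup>+y. ennreal (\<Phi> y powr p) \<partial>N) \<le> ennreal ((K + e * (1 + c)) powr p)) (at_right 0)"
    using gen by (auto simp: eventually_at_filter)
  ultimately show ?thesis
    by (intro tendsto_lowerbound[where F = "at_right (0::real)"]) auto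
qed

text \<open>Minkowski's inequality over the translates of \<open>u\<close>. The function
  \<open>v\<close> is only dominated by the convolution, so that moduli of complex integrals can be
  fed in directly; \<open>c\<close> is 1 or -1 in the applications.\<close>

lemma young_convolution:
  fixes u g :: "real \<Rightarrow> real"
  assumes p: "1 < p" and u: "Lp_le p u m" "\<And>x. u (x + 2 * pi) = u x" "\<And>x. 0 \<le> u x"
    and [measurable]: "u \<in> borel_measurable borel" "g \<in> borel_measurable borel"
    and g: "\<And>x. 0 \<le> g x" "(\<integral>\<^sup>+t. ennreal (g t) \<partial>circ) \<le> ennreal G" "0 \<le> G"
    and v: "\<And>\<theta>. 0 \<le> v \<theta>" "\<And>\<theta>. ennreal (v \<theta>) \<le> (\<integral>\<^sup>+t. ennreal (g t * u (\<theta> + c * t)) \<partial>circ)"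
  shows "Lp_le p v (m * G)"
proof -
  have m: "0 \<le> m" using u by (simp add: Lp_le_def)
  have "(\<integral>\<^sup>+\<theta>. ennreal (v \<theta> powr p) \<partial>circ) \<le> ennreal ((m * G) powr p)"
  proof (rule minkowski_integral_finite[OF p circ.finite_measure_axioms circ.sigma_finite_measure_axioms,
        where W = "\<lambda>t. m * g t" and \<phi> = "\<lambda>t \<theta>. g t * u (\<theta> + c * t)"])
    have "(\<integral>\<^sup>+t. ennreal (m * g t) \<partial>circ) = ennreal m * (\<integral>\<^sup>+t. ennreal (g t) \<partial>circ)"
      using m g by (simp add: ennreal_mult nn_integral_cmult)
    also have "\<dots> \<le> ennreal m * ennreal G" by (intro mult_left_mono g) auto
    finally show "(\<integral>\<^sup>+t. ennreal (m * g t) \<partial>circ) \<le> ennreal (m * G)" using m g by (simp add: ennreal_mult)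
    show "AE t in circ. (\<integral>\<^sup>+\<theta>. ennreal ((g t * u (\<theta> + c * t)) powr p) \<partial>circ) \<le> ennreal ((m * g t) powr p)"
    proof (intro AE_I2)
      fix t
      have "Lp_le p (\<lambda>\<theta>. g t * u (\<theta> + c * t)) (g t * m)"
        by (rule Lp_le_cmult[OF Lp_le_shift[OF u(1,2), of "c * t"]]) (use g p in \<open>auto simp: abs_mult\<close>)
      then show "(\<integral>\<^sup>+\<theta>. ennreal ((g t * u (\<theta> + c * t)) powr p) \<partial>circ) \<le> ennreal ((m * g t) powr p)"
        using g u by (simp add: Lp_le_def abs_mult mult_ac)
    qed
  qed (use m g u v in auto)
  then show ?thesis using m g v by (simp add: Lp_le_def)
qed

lemma circle_periodic: "g (cis (x + 2 * pi)) = g (cis x)"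
  by (simp add: cis_mult[symmetric])

lemma Lp_le_norm_iff: "Lp_le p (\<lambda>t. norm (u t)) B \<longleftrightarrow> Lp_le p u B"
  by (simp add: Lp_le_def)

text \<open>The Poisson kernel is positive of mass 1, so Young's inequality gives the constant
  1.\<close>

lemma Lp_le_radius_mono:
  assumes p: "1 < p" and g: "g holomorphic_on ball 0 R" "1 < R" and s: "0 \<le> s" "s < 1"
    and m: "Lp_le p (\<lambda>\<theta>. g (cis \<theta>)) m"
  shows "Lp_le p (\<lambda>\<theta>. g (of_real s * cis \<theta>)) m"
proof -
  have cont: "continuous_on UNIV (\<lambda>t. g (cis t))" by (rule continuous_on_circle[OF g])
  define P where "P t = (1 - s\<^sup>2) / (cmod (1 - of_real s * cis (- t)))\<^sup>2" for t
  have P0: "0 \<le> P t" for t using s by (simp add: P_def power_le_one)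
  have Pcont: "continuous_on UNIV P"
    unfolding P_def using one_minus_cis_nonzero[OF s] by (intro continuous_intros) auto
  have "P t = (1 - s\<^sup>2) / (cmod (1 - of_real s * cis t))\<^sup>2" for t
  proof -
    have "1 - of_real s * cis (- t) = cnj (1 - of_real s * cis t)" by (simp add: cis_cnj)
    then show ?thesis unfolding P_def by (simp only: complex_mod_cnj)
  qed
  then have PI: "(\<integral>\<^sup>+t. ennreal (P t) \<partial>circ) = 1" using poisson_kernel_integral[OF s] by simp
  have "Lp_le p (\<lambda>\<theta>. cmod (g (of_real s * cis \<theta>))) (m * 1)"
  proof (rule young_convolution[where u = "\<lambda>\<theta>. cmod (g (cis \<theta>))" and g = P and c = 1, OF p])
    show "Lp_le p (\<lambda>\<theta>. cmod (g (cis \<theta>))) m" using m by (simp add: Lp_le_norm_iff)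
    show "(\<lambda>\<theta>. cmod (g (cis \<theta>))) \<in> borel_measurable borel" "P \<in> borel_measurable borel"
      by (intro borel_measurable_continuous_onI continuous_intros cont Pcont)+
    fix \<theta>
    have g': "(\<lambda>w. g (cis \<theta> * w)) holomorphic_on ball 0 R"
      by (intro holomorphic_on_compose_gen[OF _ g(1), unfolded o_def] holomorphic_intros) (auto simp: norm_mult)
    have "g (of_real s * cis \<theta>) = (LINT t|circ. of_real (P t) * g (cis (\<theta> + t)))"
      using poisson_circ[OF g' g(2), of "of_real s"] s by (simp add: P_def cis_mult mult.commute add.commute)
    also have "ennreal (cmod \<dots>) \<le> (\<integral>\<^sup>+t. norm (of_real (P t) * g (cis (\<theta> + t))) \<partial>circ)"
      by (intro integral_norm_bound_ennreal integrable_circ_continuous continuous_intros Pcont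
          continuous_on_compose2[OF cont]) auto
    finally show "ennreal (cmod (g (of_real s * cis \<theta>))) \<le> (\<integral>\<^sup>+t. ennreal (P t * cmod (g (cis (\<theta> + 1 * t)))) \<partial>circ)"
      using P0 by (simp add: norm_mult)
  qed (use P0 PI in \<open>auto simp: circle_periodic\<close>)
  then show ?thesis by (simp add: Lp_le_norm_iff)
qed

text \<open>The mean of the modulus of the derivative kernel is at most of order
  \<open>1 / (1 - s)\<close>: this is the moment of order 0.\<close>

lemma Lp_le_deriv:
  fixes p :: real
  assumes p: "1 < p"
  obtains C where "0 < C"
    "\<And>g R s m. g holomorphic_on ball 0 R \<Longrightarrow> 1 < R \<Longrightarrow> 0 \<le> s \<Longrightarrow> s < 1 \<Longrightarrow> Lp_le p (\<lambda>\<theta>. g (cis \<theta>)) m \<Longrightarrow>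
       Lp_le p (\<lambda>\<theta>. deriv g (of_real s * cis \<theta>)) (m * (C / (1 - s)))"
proof -
  obtain C where C: "0 < C" "\<And>s. 0 \<le> s \<Longrightarrow> s < 1 \<Longrightarrow>
      (\<integral>\<^sup>+\<tau>. ennreal (4 * (1 - s) * (\<bar>\<tau>\<bar> / cmod (1 - of_real s * cis \<tau>) powr 4) * \<bar>\<tau>\<bar> powr 0) \<partial>circ)
        \<le> ennreal (C * (1 - s) powr (0 - 1))"
    using deriv_kernel_moment[of 0] by auto
  show ?thesis
  proof (rule that[OF C(1)])
    fix g R s m assume g: "g holomorphic_on ball 0 R" "1 < R" and s: "0 \<le> s" "s < (1::real)"
      and m: "Lp_le p (\<lambda>\<theta>. g (cis \<theta>)) m"
    have cont: "continuous_on UNIV (\<lambda>t. g (cis t))" by (rule continuous_on_circle[OF g])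
    have kcont: "continuous_on UNIV (deriv_kernel s)" by (rule continuous_on_deriv_kernel[OF s])
    have "(\<integral>\<^sup>+\<tau>. ennreal (norm (deriv_kernel s \<tau>)) \<partial>circ) \<le>
      (\<integral>\<^sup>+\<tau>. ennreal (4 * (1 - s) * (\<bar>\<tau>\<bar> / cmod (1 - of_real s * cis \<tau>) powr 4) * \<bar>\<tau>\<bar> powr 0) \<partial>circ)"
      using norm_deriv_kernel_le[OF s] by (intro nn_integral_mono_AE eventually_mono[OF AE_circ_nonzero] ennreal_leI) simp
    also have "\<dots> \<le> ennreal (C * (1 - s) powr (0 - 1))" by (rule C(2)[OF s])
    also have "C * (1 - s) powr (0 - 1) = C / (1 - s)" using s by (simp add: powr_minus divide_inverse)
    finally have k: "(\<integral>\<^sup>+\<tau>. ennreal (norm (deriv_kernel s \<tau>)) \<partial>circ) \<le> ennreal (C / (1 - s))" .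
    have "Lp_le p (\<lambda>\<theta>. cmod (deriv g (of_real s * cis \<theta>))) (m * (C / (1 - s)))"
    proof (rule young_convolution[where u = "\<lambda>\<theta>. cmod (g (cis \<theta>))" and g = "\<lambda>\<tau>. norm (deriv_kernel s \<tau>)" and c = 1, OF p])
      show "Lp_le p (\<lambda>\<theta>. cmod (g (cis \<theta>))) m" using m by (simp add: Lp_le_norm_iff)
      show "(\<lambda>\<theta>. cmod (g (cis \<theta>))) \<in> borel_measurable borel" "(\<lambda>\<tau>. norm (deriv_kernel s \<tau>)) \<in> borel_measurable borel"
        by (intro borel_measurable_continuous_onI continuous_intros cont kcont)+
      fix \<theta>
      have "cmod (deriv g (of_real s * cis \<theta>)) = cmod (cis \<theta> * deriv g (of_real s * cis \<theta>))" by (simp add: norm_mult)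
      also have "cis \<theta> * deriv g (of_real s * cis \<theta>) = (LINT \<tau>|circ. g (cis (\<theta> + \<tau>)) * deriv_kernel s \<tau>)"
        by (rule deriv_formula_holomorphic[OF g s, symmetric])
      also have "ennreal (cmod \<dots>) \<le> (\<integral>\<^sup>+\<tau>. norm (g (cis (\<theta> + \<tau>)) * deriv_kernel s \<tau>) \<partial>circ)"
        by (intro integral_norm_bound_ennreal integrable_circ_continuous continuous_intros kcont
            continuous_on_compose2[OF cont]) auto
      finally show "ennreal (cmod (deriv g (of_real s * cis \<theta>))) \<le>
        (\<integral>\<^sup>+\<tau>. ennreal (norm (deriv_kernel s \<tau>) * cmod (g (cis (\<theta> + 1 * \<tau>)))) \<partial>circ)"
        by (simp add: norm_mult mult.commute)
    qed (use k s C in \<open>auto simp: circle_periodic\<close>)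
    then show "Lp_le p (\<lambda>\<theta>. deriv g (of_real s * cis \<theta>)) (m * (C / (1 - s)))" by (simp add: Lp_le_norm_iff)
  qed
qed

text \<open>Lebesgue measure on an interval, kept on the Borel sets of the whole line: a finite
  measure to which the product-measure lemmas apply without restricted spaces.\<close>

definition ivl :: "real \<Rightarrow> real \<Rightarrow> real measure" where
  "ivl a b = density lborel (indicator {a..b})"

lemma sets_ivl [simp, measurable_cong]: "sets (ivl a b) = sets borel"
  by (simp add: ivl_def)

lemma space_ivl [simp]: "space (ivl a b) = UNIV"
  by (simp add: ivl_def)

lemma nn_integral_ivl:
  assumes [measurable]: "f \<in> borel_measurable borel"
  shows "(\<integral>\<^sup>+t. f t \<partial>ivl a b) = (\<integral>\<^sup>+t. f t * indicator {a..b} t \<partial>lborel)"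
  unfolding ivl_def by (subst nn_integral_density) (auto simp: mult.commute)

lemma finite_measure_ivl: "finite_measure (ivl a b)"
proof
  have "emeasure (ivl a b) UNIV = (\<integral>\<^sup>+t. 1 \<partial>ivl a b)" by simp
  also have "\<dots> = emeasure lborel {a..b}" by (subst nn_integral_ivl) auto
  finally show "emeasure (ivl a b) (space (ivl a b)) \<noteq> \<infinity>" by (simp add: emeasure_lborel_Icc_eq)
qed

lemma AE_ivl: "AE t in ivl a b. a \<le> t \<and> t \<le> b"
  unfolding ivl_def by (subst AE_density) (auto split: split_indicator)

lemma integral_ivl:
  fixes f :: "real \<Rightarrow> 'a::{banach, second_countable_topology}"
  assumes "f \<in> borel_measurable borel"
  shows "(LINT t|ivl a b. f t) = (LINT t|lborel. indicator {a..b} t *\<^sub>R f t)"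
proof -
  have "ivl a b = density lborel (\<lambda>t. ennreal (indicator {a..b} t))"
    unfolding ivl_def by (intro arg_cong2[where f = density] refl ext) (auto split: split_indicator)
  then show ?thesis using assms by (simp add: integral_density)
qed

lemma Lp_le_difference:
  fixes u u' :: "real \<Rightarrow> complex"
  assumes p: "1 < p" and der: "\<And>\<theta>. (u has_vector_derivative u' \<theta>) (at \<theta>)" and cont: "continuous_on UNIV u'"
    and m: "Lp_le p u' m" and per: "\<And>\<theta>. u' (\<theta> + 2 * pi) = u' \<theta>"
  shows "Lp_le p (\<lambda>\<theta>. u (\<theta> + \<tau>) - u \<theta>) (\<bar>\<tau>\<bar> * m)"
proof -
  have [measurable]: "u' \<in> borel_measurable borel" by (rule borel_measurable_continuous_onI[OF cont])
  have m0: "0 \<le> m" using m by (simp add: Lp_le_def)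
  \<comment> \<open>The sign of \<tau> is split off so that the path from \<theta> to
    \<open>\<theta> + \<tau>\<close> is parametrised by
    \<open>{0..\<bar>\<tau>\<bar>}\<close>.\<close>
  define s where "s = (if 0 \<le> \<tau> then 1 else - 1 :: real)"
  have "(\<integral>\<^sup>+\<theta>. ennreal (cmod (u (\<theta> + \<tau>) - u \<theta>) powr p) \<partial>circ) \<le> ennreal ((\<bar>\<tau>\<bar> * m) powr p)"
  proof (rule minkowski_integral_finite[OF p finite_measure_ivl[of 0 "\<bar>\<tau>\<bar>"] circ.sigma_finite_measure_axioms,
        where W = "\<lambda>_. m" and \<phi> = "\<lambda>x \<theta>. cmod (u' (\<theta> + s * x))"])
    show "(\<integral>\<^sup>+x. ennreal m \<partial>ivl 0 \<bar>\<tau>\<bar>) \<le> ennreal (\<bar>\<tau>\<bar> * m)"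
      using m0 by (subst nn_integral_ivl) (auto simp: nn_integral_cmult ennreal_mult[symmetric] mult.commute)
    show "AE x in ivl 0 \<bar>\<tau>\<bar>. (\<integral>\<^sup>+\<theta>. ennreal (cmod (u' (\<theta> + s * x)) powr p) \<partial>circ) \<le> ennreal (m powr p)"
      using Lp_le_shift[OF m per] by (intro AE_I2) (auto simp: Lp_le_def)
    show "AE \<theta> in circ. ennreal (cmod (u (\<theta> + \<tau>) - u \<theta>)) \<le> (\<integral>\<^sup>+x. ennreal (cmod (u' (\<theta> + s * x))) \<partial>ivl 0 \<bar>\<tau>\<bar>)"
    proof (intro AE_I2)
      fix \<theta>
      have c: "continuous_on A (\<lambda>x. u' (\<theta> + s * x))" for A
        by (rule continuous_on_compose2[OF cont]) (auto intro!: continuous_intros)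
      have "((\<lambda>x. u (\<theta> + s * x)) has_vector_derivative s *\<^sub>R u' (\<theta> + s * x)) (at x within {0..\<bar>\<tau>\<bar>})" for x
      proof -
        have "((\<lambda>x. \<theta> + s * x) has_vector_derivative s) (at x within {0..\<bar>\<tau>\<bar>})"
          by (auto intro!: derivative_eq_intros)
        from vector_diff_chain_within[OF this, of u "u' (\<theta> + s * x)"] show ?thesis
          using der by (simp add: o_def has_vector_derivative_at_within)
      qed
      then have int: "integral\<^sup>L lborel (\<lambda>x. indicator {0..\<bar>\<tau>\<bar>} x *\<^sub>R (s *\<^sub>R u' (\<theta> + s * x))) = u (\<theta> + s * \<bar>\<tau>\<bar>) - u (\<theta> + s * 0)"
        by (intro integral_FTC_Icc) (auto intro!: continuous_intros c)
      have "s * \<bar>\<tau>\<bar> = \<tau>" by (auto simp: s_def)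
      then have "u (\<theta> + \<tau>) - u \<theta> = integral\<^sup>L lborel (\<lambda>x. indicator {0..\<bar>\<tau>\<bar>} x *\<^sub>R (s *\<^sub>R u' (\<theta> + s * x)))"
        using int by simp
      also have "ennreal (cmod \<dots>) \<le> (\<integral>\<^sup>+x. norm (indicator {0..\<bar>\<tau>\<bar>} x *\<^sub>R (s *\<^sub>R u' (\<theta> + s * x))) \<partial>lborel)"
        by (intro integral_norm_bound_ennreal borel_integrable_compact continuous_intros c) auto
      also have "\<dots> = (\<integral>\<^sup>+x. ennreal (cmod (u' (\<theta> + s * x))) \<partial>ivl 0 \<bar>\<tau>\<bar>)"
        by (subst nn_integral_ivl) (auto intro!: nn_integral_cong simp: s_def split: split_indicator)
      finally show "ennreal (cmod (u (\<theta> + \<tau>) - u \<theta>)) \<le> (\<integral>\<^sup>+x. ennreal (cmod (u' (\<theta> + s * x))) \<partial>ivl 0 \<bar>\<tau>\<bar>)" .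
    qed
  qed (use m0 in auto)
  then show ?thesis using m0 by (simp add: Lp_le_def)
qed

lemma fubini_bounded:
  fixes f :: "real \<Rightarrow> real \<Rightarrow> 'a::{banach, second_countable_topology}"
  assumes fin: "finite_measure M" "finite_measure N"
    and sets [measurable_cong]: "sets M = sets borel" "sets N = sets borel"
    and m: "(\<lambda>(x, y). f x y) \<in> borel_measurable (borel \<Otimes>\<^sub>M borel)" and b: "\<And>x y. norm (f x y) \<le> B"
  shows "(LINT x|M. LINT y|N. f x y) = (LINT y|N. LINT x|M. f x y)"
    and "integrable M (\<lambda>x. LINT y|N. f x y)" "integrable N (\<lambda>y. LINT x|M. f x y)"
proof -
  interpret M: finite_measure M by fact
  interpret N: finite_measure N by fact
  interpret P: pair_sigma_finite M N ..
  interpret MN: finite_measure "M \<Otimes>\<^sub>M N" by (rule finite_measure_pair_measure[OF fin(2,1)])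
  have "integrable (M \<Otimes>\<^sub>M N) (\<lambda>(x, y). f x y)"
  proof (rule MN.integrable_const_bound[where B = B])
    show "(\<lambda>(x, y). f x y) \<in> borel_measurable (M \<Otimes>\<^sub>M N)" using m by measurable
  qed (use b in auto)
  from P.Fubini_integral[OF this] P.integrable_fst[OF this] P.integrable_snd[OF this]
  show "(LINT x|M. LINT y|N. f x y) = (LINT y|N. LINT x|M. f x y)"
    "integrable M (\<lambda>x. LINT y|N. f x y)" "integrable N (\<lambda>y. LINT x|M. f x y)" by auto
qed

text \<open>Up to the factor \<open>p\<close>, the gradient of \<open>cmod w powr p\<close>.\<close>

definition pgrad :: "real \<Rightarrow> complex \<Rightarrow> complex" where
  "pgrad p w = of_real (cmod w powr (p - 2)) * cnj w"

lemma norm_pgrad: "1 < p \<Longrightarrow> cmod (pgrad p w) = cmod w powr (p - 1)"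
  using powr_add[of "cmod w" "p - 2" 1] by (cases "w = 0") (simp_all add: pgrad_def norm_mult)

text \<open>Let \<open>cmod b \<le> cmod a\<close>. If \<open>cmod (a - b)\<close> exceeds
  \<open>cmod a\<close>, the sizes alone suffice. Otherwise the difference splits into a change of
  the argument and a change of the weight, each at most
  \<open>cmod a powr (p - 2) * cmod (a - b)\<close>; as \<open>p - 2 \<le> 0\<close>, the factor
  \<open>cmod a powr (p - 2)\<close> may be replaced by
  \<open>cmod (a - b) powr (p - 2)\<close>.\<close>

lemma pgrad_holder:
  assumes p: "1 < p" "p \<le> 2"
  shows "cmod (pgrad p a - pgrad p b) \<le> 2 * cmod (a - b) powr (p - 1)"
proof -
  have main: "cmod (pgrad p a - pgrad p b) \<le> 2 * cmod (a - b) powr (p - 1)" if ab: "cmod b \<le> cmod a" for a b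
  proof (cases "cmod (a - b) \<le> cmod a")
    case False
    have "cmod (pgrad p a - pgrad p b) \<le> cmod a powr (p - 1) + cmod b powr (p - 1)"
      using norm_triangle_ineq4[of "pgrad p a" "pgrad p b"] p by (simp add: norm_pgrad)
    also have "\<dots> \<le> cmod (a - b) powr (p - 1) + cmod (a - b) powr (p - 1)"
      using False ab p by (intro add_mono powr_mono2) auto
    finally show ?thesis by simp
  next
    case True
    show ?thesis
    proof (cases "b = 0 \<or> a = b")
      case True
      then show ?thesis using norm_pgrad[OF p(1), of a] by (auto simp: pgrad_def)
    next
      case False
      then have pos: "0 < cmod b" "0 < cmod a" "0 < cmod (a - b)" using ab by auto
      define x where "x = cmod b / cmod a"
      have x: "0 < x" "x \<le> 1" using pos ab by (auto simp: x_def)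
      have "pgrad p a - pgrad p b = of_real (cmod a powr (p - 2)) * cnj (a - b) +
         of_real (cmod a powr (p - 2) - cmod b powr (p - 2)) * cnj b"
        by (simp add: pgrad_def algebra_simps)
      also have "cmod \<dots> \<le> cmod (of_real (cmod a powr (p - 2)) * cnj (a - b)) +
         cmod (of_real (cmod a powr (p - 2) - cmod b powr (p - 2)) * cnj b)"
        by (rule norm_triangle_ineq)
      also have "\<dots> = cmod a powr (p - 2) * cmod (a - b) + \<bar>cmod a powr (p - 2) - cmod b powr (p - 2)\<bar> * cmod b"
        unfolding norm_mult norm_of_real complex_mod_cnj by simp
      also have "\<bar>cmod a powr (p - 2) - cmod b powr (p - 2)\<bar> * cmod b \<le> cmod a powr (p - 2) * cmod (a - b)"
      proof -
        have le: "cmod a powr (p - 2) \<le> cmod b powr (p - 2)"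
          using pos ab p by (intro powr_mono2') auto
        \<comment> \<open>This linearises \<open>1 - x powr (2 - p)\<close>, the relative change of
          the weight, to \<open>1 - x\<close>, which is
          \<open>(cmod a - cmod b) / cmod a\<close>.\<close>
        have "x \<le> x powr (2 - p)" using powr_mono'[of "2 - p" 1 x] x p by simp
        have aeq: "cmod a powr (p - 2) = cmod b powr (p - 2) * x powr (2 - p)"
        proof -
          have "x powr (2 - p) = cmod b powr (2 - p) * cmod a powr (p - 2)"
            unfolding x_def using pos powr_minus_divide[of "cmod a" "2 - p"] by (simp add: powr_divide)
          then have "cmod b powr (p - 2) * x powr (2 - p) = (cmod b powr (p - 2) * cmod b powr (2 - p)) * cmod a powr (p - 2)"
            by simp
          also have "cmod b powr (p - 2) * cmod b powr (2 - p) = 1" using pos by (simp flip: powr_add)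
          finally show ?thesis by simp
        qed
        have "\<bar>cmod a powr (p - 2) - cmod b powr (p - 2)\<bar> * cmod b = (cmod b powr (p - 2) * cmod b) * (1 - x powr (2 - p))"
          using le aeq by (simp add: algebra_simps)
        also have "\<dots> \<le> (cmod b powr (p - 2) * cmod b) * (1 - x)"
          using \<open>x \<le> x powr (2 - p)\<close> by (intro mult_left_mono) auto
        also have "(cmod b powr (p - 2) * cmod b) = cmod b powr (p - 1)" using pos by (simp add: powr_diff power2_eq_square)
        also have "1 - x = (cmod a - cmod b) / cmod a" using pos by (simp add: x_def field_simps)
        also have "cmod b powr (p - 1) * ((cmod a - cmod b) / cmod a) \<le> cmod a powr (p - 1) * (cmod (a - b) / cmod a)"
          using ab p pos norm_triangle_ineq2[of a b]
          by (intro mult_mono powr_mono2 divide_right_mono) auto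
        also have "\<dots> = cmod a powr (p - 2) * cmod (a - b)" using pos by (simp add: powr_diff power2_eq_square)
        finally show ?thesis .
      qed
      also have "cmod a powr (p - 2) * cmod (a - b) + cmod a powr (p - 2) * cmod (a - b) = 2 * (cmod a powr (p - 2) * cmod (a - b))"
        by simp
      also have "cmod a powr (p - 2) \<le> cmod (a - b) powr (p - 2)"
        using True pos p by (intro powr_mono2') auto
      also have "cmod (a - b) powr (p - 2) * cmod (a - b) = cmod (a - b) powr (p - 1)"
        using pos by (simp add: powr_diff power2_eq_square)
      finally show ?thesis by (simp add: mult_right_mono)
    qed
  qed
  show ?thesis
    using main[of b a] main[of a b] by (cases "cmod b \<le> cmod a") (auto simp: norm_minus_commute)
qed

lemma continuous_on_pgrad:
  assumes p: "1 < p" "p \<le> 2"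
  shows "continuous_on A (pgrad p)"
proof (rule continuous_on_subset[OF continuous_at_imp_continuous_on])
  show "\<forall>a\<in>UNIV. isCont (pgrad p) a"
  proof
    fix a
    have "((\<lambda>b. 2 * cmod (b - a) powr (p - 1)) \<longlongrightarrow> 2 * cmod (a - a) powr (p - 1)) (at a)"
      using p by (intro tendsto_powr' tendsto_intros) auto
    then have "((\<lambda>b. 2 * cmod (b - a) powr (p - 1)) \<longlongrightarrow> 0) (at a)" by simp
    then have "((\<lambda>b. pgrad p b - pgrad p a) \<longlongrightarrow> 0) (at a)"
      by (rule Lim_null_comparison[rotated]) (intro always_eventually allI pgrad_holder[OF p])
    then show "isCont (pgrad p) a" by (simp add: isCont_def LIM_zero_iff)
  qed
qed auto

text \<open>For \<open>p > 1\<close> the power of the modulus is differentiable at the origin as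
  well, with derivative 0, because \<open>cmod h powr p / cmod h\<close> tends to 0; zeros of
  \<open>y\<close> are therefore covered.\<close>

lemma has_vector_derivative_norm_powr:
  fixes y :: "real \<Rightarrow> complex"
  assumes p: "1 < p" and y: "(y has_vector_derivative y') (at x within S)"
  shows "((\<lambda>x. cmod (y x) powr p) has_vector_derivative (p * Re (pgrad p (y x) * y'))) (at x within S)"
proof -
  have "((\<lambda>w. cmod w powr p) has_derivative (\<lambda>h. p * Re (pgrad p a * h))) (at a)" for a
  proof (cases "a = 0")
    case True
    have "((\<lambda>h. cmod h powr (p - 1)) \<longlongrightarrow> cmod (0::complex) powr (p - 1)) (at 0)"
      using p by (intro tendsto_powr' tendsto_intros) auto
    then have "((\<lambda>h. cmod h powr (p - 1)) \<longlongrightarrow> 0) (at (0::complex))" by simp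
    moreover have "eventually (\<lambda>h. cmod h powr (p - 1) = norm (cmod h powr p) / norm h) (at (0::complex))"
      by (auto simp: eventually_at_filter powr_diff)
    ultimately have "((\<lambda>h. norm (cmod h powr p) / norm h) \<longlongrightarrow> 0) (at (0::complex))"
      by (rule Lim_transform_eventually)
    then show ?thesis using True p by (simp add: has_derivative_at pgrad_def)
  next
    case False
    have "((\<lambda>z. z powr p) has_derivative (*) (p * cmod a powr (p - 1))) (at (cmod a))"
      using has_real_derivative_powr[of "cmod a" p] False by (simp add: has_field_derivative_def)
    from has_derivative_compose[OF has_derivative_norm[OF False] this]
    have "((\<lambda>w. cmod w powr p) has_derivative (\<lambda>h. p * cmod a powr (p - 1) * (h \<bullet> sgn a))) (at a)"
      by simp
    moreover have "p * cmod a powr (p - 1) * (h \<bullet> sgn a) = p * Re (pgrad p a * h)" for h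
      using False by (simp add: pgrad_def sgn_eq inner_complex_def powr_diff power2_eq_square field_simps)
    ultimately show ?thesis by simp
  qed
  from has_derivative_compose[OF y[unfolded has_vector_derivative_def] this]
  show ?thesis by (simp add: has_vector_derivative_def mult_ac)
qed

section \<open>The Rhaly operator as a convolution\<close>

lemma less_conv_radius_disc:
  fixes A :: "complex fps"
  assumes "1 \<le> fps_conv_radius A" "cmod z < 1"
  shows "ereal (cmod z) < fps_conv_radius A"
proof -
  have "ereal (cmod z) < 1" using assms(2) by simp
  then show ?thesis using assms(1) by (rule less_le_trans)
qed

text \<open>With \<open>t = sqrt r\<close> both series are evaluated at radius \<open>t < 1\<close>:
  one is absolutely summable there, the terms of the other are bounded, and the product lives at
  radius \<open>t * t\<close>.\<close>

lemma fps_conv_radius_hadamard: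
  fixes A B :: "complex fps"
  assumes "1 \<le> fps_conv_radius A" "1 \<le> fps_conv_radius B"
  shows "1 \<le> fps_conv_radius (Abs_fps (\<lambda>n. fps_nth A n * fps_nth B n))"
  unfolding fps_conv_radius_def
proof (rule conv_radius_geI_ex)
  fix r :: real assume r: "0 < r" "ereal r < 1"
  define t where "t = sqrt r"
  have t: "0 < t" "t < 1" "t * t = r" using r by (auto simp: t_def)
  have "summable (\<lambda>n. norm (fps_nth A n * of_real t ^ n))" "summable (\<lambda>n. norm (fps_nth B n * of_real t ^ n))"
    using t by (intro norm_summable_fps less_conv_radius_disc assms; simp)+
  then have s: "summable (\<lambda>n. norm (fps_nth A n * of_real t ^ n))" "bounded (range (\<lambda>n. norm (fps_nth B n * of_real t ^ n)))"
    using summable_imp_bounded by auto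
  then obtain M where M: "norm (fps_nth B n * of_real t ^ n) \<le> M" for n
    by (auto simp: bounded_iff)
  have "summable (\<lambda>n. norm (fps_nth A n * of_real t ^ n) * M)" by (intro summable_mult2 s)
  then have "summable (\<lambda>n. fps_nth (Abs_fps (\<lambda>n. fps_nth A n * fps_nth B n)) n * of_real r ^ n)"
  proof (rule summable_comparison_test'[where N = 0])
    fix n
    have "norm (fps_nth A n * fps_nth B n * of_real r ^ n) = norm (fps_nth A n * of_real t ^ n) * norm (fps_nth B n * of_real t ^ n)"
      using t(1) by (simp add: t(3)[symmetric] norm_mult norm_power power_mult_distrib)
    also have "\<dots> \<le> norm (fps_nth A n * of_real t ^ n) * M" by (intro mult_left_mono M) auto
    finally show "norm (fps_nth (Abs_fps (\<lambda>n. fps_nth A n * fps_nth B n)) n * of_real r ^ n) \<le> norm (fps_nth A n * of_real t ^ n) * M"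
      by simp
  qed
  then show "\<exists>z. norm z = r \<and> summable (\<lambda>n. fps_nth (Abs_fps (\<lambda>n. fps_nth A n * fps_nth B n)) n * z ^ n)"
    using r by (intro exI[of _ "of_real r"]) auto
qed

definition partial_sums_fps :: "(complex \<Rightarrow> complex) \<Rightarrow> complex fps" where
  "partial_sums_fps f = Abs_fps (\<lambda>n. \<Sum>k\<le>n. fps_nth (fps_expansion f 0) k)"

lemma partial_sums_fps:
  assumes f: "f holomorphic_on ball 0 1"
  shows "1 \<le> fps_conv_radius (partial_sums_fps f)"
    and "cmod z < 1 \<Longrightarrow> eval_fps (partial_sums_fps f) z = f z / (1 - z)"
proof -
  define g :: "complex fps" where "g = Abs_fps (\<lambda>_. 1)"
  have eq: "partial_sums_fps f = fps_expansion f 0 * g"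
    by (rule fps_ext) (simp add: partial_sums_fps_def g_def fps_mult_nth atLeast0AtMost)
  have 1: "1 \<le> fps_conv_radius (fps_expansion f 0)"
    using conv_radius_fps_expansion[of f 0 1] f by (simp add: one_ereal_def)
  have 2: "1 \<le> fps_conv_radius g"
    unfolding fps_conv_radius_def
  proof (rule conv_radius_geI_ex)
    fix r :: real assume "0 < r" "ereal r < 1"
    then show "\<exists>z. norm z = r \<and> summable (\<lambda>n. fps_nth g n * z ^ n)"
      by (intro exI[of _ "of_real r"]) (auto simp: g_def)
  qed
  show "1 \<le> fps_conv_radius (partial_sums_fps f)"
    unfolding eq using fps_conv_radius_mult[of "fps_expansion f 0" g] 1 2 by (meson min.boundedI order_trans)
  assume z: "cmod z < 1"
  then have z': "ereal (cmod z) < fps_conv_radius (fps_expansion f 0)" "ereal (cmod z) < fps_conv_radius g"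
    using 1 2 z by (auto intro: less_conv_radius_disc)
  have "eval_fps g z = 1 / (1 - z)" using z by (simp add: eval_fps_def g_def suminf_geometric)
  then show "eval_fps (partial_sums_fps f) z = f z / (1 - z)"
    unfolding eq using z' holomorphic_fps_ball(2)[OF f z] by (simp add: eval_fps_mult)
qed

lemma rhaly_fps_eq: "rhaly_fps \<eta> f = Abs_fps (\<lambda>n. fps_nth (Abs_fps \<eta>) n * fps_nth (partial_sums_fps f) n)"
  by (simp add: rhaly_fps_def partial_sums_fps_def)

lemma analytic_rhaly_fps:
  assumes "analytic_in_disc (Abs_fps \<eta>)" "f holomorphic_on ball 0 1"
  shows "analytic_in_disc (rhaly_fps \<eta> f)"
  using assms fps_conv_radius_hadamard partial_sums_fps(1) unfolding analytic_in_disc_def rhaly_fps_eq by blast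

lemma holomorphic_eval_fps_disc:
  assumes "analytic_in_disc A"
  shows "eval_fps A holomorphic_on ball 0 1"
proof -
  have "ball (0::complex) 1 \<subseteq> eball 0 (fps_conv_radius A)"
    using assms by (auto simp: analytic_in_disc_def in_eball_iff intro!: less_conv_radius_disc)
  then show ?thesis by (rule holomorphic_on_eval_fps)
qed

definition euler_op :: "(complex \<Rightarrow> complex) \<Rightarrow> complex \<Rightarrow> complex" where
  "euler_op f z = z * deriv f z"

lemma holomorphic_euler_op:
  assumes "f holomorphic_on ball 0 1"
  shows "euler_op f holomorphic_on ball 0 1"
  unfolding euler_op_def using assms by (intro holomorphic_intros) auto

lemma euler_op_eval_fps:
  assumes "analytic_in_disc A" "cmod z < 1"
  shows "euler_op (eval_fps A) z = eval_fps (Abs_fps (\<lambda>n. of_nat n * fps_nth A n)) z"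
proof -
  have z: "ereal (cmod z) < fps_conv_radius A"
    using assms by (intro less_conv_radius_disc) (auto simp: analytic_in_disc_def)
  have eq: "Abs_fps (\<lambda>n. of_nat n * fps_nth A n) = fps_X * fps_deriv A"
  proof (rule fps_ext)
    fix n show "fps_nth (Abs_fps (\<lambda>n. of_nat n * fps_nth A n)) n = fps_nth (fps_X * fps_deriv A) n"
      by (cases n) auto
  qed
  have "deriv (eval_fps A) z = eval_fps (fps_deriv A) z"
    by (rule DERIV_imp_deriv, rule has_field_derivative_eval_fps[OF z])
  then show ?thesis
    unfolding euler_op_def eq using z fps_conv_radius_deriv[of A]
    by (subst eval_fps_mult) (auto intro: less_le_trans[OF z])
qed

text \<open>Hadamard product with the series of coefficients \<open>n\<close>, whose radius of
  convergence is at least 1.\<close>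

lemma analytic_euler:
  assumes "analytic_in_disc (Abs_fps \<eta>)"
  shows "analytic_in_disc (Abs_fps (\<lambda>n. of_nat n * \<eta> n))"
proof -
  have "1 \<le> fps_conv_radius (Abs_fps (\<lambda>n. of_nat n) :: complex fps)"
    unfolding fps_conv_radius_def
  proof (rule conv_radius_geI_ex)
    fix r :: real assume r: "0 < r" "ereal r < 1"
    have "summable (\<lambda>n. of_nat (Suc n) * (of_real r :: complex) ^ n)"
      using geometric_deriv_sums[of "of_real r :: complex"] r by (simp add: sums_iff)
    from summable_mult2[OF this, of "of_real r"]
    have "summable (\<lambda>n. of_nat (Suc n) * (of_real r :: complex) ^ Suc n)" by (simp add: mult_ac)
    then have "summable (\<lambda>n. of_nat n * (of_real r :: complex) ^ n)" by (subst (asm) summable_Suc_iff)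
    then show "\<exists>z. norm z = r \<and> summable (\<lambda>n. fps_nth (Abs_fps (\<lambda>n. of_nat n) :: complex fps) n * z ^ n)"
      using r by (intro exI[of _ "of_real r"]) auto
  qed
  from fps_conv_radius_hadamard[OF this, of "Abs_fps \<eta>"] assms show ?thesis by (simp add: analytic_in_disc_def)
qed

text \<open>The Euler operator multiplies coefficients by their index, so on a Hadamard product it
  may be charged to the symbol alone; this brings the bound on \<open>F'\<close> into play while
  \<open>f\<close> is not differentiated.\<close>

lemma euler_op_rhaly:
  assumes "analytic_in_disc (Abs_fps \<eta>)" "f holomorphic_on ball 0 1" "cmod z < 1"
  shows "euler_op (rhaly \<eta> f) z = rhaly (\<lambda>n. of_nat n * \<eta> n) f z"
  unfolding rhaly_def using euler_op_eval_fps[OF analytic_rhaly_fps[OF assms(1,2)] assms(3)]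
  by (simp add: rhaly_fps_def mult.assoc)

lemma euler_op_symbol:
  assumes "analytic_in_disc (Abs_fps \<eta>)" "cmod z < 1"
  shows "euler_op (symbol_fun \<eta>) z = symbol_fun (\<lambda>n. of_nat n * \<eta> n) z"
  unfolding symbol_fun_def using euler_op_eval_fps[OF assms] by simp

lemma rhaly_integral:
  assumes \<eta>: "analytic_in_disc (Abs_fps \<eta>)" and f: "f holomorphic_on ball 0 1" and \<rho>: "0 \<le> \<rho>" "\<rho> < 1"
  shows "rhaly \<eta> f (of_real (\<rho>\<^sup>2) * cis \<theta>) =
    (LINT t|circ. symbol_fun \<eta> (of_real \<rho> * cis (\<theta> - t)) * (f (of_real \<rho> * cis t) / (1 - of_real \<rho> * cis t)))"
proof -
  have s: "summable (\<lambda>n. norm (fps_nth A n) * \<rho> ^ n)" if "1 \<le> fps_conv_radius A" for A :: "complex fps"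
  proof -
    have "ereal (cmod (of_real \<rho>)) < fps_conv_radius A" by (rule less_conv_radius_disc[OF that]) (use \<rho> in auto)
    from norm_summable_fps[OF this] show ?thesis using \<rho> by (simp add: norm_mult norm_power)
  qed
  have "(LINT t|circ. symbol_fun \<eta> (of_real \<rho> * cis (\<theta> - t)) * (f (of_real \<rho> * cis t) / (1 - of_real \<rho> * cis t))) =
    (LINT t|circ. eval_fps (Abs_fps \<eta>) (of_real \<rho> * cis (\<theta> - t)) * eval_fps (partial_sums_fps f) (of_real \<rho> * cis t))"
    using \<rho> by (simp add: symbol_fun_def partial_sums_fps(2)[OF f] norm_mult)
  also have "\<dots> = (\<Sum>n. fps_nth (partial_sums_fps f) n * fps_nth (Abs_fps \<eta>) n * (of_real (\<rho>\<^sup>2) * cis \<theta>) ^ n)"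
    unfolding eval_fps_def using \<eta>
    by (intro hadamard_formula s partial_sums_fps(1)[OF f] \<rho>) (auto simp: analytic_in_disc_def)
  finally show ?thesis by (simp add: rhaly_def rhaly_fps_eq eval_fps_def mult.commute)
qed

lemma norm_rhaly_le:
  assumes \<eta>: "analytic_in_disc (Abs_fps \<eta>)" and f: "f holomorphic_on ball 0 1" and \<rho>: "0 \<le> \<rho>" "\<rho> < 1"
  shows "ennreal (cmod (rhaly \<eta> f (of_real (\<rho>\<^sup>2) * cis \<theta>))) \<le>
    (\<integral>\<^sup>+t. ennreal (cmod (f (of_real \<rho> * cis t)) / cmod (1 - of_real \<rho> * cis t) *
       cmod (symbol_fun \<eta> (of_real \<rho> * cis (\<theta> - t)))) \<partial>circ)"
proof -
  define u where "u t = symbol_fun \<eta> (of_real \<rho> * cis (\<theta> - t)) * (f (of_real \<rho> * cis t) / (1 - of_real \<rho> * cis t))" for t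
  have sh: "symbol_fun \<eta> holomorphic_on ball 0 1"
    unfolding symbol_fun_def by (rule holomorphic_eval_fps_disc[OF \<eta>])
  have "continuous_on UNIV u" unfolding u_def
    using one_minus_cis_nonzero[OF \<rho>] \<rho>
    by (intro continuous_intros continuous_on_circle_radius holomorphic_on_imp_continuous_on f sh
        continuous_on_compose2[OF holomorphic_on_imp_continuous_on[OF sh]]) (auto simp: norm_mult)
  then have "ennreal (cmod (LINT t|circ. u t)) \<le> (\<integral>\<^sup>+t. norm (u t) \<partial>circ)"
    by (intro integral_norm_bound_ennreal integrable_circ_continuous)
  then show ?thesis
    unfolding rhaly_integral[OF \<eta> f \<rho>] u_def by (simp add: norm_mult norm_divide mult_ac)
qed

lemma symbol_measurable:
  assumes \<eta>: "analytic_in_disc (Abs_fps \<eta>)" and \<rho>: "0 \<le> \<rho>" "\<rho> < 1"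
  shows "(\<lambda>\<theta>. cmod (symbol_fun \<eta> (of_real \<rho> * cis \<theta>))) \<in> borel_measurable borel"
proof -
  have sh: "symbol_fun \<eta> holomorphic_on ball 0 1"
    unfolding symbol_fun_def by (rule holomorphic_eval_fps_disc[OF \<eta>])
  show ?thesis using \<rho>
    by (intro borel_measurable_continuous_onI continuous_intros continuous_on_circle_radius
        holomorphic_on_imp_continuous_on[OF sh])
qed

lemma quotient_measurable:
  assumes f: "f holomorphic_on ball 0 1" and \<rho>: "0 \<le> \<rho>" "\<rho> < 1"
  shows "(\<lambda>t. cmod (f (of_real \<rho> * cis t)) / cmod (1 - of_real \<rho> * cis t)) \<in> borel_measurable borel"
  by (intro borel_measurable_continuous_onI continuous_on_circle_radius[OF continuous_on_quotient_ball[OF f] \<rho>])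

text \<open>Stated for any nonnegative \<open>v\<close> below the convolution of moduli, because it
  is applied both to the modulus of \<open>rhaly\<close> and to the positive convolution that
  majorises it.\<close>

lemma Lp_le_rhaly_convolution:
  assumes \<eta>: "analytic_in_disc (Abs_fps \<eta>)" and f: "f holomorphic_on ball 0 1" and \<rho>: "0 \<le> \<rho>" "\<rho> < 1"
    and p: "1 < p" and m: "Lp_le p (\<lambda>\<theta>. symbol_fun \<eta> (of_real \<rho> * cis \<theta>)) m"
    and v: "\<And>\<theta>. 0 \<le> v \<theta>" "\<And>\<theta>. ennreal (v \<theta>) \<le> (\<integral>\<^sup>+t. ennreal (cmod (f (of_real \<rho> * cis t)) / cmod (1 - of_real \<rho> * cis t) *
       cmod (symbol_fun \<eta> (of_real \<rho> * cis (\<theta> - t)))) \<partial>circ)"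
  shows "Lp_le p v (m * cesaro_mean f \<rho>)"
proof (rule young_convolution[where u = "\<lambda>\<theta>. cmod (symbol_fun \<eta> (of_real \<rho> * cis \<theta>))" and c = "-1"
      and g = "\<lambda>t. cmod (f (of_real \<rho> * cis t)) / cmod (1 - of_real \<rho> * cis t)", OF p])
  show "(\<integral>\<^sup>+t. ennreal (cmod (f (of_real \<rho> * cis t)) / cmod (1 - of_real \<rho> * cis t)) \<partial>circ) \<le> ennreal (cesaro_mean f \<rho>)"
    by (simp add: ennreal_cesaro_mean[OF f \<rho>])
qed (use v m in \<open>auto simp: Lp_le_norm_iff circle_periodic cesaro_mean_nonneg symbol_measurable[OF \<eta> \<rho>] quotient_measurable[OF f \<rho>]
    circle_periodic[where g = "\<lambda>w. symbol_fun \<eta> (of_real \<rho> * w)"]\<close>)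

lemma Lp_le_rhaly:
  assumes \<eta>: "analytic_in_disc (Abs_fps \<eta>)" and f: "f holomorphic_on ball 0 1" and \<rho>: "0 \<le> \<rho>" "\<rho> < 1"
    and p: "1 < p" and m: "Lp_le p (\<lambda>\<theta>. symbol_fun \<eta> (of_real \<rho> * cis \<theta>)) m"
  shows "Lp_le p (\<lambda>\<theta>. rhaly \<eta> f (of_real (\<rho>\<^sup>2) * cis \<theta>)) (m * cesaro_mean f \<rho>)"
proof -
  have "Lp_le p (\<lambda>\<theta>. cmod (rhaly \<eta> f (of_real (\<rho>\<^sup>2) * cis \<theta>))) (m * cesaro_mean f \<rho>)"
    by (rule Lp_le_rhaly_convolution[OF \<eta> f \<rho> p m]) (use norm_rhaly_le[OF \<eta> f \<rho>] in auto)
  then show ?thesis by (simp add: Lp_le_norm_iff)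
qed

text \<open>The uniform counterpart of \<open>Lp_le_rhaly\<close>, meant for the fixed small radius
  at which the radial integrations start.\<close>

lemma norm_rhaly_le_sup:
  assumes \<eta>: "analytic_in_disc (Abs_fps \<eta>)" and f: "f holomorphic_on ball 0 1" and \<rho>: "0 \<le> \<rho>" "\<rho> < 1"
    and m: "\<And>\<theta>. cmod (symbol_fun \<eta> (of_real \<rho> * cis \<theta>)) \<le> m" "0 \<le> m"
  shows "cmod (rhaly \<eta> f (of_real (\<rho>\<^sup>2) * cis \<theta>)) \<le> m * cesaro_mean f \<rho>"
proof -
  define g where "g t = cmod (f (of_real \<rho> * cis t)) / cmod (1 - of_real \<rho> * cis t)" for t
  have [measurable]: "g \<in> borel_measurable borel" unfolding g_def by (rule quotient_measurable[OF f \<rho>])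
  have "ennreal (cmod (rhaly \<eta> f (of_real (\<rho>\<^sup>2) * cis \<theta>))) \<le> (\<integral>\<^sup>+t. ennreal (g t * m) \<partial>circ)"
    by (rule order_trans[OF norm_rhaly_le[OF \<eta> f \<rho>]])
       (unfold g_def, intro nn_integral_mono ennreal_leI mult_left_mono m, simp)
  also have "\<dots> = (\<integral>\<^sup>+t. ennreal m * ennreal (g t) \<partial>circ)"
    using m by (intro nn_integral_cong) (simp add: ennreal_mult[symmetric] g_def mult.commute)
  also have "\<dots> = ennreal m * (\<integral>\<^sup>+t. ennreal (g t) \<partial>circ)" by (rule nn_integral_cmult) measurable
  also have "\<dots> = ennreal (m * cesaro_mean f \<rho>)"
    unfolding g_def using m by (simp add: ennreal_cesaro_mean[OF f \<rho>, symmetric] ennreal_mult cesaro_mean_nonneg)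
  finally show ?thesis using m cesaro_mean_nonneg[of f \<rho>] by (simp add: ennreal_le_iff)
qed

lemma bounded_circle_function:
  fixes u :: "complex \<Rightarrow> 'a::real_normed_vector"
  assumes "continuous_on (sphere 0 1) u"
  obtains B where "0 < B" "\<And>t. norm (u (cis t)) \<le> B"
proof -
  have "bounded (u ` sphere 0 1)" using assms by (intro compact_imp_bounded compact_continuous_image) auto
  then obtain B where "0 < B" "\<And>x. x \<in> u ` sphere 0 1 \<Longrightarrow> norm x \<le> B" by (auto simp: bounded_pos)
  then show ?thesis using that by auto
qed

lemma continuous_on_circle_function:
  fixes u :: "complex \<Rightarrow> 'a::topological_space"
  assumes "continuous_on (sphere 0 1) u" "continuous_on S f"
  shows "continuous_on S (\<lambda>x. u (cis (f x)))"
  by (rule continuous_on_compose2[OF assms(1)]) (auto intro!: continuous_intros assms)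

section \<open>Boundedness for \<open>p \<le> 2\<close>\<close>

text \<open>The kernel has mean zero, so it can be moved onto the \<open>(p - 1)\<close>-Hoelder function \<open>pgrad p \<circ> H\<close>.\<close>

lemma pgrad_duality:
  fixes p :: real
  assumes p: "1 < p" "p \<le> 2"
  obtains C where "0 < C"
    "\<And>(H :: complex \<Rightarrow> complex) g R s m X. continuous_on (sphere 0 1) H \<Longrightarrow> g holomorphic_on ball 0 R \<Longrightarrow> 1 < R \<Longrightarrow> 0 \<le> s \<Longrightarrow> s < 1 \<Longrightarrow>
       Lp_le p (\<lambda>\<theta>. g (cis \<theta>)) m \<Longrightarrow> 0 \<le> X \<Longrightarrow>
       (\<And>\<tau>. Lp_le p (\<lambda>\<theta>. H (cis (\<theta> + \<tau>)) - H (cis \<theta>)) (\<bar>\<tau>\<bar> * X)) \<Longrightarrow>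
       cmod (LINT \<theta>|circ. pgrad p (H (cis \<theta>)) * (cis \<theta> * deriv g (of_real s * cis \<theta>)))
         \<le> C * X powr (p - 1) * m * (1 - s) powr (p - 2)"
proof -
  obtain C where C: "0 < C" "\<And>s. 0 \<le> s \<Longrightarrow> s < 1 \<Longrightarrow>
      (\<integral>\<^sup>+\<tau>. ennreal (4 * (1 - s) * (\<bar>\<tau>\<bar> / cmod (1 - of_real s * cis \<tau>) powr 4) * \<bar>\<tau>\<bar> powr (p - 1)) \<partial>circ)
        \<le> ennreal (C * (1 - s) powr (p - 1 - 1))"
    using deriv_kernel_moment[of "p - 1"] p by auto
  show ?thesis
  proof (rule that[of "2 * C"])
    show "0 < 2 * C" using C by simp
    fix H :: "complex \<Rightarrow> complex" and g R s m X assume H: "continuous_on (sphere 0 1) H" and g: "g holomorphic_on ball 0 R" "1 < R"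
      and s: "0 \<le> s" "s < (1::real)" and m: "Lp_le p (\<lambda>\<theta>. g (cis \<theta>)) m" and X: "0 \<le> X"
      and mod: "\<And>\<tau>. Lp_le p (\<lambda>\<theta>. H (cis (\<theta> + \<tau>)) - H (cis \<theta>)) (\<bar>\<tau>\<bar> * X)"
    define V where "V w = pgrad p (H w)" for w
    have Vc: "continuous_on (sphere 0 1) V" unfolding V_def
      by (rule continuous_on_compose2[OF continuous_on_pgrad[OF p] H subset_UNIV])
    have gc: "continuous_on (sphere 0 1) g"
      by (rule continuous_on_subset[OF holomorphic_on_imp_continuous_on[OF g(1)]]) (use g in auto)
    have kcont: "continuous_on A (deriv_kernel s)" for A by (rule continuous_on_deriv_kernel[OF s])
    define k0 where "k0 w = - 2 * \<i> * of_real ((1 - s\<^sup>2) * Im w / cmod (1 - of_real s * w) ^ 4)" for w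
    have k0: "deriv_kernel s \<tau> = k0 (cis \<tau>)" for \<tau> by (simp add: deriv_kernel_def k0_def)
    have "1 - of_real s * w \<noteq> 0" if "w \<in> sphere 0 1" for w :: complex
    proof
      assume "1 - of_real s * w = 0"
      then have "cmod (of_real s * w) = 1" by (metis eq_iff_diff_eq_0 norm_one)
      then show False using s that by (simp add: norm_mult)
    qed
    then have k0c: "continuous_on (sphere 0 1) k0" unfolding k0_def by (intro continuous_intros) auto
    obtain B1 where B1: "0 < B1" "\<And>t. norm (V (cis t)) \<le> B1" using bounded_circle_function[OF Vc] by metis
    obtain B2 where B2: "0 < B2" "\<And>t. norm (g (cis t)) \<le> B2" using bounded_circle_function[OF gc] by metis
    obtain B3 where B3: "0 < B3" "\<And>t. norm (deriv_kernel s t) \<le> B3" using bounded_circle_function[OF k0c] unfolding k0 by metis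
    \<comment> \<open>In \<Phi> the translation has been moved from \<open>g\<close> to
      \<open>V\<close>, so that its dependence on \<tau> is governed by the Hoelder continuity of
      \<open>pgrad p\<close>, and \<open>g\<close> enters through its norm only.\<close>
    define \<Phi> where "\<Phi> \<tau> = (LINT \<theta>|circ. V (cis (\<theta> - \<tau>)) * g (cis \<theta>))" for \<tau>
    have conts [continuous_intros]: "continuous_on A (\<lambda>x. V (cis (l x)))" "continuous_on A (\<lambda>x. g (cis (l x)))"
      if "continuous_on A l" for A :: "'z::topological_space set" and l
      by (intro continuous_on_circle_function Vc gc that)+
    have m': "(\<lambda>(\<theta>, \<tau>). V (cis \<theta>) * g (cis (\<theta> + \<tau>)) * deriv_kernel s \<tau>) \<in> borel_measurable (borel \<Otimes>\<^sub>M borel)"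
      unfolding borel_prod split_beta
      by (intro borel_measurable_continuous_onI continuous_intros continuous_on_compose2[OF kcont[of UNIV]]) auto
    have b': "norm (V (cis \<theta>) * g (cis (\<theta> + \<tau>)) * deriv_kernel s \<tau>) \<le> B1 * B2 * B3" for \<theta> \<tau>
      unfolding norm_mult using B1 B2 B3 by (intro mult_mono) (auto intro: mult_nonneg_nonneg less_imp_le)
    note fub = fubini_bounded[OF circ.finite_measure_axioms circ.finite_measure_axioms sets_circ sets_circ m' b']
    have inner: "(LINT \<theta>|circ. V (cis \<theta>) * g (cis (\<theta> + \<tau>)) * deriv_kernel s \<tau>) = \<Phi> \<tau> * deriv_kernel s \<tau>" for \<tau>
    proof -
      have "(LINT \<theta>|circ. V (cis \<theta>) * g (cis (\<theta> + \<tau>))) = (LINT \<theta>|circ. V (cis (\<theta> - \<tau>)) * g (cis (\<theta> - \<tau> + \<tau>)))"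
      proof -
        have "cis (x + 2 * pi) = cis x" "cis (x + 2 * pi + \<tau>) = cis (x + \<tau>)" for x
          by (simp_all add: cis_mult[symmetric])
        then have per: "V (cis (x + 2 * pi)) * g (cis (x + 2 * pi + \<tau>)) = V (cis x) * g (cis (x + \<tau>))" for x
          by simp
        have "continuous_on UNIV (\<lambda>\<theta>. V (cis \<theta>) * g (cis (\<theta> + \<tau>)))"
          by (intro continuous_intros)
        from integral_circ_shift[OF this per, of "- \<tau>"] show ?thesis by simp
      qed
      then show ?thesis by (simp add: \<Phi>_def)
    qed
    have "(LINT \<theta>|circ. pgrad p (H (cis \<theta>)) * (cis \<theta> * deriv g (of_real s * cis \<theta>))) =
      (LINT \<theta>|circ. LINT \<tau>|circ. V (cis \<theta>) * g (cis (\<theta> + \<tau>)) * deriv_kernel s \<tau>)"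
      by (simp add: deriv_formula_holomorphic[OF g s, symmetric] V_def mult.assoc)
    also have "\<dots> = (LINT \<tau>|circ. \<Phi> \<tau> * deriv_kernel s \<tau>)"
      unfolding fub(1) inner ..
    also have "\<dots> = (LINT \<tau>|circ. (\<Phi> \<tau> - \<Phi> 0) * deriv_kernel s \<tau>)"
    proof -
      have "integrable circ (\<lambda>\<tau>. \<Phi> \<tau> * deriv_kernel s \<tau>)" using fub(3) unfolding inner .
      moreover have "integrable circ (\<lambda>\<tau>. \<Phi> 0 * deriv_kernel s \<tau>)"
        by (intro integrable_mult_right integrable_circ_continuous kcont)
      ultimately show ?thesis
        by (simp add: left_diff_distrib integral_deriv_kernel[OF s])
    qed
    finally have eq: "(LINT \<theta>|circ. pgrad p (H (cis \<theta>)) * (cis \<theta> * deriv g (of_real s * cis \<theta>))) =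
      (LINT \<tau>|circ. (\<Phi> \<tau> - \<Phi> 0) * deriv_kernel s \<tau>)" .
    have m0: "0 \<le> m" using m by (simp add: Lp_le_def)
    have \<Phi>: "cmod (\<Phi> \<tau> - \<Phi> 0) \<le> m * (2 * (\<bar>\<tau>\<bar> * X) powr (p - 1))" for \<tau>
    proof -
      \<comment> \<open>\<open>q\<close> is conjugate to \<open>p\<close> and
        \<open>(p - 1) * q = p\<close>: the \<open>q\<close>-th power of an increment of
        \<open>V\<close> is controlled by the \<open>p\<close>-th power of the increment of
        \<open>H\<close>.\<close>
      define q where "q = p / (p - 1)"
      have pq: "1 / p + 1 / q = 1" "0 < q" "(p - 1) * q = p" using p by (auto simp: q_def field_simps)
      have "\<Phi> \<tau> - \<Phi> 0 = (LINT \<theta>|circ. (V (cis (\<theta> - \<tau>)) - V (cis \<theta>)) * g (cis \<theta>))"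
        unfolding \<Phi>_def left_diff_distrib
        by (subst Bochner_Integration.integral_diff) (auto intro!: integrable_circ_continuous continuous_intros)
      also have "ennreal (cmod \<dots>) \<le> (\<integral>\<^sup>+\<theta>. norm ((V (cis (\<theta> - \<tau>)) - V (cis \<theta>)) * g (cis \<theta>)) \<partial>circ)"
        by (intro integral_norm_bound_ennreal integrable_circ_continuous continuous_intros)
      also have "\<dots> = (\<integral>\<^sup>+\<theta>. ennreal (cmod (g (cis \<theta>)) * cmod (V (cis (\<theta> - \<tau>)) - V (cis \<theta>))) \<partial>circ)"
        by (simp add: norm_mult mult.commute)
      also have "\<dots> \<le> ennreal (m * (2 * (\<bar>\<tau>\<bar> * X) powr (p - 1)))"
      proof (rule nn_holder[OF p(1) pq(1)])
        show "(\<integral>\<^sup>+\<theta>. ennreal (cmod (g (cis \<theta>)) powr p) \<partial>circ) \<le> ennreal (m powr p)"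
          using m by (simp add: Lp_le_def)
        have "(\<integral>\<^sup>+\<theta>. ennreal (cmod (V (cis (\<theta> - \<tau>)) - V (cis \<theta>)) powr q) \<partial>circ) \<le>
          (\<integral>\<^sup>+\<theta>. ennreal (2 powr q) * ennreal (cmod (H (cis (\<theta> + - \<tau>)) - H (cis \<theta>)) powr p) \<partial>circ)"
        proof (intro nn_integral_mono)
          fix \<theta>
          have "cmod (V (cis (\<theta> - \<tau>)) - V (cis \<theta>)) powr q \<le> (2 * cmod (H (cis (\<theta> - \<tau>)) - H (cis \<theta>)) powr (p - 1)) powr q"
            unfolding V_def using pq by (intro powr_mono2 pgrad_holder[OF p]) auto
          also have "\<dots> = 2 powr q * cmod (H (cis (\<theta> + - \<tau>)) - H (cis \<theta>)) powr p"
            using pq by (simp add: powr_mult powr_powr)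
          finally show "ennreal (cmod (V (cis (\<theta> - \<tau>)) - V (cis \<theta>)) powr q) \<le>
            ennreal (2 powr q) * ennreal (cmod (H (cis (\<theta> + - \<tau>)) - H (cis \<theta>)) powr p)"
            by (simp add: ennreal_mult[symmetric] ennreal_leI)
        qed
        also have "\<dots> = ennreal (2 powr q) * (\<integral>\<^sup>+\<theta>. ennreal (cmod (H (cis (\<theta> + - \<tau>)) - H (cis \<theta>)) powr p) \<partial>circ)"
        proof -
          have [measurable]: "(\<lambda>\<theta>. H (cis (\<theta> + - \<tau>))) \<in> borel_measurable borel"
              "(\<lambda>\<theta>. H (cis \<theta>)) \<in> borel_measurable borel"
            by (intro borel_measurable_continuous_onI continuous_on_circle_function[OF H] continuous_intros)+
          show ?thesis by (rule nn_integral_cmult) measurable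
        qed
        also have "\<dots> \<le> ennreal (2 powr q) * ennreal ((\<bar>\<tau>\<bar> * X) powr p)"
          using mod[of "- \<tau>"] by (intro mult_left_mono) (auto simp: Lp_le_def)
        also have "\<dots> = ennreal ((2 * (\<bar>\<tau>\<bar> * X) powr (p - 1)) powr q)"
          using pq X by (simp add: ennreal_mult[symmetric] powr_mult powr_powr)
        finally show "(\<integral>\<^sup>+\<theta>. ennreal (cmod (V (cis (\<theta> - \<tau>)) - V (cis \<theta>)) powr q) \<partial>circ) \<le>
          ennreal ((2 * (\<bar>\<tau>\<bar> * X) powr (p - 1)) powr q)" .
        have [measurable]: "(\<lambda>\<theta>. V (cis (\<theta> - \<tau>))) \<in> borel_measurable borel"
          "(\<lambda>\<theta>. V (cis \<theta>)) \<in> borel_measurable borel" "(\<lambda>\<theta>. g (cis \<theta>)) \<in> borel_measurable borel"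
          by (intro borel_measurable_continuous_onI continuous_intros)+
        show "(\<lambda>\<theta>. cmod (g (cis \<theta>))) \<in> borel_measurable circ"
          "(\<lambda>\<theta>. cmod (V (cis (\<theta> - \<tau>)) - V (cis \<theta>))) \<in> borel_measurable circ" by measurable
      qed (auto simp: m0)
      finally show ?thesis using m0 by (simp add: ennreal_le_iff)
    qed
    \<comment> \<open>The increment of \<Phi> contributes
      \<open>\<bar>\<tau>\<bar> powr (p - 1)\<close>, so the kernel enters through its moment of
      order \<open>p - 1\<close>.\<close>
    define W0 where "W0 \<tau> = 4 * (1 - s) * (\<bar>\<tau>\<bar> / cmod (1 - of_real s * cis \<tau>) powr 4)" for \<tau>
    have W0: "norm (deriv_kernel s \<tau>) \<le> W0 \<tau>" for \<tau> using norm_deriv_kernel_le[OF s] by (simp add: W0_def)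
    have "ennreal (cmod (LINT \<tau>|circ. (\<Phi> \<tau> - \<Phi> 0) * deriv_kernel s \<tau>)) \<le>
       (\<integral>\<^sup>+\<tau>. norm ((\<Phi> \<tau> - \<Phi> 0) * deriv_kernel s \<tau>) \<partial>circ)"
      by (cases "integrable circ (\<lambda>\<tau>. (\<Phi> \<tau> - \<Phi> 0) * deriv_kernel s \<tau>)")
         (auto simp: not_integrable_integral_eq intro: integral_norm_bound_ennreal)
    also have "\<dots> \<le> (\<integral>\<^sup>+\<tau>. ennreal (m * 2 * X powr (p - 1)) * ennreal (W0 \<tau> * \<bar>\<tau>\<bar> powr (p - 1)) \<partial>circ)"
    proof (intro nn_integral_mono)
      fix \<tau>
      have "norm ((\<Phi> \<tau> - \<Phi> 0) * deriv_kernel s \<tau>) \<le> (m * (2 * (\<bar>\<tau>\<bar> * X) powr (p - 1))) * W0 \<tau>"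
        unfolding norm_mult using m0 by (intro mult_mono \<Phi> W0) auto
      also have "\<dots> = (m * 2 * X powr (p - 1)) * (W0 \<tau> * \<bar>\<tau>\<bar> powr (p - 1))"
        using X by (simp add: powr_mult mult_ac)
      finally show "ennreal (norm ((\<Phi> \<tau> - \<Phi> 0) * deriv_kernel s \<tau>)) \<le>
        ennreal (m * 2 * X powr (p - 1)) * ennreal (W0 \<tau> * \<bar>\<tau>\<bar> powr (p - 1))"
        using m0 s by (simp add: ennreal_mult[symmetric] ennreal_leI W0_def)
    qed
    also have "\<dots> = ennreal (m * 2 * X powr (p - 1)) * (\<integral>\<^sup>+\<tau>. ennreal (W0 \<tau> * \<bar>\<tau>\<bar> powr (p - 1)) \<partial>circ)"
      by (rule nn_integral_cmult) (unfold W0_def, measurable)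
    also have "\<dots> \<le> ennreal (m * 2 * X powr (p - 1)) * ennreal (C * (1 - s) powr (p - 1 - 1))"
      unfolding W0_def by (intro mult_left_mono C(2)[OF s]) auto
    also have "\<dots> = ennreal (2 * C * X powr (p - 1) * m * (1 - s) powr (p - 2))"
      using m0 C by (simp add: ennreal_mult[symmetric] mult_ac)
    finally show "cmod (LINT \<theta>|circ. pgrad p (H (cis \<theta>)) * (cis \<theta> * deriv g (of_real s * cis \<theta>)))
         \<le> 2 * C * X powr (p - 1) * m * (1 - s) powr (p - 2)"
      unfolding eq using m0 C by (simp add: ennreal_le_iff)
  qed
qed

section \<open>Angular and radial derivatives, and the smoothed dilation\<close>

lemma has_vector_derivative_cis:
  "(cis has_vector_derivative \<i> * cis t) (at t within S)"
  unfolding cis_conv_exp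
  by (rule has_vector_derivative_real_field) (auto intro!: derivative_eq_intros)

lemma has_vector_derivative_angular:
  assumes f: "f holomorphic_on ball 0 1" and r: "0 \<le> r" "r < 1"
  shows "((\<lambda>\<theta>. f (of_real r * cis \<theta>)) has_vector_derivative \<i> * euler_op f (of_real r * cis \<theta>)) (at \<theta> within S)"
proof -
  have "((\<lambda>\<theta>. of_real r * cis \<theta>) has_vector_derivative of_real r * (\<i> * cis \<theta>)) (at \<theta> within S)"
    by (intro has_vector_derivative_mult_right has_vector_derivative_cis)
  moreover have "(f has_field_derivative deriv f (of_real r * cis \<theta>)) (at (of_real r * cis \<theta>))"
    using f r by (intro holomorphic_derivI[of f "ball 0 1"]) (auto simp: norm_mult)
  ultimately have "(f \<circ> (\<lambda>\<theta>. of_real r * cis \<theta>) has_vector_derivative of_real r * (\<i> * cis \<theta>) * deriv f (of_real r * cis \<theta>)) (at \<theta> within S)"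
    by (rule field_vector_diff_chain_within[OF _ has_field_derivative_at_within])
  then show ?thesis by (simp add: o_def euler_op_def mult_ac)
qed

lemma has_vector_derivative_radial:
  assumes f: "f holomorphic_on ball 0 1" and r: "0 < r" "r < 1" and w: "cmod w \<le> 1" and k: "0 < k"
  shows "((\<lambda>r. f (of_real (r ^ k) * w)) has_vector_derivative of_real (real k / r) * euler_op f (of_real (r ^ k) * w)) (at r within S)"
proof -
  have "((\<lambda>r. r ^ k) has_real_derivative real k * r ^ (k - 1)) (at r within S)"
    by (auto intro!: derivative_eq_intros)
  then have "((\<lambda>r. complex_of_real (r ^ k)) has_vector_derivative of_real (real k * r ^ (k - 1))) (at r within S)"
    by (intro has_vector_derivative_of_real) (simp add: has_real_derivative_iff_has_vector_derivative)
  then have "((\<lambda>r. of_real (r ^ k) * w) has_vector_derivative of_real (real k * r ^ (k - 1)) * w) (at r within S)"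
    by (rule has_vector_derivative_mult_left)
  moreover have "(f has_field_derivative deriv f (of_real (r ^ k) * w)) (at (of_real (r ^ k) * w))"
  proof (rule holomorphic_derivI[OF f])
    have "r ^ k < 1" using r k by (simp add: power_less_one_iff)
    then have "r ^ k * cmod w < 1" using w r by (smt (verit) mult_left_le zero_le_power)
    then show "of_real (r ^ k) * w \<in> ball 0 1" using r by (simp add: norm_mult norm_power)
  qed auto
  ultimately have 1: "(f \<circ> (\<lambda>r. of_real (r ^ k) * w) has_vector_derivative
     of_real (real k * r ^ (k - 1)) * w * deriv f (of_real (r ^ k) * w)) (at r within S)"
    by (rule field_vector_diff_chain_within[OF _ has_field_derivative_at_within])
  have 2: "real k * r ^ (k - 1) = real k / r * r ^ k"
    using r k by (cases k) auto
  show ?thesis using 1[unfolded 2] by (simp only: o_def euler_op_def of_real_mult mult_ac)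
qed

text \<open>\<open>smoothed_dilation h R\<close> is chosen so that only the second Euler derivative of \<open>h\<close> occurs in its
  radial derivative; its value at \<open>\<rho> = R\<close> is the dilation of \<open>h\<close> by \<open>R ^ 4\<close>.\<close>

definition smoothed_dilation :: "(complex \<Rightarrow> complex) \<Rightarrow> real \<Rightarrow> real \<Rightarrow> complex \<Rightarrow> complex" where
  "smoothed_dilation h R \<rho> w = h (of_real (\<rho> ^ 4) * w) + of_real (4 * ln (R / \<rho>)) * euler_op h (of_real (\<rho> ^ 4) * w)"

text \<open>The coefficient 4 of the logarithm is the exponent in \<open>\<rho> ^ 4\<close>: the
  derivative \<open>- 4 / \<rho>\<close> of the logarithmic factor then cancels the term
  \<open>4 / \<rho> * euler_op h\<close>, and the second Euler derivative is left with the factor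
  \<open>4 * 4\<close>.\<close>

lemma has_vector_derivative_smoothed_dilation:
  assumes h: "h holomorphic_on ball 0 1" and \<rho>: "0 < \<rho>" "\<rho> < 1" and R: "0 < R" and w: "cmod w \<le> 1"
  shows "((\<lambda>\<rho>. smoothed_dilation h R \<rho> w) has_vector_derivative
     of_real (16 * ln (R / \<rho>) / \<rho>) * euler_op (euler_op h) (of_real (\<rho> ^ 4) * w)) (at \<rho> within S)"
proof -
  define z where "z = of_real (\<rho> ^ 4) * w"
  have 1: "((\<lambda>\<rho>. h (of_real (\<rho> ^ 4) * w)) has_vector_derivative of_real (4 / \<rho>) * euler_op h z) (at \<rho> within S)"
    using has_vector_derivative_radial[OF h \<rho> w, of 4 S] by (simp add: z_def)
  have 2: "((\<lambda>\<rho>. euler_op h (of_real (\<rho> ^ 4) * w)) has_vector_derivative of_real (4 / \<rho>) * euler_op (euler_op h) z) (at \<rho> within S)"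
    using has_vector_derivative_radial[OF holomorphic_euler_op[OF h] \<rho> w, of 4 S] by (simp add: z_def)
  have "((\<lambda>\<rho>. 4 * ln (R / \<rho>)) has_real_derivative - 4 / \<rho>) (at \<rho> within S)"
    using \<rho> R by (auto intro!: derivative_eq_intros simp: field_simps power2_eq_square)
  then have 3: "((\<lambda>\<rho>. complex_of_real (4 * ln (R / \<rho>))) has_vector_derivative of_real (- 4 / \<rho>)) (at \<rho> within S)"
    by (intro has_vector_derivative_of_real) (simp add: has_real_derivative_iff_has_vector_derivative)
  have 4: "((\<lambda>\<rho>. smoothed_dilation h R \<rho> w) has_vector_derivative
     of_real (4 / \<rho>) * euler_op h z + (of_real (4 * ln (R / \<rho>)) * (of_real (4 / \<rho>) * euler_op (euler_op h) z) +
       of_real (- 4 / \<rho>) * euler_op h z)) (at \<rho> within S)"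
    unfolding smoothed_dilation_def
    using has_vector_derivative_add[OF 1 has_vector_derivative_mult[OF 3 2]] by (simp add: z_def)
  have 5: "of_real (4 / \<rho>) * euler_op h z + (of_real (4 * ln (R / \<rho>)) * (of_real (4 / \<rho>) * euler_op (euler_op h) z) +
       of_real (- 4 / \<rho>) * euler_op h z) = of_real (16 * ln (R / \<rho>) / \<rho>) * euler_op (euler_op h) z"
    by (simp add: algebra_simps)
  show ?thesis using 4 unfolding 5 unfolding z_def .
qed

text \<open>The logarithm is at most of the size of the distance to the boundary: it supplies the
  factor \<open>1 - \<rho>\<close> that pays for the second derivative.\<close>

lemma ln_ratio_bounds:
  assumes "1 / 2 \<le> \<rho>" "\<rho> \<le> R" "R < (1::real)"
  shows "0 \<le> ln (R / \<rho>)" "\<rho> * ln (R / \<rho>) \<le> 1 - \<rho>" "ln (R / \<rho>) \<le> 2 * (1 - \<rho>)"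
proof -
  show "0 \<le> ln (R / \<rho>)" using assms by simp
  have "ln (R / \<rho>) \<le> ln (1 / \<rho>)" using assms by (subst ln_le_cancel_iff) (auto simp: divide_right_mono)
  also have "\<dots> \<le> 1 / \<rho> - 1" using assms by (intro ln_le_minus_one) auto
  finally have *: "ln (R / \<rho>) \<le> (1 - \<rho>) / \<rho>" using assms by (simp add: field_simps)
  then show "\<rho> * ln (R / \<rho>) \<le> 1 - \<rho>" using assms by (simp add: field_simps)
  have "(1 - \<rho>) / \<rho> \<le> (1 - \<rho>) / (1 / 2)" using assms by (intro divide_left_mono) auto
  then show "ln (R / \<rho>) \<le> 2 * (1 - \<rho>)" using * by simp
qed

lemma continuous_on_smoothed_dilation:
  assumes h: "h holomorphic_on ball 0 1" and \<rho>: "0 \<le> \<rho>" "\<rho> < 1"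
  shows "continuous_on (sphere 0 1) (smoothed_dilation h R \<rho>)"
proof -
  have "\<rho> ^ 4 < 1" using \<rho> by (simp add: power_less_one_iff)
  then have img: "(\<lambda>w :: complex. of_real (\<rho> ^ 4) * w) ` sphere 0 1 \<subseteq> ball 0 1"
    using \<rho> by (auto simp: norm_mult norm_power)
  have c: "continuous_on (sphere 0 1) (\<lambda>w. f (of_real (\<rho> ^ 4) * w))" if "f holomorphic_on ball 0 1" for f
    by (rule continuous_on_compose2[OF holomorphic_on_imp_continuous_on[OF that] _ img]) (intro continuous_intros)
  show ?thesis unfolding smoothed_dilation_def[abs_def]
    by (intro continuous_intros c h holomorphic_euler_op)
qed

text \<open>With \<open>s = \<rho>^2\<close>, the corrector \<open>4 * ln (R / \<rho>)\<close> is at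
  most \<open>8 * (1 - s)\<close>, which absorbs the loss \<open>C0 / (1 - s)\<close> in
  differentiating \<open>euler_op h\<close>; hence increments of the smoothed dilation by \<tau>
  have norm at most \<open>\<bar>\<tau>\<bar> * (K * m)\<close>. \<open>pgrad_duality\<close> then
  gives a multiple of \<open>(K * m) powr (p - 1) * m * (1 - s) powr (p - 2)\<close>, and the
  logarithm in front contributes one more factor \<open>1 - \<rho>\<close>.\<close>

lemma smoothed_dilation_step:
  fixes p :: real
  assumes p: "1 < p" "p \<le> 2"
  obtains C where "0 < C"
    "\<And>h \<rho> R m. h holomorphic_on ball 0 1 \<Longrightarrow> 1 / 2 \<le> \<rho> \<Longrightarrow> \<rho> \<le> R \<Longrightarrow> R < 1 \<Longrightarrow>
       Lp_le p (\<lambda>\<theta>. euler_op h (of_real (\<rho>\<^sup>2) * cis \<theta>)) m \<Longrightarrow>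
       \<bar>LINT \<theta>|circ. p * Re (pgrad p (smoothed_dilation h R \<rho> (cis \<theta>)) *
          (of_real (16 * ln (R / \<rho>) / \<rho>) * euler_op (euler_op h) (of_real (\<rho> ^ 4) * cis \<theta>)))\<bar>
         \<le> C * ((1 - \<rho>) powr (p - 1) * m powr p)"
proof -
  obtain C0 where C0: "0 < C0"
    "\<And>g R s m. g holomorphic_on ball 0 R \<Longrightarrow> 1 < R \<Longrightarrow> 0 \<le> s \<Longrightarrow> s < 1 \<Longrightarrow> Lp_le p (\<lambda>\<theta>. g (cis \<theta>)) m \<Longrightarrow>
       Lp_le p (\<lambda>\<theta>. deriv g (of_real s * cis \<theta>)) (m * (C0 / (1 - s)))"
    using Lp_le_deriv[OF p(1)] by blast
  obtain C1 where C1: "0 < C1"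
    "\<And>(H :: complex \<Rightarrow> complex) g R s m X. continuous_on (sphere 0 1) H \<Longrightarrow> g holomorphic_on ball 0 R \<Longrightarrow> 1 < R \<Longrightarrow> 0 \<le> s \<Longrightarrow> s < 1 \<Longrightarrow>
       Lp_le p (\<lambda>\<theta>. g (cis \<theta>)) m \<Longrightarrow> 0 \<le> X \<Longrightarrow>
       (\<And>\<tau>. Lp_le p (\<lambda>\<theta>. H (cis (\<theta> + \<tau>)) - H (cis \<theta>)) (\<bar>\<tau>\<bar> * X)) \<Longrightarrow>
       cmod (LINT \<theta>|circ. pgrad p (H (cis \<theta>)) * (cis \<theta> * deriv g (of_real s * cis \<theta>)))
         \<le> C1 * X powr (p - 1) * m * (1 - s) powr (p - 2)"
    using pgrad_duality[OF p] by blast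
  \<comment> \<open>The 4 is that of \<open>Lp_le_add\<close>; 1 and \<open>8 * C0\<close> bound the
    two terms of the angular derivative of the smoothed dilation.\<close>
  define K where "K = 4 * (1 + 8 * C0)"
  have K: "0 < K" using C0 by (simp add: K_def add_pos_pos)
  show ?thesis
  proof (rule that[of "p * 16 * C1 * K powr (p - 1)"])
    show "0 < p * 16 * C1 * K powr (p - 1)" using p C1 K by simp
    fix h \<rho> R m assume h: "h holomorphic_on ball 0 1" and \<rho>: "1 / 2 \<le> \<rho>" "\<rho> \<le> R" "R < (1::real)"
      and m: "Lp_le p (\<lambda>\<theta>. euler_op h (of_real (\<rho>\<^sup>2) * cis \<theta>)) m"
    define e where "e = euler_op h"
    have e: "e holomorphic_on ball 0 1" unfolding e_def by (rule holomorphic_euler_op[OF h])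
    have ee: "euler_op e holomorphic_on ball 0 1" by (rule holomorphic_euler_op[OF e])
    define s where "s = \<rho>\<^sup>2"
    have s: "0 < s" "s < 1" "1 - \<rho> \<le> 1 - s" "s * s = \<rho> ^ 4"
    proof -
      have "\<rho> * \<rho> \<le> \<rho>" using \<rho> mult_left_mono[of \<rho> 1 \<rho>] by simp
      then show "s < 1" "1 - \<rho> \<le> 1 - s" unfolding s_def power2_eq_square using \<rho> by linarith+
      show "0 < s" "s * s = \<rho> ^ 4" using \<rho> by (auto simp: s_def power2_eq_square power4_eq_xxxx)
    qed
    have s4: "0 \<le> \<rho> ^ 4" "\<rho> ^ 4 < 1" using \<rho> by (auto simp: power_less_one_iff)
    \<comment> \<open>\<open>g\<close> represents \<open>euler_op h\<close> on the circle of radius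
      \<open>s\<close>; its derivative at radius \<open>s\<close> then sees the second Euler
      derivative at radius \<open>s * s = \<rho> ^ 4\<close>, and the gap between the two circles
      pays for the differentiation.\<close>
    define g where "g w = e (of_real s * w)" for w
    have g: "g holomorphic_on ball 0 (1 / s)" unfolding g_def
      using s by (intro holomorphic_on_compose_gen[OF _ e, unfolded o_def] holomorphic_intros)
        (auto simp: norm_mult field_simps)
    have R1: "1 < 1 / s" using s by simp
    have gm: "Lp_le p (\<lambda>\<theta>. g (cis \<theta>)) m" using m by (simp add: g_def e_def s_def)
    have m0: "0 \<le> m" using m by (simp add: Lp_le_def)
    have dg: "of_real s * (cis \<theta> * deriv g (of_real s * cis \<theta>)) = euler_op e (of_real (\<rho> ^ 4) * cis \<theta>)" for \<theta>
    proof -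
      define z where "z = of_real s * cis \<theta>"
      have "cmod (of_real s * z) < 1" using s4 s by (simp add: z_def norm_mult)
      then have "(e has_field_derivative deriv e (of_real s * z)) (at (of_real s * z))"
        by (intro holomorphic_derivI[OF e]) auto
      then have "((\<lambda>w. e (of_real s * w)) has_field_derivative deriv e (of_real s * z) * of_real s) (at z)"
        by (rule DERIV_chain2) (auto intro!: derivative_eq_intros)
      then have "deriv g z = deriv e (of_real s * z) * of_real s" unfolding g_def by (rule DERIV_imp_deriv)
      moreover have "of_real s * z = of_real (\<rho> ^ 4) * cis \<theta>" by (simp add: z_def s(4)[symmetric] mult.assoc)
      ultimately show ?thesis unfolding euler_op_def z_def[symmetric] by (simp add: z_def mult_ac)
    qed
    define L where "L = ln (R / \<rho>)"
    have L: "0 \<le> L" "\<rho> * L \<le> 1 - \<rho>" "L \<le> 2 * (1 - \<rho>)" using ln_ratio_bounds[OF \<rho>] by (auto simp: L_def)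
    define H where "H = smoothed_dilation h R \<rho>"
    have Hc: "continuous_on (sphere 0 1) H"
      unfolding H_def using \<rho> by (intro continuous_on_smoothed_dilation h) auto
    define u' where "u' \<theta> = \<i> * e (of_real (\<rho> ^ 4) * cis \<theta>) + of_real (4 * L) * (\<i> * euler_op e (of_real (\<rho> ^ 4) * cis \<theta>))" for \<theta>
    have du: "((\<lambda>\<theta>. H (cis \<theta>)) has_vector_derivative u' \<theta>) (at \<theta>)" for \<theta>
      unfolding H_def smoothed_dilation_def u'_def L_def[symmetric] e_def[symmetric]
      by (intro has_vector_derivative_add has_vector_derivative_mult_right
          has_vector_derivative_angular[OF e s4] has_vector_derivative_angular[OF h s4, folded e_def])
    have ec: "continuous_on UNIV (\<lambda>\<theta>. e (of_real (\<rho> ^ 4) * cis \<theta>))" "continuous_on UNIV (\<lambda>\<theta>. euler_op e (of_real (\<rho> ^ 4) * cis \<theta>))"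
      by (intro continuous_on_circle_radius holomorphic_on_imp_continuous_on e ee s4)+
    have u'c: "continuous_on UNIV u'" unfolding u'_def by (intro continuous_intros ec)
    have [measurable]: "(\<lambda>\<theta>. e (of_real (\<rho> ^ 4) * cis \<theta>)) \<in> borel_measurable borel"
      "(\<lambda>\<theta>. euler_op e (of_real (\<rho> ^ 4) * cis \<theta>)) \<in> borel_measurable borel"
      by (rule borel_measurable_continuous_onI[OF ec(1)], rule borel_measurable_continuous_onI[OF ec(2)])
    have dgm: "(\<lambda>\<theta>. norm (deriv g (of_real s * cis \<theta>))) \<in> borel_measurable borel"
    proof -
      have "deriv g (of_real s * cis \<theta>) = euler_op e (of_real (\<rho> ^ 4) * cis \<theta>) / (of_real s * cis \<theta>)" for \<theta>
        unfolding dg[symmetric] using s by simp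
      then have "norm (deriv g (of_real s * cis \<theta>)) = cmod (euler_op e (of_real (\<rho> ^ 4) * cis \<theta>)) / s" for \<theta>
        using s by (simp add: norm_divide norm_mult)
      then show ?thesis by (simp only:) measurable
    qed
    have "Lp_le p (\<lambda>\<theta>. g (of_real s * cis \<theta>)) m"
      by (rule Lp_le_radius_mono[OF p(1) g R1 _ _ gm]) (use s in auto)
    then have l1: "Lp_le p (\<lambda>\<theta>. e (of_real (\<rho> ^ 4) * cis \<theta>)) m"
      by (simp add: g_def s(4)[symmetric] mult.assoc)
    have l2: "Lp_le p (\<lambda>\<theta>. of_real (4 * L) * (\<i> * euler_op e (of_real (\<rho> ^ 4) * cis \<theta>))) (8 * C0 * m)"
    proof -
      have "Lp_le p (\<lambda>\<theta>. of_real (4 * L) * (\<i> * euler_op e (of_real (\<rho> ^ 4) * cis \<theta>))) (4 * L * (m * (C0 / (1 - s))))"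
      proof (rule Lp_le_cmult[OF C0(2)[OF g R1 _ _ gm, of s]])
        show "AE t in circ. cmod (of_real (4 * L) * (\<i> * euler_op e (of_real (\<rho> ^ 4) * cis t)))
          \<le> 4 * L * cmod (deriv g (of_real s * cis t))"
          unfolding dg[symmetric] using L s by (auto simp: norm_mult intro!: mult_left_mono mult_left_le_one_le)
      qed (use s L p dgm in auto)
      moreover have "4 * L * (m * (C0 / (1 - s))) \<le> 8 * C0 * m"
      proof -
        have "4 * L \<le> 4 * (2 * (1 - s))"
          by (intro mult_left_mono order_trans[OF L(3)] s(3)) auto
        then have "4 * L \<le> 8 * (1 - s)" by simp
        then have "4 * L * (m * (C0 / (1 - s))) \<le> 8 * (1 - s) * (m * (C0 / (1 - s)))"
          using m0 C0 s by (intro mult_right_mono) auto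
        also have "8 * (1 - s) * (m * (C0 / (1 - s))) = 8 * m * ((1 - s) * (C0 / (1 - s)))"
          by (simp only: mult_ac)
        also have "(1 - s) * (C0 / (1 - s)) = C0" using s(2) by simp
        also have "8 * m * C0 = 8 * C0 * m" by simp
        finally show ?thesis .
      qed
      ultimately show ?thesis using p Lp_le_mono[of p _ _ "\<lambda>\<theta>. of_real (4 * L) * (\<i> * euler_op e (of_real (\<rho> ^ 4) * cis \<theta>))"] by auto
    qed
    have lu: "Lp_le p u' (K * m)"
    proof -
      have "Lp_le p u' (4 * (m + 8 * C0 * m))"
      proof (rule Lp_le_add[OF l1 l2])
        show "AE t in circ. cmod (u' t) \<le> cmod (e (of_real (\<rho> ^ 4) * cis t)) +
           cmod (of_real (4 * L) * (\<i> * euler_op e (of_real (\<rho> ^ 4) * cis t)))"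
          unfolding u'_def by (intro AE_I2 order_trans[OF norm_triangle_ineq]) (simp add: norm_mult)
      qed (use p in simp, measurable)
      then show ?thesis by (simp add: K_def algebra_simps)
    qed
    have mod: "Lp_le p (\<lambda>\<theta>. H (cis (\<theta> + \<tau>)) - H (cis \<theta>)) (\<bar>\<tau>\<bar> * (K * m))" for \<tau>
      by (rule Lp_le_difference[OF p(1) du u'c lu]) (simp add: u'_def cis_mult[symmetric])
    define I where "I = (LINT \<theta>|circ. pgrad p (H (cis \<theta>)) * (cis \<theta> * deriv g (of_real s * cis \<theta>)))"
    have I: "cmod I \<le> C1 * (K * m) powr (p - 1) * m * (1 - s) powr (p - 2)"
      unfolding I_def by (rule C1(2)[OF Hc g R1 _ _ gm _ mod]) (use s K m0 in auto)
    define c where "c = 16 * L / \<rho>"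
    have "(LINT \<theta>|circ. p * Re (pgrad p (H (cis \<theta>)) * (of_real c * euler_op e (of_real (\<rho> ^ 4) * cis \<theta>)))) =
      (LINT \<theta>|circ. (p * (c * s)) * Re (pgrad p (H (cis \<theta>)) * (cis \<theta> * deriv g (of_real s * cis \<theta>))))"
      unfolding dg[symmetric]
      by (intro Bochner_Integration.integral_cong refl) (simp add: algebra_simps)
    also have "\<dots> = (p * (c * s)) * Re I"
    proof -
      have "integrable circ (\<lambda>\<theta>. pgrad p (H (cis \<theta>)) * (cis \<theta> * deriv g (of_real s * cis \<theta>)))"
      proof (intro integrable_circ_continuous continuous_intros)
        show "continuous_on UNIV (\<lambda>\<theta>. pgrad p (H (cis \<theta>)))"
          by (rule continuous_on_compose2[OF continuous_on_pgrad[OF p] continuous_on_circle_function[OF Hc]]) auto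
        show "continuous_on UNIV (\<lambda>\<theta>. deriv g (of_real s * cis \<theta>))"
          by (rule continuous_on_compose2[OF holomorphic_on_imp_continuous_on[OF holomorphic_deriv[OF g]]])
             (use s less_trans[OF s(2) R1] in \<open>auto intro!: continuous_intros simp: norm_mult\<close>)
      qed
      from integral_Re[OF this] show ?thesis unfolding I_def by (simp only: integral_mult_right_zero)
    qed
    finally have "\<bar>LINT \<theta>|circ. p * Re (pgrad p (H (cis \<theta>)) * (of_real c * euler_op e (of_real (\<rho> ^ 4) * cis \<theta>)))\<bar> = p * (c * s) * \<bar>Re I\<bar>"
      using p L s \<rho> by (simp add: abs_mult c_def)
    also have "\<dots> \<le> p * (16 * (1 - \<rho>)) * (C1 * (K * m) powr (p - 1) * m * (1 - \<rho>) powr (p - 2))"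
    proof -
      have "c * s = 16 * (\<rho> * L)" using \<rho> by (simp add: c_def s_def power2_eq_square)
      then have a: "c * s \<le> 16 * (1 - \<rho>)" using L by simp
      have "(1 - s) powr (p - 2) \<le> (1 - \<rho>) powr (p - 2)" using s \<rho> p by (intro powr_mono2') auto
      then have "C1 * (K * m) powr (p - 1) * m * (1 - s) powr (p - 2) \<le> C1 * (K * m) powr (p - 1) * m * (1 - \<rho>) powr (p - 2)"
        using C1 m0 by (intro mult_left_mono) auto
      then have b: "\<bar>Re I\<bar> \<le> C1 * (K * m) powr (p - 1) * m * (1 - \<rho>) powr (p - 2)"
        using I abs_Re_le_cmod[of I] by linarith
      show ?thesis by (rule mult_mono[OF mult_left_mono[OF a] b]) (use p \<rho> in auto)
    qed
    also have "\<dots> = p * 16 * C1 * K powr (p - 1) * (((1 - \<rho>) * (1 - \<rho>) powr (p - 2)) * (m powr (p - 1) * m))"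
      using K m0 by (simp add: powr_mult mult_ac)
    also have "(1 - \<rho>) * (1 - \<rho>) powr (p - 2) = (1 - \<rho>) powr (p - 1)"
      using \<rho> powr_add[of "1 - \<rho>" 1 "p - 2"] by simp
    also have "m powr (p - 1) * m = m powr p"
      using m0 powr_add[of m "p - 1" 1] by (cases "m = 0") auto
    finally show "\<bar>LINT \<theta>|circ. p * Re (pgrad p (smoothed_dilation h R \<rho> (cis \<theta>)) *
          (of_real (16 * ln (R / \<rho>) / \<rho>) * euler_op (euler_op h) (of_real (\<rho> ^ 4) * cis \<theta>)))\<bar>
         \<le> p * 16 * C1 * K powr (p - 1) * ((1 - \<rho>) powr (p - 1) * m powr p)"
      unfolding H_def c_def L_def e_def .
  qed
qed

text \<open>The derivative of the \<open>p\<close>-th power mean of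
  \<open>smoothed_dilation h R \<rho>\<close> is integrated from \<open>\<rho> = 1 / 2\<close> to
  \<open>R\<close>. At the upper end the logarithm is \<open>ln 1 = 0\<close>, leaving the plain
  dilation; at the lower end the radius is \<open>(1 / 2) ^ 4\<close>, where crude bounds are
  available.\<close>

lemma hardy_type_inequality:
  fixes p :: real
  assumes p: "1 < p" "p \<le> 2"
  obtains C where "0 < C"
    "\<And>h R m E. h holomorphic_on ball 0 1 \<Longrightarrow> 1 / 2 \<le> R \<Longrightarrow> R < 1 \<Longrightarrow> 
       (\<And>\<rho>. 1 / 2 \<le> \<rho> \<Longrightarrow> \<rho> \<le> R \<Longrightarrow> Lp_le p (\<lambda>\<theta>. euler_op h (of_real (\<rho>\<^sup>2) * cis \<theta>)) (m \<rho>)) \<Longrightarrow>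
       m \<in> borel_measurable borel \<Longrightarrow> 0 \<le> E \<Longrightarrow>
       (\<integral>\<^sup>+\<rho>. ennreal ((1 - \<rho>) powr (p - 1) * m \<rho> powr p) \<partial>ivl (1 / 2) R) \<le> ennreal E \<Longrightarrow>
       (LINT \<theta>|circ. cmod (h (of_real (R ^ 4) * cis \<theta>)) powr p) \<le>
         (LINT \<theta>|circ. cmod (smoothed_dilation h R (1 / 2) (cis \<theta>)) powr p) + C * E"
proof -
  obtain C where C: "0 < C"
    "\<And>h \<rho> R m. h holomorphic_on ball 0 1 \<Longrightarrow> 1 / 2 \<le> \<rho> \<Longrightarrow> \<rho> \<le> R \<Longrightarrow> R < 1 \<Longrightarrow>
       Lp_le p (\<lambda>\<theta>. euler_op h (of_real (\<rho>\<^sup>2) * cis \<theta>)) m \<Longrightarrow>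
       \<bar>LINT \<theta>|circ. p * Re (pgrad p (smoothed_dilation h R \<rho> (cis \<theta>)) *
          (of_real (16 * ln (R / \<rho>) / \<rho>) * euler_op (euler_op h) (of_real (\<rho> ^ 4) * cis \<theta>)))\<bar>
         \<le> C * ((1 - \<rho>) powr (p - 1) * m powr p)"
    using smoothed_dilation_step[OF p] by blast
  show ?thesis
  proof (rule that[OF C(1)])
    fix h R m E assume h: "h holomorphic_on ball 0 1" and R: "1 / 2 \<le> R" "R < (1::real)"
      and m: "\<And>\<rho>. 1 / 2 \<le> \<rho> \<Longrightarrow> \<rho> \<le> R \<Longrightarrow> Lp_le p (\<lambda>\<theta>. euler_op h (of_real (\<rho>\<^sup>2) * cis \<theta>)) (m \<rho>)"
      and [measurable]: "m \<in> borel_measurable borel" and E0: "0 \<le> E"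
      and E: "(\<integral>\<^sup>+\<rho>. ennreal ((1 - \<rho>) powr (p - 1) * m \<rho> powr p) \<partial>ivl (1 / 2) R) \<le> ennreal E"
    define \<psi> where "\<psi> \<rho> w = p * Re (pgrad p (smoothed_dilation h R \<rho> w) *
          (of_real (16 * ln (R / \<rho>) / \<rho>) * euler_op (euler_op h) (of_real (\<rho> ^ 4) * w)))" for \<rho> w
    have c1: "continuous_on ({1/2..R} \<times> sphere 0 1) (\<lambda>x. f (of_real (fst x ^ 4) * snd x))"
      if "f holomorphic_on ball 0 1" for f
    proof (rule continuous_on_compose2[OF holomorphic_on_imp_continuous_on[OF that]])
      show "(\<lambda>x. complex_of_real (fst x ^ 4) * snd x) ` ({1/2..R} \<times> sphere 0 1) \<subseteq> ball 0 1"
        using R by (auto simp: norm_mult norm_power power_less_one_iff)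
    qed (intro continuous_intros)
    have c2: "continuous_on ({1/2..R} \<times> (sphere 0 1 :: complex set)) (\<lambda>x. complex_of_real (a * ln (R / fst x)))" for a
      using R by (intro continuous_intros) auto
    have c3: "continuous_on ({1/2..R} \<times> sphere 0 1) (\<lambda>x. smoothed_dilation h R (fst x) (snd x))"
      unfolding smoothed_dilation_def by (intro continuous_intros c1 c2 h holomorphic_euler_op)
    have \<psi>c: "continuous_on ({1/2..R} \<times> sphere 0 1) (\<lambda>x. \<psi> (fst x) (snd x))"
      unfolding \<psi>_def of_real_divide
      using R by (intro continuous_intros continuous_on_compose2[OF continuous_on_pgrad[OF p] c3] c1 c2 holomorphic_euler_op h) auto
    obtain B where B: "\<And>x. x \<in> {1/2..R} \<times> sphere 0 1 \<Longrightarrow> norm (\<psi> (fst x) (snd x)) \<le> B"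
    proof -
      have "bounded ((\<lambda>x. \<psi> (fst x) (snd x)) ` ({1/2..R} \<times> sphere 0 1))"
        by (intro compact_imp_bounded compact_continuous_image \<psi>c compact_Times) auto
      then have "\<exists>B. \<forall>x\<in>{1/2..R} \<times> sphere 0 1. norm (\<psi> (fst x) (snd x)) \<le> B"
        unfolding bounded_iff by blast
      then show ?thesis using that by blast
    qed
    \<comment> \<open>Clamping the radius extends the integrand continuously and boundedly to the
      whole line, on which the measure \<open>ivl\<close> is defined; on \<open>{1/2..R}\<close>
      nothing changes.\<close>
    define cl where "cl \<rho> = max (1 / 2) (min R \<rho>)" for \<rho>
    have cl: "cl \<rho> \<in> {1/2..R}" for \<rho> using R by (auto simp: cl_def)
    have clid: "cl \<rho> = \<rho>" if "1 / 2 \<le> \<rho>" "\<rho> \<le> R" for \<rho> using that by (simp add: cl_def)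
    have jc: "continuous_on UNIV (\<lambda>x. \<psi> (cl (fst x)) (cis (snd x)))"
    proof -
      have "continuous_on UNIV (\<lambda>x :: real \<times> real. (cl (fst x), cis (snd x)))"
        unfolding cl_def by (intro continuous_intros)
      moreover have "(\<lambda>x :: real \<times> real. (cl (fst x), cis (snd x))) ` UNIV \<subseteq> {1/2..R} \<times> sphere 0 1"
        using cl by (auto simp del: atLeastAtMost_iff)
      ultimately show ?thesis using continuous_on_compose2[OF \<psi>c] by fastforce
    qed
    have jm: "(\<lambda>(\<rho>, \<theta>). \<psi> (cl \<rho>) (cis \<theta>)) \<in> borel_measurable (borel \<Otimes>\<^sub>M borel)"
      unfolding borel_prod split_beta by (rule borel_measurable_continuous_onI[OF jc])
    have jb: "norm (\<psi> (cl \<rho>) (cis \<theta>)) \<le> B" for \<rho> \<theta>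
      using B[of "(cl \<rho>, cis \<theta>)"] cl by auto
    note fub = fubini_bounded[OF finite_measure_ivl[of "1/2" R] circ.finite_measure_axioms sets_ivl sets_circ jm jb]
    define \<Theta> where "\<Theta> \<rho> \<theta> = cmod (smoothed_dilation h R \<rho> (cis \<theta>)) powr p" for \<rho> \<theta>
    have ftc: "(LINT \<rho>|ivl (1/2) R. \<psi> (cl \<rho>) (cis \<theta>)) = \<Theta> R \<theta> - \<Theta> (1 / 2) \<theta>" for \<theta>
    proof -
      have cc: "continuous_on {1/2..R} (\<lambda>\<rho>. \<psi> \<rho> (cis \<theta>))"
      proof -
        have a: "continuous_on {1/2..R} (\<lambda>\<rho>. (\<rho>, cis \<theta>))" by (intro continuous_intros)
        have b: "(\<lambda>\<rho>. (\<rho>, cis \<theta>)) ` {1/2..R} \<subseteq> {1/2..R} \<times> sphere 0 1" by auto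
        from continuous_on_compose2[OF \<psi>c a b] show ?thesis by simp
      qed
      have cc': "(\<lambda>\<rho>. \<psi> (cl \<rho>) (cis \<theta>)) \<in> borel_measurable borel"
      proof (rule borel_measurable_continuous_onI)
        have "continuous_on UNIV (\<lambda>\<rho>. (\<rho>, \<theta>))" by (intro continuous_intros)
        from continuous_on_compose2[OF jc this subset_UNIV] show "continuous_on UNIV (\<lambda>\<rho>. \<psi> (cl \<rho>) (cis \<theta>))" by simp
      qed
      have "(LINT \<rho>|ivl (1/2) R. \<psi> (cl \<rho>) (cis \<theta>)) = (LINT \<rho>|lborel. indicator {1/2..R} \<rho> *\<^sub>R \<psi> (cl \<rho>) (cis \<theta>))"
        by (rule integral_ivl[OF cc'])
      also have "\<dots> = (LINT \<rho>|lborel. indicator {1/2..R} \<rho> *\<^sub>R \<psi> \<rho> (cis \<theta>))"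
        by (intro Bochner_Integration.integral_cong) (auto simp: clid split: split_indicator)
      also have "\<dots> = \<Theta> R \<theta> - \<Theta> (1 / 2) \<theta>"
      proof (rule integral_FTC_Icc[OF R(1) _ cc])
        fix \<rho> assume \<rho>: "1 / 2 \<le> \<rho>" "\<rho> \<le> R"
        show "(((\<lambda>\<rho>. \<Theta> \<rho> \<theta>)) has_vector_derivative \<psi> \<rho> (cis \<theta>)) (at \<rho> within {1/2..R})"
          unfolding \<Theta>_def \<psi>_def
          using \<rho> R by (intro has_vector_derivative_norm_powr[OF p(1)] has_vector_derivative_smoothed_dilation[OF h]) auto
      qed
      finally show ?thesis .
    qed
    have int: "integrable circ (\<Theta> \<rho>)" if "1 / 2 \<le> \<rho>" "\<rho> \<le> R" for \<rho>
      unfolding \<Theta>_def using that R p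
      by (intro integrable_circ_continuous continuous_on_powr' continuous_intros
          continuous_on_circle_function[OF continuous_on_smoothed_dilation[OF h]]) auto
    have "(LINT \<theta>|circ. \<Theta> R \<theta>) - (LINT \<theta>|circ. \<Theta> (1 / 2) \<theta>) = (LINT \<theta>|circ. \<Theta> R \<theta> - \<Theta> (1 / 2) \<theta>)"
      using int R by simp
    also have "\<dots> = (LINT \<rho>|ivl (1/2) R. LINT \<theta>|circ. \<psi> (cl \<rho>) (cis \<theta>))"
      unfolding ftc[symmetric] by (rule fub(1)[symmetric])
    also have "\<dots> \<le> C * E"
    proof (rule integral_real_bounded)
      have "(\<integral>\<^sup>+\<rho>. ennreal (LINT \<theta>|circ. \<psi> (cl \<rho>) (cis \<theta>)) \<partial>ivl (1/2) R) \<le>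
        (\<integral>\<^sup>+\<rho>. ennreal C * ennreal ((1 - \<rho>) powr (p - 1) * m \<rho> powr p) \<partial>ivl (1 / 2) R)"
      proof (intro nn_integral_mono_AE eventually_mono[OF AE_ivl])
        fix \<rho> assume \<rho>: "1 / 2 \<le> \<rho> \<and> \<rho> \<le> R"
        have "\<bar>LINT \<theta>|circ. \<psi> \<rho> (cis \<theta>)\<bar> \<le> C * ((1 - \<rho>) powr (p - 1) * m \<rho> powr p)"
          unfolding \<psi>_def by (rule C(2)[OF h _ _ R(2) m]) (use \<rho> in auto)
        moreover have "cl \<rho> = \<rho>" using \<rho> by (intro clid) auto
        ultimately have "(LINT \<theta>|circ. \<psi> (cl \<rho>) (cis \<theta>)) \<le> C * ((1 - \<rho>) powr (p - 1) * m \<rho> powr p)"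
          by (simp only: abs_le_iff)
        then show "ennreal (LINT \<theta>|circ. \<psi> (cl \<rho>) (cis \<theta>)) \<le> ennreal C * ennreal ((1 - \<rho>) powr (p - 1) * m \<rho> powr p)"
          using C by (simp add: ennreal_mult[symmetric] ennreal_leI)
      qed
      also have "\<dots> = ennreal C * (\<integral>\<^sup>+\<rho>. ennreal ((1 - \<rho>) powr (p - 1) * m \<rho> powr p) \<partial>ivl (1 / 2) R)"
        by (rule nn_integral_cmult) measurable
      also have "\<dots> \<le> ennreal C * ennreal E" by (intro mult_left_mono E) auto
      finally show "(\<integral>\<^sup>+\<rho>. ennreal (LINT \<theta>|circ. \<psi> (cl \<rho>) (cis \<theta>)) \<partial>ivl (1/2) R) \<le> ennreal (C * E)"
        using C E0 by (simp add: ennreal_mult)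
    qed (use C E0 in auto)
    finally show "(LINT \<theta>|circ. cmod (h (of_real (R ^ 4) * cis \<theta>)) powr p) \<le>
         (LINT \<theta>|circ. cmod (smoothed_dilation h R (1 / 2) (cis \<theta>)) powr p) + C * E"
      using R by (simp add: \<Theta>_def smoothed_dilation_def)
  qed
qed

section \<open>Linearity and reduction to large radii\<close>

lemma fps_nth_fps_expansion_add:
  assumes "f holomorphic_on ball 0 1" "g holomorphic_on ball 0 1"
  shows "fps_expansion (\<lambda>w. f w + g w) 0 = fps_expansion f 0 + fps_expansion g 0"
proof -
  have "f has_fps_expansion fps_expansion f 0" "g has_fps_expansion fps_expansion g 0"
    using assms by (auto intro!: has_fps_expansion_fps_expansion[of "ball 0 1"])
  then have "(\<lambda>w. f w + g w) has_fps_expansion fps_expansion f 0 + fps_expansion g 0"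
    by (rule has_fps_expansion_add)
  moreover have "(\<lambda>w. f w + g w) has_fps_expansion fps_expansion (\<lambda>w. f w + g w) 0"
    using assms by (intro has_fps_expansion_fps_expansion[of "ball 0 1"] holomorphic_intros) auto
  ultimately show ?thesis by (rule fps_expansion_unique_complex[symmetric])
qed

lemma fps_nth_fps_expansion_cmult:
  assumes "f holomorphic_on ball 0 1"
  shows "fps_expansion (\<lambda>w. c * f w) 0 = fps_const c * fps_expansion f 0"
proof -
  have "f has_fps_expansion fps_expansion f 0"
    using assms by (auto intro!: has_fps_expansion_fps_expansion[of "ball 0 1"])
  then have "(\<lambda>w. c * f w) has_fps_expansion fps_const c * fps_expansion f 0"
    by (rule has_fps_expansion_cmult_left)
  moreover have "(\<lambda>w. c * f w) has_fps_expansion fps_expansion (\<lambda>w. c * f w) 0"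
    using assms by (intro has_fps_expansion_fps_expansion[of "ball 0 1"] holomorphic_intros) auto
  ultimately show ?thesis by (rule fps_expansion_unique_complex[symmetric])
qed

text \<open>Linearity is read off from the coefficients, so only the norm bound is at stake. The
  threshold \<open>1 / 16\<close> is the common starting radius of the two radial integrations:
  \<open>(1 / 2) ^ 4\<close> in the case \<open>p \<le> 2\<close> and \<open>(1 / 4)^2\<close> in
  the case \<open>p > q\<close>.\<close>

lemma rhaly_boundedI:
  fixes p :: real
  assumes \<eta>: "analytic_in_disc (Abs_fps \<eta>)" and p: "1 < p"
    and K: "\<And>f r. f \<in> hardy_space p \<Longrightarrow> 1 / 16 \<le> r \<Longrightarrow> r < 1 \<Longrightarrow>
      Lp_le p (\<lambda>\<theta>. rhaly \<eta> f (of_real r * cis \<theta>)) (K * hardy_norm p f)"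
  shows "rhaly_bounded p \<eta>"
proof -
  have hol: "f holomorphic_on ball 0 1" if "f \<in> hardy_space p" for f
    using that by (simp add: hardy_space_def)
  have an: "analytic_in_disc (rhaly_fps \<eta> f)" if "f \<in> hardy_space p" for f
    by (rule analytic_rhaly_fps[OF \<eta> hol[OF that]])
  have rhol: "rhaly \<eta> f holomorphic_on ball 0 1" if "f \<in> hardy_space p" for f
    unfolding rhaly_def by (rule holomorphic_eval_fps_disc[OF an[OF that]])
  have all: "Lp_le p (\<lambda>\<theta>. rhaly \<eta> f (of_real r * cis \<theta>)) (K * hardy_norm p f)"
    if f: "f \<in> hardy_space p" and r: "0 < r" "r < 1" for f r
  proof (cases "1 / 16 \<le> r")
    case True
    then show ?thesis using K f r by auto
  next
    case False
    \<comment> \<open>The dilation by \<open>1 / 16\<close> is holomorphic in the ball of radius 16,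
      so the bound on the circle of radius \<open>1 / 16\<close> serves as boundary data for all
      smaller radii.\<close>
    have "(\<lambda>w. rhaly \<eta> f (of_real (1 / 16) * w)) holomorphic_on ball 0 16"
      by (intro holomorphic_on_compose_gen[OF _ rhol[OF f], unfolded o_def] holomorphic_intros) (auto simp: norm_mult)
    from Lp_le_radius_mono[OF p this _ _ _ K[OF f, of "1 / 16"], of "16 * r"] False r
    show ?thesis by simp
  qed
  have sum: "fps_nth (rhaly_fps \<eta> (\<lambda>w. f w + g w)) n = fps_nth (rhaly_fps \<eta> f) n + fps_nth (rhaly_fps \<eta> g) n"
    if "f \<in> hardy_space p" "g \<in> hardy_space p" for f g n
    using fps_nth_fps_expansion_add[OF hol[OF that(1)] hol[OF that(2)]]
    by (simp add: rhaly_fps_def sum.distrib algebra_simps)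
  have scal: "fps_nth (rhaly_fps \<eta> (\<lambda>w. c * f w)) n = c * fps_nth (rhaly_fps \<eta> f) n"
    if "f \<in> hardy_space p" for f c n
    using fps_nth_fps_expansion_cmult[OF hol[OF that], of c]
    by (simp add: rhaly_fps_def sum_distrib_left[symmetric] mult_ac)
  have add: "rhaly \<eta> (\<lambda>w. f w + g w) z = rhaly \<eta> f z + rhaly \<eta> g z"
    if "f \<in> hardy_space p" "g \<in> hardy_space p" "z \<in> ball 0 1" for f g z
  proof -
    have "rhaly_fps \<eta> (\<lambda>w. f w + g w) = rhaly_fps \<eta> f + rhaly_fps \<eta> g"
      by (rule fps_ext) (simp add: sum[OF that(1,2)])
    then show ?thesis unfolding rhaly_def using that an
      by (simp add: eval_fps_add less_conv_radius_disc analytic_in_disc_def)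
  qed
  have cmult: "rhaly \<eta> (\<lambda>w. c * f w) z = c * rhaly \<eta> f z"
    if "f \<in> hardy_space p" "z \<in> ball 0 1" for f c z
  proof -
    have eq: "rhaly_fps \<eta> (\<lambda>w. c * f w) = fps_const c * rhaly_fps \<eta> f"
      by (rule fps_ext) (simp add: scal[OF that(1)])
    show ?thesis unfolding rhaly_def eq using that an
      by (subst eval_fps_mult) (auto simp: less_conv_radius_disc analytic_in_disc_def)
  qed
  have "\<forall>f\<in>hardy_space p. rhaly \<eta> f \<in> hardy_space p \<and> hardy_norm p (rhaly \<eta> f) \<le> K * hardy_norm p f"
    using hardy_spaceI[OF rhol] all p by (metis zero_less_one order_less_trans)
  then show ?thesis
    unfolding rhaly_bounded_def hardy_operator_def using an add cmult by blast
qed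

lemma Lp_le_euler_symbol:
  assumes \<eta>: "analytic_in_disc (Abs_fps \<eta>)" and \<rho>: "0 \<le> \<rho>" "\<rho> < 1" and p: "0 < p"
    and m: "Lp_le p (\<lambda>\<theta>. deriv (symbol_fun \<eta>) (of_real \<rho> * cis \<theta>)) m"
  shows "Lp_le p (\<lambda>\<theta>. symbol_fun (\<lambda>n. of_nat n * \<eta> n) (of_real \<rho> * cis \<theta>)) m"
proof (rule Lp_le_mono[OF m _ order_refl p])
  have "cmod (symbol_fun (\<lambda>n. of_nat n * \<eta> n) (of_real \<rho> * cis t)) = \<rho> * cmod (deriv (symbol_fun \<eta>) (of_real \<rho> * cis t))" for t
  proof -
    define z where "z = of_real \<rho> * cis t"
    have "symbol_fun (\<lambda>n. of_nat n * \<eta> n) z = z * deriv (symbol_fun \<eta>) z"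
      using euler_op_symbol[OF \<eta>, of z] \<rho> by (simp add: z_def norm_mult euler_op_def)
    then show ?thesis using \<rho> by (simp add: z_def[symmetric] norm_mult) (simp add: z_def norm_mult)
  qed
  then show "AE t in circ. cmod (symbol_fun (\<lambda>n. of_nat n * \<eta> n) (of_real \<rho> * cis t)) \<le>
     cmod (deriv (symbol_fun \<eta>) (of_real \<rho> * cis t))"
    using \<rho> by (simp add: mult_left_le_one_le)
qed

text \<open>The circle of radius \<open>1 / 16\<close> is reached by the convolution at radius
  \<open>1 / 4\<close>, where the symbol is bounded and \<open>cesaro_mean\<close> is at most
  \<open>hardy_norm p f / (1 - 1 / 4)\<close>. The smoothed dilation starts from both
  \<open>rhaly\<close> and its Euler derivative.\<close>

lemma rhaly_small_radius:
  assumes \<eta>: "analytic_in_disc (Abs_fps \<eta>)" and p: "1 < p"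
  obtains K where "0 < K"
    "\<And>f \<theta>. f \<in> hardy_space p \<Longrightarrow> cmod (rhaly \<eta> f (of_real (1 / 16) * cis \<theta>)) \<le> K * hardy_norm p f"
    "\<And>f \<theta>. f \<in> hardy_space p \<Longrightarrow> cmod (euler_op (rhaly \<eta> f) (of_real (1 / 16) * cis \<theta>)) \<le> K * hardy_norm p f"
proof -
  have *: "\<exists>B>0. \<forall>f\<in>hardy_space p. \<forall>\<theta>. cmod (rhaly c f (of_real (1 / 16) * cis \<theta>)) \<le> B * hardy_norm p f"
    if c: "analytic_in_disc (Abs_fps c)" for c
  proof -
    have sh: "symbol_fun c holomorphic_on ball 0 1"
      unfolding symbol_fun_def by (rule holomorphic_eval_fps_disc[OF c])
    have "continuous_on (sphere 0 1) (\<lambda>w. symbol_fun c (of_real (1 / 4) * w))"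
      by (rule continuous_on_compose2[OF holomorphic_on_imp_continuous_on[OF sh]])
         (auto intro!: continuous_intros simp: norm_mult)
    then obtain B where B: "0 < B" "\<And>t. cmod (symbol_fun c (of_real (1 / 4) * cis t)) \<le> B"
      by (rule bounded_circle_function) blast
    have "cmod (rhaly c f (of_real (1 / 16) * cis \<theta>)) \<le> (B * (4 / 3)) * hardy_norm p f" if f: "f \<in> hardy_space p" for f \<theta>
    proof -
      have h: "f holomorphic_on ball 0 1" using f by (simp add: hardy_space_def)
      have "Lp_le p (\<lambda>t. f (of_real (1 / 4) * cis t)) (hardy_norm p f)"
        using f p by (intro hardy_norm_Lp_le) auto
      then have "cesaro_mean f (1 / 4) \<le> hardy_norm p f / (1 - 1 / 4)"
        by (intro cesaro_mean_le[OF h _ _ p]) auto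
      then have "B * cesaro_mean f (1 / 4) \<le> B * (hardy_norm p f / (1 - 1 / 4))"
        using B by (intro mult_left_mono) auto
      moreover have "cmod (rhaly c f (of_real ((1 / 4)\<^sup>2) * cis \<theta>)) \<le> B * cesaro_mean f (1 / 4)"
        using B by (intro norm_rhaly_le_sup[OF c h]) auto
      ultimately show ?thesis by (simp add: power2_eq_square)
    qed
    then show ?thesis using B by (intro exI[of _ "B * (4 / 3)"]) auto
  qed
  obtain B1 where B1: "0 < B1" "\<And>f \<theta>. f \<in> hardy_space p \<Longrightarrow> cmod (rhaly \<eta> f (of_real (1 / 16) * cis \<theta>)) \<le> B1 * hardy_norm p f"
    using *[OF \<eta>] by blast
  obtain B2 where B2: "0 < B2" "\<And>f \<theta>. f \<in> hardy_space p \<Longrightarrow>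
      cmod (rhaly (\<lambda>n. of_nat n * \<eta> n) f (of_real (1 / 16) * cis \<theta>)) \<le> B2 * hardy_norm p f"
    using *[OF analytic_euler[OF \<eta>]] by blast
  show ?thesis
  proof (rule that[of "B1 + B2"])
    fix f \<theta> assume f: "f \<in> hardy_space p"
    have N: "0 \<le> hardy_norm p f" using hardy_norm_nonneg[OF f] p by simp
    show "cmod (rhaly \<eta> f (of_real (1 / 16) * cis \<theta>)) \<le> (B1 + B2) * hardy_norm p f"
      using B1(2)[OF f, of \<theta>] N B2(1) by (simp add: distrib_right add_increasing2)
    have "euler_op (rhaly \<eta> f) (of_real (1 / 16) * cis \<theta>) = rhaly (\<lambda>n. of_nat n * \<eta> n) f (of_real (1 / 16) * cis \<theta>)"
      using f by (intro euler_op_rhaly \<eta>) (auto simp: hardy_space_def norm_mult)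
    then show "cmod (euler_op (rhaly \<eta> f) (of_real (1 / 16) * cis \<theta>)) \<le> (B1 + B2) * hardy_norm p f"
      using B2(2)[OF f, of \<theta>] N B1(1) by (simp add: distrib_right add_increasing)
  qed (use B1 B2 in simp)
qed

text \<open>With \<open>m \<rho> = C0 * (1 - \<rho>) powr (1 / p - 1) * cesaro_mean f \<rho>\<close>
  the weight in \<open>hardy_type_inequality\<close> cancels exactly, since
  \<open>(1 / p - 1) * p = 1 - p\<close>; what remains is the integral in Hilbert's
  inequality.\<close>

lemma rhaly_bounded_le_2:
  fixes p :: real
  assumes p: "1 < p" "p \<le> 2" and \<eta>: "analytic_in_disc (Abs_fps \<eta>)" and C0: "0 < C0"
    and F: "\<And>s. 0 \<le> s \<Longrightarrow> s < 1 \<Longrightarrow>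
      Lp_le p (\<lambda>\<theta>. deriv (symbol_fun \<eta>) (of_real s * cis \<theta>)) (C0 * (1 - s) powr (1 / p - 1))"
  shows "rhaly_bounded p \<eta>"
proof -
  obtain C where C: "0 < C"
    "\<And>h R m E. h holomorphic_on ball 0 1 \<Longrightarrow> 1 / 2 \<le> R \<Longrightarrow> R < 1 \<Longrightarrow> 
       (\<And>\<rho>. 1 / 2 \<le> \<rho> \<Longrightarrow> \<rho> \<le> R \<Longrightarrow> Lp_le p (\<lambda>\<theta>. euler_op h (of_real (\<rho>\<^sup>2) * cis \<theta>)) (m \<rho>)) \<Longrightarrow>
       m \<in> borel_measurable borel \<Longrightarrow> 0 \<le> E \<Longrightarrow>
       (\<integral>\<^sup>+\<rho>. ennreal ((1 - \<rho>) powr (p - 1) * m \<rho> powr p) \<partial>ivl (1 / 2) R) \<le> ennreal E \<Longrightarrow>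
       (LINT \<theta>|circ. cmod (h (of_real (R ^ 4) * cis \<theta>)) powr p) \<le>
         (LINT \<theta>|circ. cmod (smoothed_dilation h R (1 / 2) (cis \<theta>)) powr p) + C * E"
    using hardy_type_inequality[OF p] by blast
  obtain C1 where C1: "0 < C1"
    "\<And>f N R. f holomorphic_on ball 0 1 \<Longrightarrow> 0 < R \<Longrightarrow> R < 1 \<Longrightarrow>
       Lp_le p (\<lambda>t. f (of_real R * cis t)) N \<Longrightarrow>
       (\<integral>\<^sup>+r. ennreal (cesaro_mean f r powr p) * indicator {0..<R} r \<partial>lborel) \<le> ennreal ((C1 * N) powr p)"
    using cesaro_mean_Lp[OF p(1)] by blast
  obtain K0 where K0: "0 < K0"
    "\<And>f \<theta>. f \<in> hardy_space p \<Longrightarrow> cmod (rhaly \<eta> f (of_real (1 / 16) * cis \<theta>)) \<le> K0 * hardy_norm p f"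
    "\<And>f \<theta>. f \<in> hardy_space p \<Longrightarrow> cmod (euler_op (rhaly \<eta> f) (of_real (1 / 16) * cis \<theta>)) \<le> K0 * hardy_norm p f"
    using rhaly_small_radius[OF \<eta> p(1)] by blast
  define K where "K = ((5 * K0) powr p + C * (C0 * C1) powr p) powr (1 / p)"
  have Kp: "K powr p = (5 * K0) powr p + C * (C0 * C1) powr p" "0 \<le> K"
    using p C by (auto simp: K_def powr_powr)
  show ?thesis
  proof (rule rhaly_boundedI[OF \<eta> p(1)])
    fix f r assume f: "f \<in> hardy_space p" and r: "1 / 16 \<le> r" "r < (1::real)"
    define N where "N = hardy_norm p f"
    have N: "0 \<le> N" using hardy_norm_nonneg[OF f] p by (simp add: N_def)
    have fh: "f holomorphic_on ball 0 1" using f by (simp add: hardy_space_def)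
    define h where "h = rhaly \<eta> f"
    have h: "h holomorphic_on ball 0 1"
      unfolding h_def rhaly_def by (rule holomorphic_eval_fps_disc[OF analytic_rhaly_fps[OF \<eta> fh]])
    define R where "R = root 4 r"
    have R4: "R ^ 4 = r" using r by (simp add: R_def)
    have R: "1 / 2 \<le> R" "R < 1"
    proof -
      show "R < 1" using r by (simp add: R_def)
      have "(1 / 2) ^ 4 \<le> R ^ 4" using R4 r by (simp add: power4_eq_xxxx)
      then show "1 / 2 \<le> R" by (rule power_le_imp_le_base[of _ 3, simplified]) (use r in \<open>simp add: R_def\<close>)
    qed
    define m where "m \<rho> = C0 * (1 - \<rho>) powr (1 / p - 1) * cesaro_mean f \<rho>" for \<rho>
    have [measurable]: "cesaro_mean f \<in> borel_measurable borel" by (rule borel_measurable_cesaro_mean[OF fh])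
    have main: "(LINT \<theta>|circ. cmod (h (of_real (R ^ 4) * cis \<theta>)) powr p) \<le>
         (LINT \<theta>|circ. cmod (smoothed_dilation h R (1 / 2) (cis \<theta>)) powr p) + C * (C0 * C1 * N) powr p"
    proof (rule C(2)[OF h R])
      fix \<rho> assume \<rho>: "1 / 2 \<le> \<rho>" "\<rho> \<le> R"
      have "Lp_le p (\<lambda>\<theta>. symbol_fun (\<lambda>n. of_nat n * \<eta> n) (of_real \<rho> * cis \<theta>)) (C0 * (1 - \<rho>) powr (1 / p - 1))"
        using \<rho> R p by (intro Lp_le_euler_symbol \<eta> F) auto
      then have "Lp_le p (\<lambda>\<theta>. rhaly (\<lambda>n. of_nat n * \<eta> n) f (of_real (\<rho>\<^sup>2) * cis \<theta>)) (m \<rho>)"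
        unfolding m_def using \<rho> R by (intro Lp_le_rhaly analytic_euler \<eta> fh p) auto
      moreover have "euler_op h (of_real (\<rho>\<^sup>2) * cis \<theta>) = rhaly (\<lambda>n. of_nat n * \<eta> n) f (of_real (\<rho>\<^sup>2) * cis \<theta>)" for \<theta>
        unfolding h_def using \<rho> R by (intro euler_op_rhaly \<eta> fh) (auto simp: norm_mult norm_power power_less_one_iff)
      ultimately show "Lp_le p (\<lambda>\<theta>. euler_op h (of_real (\<rho>\<^sup>2) * cis \<theta>)) (m \<rho>)" by simp
    next
      show "m \<in> borel_measurable borel" unfolding m_def by measurable
      \<comment> \<open>Hilbert's inequality covers a half-open interval; a bound \<open>R'\<close>
        beyond \<open>R\<close> makes it contain the endpoint \<open>R\<close>.\<close>
      define R' where "R' = (1 + R) / 2"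
      have R': "0 < R'" "R' < 1" "R < R'" using R by (auto simp: R'_def)
      have "(\<integral>\<^sup>+\<rho>. ennreal ((1 - \<rho>) powr (p - 1) * m \<rho> powr p) \<partial>ivl (1 / 2) R) =
        (\<integral>\<^sup>+\<rho>. ennreal ((1 - \<rho>) powr (p - 1) * m \<rho> powr p) * indicator {1 / 2..R} \<rho> \<partial>lborel)"
        by (rule nn_integral_ivl) (unfold m_def, measurable)
      also have "\<dots> \<le> (\<integral>\<^sup>+\<rho>. ennreal (C0 powr p) * (ennreal (cesaro_mean f \<rho> powr p) * indicator {0..<R'} \<rho>) \<partial>lborel)"
      proof (intro nn_integral_mono)
        fix \<rho>
        show "ennreal ((1 - \<rho>) powr (p - 1) * m \<rho> powr p) * indicator {1 / 2..R} \<rho> \<le>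
          ennreal (C0 powr p) * (ennreal (cesaro_mean f \<rho> powr p) * indicator {0..<R'} \<rho>)"
        proof (cases "\<rho> \<in> {1 / 2..R}")
          case True
          then have \<rho>: "1 / 2 \<le> \<rho>" "\<rho> \<le> R" by auto
          have "m \<rho> powr p = C0 powr p * ((1 - \<rho>) powr (1 / p - 1)) powr p * cesaro_mean f \<rho> powr p"
            unfolding m_def using C0 \<rho> R by (simp add: powr_mult)
          also have "((1 - \<rho>) powr (1 / p - 1)) powr p = (1 - \<rho>) powr (1 - p)"
            using p by (simp add: powr_powr left_diff_distrib)
          finally have "(1 - \<rho>) powr (p - 1) * m \<rho> powr p =
            ((1 - \<rho>) powr (p - 1) * (1 - \<rho>) powr (1 - p)) * (C0 powr p * cesaro_mean f \<rho> powr p)" by simp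
          also have "(1 - \<rho>) powr (p - 1) * (1 - \<rho>) powr (1 - p) = 1"
            using \<rho> R by (simp flip: powr_add)
          finally show ?thesis using \<rho> R' by (simp add: ennreal_mult)
        qed simp
      qed
      also have "\<dots> = ennreal (C0 powr p) * (\<integral>\<^sup>+\<rho>. ennreal (cesaro_mean f \<rho> powr p) * indicator {0..<R'} \<rho> \<partial>lborel)"
        by (rule nn_integral_cmult) measurable
      also have "\<dots> \<le> ennreal (C0 powr p) * ennreal ((C1 * N) powr p)"
        unfolding N_def using R' p by (intro mult_left_mono C1(2)[OF fh] hardy_norm_Lp_le[OF f]) auto
      also have "\<dots> = ennreal ((C0 * C1 * N) powr p)"
        using C0 C1 N by (simp add: ennreal_mult[symmetric] powr_mult mult_ac)
      finally show "(\<integral>\<^sup>+\<rho>. ennreal ((1 - \<rho>) powr (p - 1) * m \<rho> powr p) \<partial>ivl (1 / 2) R) \<le> ennreal ((C0 * C1 * N) powr p)" .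
    qed simp
    have start: "(LINT \<theta>|circ. cmod (smoothed_dilation h R (1 / 2) (cis \<theta>)) powr p) \<le> (5 * K0 * N) powr p"
    proof (rule integral_real_bounded)
      \<comment> \<open>\<open>5 = 1 + 4 * 1\<close>: the value of \<open>h\<close>, and the
        corrector, whose logarithm is at most 1.\<close>
      have "cmod (smoothed_dilation h R (1 / 2) (cis \<theta>)) \<le> 5 * K0 * N" for \<theta>
      proof -
        have L: "0 \<le> ln (R / (1 / 2))" "ln (R / (1 / 2)) \<le> 1"
          using ln_ratio_bounds[of "1 / 2" R] R by auto
        have "cmod (smoothed_dilation h R (1 / 2) (cis \<theta>)) \<le>
          cmod (h (of_real (1 / 16) * cis \<theta>)) + cmod (of_real (4 * ln (R / (1 / 2))) * euler_op h (of_real (1 / 16) * cis \<theta>))"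
          unfolding smoothed_dilation_def by (rule order_trans[OF norm_triangle_ineq]) (simp add: power4_eq_xxxx)
        also have "\<dots> \<le> K0 * N + 4 * 1 * (K0 * N)"
          unfolding norm_mult[of "of_real _" "euler_op h _"] norm_of_real
          using K0(2,3)[OF f, of \<theta>] L K0(1) N unfolding N_def h_def
          by (intro add_mono mult_mono) auto
        finally show ?thesis by simp
      qed
      then have "(\<integral>\<^sup>+\<theta>. ennreal (cmod (smoothed_dilation h R (1 / 2) (cis \<theta>)) powr p) \<partial>circ) \<le>
        (\<integral>\<^sup>+\<theta>. ennreal ((5 * K0 * N) powr p) \<partial>circ)"
        using p by (intro nn_integral_mono ennreal_leI powr_mono2) auto
      then show "(\<integral>\<^sup>+\<theta>. ennreal (cmod (smoothed_dilation h R (1 / 2) (cis \<theta>)) powr p) \<partial>circ) \<le> ennreal ((5 * K0 * N) powr p)"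
        by (simp add: emeasure_circ_UNIV)
    qed simp
    have "(LINT \<theta>|circ. cmod (h (of_real r * cis \<theta>)) powr p) \<le> (K * N) powr p"
    proof -
      have "(5 * K0 * N) powr p + C * (C0 * C1 * N) powr p = (K * N) powr p"
        using N K0 C0 C1 Kp by (simp add: powr_mult algebra_simps)
      then show ?thesis using main start unfolding R4 by linarith
    qed
    moreover have "continuous_on UNIV (\<lambda>\<theta>. cmod (h (of_real r * cis \<theta>)) powr p)"
      using r p by (intro continuous_on_powr' continuous_intros continuous_on_circle_radius holomorphic_on_imp_continuous_on h) auto
    then have "(\<integral>\<^sup>+\<theta>. ennreal (cmod (h (of_real r * cis \<theta>)) powr p) \<partial>circ) = ennreal (LINT \<theta>|circ. cmod (h (of_real r * cis \<theta>)) powr p)"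
      by (intro nn_integral_eq_integral integrable_circ_continuous) auto
    ultimately show "Lp_le p (\<lambda>\<theta>. rhaly \<eta> f (of_real r * cis \<theta>)) (K * hardy_norm p f)"
      using N Kp(2) by (simp add: Lp_le_def h_def N_def ennreal_leI)
  qed
qed

section \<open>Boundedness for \<open>p > q\<close>\<close>

lemma continuous_on_circ_integral:
  fixes f :: "'a::topological_space \<Rightarrow> real \<Rightarrow> real"
  assumes "continuous_on (U \<times> UNIV) (\<lambda>(x, t). f x t)"
  shows "continuous_on U (\<lambda>x. LINT t|circ. f x t)"
proof -
  have c: "continuous_on (U \<times> cbox (-pi) pi) (\<lambda>(x, t). f x t)"
    by (rule continuous_on_subset[OF assms]) auto
  have eq: "(LINT t|circ. f x t) = (1 / (2 * pi)) * integral (cbox (-pi) pi) (f x)" if "x \<in> U" for x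
  proof -
    have cx: "continuous_on UNIV (f x)"
    proof -
      have "continuous_on UNIV (\<lambda>t. (x, t))" by (intro continuous_intros)
      from continuous_on_compose2[OF assms this] that show ?thesis by auto
    qed
    have "set_integrable lborel {-pi..pi} (f x)"
      unfolding set_integrable_def by (intro borel_integrable_compact continuous_on_subset[OF cx]) auto
    from set_borel_integral_eq_integral(2)[OF this]
    show ?thesis by (simp add: integral_circ[OF borel_measurable_continuous_onI[OF cx]])
  qed
  have "continuous_on U (\<lambda>x. (1 / (2 * pi)) * integral (cbox (-pi) pi) (f x))"
    by (intro continuous_intros integral_continuous_on_param c)
  then show ?thesis using eq by (subst continuous_on_cong[OF refl eq]) auto
qed

text \<open>The power is the integral of its derivative. Heuristically, among \<open>p\<close> equal
  factors the one at the largest parameter \<open>x\<close> is singled out and the others are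
  integrated over \<open>y \<le> x\<close>; the almost orthogonality argument estimates this ordered
  form.\<close>

lemma powr_integral_FTC:
  fixes b :: "real \<Rightarrow> real"
  assumes cont: "continuous_on UNIV b" and nn: "\<And>x. 0 \<le> b x" and p: "1 < p" and aR: "a \<le> R"
  shows "ennreal (integral {a..R} b powr p) =
    (\<integral>\<^sup>+x. ennreal (p * (b x * integral {a..x} b powr (p - 1))) \<partial>ivl a R)"
proof -
  define A where "A x = integral {a..x} b" for x
  have intb: "b integrable_on {a..x}" for x
    by (intro integrable_continuous_interval continuous_on_subset[OF cont]) auto
  have A0: "0 \<le> A x" for x unfolding A_def by (intro integral_nonneg intb nn)
  have dA: "(A has_vector_derivative b x) (at x within {a..R})" if "x \<in> {a..R}" for x
    unfolding A_def by (rule integral_has_vector_derivative[OF continuous_on_subset[OF cont] that]) auto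
  have Ac: "continuous_on {a..R} A"
    by (rule continuous_on_vector_derivative) (rule dA)
  define \<psi> where "\<psi> x = p * (b x * A x powr (p - 1))" for x
  have d: "((\<lambda>x. A x powr p) has_vector_derivative \<psi> x) (at x within {a..R})" if "x \<in> {a..R}" for x
  proof -
    \<comment> \<open>The derivative lemma for powers of moduli is applied to the real function
      \<open>A\<close>, viewed as complex; it includes points where \<open>A\<close>
      vanishes.\<close>
    have "((\<lambda>x. complex_of_real (A x)) has_vector_derivative of_real (b x)) (at x within {a..R})"
      by (intro has_vector_derivative_of_real)
         (simp add: has_real_derivative_iff_has_vector_derivative dA[OF that])
    from has_vector_derivative_norm_powr[OF p this] 
    have 1: "((\<lambda>x. A x powr p) has_vector_derivative p * (A x powr (p - 2) * A x * b x)) (at x within {a..R})"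
      using A0 by (simp add: pgrad_def)
    have 2: "A x powr (p - 2) * A x = A x powr (p - 1)"
      using A0[of x] powr_add[of "A x" "p - 2" 1] by (cases "A x = 0") auto
    show ?thesis using 1 unfolding \<psi>_def by (simp only: 2 mult.commute[of "b x"])
  qed
  have \<psi>c: "continuous_on {a..R} \<psi>" unfolding \<psi>_def
    using p A0 by (intro continuous_intros continuous_on_powr' continuous_on_subset[OF cont] Ac) auto
  have \<psi>0: "0 \<le> \<psi> x" for x using p nn by (simp add: \<psi>_def)
  have "ennreal (A R powr p) = ennreal (A R powr p - A a powr p)" using p by (simp add: A_def)
  also have "\<dots> = ennreal (LINT x|lborel. indicator {a..R} x *\<^sub>R \<psi> x)"
    by (subst integral_FTC_Icc[OF aR d \<psi>c]) auto
  also have "\<dots> = (\<integral>\<^sup>+x. ennreal (indicator {a..R} x *\<^sub>R \<psi> x) \<partial>lborel)"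
    by (intro nn_integral_eq_integral[symmetric] borel_integrable_compact \<psi>c) (auto simp: \<psi>0)
  also have "\<dots> = (\<integral>\<^sup>+x. ennreal (\<psi> x) \<partial>ivl a R)"
  proof -
    have "indicator {a..R} x *\<^sub>R \<psi> x = indicator {a..R} x *\<^sub>R \<psi> (max a (min R x))" for x
      by (auto split: split_indicator)
    have m: "(\<lambda>x. indicator {a..R} x *\<^sub>R \<psi> x) \<in> borel_measurable borel"
      by (rule borel_measurable_continuous_on_indicator[OF _ \<psi>c]) auto
    have "(\<integral>\<^sup>+x. ennreal (\<psi> x) \<partial>ivl a R) = (\<integral>\<^sup>+x. ennreal (indicator {a..R} x *\<^sub>R \<psi> x) \<partial>ivl a R)"
      by (intro nn_integral_cong_AE eventually_mono[OF AE_ivl]) auto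
    also have "\<dots> = (\<integral>\<^sup>+x. ennreal (indicator {a..R} x *\<^sub>R \<psi> x) * indicator {a..R} x \<partial>lborel)"
      using m by (intro nn_integral_ivl) auto
    also have "\<dots> = (\<integral>\<^sup>+x. ennreal (indicator {a..R} x *\<^sub>R \<psi> x) \<partial>lborel)"
      by (intro nn_integral_cong) (auto split: split_indicator)
    finally show ?thesis by simp
  qed
  finally show ?thesis unfolding \<psi>_def A_def .
qed

lemma nn_integral_one_minus_powr:
  assumes "a \<le> x" "x < 1" "e < - 1"
  shows "(\<integral>\<^sup>+r. ennreal ((1 - r) powr e) \<partial>ivl a x) \<le> ennreal ((1 - x) powr (e + 1) / (- e - 1))"
proof -
  have "(\<integral>\<^sup>+r. ennreal ((1 - r) powr e) \<partial>ivl a x) = (\<integral>\<^sup>+r. ennreal ((1 - r) powr e) * indicator {a..x} r \<partial>lborel)"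
    by (rule nn_integral_ivl) measurable
  also have "\<dots> = (\<integral>\<^sup>+u. ennreal (u powr e) * indicator {a..x} (1 - u) \<partial>lborel)"
    by (subst nn_integral_real_affine[where c = "-1" and t = 1]) auto
  also have "\<dots> \<le> (\<integral>\<^sup>+u. ennreal (u powr e) * indicator {1 - x..} u \<partial>lborel)"
    by (intro nn_integral_mono) (auto split: split_indicator)
  also have "\<dots> = ennreal (- ((1 - x) powr (e + 1)) / (e + 1))"
    using assms by (intro nn_integral_has_integral_lebesgue' has_integral_powr_to_inf) auto
  also have "- ((1 - x) powr (e + 1)) / (e + 1) = (1 - x) powr (e + 1) / (- e - 1)"
    using assms by (simp add: field_simps)
  finally show ?thesis .
qed

lemma nn_integral_one_minus_powr_upper:
  assumes "x \<le> R" "R < 1" "0 < e"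
  shows "(\<integral>\<^sup>+r. ennreal ((1 - r) powr (e - 1)) * indicator {x..R} r \<partial>lborel) \<le> ennreal ((1 - x) powr e / e)"
proof -
  have "(\<integral>\<^sup>+r. ennreal ((1 - r) powr (e - 1)) * indicator {x..R} r \<partial>lborel) =
     (\<integral>\<^sup>+u. ennreal (u powr (e - 1)) * indicator {x..R} (1 - u) \<partial>lborel)"
    by (subst nn_integral_real_affine[where c = "-1" and t = 1]) auto
  also have "\<dots> \<le> (\<integral>\<^sup>+u. ennreal (u powr (e - 1)) * indicator {0..1 - x} u \<partial>lborel)"
    using assms by (intro nn_integral_mono) (auto split: split_indicator)
  also have "\<dots> = ennreal ((1 - x) powr (e - 1 + 1) / (e - 1 + 1))"
    using assms by (intro nn_integral_has_integral_lebesgue' has_integral_powr_from_0) auto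
  finally show ?thesis by simp
qed

text \<open>An almost orthogonality argument for positive functions: the two bounds on either side of \<open>p\<close> make the
  interaction of \<open>b x\<close> and \<open>b y\<close> in the \<open>p\<close>-th power of the integral decay with the ratio of \<open>1 - x\<close> and \<open>1 - y\<close>.\<close>

lemma positive_superposition:
  fixes p \<delta> \<sigma> \<tau> :: real
  assumes p: "1 < p" and \<delta>: "0 < \<delta>" and \<sigma>: "1 < \<sigma>" "1 / \<sigma> = 1 / p + (p - 1) * \<delta>"
    and \<tau>: "1 < \<tau>" "1 / \<tau> = 1 / p - \<delta>"
  obtains C where "0 < C"
    "\<And>(b :: real \<Rightarrow> real \<Rightarrow> real) a R \<Gamma> M G. continuous_on UNIV (\<lambda>(x, \<theta>). b x \<theta>) \<Longrightarrow> (\<And>x \<theta>. 0 \<le> b x \<theta>) \<Longrightarrow> a \<le> R \<Longrightarrow> R < 1 \<Longrightarrow>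
       \<Gamma> \<in> borel_measurable borel \<Longrightarrow> (\<And>x. 0 \<le> \<Gamma> x) \<Longrightarrow> 0 < M \<Longrightarrow> 0 \<le> G \<Longrightarrow>
       (\<And>x. a \<le> x \<Longrightarrow> x \<le> R \<Longrightarrow> Lp_le \<sigma> (b x) (M * (1 - x) powr (1 / \<sigma> - 1) * \<Gamma> x)) \<Longrightarrow>
       (\<And>x. a \<le> x \<Longrightarrow> x \<le> R \<Longrightarrow> Lp_le \<tau> (b x) (M * (1 - x) powr (1 / \<tau> - 1) * \<Gamma> x)) \<Longrightarrow>
       (\<integral>\<^sup>+x. ennreal (\<Gamma> x powr p) \<partial>ivl a R) \<le> ennreal (G powr p) \<Longrightarrow>
       Lp_le p (\<lambda>\<theta>. integral {a..R} (\<lambda>x. b x \<theta>)) (C * M * G)"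
proof -
  define pc where "pc = p / (p - 1)"
  have pc: "1 / p + 1 / pc = 1" "1 / pc + 1 / p = 1" "1 < pc" "1 / pc = 1 - 1 / p" "pc * (p - 1) = p"
    using p by (auto simp: pc_def field_simps)
  define sc where "sc = \<sigma> / (\<sigma> - 1)"
  have sc: "1 / \<sigma> + 1 / sc = 1" "1 < sc" "1 / sc = 1 - 1 / \<sigma>" using \<sigma> by (auto simp: sc_def field_simps)
  \<comment> \<open>The two exponents satisfy \<open>1 / \<sigma> + (p - 1) / \<tau> = 1\<close>: a
    factor bounded in the \<sigma>-norm can be paired with the power \<open>p - 1\<close> of a
    function bounded in the \<tau>-norm.\<close>
  have sct: "(p - 1) * sc = \<tau>"
  proof -
    have "1 / sc = (p - 1) * (1 / \<tau>)" unfolding sc(3) \<sigma>(2) \<tau>(2) using p by (simp add: field_simps)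
    then show ?thesis using sc(2) \<tau>(1) by (simp add: field_simps)
  qed
  define c1 where "c1 = (1 / (\<delta> * pc / 2)) powr (1 / pc)"
  have c1: "0 < c1" using \<delta> pc by (simp add: c1_def)
  define c2 where "c2 = c1 powr p * (1 / (p * \<delta> / 2))"
  have c2: "0 < c2" using c1 p \<delta> by (simp add: c2_def)
  define C where "C = (p * c2 powr (1 / pc)) powr (1 / p)"
  have C: "0 < C" "C powr p = p * c2 powr (1 / pc)" using p c2 by (auto simp: C_def powr_powr)
  show ?thesis
  proof (rule that[OF C(1)])
    fix b :: "real \<Rightarrow> real \<Rightarrow> real" and a R \<Gamma> M G
    assume bc: "continuous_on UNIV (\<lambda>(x, \<theta>). b x \<theta>)" and b0: "\<And>x \<theta>. 0 \<le> b x \<theta>" and aR: "a \<le> R" "R < (1::real)"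
      and \<Gamma>m [measurable]: "\<Gamma> \<in> borel_measurable borel" and \<Gamma>0: "\<And>x. 0 \<le> \<Gamma> x" and M: "0 < M" and G: "0 \<le> G"
      and bs: "\<And>x. a \<le> x \<Longrightarrow> x \<le> R \<Longrightarrow> Lp_le \<sigma> (b x) (M * (1 - x) powr (1 / \<sigma> - 1) * \<Gamma> x)"
      and bt: "\<And>x. a \<le> x \<Longrightarrow> x \<le> R \<Longrightarrow> Lp_le \<tau> (b x) (M * (1 - x) powr (1 / \<tau> - 1) * \<Gamma> x)"
      and \<Gamma>G: "(\<integral>\<^sup>+x. ennreal (\<Gamma> x powr p) \<partial>ivl a R) \<le> ennreal (G powr p)"
    have bm [measurable]: "(\<lambda>x. b (fst x) (snd x)) \<in> borel_measurable (borel \<Otimes>\<^sub>M borel)"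
      unfolding borel_prod using borel_measurable_continuous_onI[OF bc] by (simp only: case_prod_beta')
    have bm3 [measurable]: "(\<lambda>x. b (snd x) (snd (fst x))) \<in> borel_measurable ((borel \<Otimes>\<^sub>M borel) \<Otimes>\<^sub>M borel)"
    proof -
      have "(\<lambda>x. (snd x, snd (fst x))) \<in> ((borel \<Otimes>\<^sub>M borel) \<Otimes>\<^sub>M borel) \<rightarrow>\<^sub>M (borel \<Otimes>\<^sub>M borel :: (real \<times> real) measure)"
        by measurable
      from measurable_compose[OF this bm] show ?thesis by simp
    qed
    have bm2 [measurable]: "(\<lambda>x. b (snd x) (fst x)) \<in> borel_measurable (borel \<Otimes>\<^sub>M borel)"
    proof -
      have "(\<lambda>x. (snd x, fst x)) \<in> (borel \<Otimes>\<^sub>M borel) \<rightarrow>\<^sub>M (borel \<Otimes>\<^sub>M borel :: (real \<times> real) measure)"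
        by measurable
      from measurable_compose[OF this bm] show ?thesis by simp
    qed
    have bx: "continuous_on UNIV (\<lambda>x. b x \<theta>)" "continuous_on UNIV (b x)" for x \<theta>
    proof -
      have "continuous_on UNIV (\<lambda>x. (x, \<theta>))" "continuous_on UNIV (\<lambda>\<theta>. (x, \<theta>))" by (intro continuous_intros)+
      from continuous_on_compose2[OF bc this(1)] continuous_on_compose2[OF bc this(2)]
      show "continuous_on UNIV (\<lambda>x. b x \<theta>)" "continuous_on UNIV (b x)" by auto
    qed
    have [measurable]: "b x \<in> borel_measurable borel" "(\<lambda>x. b x \<theta>) \<in> borel_measurable borel" for x \<theta>
      by (auto intro: borel_measurable_continuous_onI bx)
    define A where "A x \<theta> = integral {a..x} (\<lambda>x. b x \<theta>)" for x \<theta>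
    have A: "ennreal (A x \<theta>) = (\<integral>\<^sup>+y. ennreal (b y \<theta>) \<partial>ivl a x)" for x \<theta>
    proof -
      have "((\<lambda>y. b y \<theta>) has_integral A x \<theta>) {a..x}" unfolding A_def
        by (intro integrable_integral integrable_continuous_interval continuous_on_subset[OF bx(1)]) auto
      from nn_integral_has_integral_lebesgue'[OF b0 this] show ?thesis by (subst nn_integral_ivl) auto
    qed
    have A0: "0 \<le> A x \<theta>" for x \<theta> unfolding A_def
      by (intro integral_nonneg integrable_continuous_interval continuous_on_subset[OF bx(1)] b0) auto
    \<comment> \<open>The condition \<open>y \<le> x\<close> is written as an indicator of
      \<open>y - x\<close>, which makes the integrand jointly measurable.\<close>
    have Aeq: "A x \<theta> = enn2real (\<integral>\<^sup>+y. ennreal (b y \<theta>) * indicator {a..} y * indicator {..0} (y - x) \<partial>lborel)" for x \<theta>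
    proof -
      have "(\<integral>\<^sup>+y. ennreal (b y \<theta>) \<partial>ivl a x) = (\<integral>\<^sup>+y. ennreal (b y \<theta>) * indicator {a..} y * indicator {..0} (y - x) \<partial>lborel)"
        by (subst nn_integral_ivl) (auto intro!: nn_integral_cong split: split_indicator)
      then show ?thesis using A[of x \<theta>] A0[of x \<theta>] by (metis enn2real_ennreal)
    qed
    have Am [measurable]: "(\<lambda>z. A (fst z) (snd z)) \<in> borel_measurable (borel \<Otimes>\<^sub>M borel)"
      unfolding Aeq by measurable
    have Am2 [measurable]: "A x \<in> borel_measurable borel" for x
      unfolding Aeq by measurable
    \<comment> \<open>Half of the gain \<delta>, multiplied by \<open>p\<close>, goes into the
      weight of \<open>Y\<close>; the other half makes the exponent in the Hoelder step for
      \<open>A\<close> smaller than -1.\<close>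
    define e where "e = p * \<delta> / 2"
    have e: "0 < e" using p \<delta> by (simp add: e_def)
    define Y where "Y x = enn2real (\<integral>\<^sup>+y. ennreal ((1 - y) powr (- e) * \<Gamma> y powr p) \<partial>ivl a x)" for x
    have YR: "(\<integral>\<^sup>+y. ennreal ((1 - y) powr (- e) * \<Gamma> y powr p) \<partial>ivl a x) \<le> ennreal ((1 - R) powr (- e)) * ennreal (G powr p)"
      if "x \<le> R" for x
    proof -
      have "(\<integral>\<^sup>+y. ennreal ((1 - y) powr (- e) * \<Gamma> y powr p) \<partial>ivl a x) =
        (\<integral>\<^sup>+y. ennreal ((1 - y) powr (- e) * \<Gamma> y powr p) * indicator {a..x} y \<partial>lborel)"
        by (rule nn_integral_ivl) measurable
      also have "\<dots> \<le> (\<integral>\<^sup>+y. ennreal ((1 - R) powr (- e)) * (ennreal (\<Gamma> y powr p) * indicator {a..R} y) \<partial>lborel)"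
      proof (intro nn_integral_mono)
        fix y
        show "ennreal ((1 - y) powr (- e) * \<Gamma> y powr p) * indicator {a..x} y \<le>
          ennreal ((1 - R) powr (- e)) * (ennreal (\<Gamma> y powr p) * indicator {a..R} y)"
        proof (cases "y \<in> {a..x}")
          case True
          then have "(1 - y) powr (- e) \<le> (1 - R) powr (- e)"
            using that aR e by (intro powr_mono2') auto
          then have "(1 - y) powr (- e) * \<Gamma> y powr p \<le> (1 - R) powr (- e) * \<Gamma> y powr p"
            by (intro mult_right_mono) auto
          then show ?thesis using True that by (simp add: ennreal_mult[symmetric] ennreal_leI)
        qed simp
      qed
      also have "\<dots> = ennreal ((1 - R) powr (- e)) * (\<integral>\<^sup>+y. ennreal (\<Gamma> y powr p) * indicator {a..R} y \<partial>lborel)"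
        by (rule nn_integral_cmult) measurable
      also have "(\<integral>\<^sup>+y. ennreal (\<Gamma> y powr p) * indicator {a..R} y \<partial>lborel) = (\<integral>\<^sup>+y. ennreal (\<Gamma> y powr p) \<partial>ivl a R)"
        by (rule nn_integral_ivl[symmetric]) measurable
      finally show ?thesis using \<Gamma>G by (meson mult_left_mono order_trans zero_le)
    qed
    have Y: "ennreal (Y x) = (\<integral>\<^sup>+y. ennreal ((1 - y) powr (- e) * \<Gamma> y powr p) \<partial>ivl a x)" if "x \<le> R" for x
      using YR[OF that] unfolding Y_def by (intro ennreal_enn2real) (auto simp: ennreal_mult[symmetric] intro: le_less_trans)
    have Y0: "0 \<le> Y x" for x by (simp add: Y_def)
    have Yeq: "Y x = enn2real (\<integral>\<^sup>+y. ennreal ((1 - y) powr (- e) * \<Gamma> y powr p) * indicator {a..} y * indicator {..0} (y - x) \<partial>lborel)" for x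
      unfolding Y_def by (subst nn_integral_ivl) (auto intro!: arg_cong[where f = enn2real] nn_integral_cong split: split_indicator)
    have Ym [measurable]: "Y \<in> borel_measurable borel" unfolding Yeq by measurable
    define E where "E x = M * (c1 * (1 - x) powr (- \<delta> / 2) * Y x powr (1 / p))" for x
    have E0: "0 \<le> E x" for x using M c1 by (simp add: E_def)
    have [measurable]: "E \<in> borel_measurable borel" unfolding E_def by measurable
    \<comment> \<open>Minkowski's inequality over \<open>y \<le> x\<close>, then Hoelder's
      inequality with the exponent split as \<open>1 / \<tau> - 1 = (- 1 / pc - \<delta> / 2) + (-
      \<delta> / 2)\<close>.\<close>
    have LA: "Lp_le \<tau> (A x) (E x)" if x: "a \<le> x" "x \<le> R" for x
    proof -
      have "(\<integral>\<^sup>+\<theta>. ennreal (A x \<theta> powr \<tau>) \<partial>circ) \<le> ennreal (E x powr \<tau>)"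
      proof (rule minkowski_integral_finite[OF \<tau>(1) finite_measure_ivl[of a x] circ.sigma_finite_measure_axioms,
          where W = "\<lambda>y. M * (1 - y) powr (1 / \<tau> - 1) * \<Gamma> y" and \<phi> = b])
        have "(\<integral>\<^sup>+y. ennreal (M * (1 - y) powr (1 / \<tau> - 1) * \<Gamma> y) \<partial>ivl a x) =
          (\<integral>\<^sup>+y. ennreal M * ennreal ((1 - y) powr (1 / \<tau> - 1) * \<Gamma> y) \<partial>ivl a x)"
          using M \<Gamma>0 by (intro nn_integral_cong) (simp add: ennreal_mult[symmetric] mult.assoc)
        also have "\<dots> = ennreal M * (\<integral>\<^sup>+y. ennreal ((1 - y) powr (1 / \<tau> - 1) * \<Gamma> y) \<partial>ivl a x)"
          by (rule nn_integral_cmult) measurable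
        also have "(\<integral>\<^sup>+y. ennreal ((1 - y) powr (1 / \<tau> - 1) * \<Gamma> y) \<partial>ivl a x) =
          (\<integral>\<^sup>+y. ennreal ((1 - y) powr (- 1 / pc - \<delta> / 2) * ((1 - y) powr (- \<delta> / 2) * \<Gamma> y)) \<partial>ivl a x)"
        proof (intro nn_integral_cong)
          have "1 / \<tau> - 1 = (- 1 / pc - \<delta> / 2) + (- \<delta> / 2)" using \<tau>(2) pc(4) by simp
          then show "ennreal ((1 - y) powr (1 / \<tau> - 1) * \<Gamma> y) =
             ennreal ((1 - y) powr (- 1 / pc - \<delta> / 2) * ((1 - y) powr (- \<delta> / 2) * \<Gamma> y))" for y
            by (simp only: powr_add mult.assoc)
        qed
        also have "\<dots> \<le> ennreal ((c1 * (1 - x) powr (- \<delta> / 2)) * Y x powr (1 / p))"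
        proof (rule nn_holder[OF pc(3,2)])
          have ex: "(- 1 / pc - \<delta> / 2) * pc = - 1 - \<delta> * pc / 2" using pc(3) by (simp add: left_diff_distrib)
          have "(\<integral>\<^sup>+y. ennreal (((1 - y) powr (- 1 / pc - \<delta> / 2)) powr pc) \<partial>ivl a x) =
            (\<integral>\<^sup>+y. ennreal ((1 - y) powr (- 1 - \<delta> * pc / 2)) \<partial>ivl a x)" by (simp only: powr_powr ex)
          also have "\<dots> \<le> ennreal ((1 - x) powr ((- 1 - \<delta> * pc / 2) + 1) / (- (- 1 - \<delta> * pc / 2) - 1))"
            using x aR \<delta> pc by (intro nn_integral_one_minus_powr) auto
          also have "(1 - x) powr ((- 1 - \<delta> * pc / 2) + 1) / (- (- 1 - \<delta> * pc / 2) - 1) =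
             (c1 * (1 - x) powr (- \<delta> / 2)) powr pc"
            using \<delta> pc(3) by (simp add: c1_def powr_mult powr_powr)
          finally show "(\<integral>\<^sup>+y. ennreal (((1 - y) powr (- 1 / pc - \<delta> / 2)) powr pc) \<partial>ivl a x)
             \<le> ennreal ((c1 * (1 - x) powr (- \<delta> / 2)) powr pc)" .
          have "- \<delta> / 2 * p = - e" by (simp add: e_def)
          then have "(\<integral>\<^sup>+y. ennreal (((1 - y) powr (- \<delta> / 2) * \<Gamma> y) powr p) \<partial>ivl a x) = ennreal (Y x)"
            unfolding Y[OF x(2)] using \<Gamma>0 by (simp only: powr_mult powr_powr powr_ge_zero)
          then show "(\<integral>\<^sup>+y. ennreal (((1 - y) powr (- \<delta> / 2) * \<Gamma> y) powr p) \<partial>ivl a x) \<le> ennreal ((Y x powr (1 / p)) powr p)"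
            using p Y0[of x] by (simp add: powr_powr)
        qed (use \<Gamma>0 c1 in auto)
        finally show "(\<integral>\<^sup>+y. ennreal (M * (1 - y) powr (1 / \<tau> - 1) * \<Gamma> y) \<partial>ivl a x) \<le> ennreal (E x)"
          using M c1 by (simp add: E_def ennreal_mult mult_left_mono)
        show "AE y in ivl a x. (\<integral>\<^sup>+\<theta>. ennreal (b y \<theta> powr \<tau>) \<partial>circ) \<le> ennreal ((M * (1 - y) powr (1 / \<tau> - 1) * \<Gamma> y) powr \<tau>)"
        proof (intro eventually_mono[OF AE_ivl])
          fix y assume "a \<le> y \<and> y \<le> x"
          then show "(\<integral>\<^sup>+\<theta>. ennreal (b y \<theta> powr \<tau>) \<partial>circ) \<le> ennreal ((M * (1 - y) powr (1 / \<tau> - 1) * \<Gamma> y) powr \<tau>)"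
            using bt[of y] x b0 by (auto simp: Lp_le_def)
        qed
        show "(\<lambda>(x, y). b x y) \<in> borel_measurable (ivl a x \<Otimes>\<^sub>M circ)"
          unfolding split_beta by measurable
      qed (use M \<Gamma>0 b0 A A0 E0 in auto)
      then show ?thesis using E0 A0 by (simp add: Lp_le_def)
    qed
    have each: "(\<integral>\<^sup>+\<theta>. ennreal (b x \<theta> * A x \<theta> powr (p - 1)) \<partial>circ) \<le>
        ennreal (M * (1 - x) powr (1 / \<sigma> - 1) * \<Gamma> x * E x powr (p - 1))" if x: "a \<le> x" "x \<le> R" for x
    proof (rule nn_holder[OF \<sigma>(1) sc(1)])
      show "(\<integral>\<^sup>+\<theta>. ennreal (b x \<theta> powr \<sigma>) \<partial>circ) \<le> ennreal ((M * (1 - x) powr (1 / \<sigma> - 1) * \<Gamma> x) powr \<sigma>)"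
        using bs[OF x] b0 by (simp add: Lp_le_def)
      show "(\<integral>\<^sup>+\<theta>. ennreal ((A x \<theta> powr (p - 1)) powr sc) \<partial>circ) \<le> ennreal ((E x powr (p - 1)) powr sc)"
        using LA[OF x] A0 by (simp add: Lp_le_def powr_powr sct)
    qed (use M \<Gamma>0 b0 in auto)
    \<comment> \<open>The total power of \<open>1 - x\<close> is \<open>e - 1\<close>, integrable up
      to the boundary. After exchanging the order, the integral over \<open>x\<close> from
      \<open>y\<close> to \<open>R\<close> is at most \<open>(1 - y) powr e / e\<close>, which
      cancels the weight in \<open>Y\<close>.\<close>
    have Ep: "(\<integral>\<^sup>+x. ennreal (((1 - x) powr (1 / \<sigma> - 1) * E x powr (p - 1)) powr pc) \<partial>ivl a R) \<le> ennreal ((M powr p * c2 * G powr p))"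
    proof -
      have exs: "(1 / \<sigma> - 1) * pc = e + e - 1"
      proof -
        have "(1 / \<sigma> - 1) * pc = (p - 1) * \<delta> * pc - (1 / pc) * pc" unfolding \<sigma>(2) pc(4) by (simp add: algebra_simps)
        also have "(p - 1) * \<delta> * pc = p * \<delta>" using pc(5) by (simp add: mult_ac)
        finally show ?thesis using pc(3) by (simp add: e_def)
      qed
      have pt: "((1 - x) powr (1 / \<sigma> - 1) * E x powr (p - 1)) powr pc = (M powr p * c1 powr p) * ((1 - x) powr (e - 1) * Y x)"
        if "x \<le> R" for x
      proof -
        have "((1 - x) powr (1 / \<sigma> - 1) * E x powr (p - 1)) powr pc = (1 - x) powr (e + e - 1) * E x powr p"
          using pc(5) by (simp add: powr_mult powr_powr exs mult.commute[of "p - 1"])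
        also have "E x powr p = M powr p * (c1 powr p * ((1 - x) powr (- e) * Y x))"
        proof -
          have "- \<delta> / 2 * p = - e" by (simp add: e_def)
          then show ?thesis unfolding E_def using M c1 Y0[of x] p
            by (simp add: powr_mult powr_powr)
        qed
        also have "(1 - x) powr (e + e - 1) * (M powr p * (c1 powr p * ((1 - x) powr (- e) * Y x))) =
          (M powr p * c1 powr p) * (((1 - x) powr (e + e - 1) * (1 - x) powr (- e)) * Y x)" by simp
        also have "(1 - x) powr (e + e - 1) * (1 - x) powr (- e) = (1 - x) powr (e - 1)"
          by (simp flip: powr_add)
        finally show ?thesis .
      qed
      have "(\<integral>\<^sup>+x. ennreal (((1 - x) powr (1 / \<sigma> - 1) * E x powr (p - 1)) powr pc) \<partial>ivl a R) =
        (\<integral>\<^sup>+x. ennreal (M powr p * c1 powr p) * ennreal ((1 - x) powr (e - 1) * Y x) \<partial>ivl a R)"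
        using M c1 Y0 by (intro nn_integral_cong_AE eventually_mono[OF AE_ivl]) (simp add: pt ennreal_mult[symmetric])
      also have "\<dots> = ennreal (M powr p * c1 powr p) * (\<integral>\<^sup>+x. ennreal ((1 - x) powr (e - 1) * Y x) \<partial>ivl a R)"
        by (rule nn_integral_cmult) measurable
      also have "(\<integral>\<^sup>+x. ennreal ((1 - x) powr (e - 1) * Y x) \<partial>ivl a R) \<le> ennreal (1 / e) * ennreal (G powr p)"
      proof -
        have "(\<integral>\<^sup>+x. ennreal ((1 - x) powr (e - 1) * Y x) \<partial>ivl a R) =
          (\<integral>\<^sup>+x. ennreal ((1 - x) powr (e - 1) * Y x) * indicator {a..R} x \<partial>lborel)"
          by (rule nn_integral_ivl) measurable
        also have "\<dots> = (\<integral>\<^sup>+x. (\<integral>\<^sup>+y. ennreal ((1 - x) powr (e - 1)) * indicator {a..R} x *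
            (ennreal ((1 - y) powr (- e) * \<Gamma> y powr p) * indicator {a..} y * indicator {..0} (y - x)) \<partial>lborel) \<partial>lborel)"
        proof (intro nn_integral_cong)
          fix x
          have "ennreal ((1 - x) powr (e - 1) * Y x) * indicator {a..R} x =
            ennreal ((1 - x) powr (e - 1)) * indicator {a..R} x * (\<integral>\<^sup>+y. ennreal ((1 - y) powr (- e) * \<Gamma> y powr p) \<partial>ivl a x)"
            using Y Y0 by (cases "x \<in> {a..R}") (auto simp: ennreal_mult)
          also have "(\<integral>\<^sup>+y. ennreal ((1 - y) powr (- e) * \<Gamma> y powr p) \<partial>ivl a x) =
             (\<integral>\<^sup>+y. ennreal ((1 - y) powr (- e) * \<Gamma> y powr p) * indicator {a..} y * indicator {..0} (y - x) \<partial>lborel)"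
            by (subst nn_integral_ivl) (auto intro!: nn_integral_cong split: split_indicator)
          finally show "ennreal ((1 - x) powr (e - 1) * Y x) * indicator {a..R} x =
            (\<integral>\<^sup>+y. ennreal ((1 - x) powr (e - 1)) * indicator {a..R} x *
            (ennreal ((1 - y) powr (- e) * \<Gamma> y powr p) * indicator {a..} y * indicator {..0} (y - x)) \<partial>lborel)"
            by (simp add: nn_integral_cmult)
        qed
        also have "\<dots> = (\<integral>\<^sup>+y. (\<integral>\<^sup>+x. ennreal ((1 - x) powr (e - 1)) * indicator {a..R} x *
            (ennreal ((1 - y) powr (- e) * \<Gamma> y powr p) * indicator {a..} y * indicator {..0} (y - x)) \<partial>lborel) \<partial>lborel)"
          by (rule lborel_pair.Fubini'[symmetric]) measurable
        also have "\<dots> \<le> (\<integral>\<^sup>+y. ennreal (1 / e) * (ennreal (\<Gamma> y powr p) * indicator {a..R} y) \<partial>lborel)"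
        proof (intro nn_integral_mono)
          fix y
          show "(\<integral>\<^sup>+x. ennreal ((1 - x) powr (e - 1)) * indicator {a..R} x *
            (ennreal ((1 - y) powr (- e) * \<Gamma> y powr p) * indicator {a..} y * indicator {..0} (y - x)) \<partial>lborel) \<le>
            ennreal (1 / e) * (ennreal (\<Gamma> y powr p) * indicator {a..R} y)"
          proof (cases "a \<le> y \<and> y \<le> R")
            case True
            have "(\<integral>\<^sup>+x. ennreal ((1 - x) powr (e - 1)) * indicator {a..R} x *
              (ennreal ((1 - y) powr (- e) * \<Gamma> y powr p) * indicator {a..} y * indicator {..0} (y - x)) \<partial>lborel) =
              (\<integral>\<^sup>+x. ennreal ((1 - y) powr (- e) * \<Gamma> y powr p) * (ennreal ((1 - x) powr (e - 1)) * indicator {y..R} x) \<partial>lborel)"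
              using True by (intro nn_integral_cong) (auto simp: mult_ac split: split_indicator)
            also have "\<dots> = ennreal ((1 - y) powr (- e) * \<Gamma> y powr p) * (\<integral>\<^sup>+x. ennreal ((1 - x) powr (e - 1)) * indicator {y..R} x \<partial>lborel)"
              by (rule nn_integral_cmult) measurable
            also have "\<dots> \<le> ennreal ((1 - y) powr (- e) * \<Gamma> y powr p) * ennreal ((1 - y) powr e / e)"
              using True aR e by (intro mult_left_mono nn_integral_one_minus_powr_upper) auto
            also have "\<dots> = ennreal (((1 - y) powr (- e) * (1 - y) powr e) * (1 / e * \<Gamma> y powr p))"
              using e by (simp add: ennreal_mult[symmetric] mult_ac)
            also have "(1 - y) powr (- e) * (1 - y) powr e = 1" using True aR by (simp flip: powr_add)
            finally show ?thesis using True e by (simp add: ennreal_mult[symmetric])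
          next
            case False
            then have "(\<integral>\<^sup>+x. ennreal ((1 - x) powr (e - 1)) * indicator {a..R} x *
              (ennreal ((1 - y) powr (- e) * \<Gamma> y powr p) * indicator {a..} y * indicator {..0} (y - x)) \<partial>lborel) = (\<integral>\<^sup>+x. 0 \<partial>(lborel :: real measure))"
              by (intro nn_integral_cong) (auto split: split_indicator)
            then show ?thesis by simp
          qed
        qed
        also have "\<dots> = ennreal (1 / e) * (\<integral>\<^sup>+y. ennreal (\<Gamma> y powr p) * indicator {a..R} y \<partial>lborel)"
          by (rule nn_integral_cmult) measurable
        also have "(\<integral>\<^sup>+y. ennreal (\<Gamma> y powr p) * indicator {a..R} y \<partial>lborel) = (\<integral>\<^sup>+y. ennreal (\<Gamma> y powr p) \<partial>ivl a R)"
          by (rule nn_integral_ivl[symmetric]) measurable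
        finally show ?thesis using \<Gamma>G by (meson mult_left_mono order_trans zero_le)
      qed
      finally have "(\<integral>\<^sup>+x. ennreal (((1 - x) powr (1 / \<sigma> - 1) * E x powr (p - 1)) powr pc) \<partial>ivl a R) \<le>
        ennreal (M powr p * c1 powr p) * (ennreal (1 / e) * ennreal (G powr p))" by (simp add: mult_left_mono)
      also have "\<dots> = ennreal (M powr p * c2 * G powr p)"
        using e by (simp add: ennreal_mult[symmetric] c2_def e_def mult_ac)
      finally show ?thesis .
    qed
    interpret I: finite_measure "ivl a R" by (rule finite_measure_ivl)
    interpret P: pair_sigma_finite "ivl a R" circ ..
    have "(\<integral>\<^sup>+\<theta>. ennreal (A R \<theta> powr p) \<partial>circ) = (\<integral>\<^sup>+\<theta>. (\<integral>\<^sup>+x. ennreal (p * (b x \<theta> * A x \<theta> powr (p - 1))) \<partial>ivl a R) \<partial>circ)"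
      unfolding A_def by (intro nn_integral_cong powr_integral_FTC bx b0 p aR)
    also have "\<dots> = (\<integral>\<^sup>+x. (\<integral>\<^sup>+\<theta>. ennreal (p * (b x \<theta> * A x \<theta> powr (p - 1))) \<partial>circ) \<partial>ivl a R)"
      by (rule P.Fubini') (unfold split_beta, measurable)
    also have "\<dots> \<le> (\<integral>\<^sup>+x. ennreal (p * M) * ennreal (\<Gamma> x * ((1 - x) powr (1 / \<sigma> - 1) * E x powr (p - 1))) \<partial>ivl a R)"
    proof (intro nn_integral_mono_AE eventually_mono[OF AE_ivl])
      fix x assume x: "a \<le> x \<and> x \<le> R"
      have "(\<integral>\<^sup>+\<theta>. ennreal (p * (b x \<theta> * A x \<theta> powr (p - 1))) \<partial>circ) = ennreal p * (\<integral>\<^sup>+\<theta>. ennreal (b x \<theta> * A x \<theta> powr (p - 1)) \<partial>circ)"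
        using p b0 by (subst nn_integral_cmult[symmetric]) (auto simp: ennreal_mult)
      also have "\<dots> \<le> ennreal p * ennreal (M * (1 - x) powr (1 / \<sigma> - 1) * \<Gamma> x * E x powr (p - 1))"
        using x by (intro mult_left_mono each) auto
      also have "\<dots> = ennreal (p * M) * ennreal (\<Gamma> x * ((1 - x) powr (1 / \<sigma> - 1) * E x powr (p - 1)))"
        using p M \<Gamma>0[of x] by (simp add: ennreal_mult[symmetric] mult_ac)
      finally show "(\<integral>\<^sup>+\<theta>. ennreal (p * (b x \<theta> * A x \<theta> powr (p - 1))) \<partial>circ) \<le>
        ennreal (p * M) * ennreal (\<Gamma> x * ((1 - x) powr (1 / \<sigma> - 1) * E x powr (p - 1)))" .
    qed
    also have "\<dots> = ennreal (p * M) * (\<integral>\<^sup>+x. ennreal (\<Gamma> x * ((1 - x) powr (1 / \<sigma> - 1) * E x powr (p - 1))) \<partial>ivl a R)"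
      by (rule nn_integral_cmult) measurable
    also have "\<dots> \<le> ennreal (p * M) * ennreal (G * (M powr p * c2 * G powr p) powr (1 / pc))"
    proof (rule mult_left_mono)
      show "(\<integral>\<^sup>+x. ennreal (\<Gamma> x * ((1 - x) powr (1 / \<sigma> - 1) * E x powr (p - 1))) \<partial>ivl a R) \<le>
        ennreal (G * (M powr p * c2 * G powr p) powr (1 / pc))"
      proof (rule nn_holder[OF p pc(1)])
      show "(\<integral>\<^sup>+x. ennreal (((1 - x) powr (1 / \<sigma> - 1) * E x powr (p - 1)) powr pc) \<partial>ivl a R) \<le>
        ennreal (((M powr p * c2 * G powr p) powr (1 / pc)) powr pc)"
        using Ep pc(3) c2 by (simp add: powr_powr)
      qed (use \<Gamma>0 \<Gamma>G G in auto)
    qed simp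
    also have "\<dots> = ennreal ((C * M * G) powr p)"
    proof -
      have ppc: "p * (1 / pc) = p - 1" unfolding pc(4) using p by (simp add: field_simps)
      have "(M powr p * c2 * G powr p) powr (1 / pc) = M powr (p - 1) * c2 powr (1 / pc) * G powr (p - 1)"
        using c2 by (simp only: powr_mult powr_powr ppc powr_ge_zero mult_nonneg_nonneg less_imp_le)
      then have "p * M * (G * (M powr p * c2 * G powr p) powr (1 / pc)) =
        (p * c2 powr (1 / pc)) * (M * M powr (p - 1)) * (G * G powr (p - 1))" by simp
      also have "M * M powr (p - 1) = M powr p" using M powr_add[of M 1 "p - 1"] by simp
      also have "G * G powr (p - 1) = G powr p" using G p powr_add[of G 1 "p - 1"] by (cases "G = 0") auto
      also have "(p * c2 powr (1 / pc)) * M powr p * G powr p = (C * M * G) powr p"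
        using C M G by (simp add: powr_mult)
      finally show ?thesis using p M G by (simp add: ennreal_mult[symmetric])
    qed
    finally show "Lp_le p (\<lambda>\<theta>. integral {a..R} (\<lambda>x. b x \<theta>)) (C * M * G)"
      using A0[of R] C M G by (simp add: Lp_le_def A_def)
  qed
qed

section \<open>Self-improvement of the derivative bound\<close>

text \<open>Poisson's formula from radius \<open>r = sqrt s\<close>: the kernel has mass 1 and is at
  most \<open>2 / (1 - r)\<close>, so its norm in the conjugate exponent is at most
  \<open>(2 / (1 - r)) powr (1 / q)\<close>. This lowers the exponent \<open>1 / q - 1\<close> of
  \<open>1 - r\<close> to -1. The 4 collects \<open>2 powr (1 / q) \<le> 2\<close> and
  \<open>1 - s \<le> 2 * (1 - r)\<close>.\<close>

lemma deriv_pointwise_bound: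
  fixes q :: real
  assumes q: "1 < q" and g: "g holomorphic_on ball 0 1" and C0: "0 < C0"
    and F: "\<And>s. 0 \<le> s \<Longrightarrow> s < 1 \<Longrightarrow> Lp_le q (\<lambda>\<theta>. g (of_real s * cis \<theta>)) (C0 * (1 - s) powr (1 / q - 1))"
    and s: "0 < s" "s < 1"
  shows "cmod (g (of_real s * cis t)) \<le> 4 * C0 / (1 - s)"
proof -
  define r where "r = sqrt s"
  have r: "0 < r" "r < 1" "r * r = s" using s by (auto simp: r_def)
  define qc where "qc = q / (q - 1)"
  have qc: "1 / qc + 1 / q = 1" "1 < qc" "(qc - 1) * (1 / qc) = 1 / q" using q by (auto simp: qc_def field_simps)
  define P where "P x = (1 - r\<^sup>2) / (cmod (1 - of_real r * cis (t - x)))\<^sup>2" for x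
  have [measurable]: "P \<in> borel_measurable borel" unfolding P_def by measurable
  have r2: "0 < 1 - r\<^sup>2" using r s by (simp add: power2_eq_square)
  have P0: "0 \<le> P x" for x using r2 by (simp add: P_def)
  have Pb: "P x \<le> 2 / (1 - r)" for x
  proof -
    have "(1 - r)\<^sup>2 \<le> (cmod (1 - of_real r * cis (t - x)))\<^sup>2"
      using r one_minus_le_cmod[of r "t - x"] by (intro power_mono) auto
    then have "P x \<le> (1 - r\<^sup>2) / (1 - r)\<^sup>2"
      unfolding P_def using r r2 by (intro divide_left_mono mult_pos_pos) auto
    also have "(1 - r\<^sup>2) / (1 - r)\<^sup>2 = (1 + r) / (1 - r)"
    proof -
      have "1 - r\<^sup>2 = (1 + r) * (1 - r)" by (simp add: power2_eq_square algebra_simps)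
      then show ?thesis unfolding power2_eq_square[of "1 - r"] using r by simp
    qed
    also have "\<dots> \<le> 2 / (1 - r)" using r by (intro divide_right_mono) auto
    finally show ?thesis .
  qed
  have PI: "(\<integral>\<^sup>+x. ennreal (P x) \<partial>circ) = 1"
  proof -
    define P' where "P' x = ennreal ((1 - r\<^sup>2) / (cmod (1 - of_real r * cis x))\<^sup>2)" for x
    have [measurable]: "P' \<in> borel_measurable borel" unfolding P'_def by measurable
    have "cmod (1 - of_real r * cis (t - x)) = cmod (1 - of_real r * cis (x + - t))" for x
    proof -
      have "1 - of_real r * cis (t - x) = cnj (1 - of_real r * cis (x + - t))" by (simp add: cis_cnj)
      then show ?thesis by (simp only: complex_mod_cnj)
    qed
    then have "(\<integral>\<^sup>+x. ennreal (P x) \<partial>circ) = (\<integral>\<^sup>+x. P' (x + - t) \<partial>circ)" by (simp only: P_def P'_def)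
    also have "\<dots> = (\<integral>\<^sup>+x. P' x \<partial>circ)"
      by (rule nn_integral_circ_shift) (auto simp: P'_def cis_mult[symmetric])
    also have "\<dots> = 1" unfolding P'_def using r by (intro poisson_kernel_integral) auto
    finally show ?thesis .
  qed
  have Pq: "(\<integral>\<^sup>+x. ennreal (P x powr qc) \<partial>circ) \<le> ennreal (((2 / (1 - r)) powr (1 / q)) powr qc)"
  proof -
    have "(\<integral>\<^sup>+x. ennreal (P x powr qc) \<partial>circ) \<le> (\<integral>\<^sup>+x. ennreal ((2 / (1 - r)) powr (qc - 1)) * ennreal (P x) \<partial>circ)"
    proof (intro nn_integral_mono)
      fix x
      have "P x powr qc = P x powr (qc - 1) * P x"
        using P0[of x] powr_add[of "P x" "qc - 1" 1] by (cases "P x = 0") auto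
      also have "\<dots> \<le> (2 / (1 - r)) powr (qc - 1) * P x"
        using P0 Pb qc by (intro mult_right_mono powr_mono2) auto
      finally show "ennreal (P x powr qc) \<le> ennreal ((2 / (1 - r)) powr (qc - 1)) * ennreal (P x)"
        using P0 by (simp add: ennreal_mult[symmetric] ennreal_leI)
    qed
    also have "\<dots> = ennreal ((2 / (1 - r)) powr (qc - 1))"
      by (subst nn_integral_cmult) (auto simp: PI)
    also have "qc - 1 = 1 / q * qc" using qc by (simp add: field_simps)
    finally show ?thesis by (simp add: powr_powr)
  qed
  have cont: "continuous_on UNIV (\<lambda>x. g (of_real r * cis x))"
    using r by (intro continuous_on_circle_radius holomorphic_on_imp_continuous_on g) auto
  have [measurable]: "(\<lambda>x. cmod (g (of_real r * cis x))) \<in> borel_measurable borel"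
    by (intro borel_measurable_continuous_onI continuous_intros cont)
  have "ennreal (cmod (g (of_real s * cis t))) \<le> (\<integral>\<^sup>+x. ennreal (P x * cmod (g (of_real r * cis x))) \<partial>circ)"
    using poisson_le[OF g, of r r t] r by (simp add: P_def)
  also have "\<dots> \<le> ennreal ((2 / (1 - r)) powr (1 / q) * (C0 * (1 - r) powr (1 / q - 1)))"
    by (rule nn_holder[OF qc(2,1)]) (use Pq F[of r] r P0 in \<open>auto simp: Lp_le_def\<close>)
  also have "(2 / (1 - r)) powr (1 / q) * (C0 * (1 - r) powr (1 / q - 1)) = 2 powr (1 / q) * C0 / (1 - r)"
    using r by (simp add: powr_divide powr_diff)
  also have "\<dots> \<le> 2 * C0 / (1 - r)"
    using r C0 q powr_mono[of "1 / q" 1 2] by (intro divide_right_mono mult_right_mono) auto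
  also have "\<dots> \<le> 4 * C0 / (1 - s)"
  proof -
    have "1 - s = (1 + r) * (1 - r)" using r(3) by (simp add: algebra_simps)
    also have "\<dots> \<le> 2 * (1 - r)" using r by (intro mult_right_mono) auto
    finally have "1 - s \<le> 2 * (1 - r)" .
    then have "4 * C0 / (2 * (1 - r)) \<le> 4 * C0 / (1 - s)" using C0 s r by (intro divide_left_mono) auto
    moreover have "2 * C0 / (1 - r) = 4 * C0 / (2 * (1 - r))" using r by (simp add: field_simps)
    ultimately show ?thesis by simp
  qed
  finally have "ennreal (cmod (g (of_real s * cis t))) \<le> ennreal (4 * C0 / (1 - s))" by (simp add: ennreal_leI)
  then show ?thesis using C0 s by (simp add: ennreal_le_iff)
qed

text \<open>Interpolation between the given exponent and the pointwise bound: the power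
  \<open>\<sigma> - q\<close> of the modulus is estimated in the supremum norm, the power
  \<open>q\<close> in the mean.\<close>

lemma deriv_bound_higher:
  fixes q \<sigma> :: real
  assumes q: "1 < q" "q \<le> \<sigma>" and g: "g holomorphic_on ball 0 1" and C0: "0 < C0"
    and F: "\<And>s. 0 \<le> s \<Longrightarrow> s < 1 \<Longrightarrow> Lp_le q (\<lambda>\<theta>. g (of_real s * cis \<theta>)) (C0 * (1 - s) powr (1 / q - 1))"
    and s: "0 < s" "s < 1"
  shows "Lp_le \<sigma> (\<lambda>\<theta>. g (of_real s * cis \<theta>)) (4 * C0 * (1 - s) powr (1 / \<sigma> - 1))"
proof -
  define K where "K = 4 * C0"
  have K: "0 < K" using C0 by (simp add: K_def)
  have pt: "cmod (g (of_real s * cis t)) \<le> K / (1 - s)" for t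
    using deriv_pointwise_bound[OF q(1) g C0 F s] by (simp add: K_def)
  have cont: "continuous_on UNIV (\<lambda>x. g (of_real s * cis x))"
    using s by (intro continuous_on_circle_radius holomorphic_on_imp_continuous_on g) auto
  have [measurable]: "(\<lambda>x. cmod (g (of_real s * cis x))) \<in> borel_measurable borel"
    by (intro borel_measurable_continuous_onI continuous_intros cont)
  have "(\<integral>\<^sup>+t. ennreal (cmod (g (of_real s * cis t)) powr \<sigma>) \<partial>circ) \<le>
    (\<integral>\<^sup>+t. ennreal ((K / (1 - s)) powr (\<sigma> - q)) * ennreal (cmod (g (of_real s * cis t)) powr q) \<partial>circ)"
  proof (intro nn_integral_mono)
    fix t
    have "cmod (g (of_real s * cis t)) powr \<sigma> = cmod (g (of_real s * cis t)) powr (\<sigma> - q) * cmod (g (of_real s * cis t)) powr q"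
      by (simp flip: powr_add)
    also have "\<dots> \<le> (K / (1 - s)) powr (\<sigma> - q) * cmod (g (of_real s * cis t)) powr q"
      using pt q by (intro mult_right_mono powr_mono2) auto
    finally show "ennreal (cmod (g (of_real s * cis t)) powr \<sigma>) \<le>
      ennreal ((K / (1 - s)) powr (\<sigma> - q)) * ennreal (cmod (g (of_real s * cis t)) powr q)"
      by (simp add: ennreal_mult[symmetric] ennreal_leI)
  qed
  also have "\<dots> = ennreal ((K / (1 - s)) powr (\<sigma> - q)) * (\<integral>\<^sup>+t. ennreal (cmod (g (of_real s * cis t)) powr q) \<partial>circ)"
    by (rule nn_integral_cmult) measurable
  also have "\<dots> \<le> ennreal ((K / (1 - s)) powr (\<sigma> - q)) * ennreal ((K * (1 - s) powr (1 / q - 1)) powr q)"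
  proof (rule mult_left_mono)
    have "(\<integral>\<^sup>+t. ennreal (cmod (g (of_real s * cis t)) powr q) \<partial>circ) \<le> ennreal ((C0 * (1 - s) powr (1 / q - 1)) powr q)"
      using F[of s] s by (simp add: Lp_le_def)
    also have "\<dots> \<le> ennreal ((K * (1 - s) powr (1 / q - 1)) powr q)"
      using C0 q by (intro ennreal_leI powr_mono2 mult_right_mono) (auto simp: K_def)
    finally show "(\<integral>\<^sup>+t. ennreal (cmod (g (of_real s * cis t)) powr q) \<partial>circ) \<le> ennreal ((K * (1 - s) powr (1 / q - 1)) powr q)" .
  qed simp
  also have "\<dots> = ennreal ((K * (1 - s) powr (1 / \<sigma> - 1)) powr \<sigma>)"
  proof -
    have e: "(1 / q - 1) * q = 1 - q" "(1 / \<sigma> - 1) * \<sigma> = 1 - \<sigma>" using q by (auto simp: left_diff_distrib)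
    have "(K / (1 - s)) powr (\<sigma> - q) = K powr (\<sigma> - q) * (1 - s) powr (- (\<sigma> - q))"
      using K s by (simp add: powr_divide powr_minus_divide del: minus_diff_eq)
    moreover have "(K * (1 - s) powr (1 / q - 1)) powr q = K powr q * (1 - s) powr (1 - q)"
      using K by (simp only: powr_mult powr_powr e)
    ultimately have "(K / (1 - s)) powr (\<sigma> - q) * (K * (1 - s) powr (1 / q - 1)) powr q =
      (K powr (\<sigma> - q) * K powr q) * ((1 - s) powr (- (\<sigma> - q)) * (1 - s) powr (1 - q))"
      by (simp only: mult_ac)
    also have "\<dots> = (K * (1 - s) powr (1 / \<sigma> - 1)) powr \<sigma>"
      using K s by (simp add: powr_mult powr_powr e flip: powr_add)
    finally show ?thesis by (simp add: ennreal_mult[symmetric])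
  qed
  finally show ?thesis using K by (simp add: Lp_le_def K_def)
qed

text \<open>The derivative bound improves to all exponents from \<open>q\<close> on, in particular
  to \<sigma> below \<open>p\<close> and \<tau> above \<open>p\<close>, and the superposition lemma
  applies with \<open>cesaro_mean f\<close> as \<Gamma>. Taking moduli is affordable because the gap
  between \<open>q\<close> and \<open>p\<close> provides the gain \<delta>.\<close>

lemma rhaly_bounded_gt:
  fixes p q :: real
  assumes q: "1 < q" "q < p" and \<eta>: "analytic_in_disc (Abs_fps \<eta>)" and C0: "0 < C0"
    and F: "\<And>s. 0 \<le> s \<Longrightarrow> s < 1 \<Longrightarrow>
      Lp_le q (\<lambda>\<theta>. deriv (symbol_fun \<eta>) (of_real s * cis \<theta>)) (C0 * (1 - s) powr (1 / q - 1))"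
  shows "rhaly_bounded p \<eta>"
proof -
  have p: "1 < p" using q by simp
  \<comment> \<open>The first bound keeps \<open>1 / \<tau> = 1 / p - \<delta>\<close> positive; the
    second keeps \<open>1 / \<sigma>\<close> at most \<open>1 / q\<close>, that is,
    \<open>q \<le> \<sigma>\<close>.\<close>
  define \<delta> where "\<delta> = min (1 / (2 * p)) ((1 / q - 1 / p) / (p - 1))"
  have iq: "1 / p < 1 / q" using q by (intro divide_strict_left_mono) auto
  have \<delta>: "0 < \<delta>" "\<delta> \<le> 1 / (2 * p)" "\<delta> \<le> (1 / q - 1 / p) / (p - 1)" using p iq by (auto simp: \<delta>_def)
  define \<sigma> where "\<sigma> = 1 / (1 / p + (p - 1) * \<delta>)"
  define \<tau> where "\<tau> = 1 / (1 / p - \<delta>)"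
  have pos\<sigma>: "0 < 1 / p + (p - 1) * \<delta>" using p \<delta> by (intro add_pos_pos) auto
  have "1 / (2 * p) < 1 / p" using p by (intro divide_strict_left_mono) auto
  then have pos\<tau>: "0 < 1 / p - \<delta>" using \<delta>(2) by linarith
  have \<sigma>: "1 / \<sigma> = 1 / p + (p - 1) * \<delta>" "q \<le> \<sigma>" "1 < \<sigma>"
  proof -
    show "1 / \<sigma> = 1 / p + (p - 1) * \<delta>" by (simp add: \<sigma>_def)
    have "(p - 1) * \<delta> \<le> 1 / q - 1 / p" using \<delta>(3) p by (simp add: field_simps)
    then have "1 / (1 / q) \<le> \<sigma>" unfolding \<sigma>_def using pos\<sigma> q by (intro divide_left_mono) auto
    then show "q \<le> \<sigma>" by simp
    then show "1 < \<sigma>" using q by simp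
  qed
  have \<tau>: "1 / \<tau> = 1 / p - \<delta>" "q \<le> \<tau>" "1 < \<tau>"
  proof -
    show "1 / \<tau> = 1 / p - \<delta>" by (simp add: \<tau>_def)
    have "1 / (1 / p) \<le> \<tau>" unfolding \<tau>_def using pos\<tau> p \<delta> by (intro divide_left_mono) auto
    then show "q \<le> \<tau>" using q by simp
    then show "1 < \<tau>" using q by simp
  qed
  obtain C where C: "0 < C"
    "\<And>(b :: real \<Rightarrow> real \<Rightarrow> real) a R \<Gamma> M G. continuous_on UNIV (\<lambda>(x, \<theta>). b x \<theta>) \<Longrightarrow> (\<And>x \<theta>. 0 \<le> b x \<theta>) \<Longrightarrow> a \<le> R \<Longrightarrow> R < 1 \<Longrightarrow>
       \<Gamma> \<in> borel_measurable borel \<Longrightarrow> (\<And>x. 0 \<le> \<Gamma> x) \<Longrightarrow> 0 < M \<Longrightarrow> 0 \<le> G \<Longrightarrow>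
       (\<And>x. a \<le> x \<Longrightarrow> x \<le> R \<Longrightarrow> Lp_le \<sigma> (b x) (M * (1 - x) powr (1 / \<sigma> - 1) * \<Gamma> x)) \<Longrightarrow>
       (\<And>x. a \<le> x \<Longrightarrow> x \<le> R \<Longrightarrow> Lp_le \<tau> (b x) (M * (1 - x) powr (1 / \<tau> - 1) * \<Gamma> x)) \<Longrightarrow>
       (\<integral>\<^sup>+x. ennreal (\<Gamma> x powr p) \<partial>ivl a R) \<le> ennreal (G powr p) \<Longrightarrow>
       Lp_le p (\<lambda>\<theta>. integral {a..R} (\<lambda>x. b x \<theta>)) (C * M * G)"
    using positive_superposition[OF p \<delta>(1) \<sigma>(3,1) \<tau>(3,1)] by blast
  obtain C1 where C1: "0 < C1"
    "\<And>f N R. f holomorphic_on ball 0 1 \<Longrightarrow> 0 < R \<Longrightarrow> R < 1 \<Longrightarrow>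
       Lp_le p (\<lambda>t. f (of_real R * cis t)) N \<Longrightarrow>
       (\<integral>\<^sup>+r. ennreal (cesaro_mean f r powr p) * indicator {0..<R} r \<partial>lborel) \<le> ennreal ((C1 * N) powr p)"
    using cesaro_mean_Lp[OF p] by blast
  obtain K0 where K0: "0 < K0"
    "\<And>f \<theta>. f \<in> hardy_space p \<Longrightarrow> cmod (rhaly \<eta> f (of_real (1 / 16) * cis \<theta>)) \<le> K0 * hardy_norm p f"
    by (rule rhaly_small_radius[OF \<eta> p], rule that; assumption)
  define \<eta>' where "\<eta>' n = of_nat n * \<eta> n" for n
  have \<eta>': "analytic_in_disc (Abs_fps \<eta>')" unfolding \<eta>'_def by (rule analytic_euler[OF \<eta>])
  have sh: "symbol_fun \<eta> holomorphic_on ball 0 1"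
    unfolding symbol_fun_def by (rule holomorphic_eval_fps_disc[OF \<eta>])
  have sh': "symbol_fun \<eta>' holomorphic_on ball 0 1"
    unfolding symbol_fun_def by (rule holomorphic_eval_fps_disc[OF \<eta>'])
  have dsh: "deriv (symbol_fun \<eta>) holomorphic_on ball 0 1" using sh by (intro holomorphic_intros) auto
  define M where "M = 4 * C0"
  have M: "0 < M" using C0 by (simp add: M_def)
  have S: "Lp_le \<kappa> (\<lambda>\<theta>. symbol_fun \<eta>' (of_real s * cis \<theta>)) (M * (1 - s) powr (1 / \<kappa> - 1))"
    if "q \<le> \<kappa>" "0 < s" "s < 1" for \<kappa> s
    unfolding \<eta>'_def M_def using that q(1)
    by (intro Lp_le_euler_symbol \<eta> deriv_bound_higher[OF q(1) that(1) dsh C0 F]) auto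
  show ?thesis
  proof (rule rhaly_boundedI[OF \<eta> p])
    fix f r assume f: "f \<in> hardy_space p" and r: "1 / 16 \<le> r" "r < (1::real)"
    define N where "N = hardy_norm p f"
    have N: "0 \<le> N" using hardy_norm_nonneg[OF f] p by (simp add: N_def)
    have fh: "f holomorphic_on ball 0 1" using f by (simp add: hardy_space_def)
    define h where "h = rhaly \<eta> f"
    have h: "h holomorphic_on ball 0 1"
      unfolding h_def rhaly_def by (rule holomorphic_eval_fps_disc[OF analytic_rhaly_fps[OF \<eta> fh]])
    define R where "R = sqrt r"
    have R2: "R ^ 2 = r" using r by (simp add: R_def)
    have R: "1 / 4 \<le> R" "R < 1"
    proof -
      show "R < 1" using r by (simp add: R_def)
      show "1 / 4 \<le> R" unfolding R_def using r by (intro real_le_rsqrt) (simp add: power2_eq_square)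
    qed
    define cl where "cl x = max (1 / 4) (min R x)" for x
    have cl: "1 / 4 \<le> cl x" "cl x \<le> R" "0 \<le> cl x" "cl x < 1" for x using R by (auto simp: cl_def)
    have clid: "cl x = x" if "1 / 4 \<le> x" "x \<le> R" for x using that by (simp add: cl_def)
    define w where "w x t = cmod (f (of_real x * cis t)) / cmod (1 - of_real x * cis t)" for x t
    \<comment> \<open>A positive majorant of the Euler derivative of \<open>h\<close> on the circle
      of radius \<open>x^2\<close>; the clamped radius makes it continuous on the whole plane, as
      the superposition lemma requires.\<close>
    define b where "b x \<theta> = (LINT t|circ. w (cl x) t * cmod (symbol_fun \<eta>' (of_real (cl x) * cis (\<theta> - t))))" for x \<theta>
    have jc: "continuous_on (UNIV \<times> UNIV) (\<lambda>(z :: real \<times> real, t). w (cl (fst z)) t * cmod (symbol_fun \<eta>' (of_real (cl (fst z)) * cis (snd z - t))))"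
      unfolding w_def split_beta
    proof (intro continuous_intros)
      have in1: "of_real (cl x) * cis t \<in> ball 0 1" for x t using cl[of x] by (simp add: norm_mult)
      have clc: "continuous_on UNIV (\<lambda>x :: (real \<times> real) \<times> real. cl (fst (fst x)))" unfolding cl_def by (intro continuous_intros)
      show "continuous_on (UNIV \<times> UNIV) (\<lambda>x :: (real \<times> real) \<times> real. f (of_real (cl (fst (fst x))) * cis (snd x)))"
        by (rule continuous_on_compose2[OF holomorphic_on_imp_continuous_on[OF fh]])
           (use in1 clc in \<open>auto intro!: continuous_intros\<close>)
      show "continuous_on (UNIV \<times> UNIV) (\<lambda>x :: (real \<times> real) \<times> real. symbol_fun \<eta>' (of_real (cl (fst (fst x))) * cis (snd (fst x) - snd x)))"
        by (rule continuous_on_compose2[OF holomorphic_on_imp_continuous_on[OF sh']])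
           (use in1 clc in \<open>auto intro!: continuous_intros\<close>)
      show "continuous_on (UNIV \<times> UNIV) (\<lambda>x :: (real \<times> real) \<times> real. cl (fst (fst x)))" using clc by simp
      show "\<forall>x\<in>UNIV \<times> UNIV. cmod (1 - of_real (cl (fst (fst x))) * cis (snd x)) \<noteq> 0"
        using one_minus_cis_nonzero[OF cl(3,4)] by auto
    qed
    have bc: "continuous_on UNIV (\<lambda>(x, \<theta>). b x \<theta>)"
    proof -
      have "continuous_on UNIV (\<lambda>z :: real \<times> real. LINT t|circ. w (cl (fst z)) t * cmod (symbol_fun \<eta>' (of_real (cl (fst z)) * cis (snd z - t))))"
        by (rule continuous_on_circ_integral[OF jc])
      then show ?thesis unfolding b_def split_beta .
    qed
    have w0: "0 \<le> w x t" for x t by (simp add: w_def)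
    have b0: "0 \<le> b x \<theta>" for x \<theta> unfolding b_def using w0 by (intro integral_nonneg_AE AE_I2) auto
    have bnn: "ennreal (b x \<theta>) = (\<integral>\<^sup>+t. ennreal (w (cl x) t * cmod (symbol_fun \<eta>' (of_real (cl x) * cis (\<theta> - t)))) \<partial>circ)" for x \<theta>
    proof -
      have "continuous_on UNIV (\<lambda>t. ((x, \<theta>), t))" by (intro continuous_intros)
      from continuous_on_compose2[OF jc this]
      have "continuous_on UNIV (\<lambda>t. w (cl x) t * cmod (symbol_fun \<eta>' (of_real (cl x) * cis (\<theta> - t))))" by simp
      then show ?thesis unfolding b_def using w0
        by (intro nn_integral_eq_integral[symmetric] integrable_circ_continuous) auto
    qed
    have Lb: "Lp_le \<kappa> (b x) (M * (1 - x) powr (1 / \<kappa> - 1) * cesaro_mean f x)"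
      if \<kappa>: "q \<le> \<kappa>" and x: "1 / 4 \<le> x" "x \<le> R" for \<kappa> x
    proof (rule Lp_le_rhaly_convolution[OF \<eta>' fh])
      show "Lp_le \<kappa> (\<lambda>\<theta>. symbol_fun \<eta>' (of_real x * cis \<theta>)) (M * (1 - x) powr (1 / \<kappa> - 1))"
        using x R by (intro S \<kappa>) auto
      show "ennreal (b x \<theta>) \<le> (\<integral>\<^sup>+t. ennreal (cmod (f (of_real x * cis t)) / cmod (1 - of_real x * cis t) *
          cmod (symbol_fun \<eta>' (of_real x * cis (\<theta> - t)))) \<partial>circ)" for \<theta>
        using bnn[of x \<theta>] clid[OF x] by (simp add: w_def)
    qed (use x R q \<kappa> b0 in auto)
    have \<Gamma>: "(\<integral>\<^sup>+x. ennreal (cesaro_mean f x powr p) \<partial>ivl (1 / 4) R) \<le> ennreal ((C1 * N) powr p)"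
    proof -
      have [measurable]: "cesaro_mean f \<in> borel_measurable borel" by (rule borel_measurable_cesaro_mean[OF fh])
      define R' where "R' = (1 + R) / 2"
      have R': "0 < R'" "R' < 1" "R < R'" using R by (auto simp: R'_def)
      have "(\<integral>\<^sup>+x. ennreal (cesaro_mean f x powr p) \<partial>ivl (1 / 4) R) =
        (\<integral>\<^sup>+x. ennreal (cesaro_mean f x powr p) * indicator {1 / 4..R} x \<partial>lborel)"
        by (rule nn_integral_ivl) measurable
      also have "\<dots> \<le> (\<integral>\<^sup>+x. ennreal (cesaro_mean f x powr p) * indicator {0..<R'} x \<partial>lborel)"
        using R' by (intro nn_integral_mono) (auto split: split_indicator)
      also have "\<dots> \<le> ennreal ((C1 * N) powr p)"
        unfolding N_def using R' p by (intro C1(2)[OF fh] hardy_norm_Lp_le[OF f]) auto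
      finally show ?thesis .
    qed
    define B where "B \<theta> = integral {1/4..R} (\<lambda>x. b x \<theta>)" for \<theta>
    have LB: "Lp_le p B (C * M * (C1 * N))" unfolding B_def
      by (rule C(2)[OF bc b0 R(1,2) borel_measurable_cesaro_mean[OF fh] cesaro_mean_nonneg M _ Lb[OF \<sigma>(2)] Lb[OF \<tau>(2)] \<Gamma>])
         (use C1 N in auto)
    have bx: "continuous_on UNIV (\<lambda>x. b x \<theta>)" for \<theta>
    proof -
      have "continuous_on UNIV (\<lambda>x. (x, \<theta>))" by (intro continuous_intros)
      from continuous_on_compose2[OF bc this] show ?thesis by auto
    qed
    have Bm [measurable]: "B \<in> borel_measurable borel"
    proof -
      have "continuous_on (UNIV \<times> cbox (1/4) R) (\<lambda>(\<theta>, x). b x \<theta>)"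
      proof -
        have "continuous_on (UNIV \<times> cbox (1/4) R) (\<lambda>z :: real \<times> real. (snd z, fst z))" by (intro continuous_intros)
        from continuous_on_compose2[OF bc this] show ?thesis by (auto simp: split_beta)
      qed
      from integral_continuous_on_param[OF this] have "continuous_on UNIV B" by (simp add: B_def[abs_def])
      then show ?thesis by (rule borel_measurable_continuous_onI)
    qed
    have main: "cmod (h (of_real r * cis \<theta>)) \<le> cmod (of_real (K0 * N) :: complex) + cmod (of_real (8 * B \<theta>) :: complex)" for \<theta>
    proof -
      \<comment> \<open>The radial derivative of \<open>h (x^2 * cis \<theta>)\<close>; its factor
        \<open>2 / x\<close> is at most 8 because \<open>x \<ge> 1 / 4\<close>.\<close>
      define u where "u x = of_real (real 2 / x) * euler_op h (of_real (x ^ 2) * cis \<theta>)" for x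
      have eu: "cmod (euler_op h (of_real (x ^ 2) * cis \<theta>)) \<le> b x \<theta>" if x: "1 / 4 \<le> x" "x \<le> R" for x
      proof -
        have "euler_op h (of_real (x ^ 2) * cis \<theta>) = rhaly \<eta>' f (of_real (x ^ 2) * cis \<theta>)"
          unfolding h_def \<eta>'_def using x R by (intro euler_op_rhaly \<eta> fh) (auto simp: norm_mult norm_power power_less_one_iff)
        then have "ennreal (cmod (euler_op h (of_real (x ^ 2) * cis \<theta>))) \<le> ennreal (b x \<theta>)"
          using norm_rhaly_le[OF \<eta>' fh, of x \<theta>] x R unfolding bnn clid[OF x] w_def by simp
        then show ?thesis using b0 by (simp add: ennreal_le_iff)
      qed
      have "(u has_integral (h (of_real (R ^ 2) * cis \<theta>) - h (of_real ((1 / 4) ^ 2) * cis \<theta>))) {1/4..R}"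
        unfolding u_def using R
        by (intro fundamental_theorem_of_calculus has_vector_derivative_radial h) auto
      then have hi: "(u has_integral (h (of_real r * cis \<theta>) - h (of_real (1 / 16) * cis \<theta>))) {1/4..R}"
        unfolding R2 by (simp add: power2_eq_square)
      have "cmod (h (of_real r * cis \<theta>) - h (of_real (1 / 16) * cis \<theta>)) \<le> integral {1/4..R} (\<lambda>x. 8 * b x \<theta>)"
        unfolding integral_unique[OF hi, symmetric]
      proof (rule integral_norm_bound_integral)
        show "u integrable_on {1/4..R}" using hi by blast
        show "(\<lambda>x. 8 * b x \<theta>) integrable_on {1/4..R}"
          by (intro integrable_continuous_interval continuous_intros continuous_on_subset[OF bx]) auto
        fix x assume "x \<in> {1/4..R}"
        then have x: "1 / 4 \<le> x" "x \<le> R" by auto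
        have "2 / x \<le> 2 / (1 / 4)" using x by (intro divide_left_mono) auto
        then have "2 / x * cmod (euler_op h (of_real (x ^ 2) * cis \<theta>)) \<le> 8 * b x \<theta>"
          using x b0 by (intro mult_mono eu) auto
        then show "norm (u x) \<le> 8 * b x \<theta>" using x by (simp add: u_def norm_mult norm_divide)
      qed
      also have "\<dots> = 8 * B \<theta>" by (simp add: B_def)
      finally have "cmod (h (of_real r * cis \<theta>)) \<le> cmod (h (of_real (1 / 16) * cis \<theta>)) + 8 * B \<theta>"
        using norm_triangle_ineq2[of "h (of_real r * cis \<theta>)" "h (of_real (1 / 16) * cis \<theta>)"] by linarith
      moreover have "cmod (h (of_real (1 / 16) * cis \<theta>)) \<le> K0 * N" unfolding h_def N_def by (rule K0(2)[OF f])
      ultimately have "cmod (h (of_real r * cis \<theta>)) \<le> K0 * N + 8 * B \<theta>" by linarith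
      also have "\<dots> \<le> cmod (of_real (K0 * N) :: complex) + cmod (of_real (8 * B \<theta>) :: complex)"
        unfolding norm_of_real by linarith
      finally show ?thesis .
    qed
    have "Lp_le p (\<lambda>\<theta>. h (of_real r * cis \<theta>)) (4 * (K0 * N + 8 * (C * M * (C1 * N))))"
    proof (rule Lp_le_add)
      show "Lp_le p (\<lambda>\<theta>. of_real (K0 * N) :: complex) (K0 * N)"
        using K0(1) N p by (intro Lp_le_const) (auto simp: norm_mult)
      show "Lp_le p (\<lambda>\<theta>. of_real (8 * B \<theta>) :: complex) (8 * (C * M * (C1 * N)))"
        using p by (intro Lp_le_cmult[OF LB]) (auto simp: norm_mult)
      show "AE t in circ. cmod (h (of_real r * cis t)) \<le> cmod (of_real (K0 * N) :: complex) + cmod (of_real (8 * B t) :: complex)"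
        using main by (intro AE_I2)
    qed (use p in simp, measurable)
    then show "Lp_le p (\<lambda>\<theta>. rhaly \<eta> f (of_real r * cis \<theta>)) (4 * (K0 + 8 * (C * M * C1)) * hardy_norm p f)"
      by (simp add: h_def N_def algebra_simps)
  qed
qed

section \<open>Necessity\<close>

text \<open>For the constant function 1 all partial sums equal 1, so its image has the coefficients
  \<eta>.\<close>

lemma rhaly_bounded_imp_analytic:
  assumes "rhaly_bounded p \<eta>" "0 < p"
  shows "analytic_in_disc (Abs_fps \<eta>)"
proof -
  have one: "(\<lambda>_. 1 :: complex) \<in> hardy_space p"
    by (rule hardy_spaceI(1)[of _ p 1]) (use assms in \<open>auto intro!: Lp_le_const\<close>)
  have "(\<lambda>_. 1 :: complex) has_fps_expansion 1" by simp
  moreover have "(\<lambda>_. 1 :: complex) has_fps_expansion fps_expansion (\<lambda>_. 1) 0"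
    by (intro has_fps_expansion_fps_expansion[of UNIV]) auto
  ultimately have "fps_expansion (\<lambda>_. 1 :: complex) 0 = 1"
    by (rule fps_expansion_unique_complex[symmetric])
  then have "rhaly_fps \<eta> (\<lambda>_. 1) = Abs_fps \<eta>"
    by (simp add: rhaly_fps_def fps_one_def if_distrib sum.delta cong: if_cong)
  then show ?thesis using assms one unfolding rhaly_bounded_def by metis
qed

text \<open>For \<open>f z = (1 - z) * (\<rho> z) / (1 - \<rho> z)\<^sup>2\<close> the partial sums of the coefficients are \<open>n * \<rho> ^ n\<close>, so that
  \<open>rhaly \<eta> f z\<close> is the Euler derivative of the symbol at \<open>\<rho> z\<close>.\<close>

lemma rhaly_bounded_imp_deriv_bound:
  fixes p :: real
  assumes R: "rhaly_bounded p \<eta>" and p: "1 < p"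
  obtains C where "0 < C"
    "\<And>s. 0 \<le> s \<Longrightarrow> s < 1 \<Longrightarrow> Lp_le p (\<lambda>\<theta>. deriv (symbol_fun \<eta>) (of_real s * cis \<theta>)) (C * (1 - s) powr (1 / p - 1))"
proof -
  have \<eta>: "analytic_in_disc (Abs_fps \<eta>)" using rhaly_bounded_imp_analytic[OF R] p by simp
  have sh: "symbol_fun \<eta> holomorphic_on ball 0 1"
    unfolding symbol_fun_def by (rule holomorphic_eval_fps_disc[OF \<eta>])
  have dsh: "deriv (symbol_fun \<eta>) holomorphic_on ball 0 1" using sh by (intro holomorphic_intros) auto
  obtain K0 where K0: "\<And>f. f \<in> hardy_space p \<Longrightarrow> rhaly \<eta> f \<in> hardy_space p"
    "\<And>f. f \<in> hardy_space p \<Longrightarrow> hardy_norm p (rhaly \<eta> f) \<le> K0 * hardy_norm p f"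
    using R unfolding rhaly_bounded_def hardy_operator_def by blast
  \<comment> \<open>The operator bound is only some real number \<open>K0\<close>, possibly
    negative; it is enlarged to a positive one.\<close>
  define K where "K = \<bar>K0\<bar> + 1"
  obtain C0 where C0: "0 < C0" "\<And>r. 0 \<le> r \<Longrightarrow> r < 1 \<Longrightarrow>
      (\<integral>\<^sup>+t. ennreal (1 / cmod (1 - of_real r * cis t) powr p) \<partial>circ) \<le> ennreal (C0 * (1 - r) powr (1 - p))"
    using circ_kernel0[OF p] by blast
  define N0 where "N0 = 2 * C0 powr (1 / p)"
  have N0: "0 < N0" using C0 by (simp add: N0_def)
  define C1 where "C1 = 4 * K * N0 * 2 powr (1 - 1 / p)"
  have C1: "0 < C1" using N0 by (simp add: C1_def K_def add_nonneg_pos)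
  have ip: "1 / p < 1" using p by simp
  have big: "Lp_le p (\<lambda>\<theta>. deriv (symbol_fun \<eta>) (of_real s * cis \<theta>)) (C1 * (1 - s) powr (1 / p - 1))"
    if s: "1 / 4 \<le> s" "s < 1" for s
  proof -
    \<comment> \<open>The parameter of the test function and the radius at which its image is
      measured are both \<open>sqrt s\<close>, so that the symbol is reached at radius
      \<open>s\<close>.\<close>
    define \<rho> where "\<rho> = sqrt s"
    have \<rho>: "0 < \<rho>" "\<rho> < 1" "\<rho> * \<rho> = s" using s by (auto simp: \<rho>_def)
    define A :: "complex fps" where "A = Abs_fps (\<lambda>n. of_nat n * of_real \<rho> ^ n)"
    define f where "f z = (1 - z) * (of_real \<rho> * z / (1 - of_real \<rho> * z)\<^sup>2)" for z :: complex
    have lt: "cmod (of_real \<rho> * z) < 1" if "cmod z \<le> 1" for z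
    proof -
      have "\<rho> * cmod z \<le> \<rho>" using \<rho> that mult_left_mono[of "cmod z" 1 \<rho>] by simp
      then have "\<rho> * cmod z < 1" using \<rho>(2) by linarith
      then show ?thesis using \<rho> by (simp add: norm_mult)
    qed
    have nz: "1 - of_real \<rho> * z \<noteq> 0" if "cmod z \<le> 1" for z
      using lt[OF that] by auto
    have Asums: "(\<lambda>n. fps_nth A n * z ^ n) sums (of_real \<rho> * z / (1 - of_real \<rho> * z)\<^sup>2)" if "cmod z \<le> 1" for z
    proof -
      from sums_mult[OF geometric_deriv_sums[OF lt[OF that]], of "of_real \<rho> * z"]
      have "(\<lambda>n. fps_nth A (Suc n) * z ^ Suc n) sums (of_real \<rho> * z / (1 - of_real \<rho> * z)\<^sup>2)"
        by (simp add: A_def power_mult_distrib mult_ac)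
      then show ?thesis by (subst (asm) sums_Suc_iff) (simp add: A_def)
    qed
    have Arad: "1 \<le> fps_conv_radius A"
      unfolding fps_conv_radius_def
    proof (rule conv_radius_geI_ex)
      fix r :: real assume "0 < r" "ereal r < 1"
      then show "\<exists>z. norm z = r \<and> summable (\<lambda>n. fps_nth A n * z ^ n)"
        using Asums[of "of_real r"] by (intro exI[of _ "of_real r"]) (auto simp: sums_iff)
    qed
    have fA: "f z = eval_fps ((1 - fps_X) * A) z" if z: "cmod z < 1" for z
    proof -
      have "ereal (cmod z) < fps_conv_radius A" by (rule less_conv_radius_disc[OF Arad z])
      moreover have "ereal (cmod z) < fps_conv_radius (1 - fps_X :: complex fps)"
        using fps_conv_radius_diff[of "1 :: complex fps" fps_X] by (simp add: less_le_trans)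
      ultimately have "eval_fps ((1 - fps_X) * A) z = (1 - z) * eval_fps A z"
        by (simp add: eval_fps_mult eval_fps_diff)
      also have "eval_fps A z = of_real \<rho> * z / (1 - of_real \<rho> * z)\<^sup>2"
        using Asums[of z] z by (simp add: eval_fps_def sums_iff)
      finally show ?thesis by (simp add: f_def)
    qed
    have fh: "f holomorphic_on ball 0 1" unfolding f_def
      using nz by (intro holomorphic_intros) auto
    have fexp: "fps_expansion f 0 = (1 - fps_X) * A"
    proof (rule fps_expansion_unique_complex)
      show "f has_fps_expansion fps_expansion f 0"
        using fh by (intro has_fps_expansion_fps_expansion[of "ball 0 1"]) auto
      have "0 < fps_conv_radius ((1 - fps_X) * A)"
      proof -
        have "min (fps_conv_radius (1 - fps_X :: complex fps)) (fps_conv_radius A) \<le> fps_conv_radius ((1 - fps_X) * A)"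
          by (rule fps_conv_radius_mult)
        moreover have "fps_conv_radius (1 - fps_X :: complex fps) \<ge> \<infinity>"
          using fps_conv_radius_diff[of "1 :: complex fps" fps_X] by simp
        ultimately show ?thesis using Arad by (auto simp: min_def split: if_splits intro: less_le_trans[of 0 1] order_trans)
      qed
      then show "f has_fps_expansion (1 - fps_X) * A"
        unfolding has_fps_expansion_def
        using fA eventually_nhds_in_open[of "ball 0 1" "0 :: complex"] by (auto elim!: eventually_mono)
    qed
    \<comment> \<open>The factor \<open>1 - fps_X\<close> makes the partial sums telescope to the
      coefficients of \<open>A\<close>.\<close>
    have ps: "(\<Sum>k\<le>n. fps_nth (fps_expansion f 0) k) = of_nat n * of_real \<rho> ^ n" for n
    proof (induction n)
      case 0
      then show ?case by (simp add: fexp A_def left_diff_distrib)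
    next
      case (Suc n)
      then show ?case by (simp add: fexp A_def left_diff_distrib)
    qed
    have Rf: "rhaly \<eta> f z = euler_op (symbol_fun \<eta>) (of_real \<rho> * z)" if "cmod z \<le> 1" for z
      unfolding euler_op_symbol[OF \<eta> lt[OF that]] rhaly_def rhaly_fps_def ps
      by (simp add: symbol_fun_def eval_fps_def power_mult_distrib mult_ac)
    define N where "N = N0 * (1 - \<rho>) powr (1 / p - 1)"
    have Nf: "Lp_le p (\<lambda>t. f (of_real r * cis t)) N" if r: "0 < r" "r < 1" for r
    proof -
      have rr: "0 \<le> \<rho> * r" "\<rho> * r < 1" "\<rho> * r \<le> \<rho>"
      proof -
        show "0 \<le> \<rho> * r" using \<rho> r by simp
        show "\<rho> * r \<le> \<rho>" using \<rho> r mult_left_mono[of r 1 \<rho>] by simp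
        then show "\<rho> * r < 1" using \<rho> by linarith
      qed
      \<comment> \<open>\<open>cmod (1 - z) \<le> 2 * cmod (1 - \<rho> * z)\<close> cancels one of
        the two factors in the denominator of \<open>f\<close>; the mean of the remaining kernel
        then gives the growth \<open>(1 - \<rho>) powr (1 / p - 1)\<close> of the norm.\<close>
      have b: "cmod (f (of_real r * cis t)) \<le> 2 * (1 / cmod (1 - of_real (\<rho> * r) * cis t))" for t
      proof -
        define z where "z = of_real r * cis t"
        have z: "cmod z < 1" using r by (simp add: z_def norm_mult)
        define d where "d = cmod (1 - of_real \<rho> * z)"
        have d: "0 < d" using nz z by (simp add: d_def)
        have "1 - \<rho> \<le> d"
        proof -
          have "\<rho> * cmod z \<le> \<rho>" using \<rho> z mult_left_mono[of "cmod z" 1 \<rho>] by simp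
          moreover have "1 - \<rho> * cmod z \<le> d"
            using norm_triangle_ineq2[of 1 "of_real \<rho> * z"] \<rho> by (simp add: d_def norm_mult)
          ultimately show ?thesis by linarith
        qed
        moreover have "cmod (1 - z) \<le> d + (1 - \<rho>)"
        proof -
          have "cmod (1 - z) \<le> d + cmod (of_real (\<rho> - 1) * z)"
            using norm_triangle_ineq[of "1 - of_real \<rho> * z" "of_real (\<rho> - 1) * z"] by (simp add: d_def algebra_simps)
          also have "cmod (of_real (\<rho> - 1) * z) = (1 - \<rho>) * cmod z" using \<rho> by (simp add: norm_mult del: of_real_diff)
          also have "(1 - \<rho>) * cmod z \<le> (1 - \<rho>) * 1" using \<rho> z by (intro mult_left_mono) auto
          finally show ?thesis by simp
        qed
        ultimately have 1: "cmod (1 - z) \<le> 2 * d" by simp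
        have "cmod (f z) = cmod (1 - z) * (cmod (of_real \<rho> * z) / d\<^sup>2)"
          by (simp add: f_def d_def norm_mult norm_divide norm_power)
        also have "\<dots> \<le> (2 * d) * (1 / d\<^sup>2)"
          using 1 lt[of z] z d by (intro mult_mono divide_right_mono) auto
        also have "\<dots> = 2 * (1 / d)" using d by (simp add: power2_eq_square)
        finally show ?thesis by (simp add: z_def d_def mult_ac)
      qed
      have k: "Lp_le p (\<lambda>t. 1 / cmod (1 - of_real (\<rho> * r) * cis t)) (C0 powr (1 / p) * (1 - \<rho>) powr (1 / p - 1))"
      proof -
        have "(\<integral>\<^sup>+t. ennreal ((1 / cmod (1 - of_real (\<rho> * r) * cis t)) powr p) \<partial>circ) \<le> ennreal (C0 * (1 - \<rho> * r) powr (1 - p))"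
          using C0(2)[OF rr(1,2)] by (simp add: powr_divide)
        also have "\<dots> \<le> ennreal (C0 * (1 - \<rho>) powr (1 - p))"
          using C0 rr \<rho> p by (intro ennreal_leI mult_left_mono powr_mono2') auto
        also have "C0 * (1 - \<rho>) powr (1 - p) = (C0 powr (1 / p) * (1 - \<rho>) powr (1 / p - 1)) powr p"
          using C0 p by (simp add: powr_mult powr_powr left_diff_distrib)
        finally show ?thesis by (simp add: Lp_le_def)
      qed
      have "Lp_le p (\<lambda>t. f (of_real r * cis t)) (2 * (C0 powr (1 / p) * (1 - \<rho>) powr (1 / p - 1)))"
        by (rule Lp_le_cmult[OF k]) (use b p in \<open>auto intro!: borel_measurable_divide borel_measurable_norm borel_measurable_diff borel_measurable_times borel_measurable_cis\<close>)
      then show ?thesis by (simp add: N_def N0_def mult.assoc)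
    qed
    have fH: "f \<in> hardy_space p" "hardy_norm p f \<le> N"
      using hardy_spaceI[OF fh _ Nf] p by auto
    have KN: "hardy_norm p (rhaly \<eta> f) \<le> K * N"
    proof -
      have "hardy_norm p (rhaly \<eta> f) \<le> K0 * hardy_norm p f" by (rule K0(2)[OF fH(1)])
      also have "\<dots> \<le> K * N"
        using fH(2) hardy_norm_nonneg[OF fH(1)] p by (intro mult_mono) (auto simp: K_def)
      finally show ?thesis .
    qed
    have e: "Lp_le p (\<lambda>\<theta>. euler_op (symbol_fun \<eta>) (of_real s * cis \<theta>)) (K * N)"
    proof -
      have "Lp_le p (\<lambda>\<theta>. rhaly \<eta> f (of_real \<rho> * cis \<theta>)) (hardy_norm p (rhaly \<eta> f))"
        using \<rho> p by (intro hardy_norm_Lp_le K0(1) fH) auto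
      moreover have "rhaly \<eta> f (of_real \<rho> * cis \<theta>) = euler_op (symbol_fun \<eta>) (of_real s * cis \<theta>)" for \<theta>
        using \<rho> by (subst Rf) (auto simp: norm_mult mult.assoc[symmetric] simp flip: of_real_mult)
      ultimately have L: "Lp_le p (\<lambda>\<theta>. euler_op (symbol_fun \<eta>) (of_real s * cis \<theta>)) (hardy_norm p (rhaly \<eta> f))"
        by simp
      show ?thesis by (rule Lp_le_mono[OF L _ KN]) (use p in auto)
    qed
    \<comment> \<open>Dividing the Euler derivative by its argument costs at most a factor 4 when
      \<open>s \<ge> 1 / 4\<close>; smaller radii follow from monotonicity of the means.\<close>
    have D: "Lp_le p (\<lambda>\<theta>. deriv (symbol_fun \<eta>) (of_real s * cis \<theta>)) (4 * (K * N))"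
    proof (rule Lp_le_cmult[OF e])
      show "AE t in circ. cmod (deriv (symbol_fun \<eta>) (of_real s * cis t)) \<le> 4 * cmod (euler_op (symbol_fun \<eta>) (of_real s * cis t))"
      proof (intro AE_I2)
        fix t
        have "cmod (euler_op (symbol_fun \<eta>) (of_real s * cis t)) = s * cmod (deriv (symbol_fun \<eta>) (of_real s * cis t))"
          using s by (simp add: euler_op_def norm_mult)
        moreover have "1 / 4 * cmod (deriv (symbol_fun \<eta>) (of_real s * cis t)) \<le> s * cmod (deriv (symbol_fun \<eta>) (of_real s * cis t))"
          using s by (intro mult_right_mono) auto
        ultimately show "cmod (deriv (symbol_fun \<eta>) (of_real s * cis t)) \<le> 4 * cmod (euler_op (symbol_fun \<eta>) (of_real s * cis t))"
          by linarith
      qed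
      show "(\<lambda>t. cmod (euler_op (symbol_fun \<eta>) (of_real s * cis t))) \<in> borel_measurable borel"
        using s by (intro borel_measurable_continuous_onI continuous_intros continuous_on_circle_radius
          holomorphic_on_imp_continuous_on holomorphic_euler_op sh) auto
    qed (use p in auto)
    have "4 * (K * N) \<le> C1 * (1 - s) powr (1 / p - 1)"
    proof -
      have "1 - s = (1 + \<rho>) * (1 - \<rho>)" using \<rho>(3) by (simp add: algebra_simps)
      also have "\<dots> \<le> 2 * (1 - \<rho>)" using \<rho> by (intro mult_right_mono) auto
      finally have "(1 - \<rho>) powr (1 / p - 1) \<le> ((1 - s) / 2) powr (1 / p - 1)"
        using s ip by (intro powr_mono2') auto
      also have "\<dots> = (1 - s) powr (1 / p - 1) * 2 powr (1 - 1 / p)"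
        by (simp add: powr_divide powr_diff)
      finally have "4 * K * N0 * (1 - \<rho>) powr (1 / p - 1) \<le> 4 * K * N0 * ((1 - s) powr (1 / p - 1) * 2 powr (1 - 1 / p))"
        using N0 by (intro mult_left_mono) (auto simp: K_def)
      then show ?thesis by (simp add: N_def C1_def mult_ac)
    qed
    then show ?thesis by (intro Lp_le_mono[OF D]) (use p in auto)
  qed
  \<comment> \<open>\<open>3 / 4 = 1 - 1 / 4\<close>: the bound at radius \<open>1 / 4\<close> also
    serves inside.\<close>
  define C where "C = C1 * (3 / 4) powr (1 / p - 1)"
  have C1C: "C1 \<le> C"
    using C1 ip powr_mono2'[of "1 / p - 1" "3 / 4" 1] by (simp add: C_def)
  show ?thesis
  proof (rule that[of C])
    show "0 < C" using C1 by (simp add: C_def)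
    fix s :: real assume s: "0 \<le> s" "s < 1"
    show "Lp_le p (\<lambda>\<theta>. deriv (symbol_fun \<eta>) (of_real s * cis \<theta>)) (C * (1 - s) powr (1 / p - 1))"
    proof (cases "1 / 4 \<le> s")
      case True
      have "C1 * (1 - s) powr (1 / p - 1) \<le> C * (1 - s) powr (1 / p - 1)" by (intro mult_right_mono C1C) auto
      then show ?thesis by (intro Lp_le_mono[OF big[OF True s(2)]]) (use p in auto)
    next
      case False
      have "(\<lambda>w. deriv (symbol_fun \<eta>) (of_real (1 / 4) * w)) holomorphic_on ball 0 4"
        by (intro holomorphic_on_compose_gen[OF _ dsh, unfolded o_def] holomorphic_intros) (auto simp: norm_mult)
      from Lp_le_radius_mono[OF p this _ _ _ big[of "1 / 4"], of "4 * s"] False s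
      have D: "Lp_le p (\<lambda>\<theta>. deriv (symbol_fun \<eta>) (of_real s * cis \<theta>)) C" by (simp add: C_def)
      have "C \<le> C * (1 - s) powr (1 / p - 1)"
        using C1 C1C s ip powr_mono2'[of "1 / p - 1" "1 - s" 1] by (simp add: mult_le_cancel_left1)
      then show ?thesis by (intro Lp_le_mono[OF D]) (use p in auto)
    qed
  qed
qed

section \<open>From the derivative bound to the Lipschitz condition\<close>

text \<open>Countably many translates of the window cover the line, and a countable union of null
  sets is null.\<close>

lemma AE_circ_periodic:
  assumes "AE x in circ. P x" and per: "\<And>x. P (x + 2 * pi) = P x"
  shows "AE x in lborel. P x"
proof -
  have 0: "AE x in lborel. \<bar>x\<bar> \<le> pi \<longrightarrow> P x"
  proof -
    have "AE x in lborel. 0 < ennreal (indicator {-pi..pi} x / (2 * pi)) \<longrightarrow> P x"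
      using assms(1) unfolding circ_def by (subst (asm) AE_density) auto
    then show ?thesis by (rule eventually_mono) (auto simp: abs_le_iff)
  qed
  have perk: "P (x + 2 * pi * of_int k) = P x" for x and k :: int
  proof (induction k rule: int_induct[where k = 0])
    case (step1 i)
    then show ?case using per[of "x + 2 * pi * of_int i"] by (simp add: algebra_simps)
  next
    case (step2 i)
    then show ?case using per[of "x + 2 * pi * of_int (i - 1)"] by (simp add: algebra_simps)
  qed simp
  have "AE x in lborel. \<forall>k::int. \<bar>x + 2 * pi * of_int k\<bar> \<le> pi \<longrightarrow> P (x + 2 * pi * of_int k)"
    unfolding AE_all_countable by (intro allI AE_lborel_shift[OF 0])
  then show ?thesis
  proof (rule eventually_mono)
    fix x assume *: "\<forall>k::int. \<bar>x + 2 * pi * of_int k\<bar> \<le> pi \<longrightarrow> P (x + 2 * pi * of_int k)"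
    define k where "k = - \<lfloor>(x + pi) / (2 * pi)\<rfloor>"
    define y :: real where "y = of_int \<lfloor>(x + pi) / (2 * pi)\<rfloor>"
    have "y \<le> (x + pi) / (2 * pi)" "(x + pi) / (2 * pi) < y + 1" unfolding y_def by linarith+
    then have "y * (2 * pi) \<le> x + pi" "x + pi < (y + 1) * (2 * pi)"
      by (simp_all only: pos_le_divide_eq pos_divide_less_eq pi_gt_zero mult_pos_pos zero_less_numeral)
    moreover have "x + 2 * pi * of_int k = x - y * (2 * pi)" by (simp add: k_def y_def)
    ultimately have "\<bar>x + 2 * pi * of_int k\<bar> \<le> pi" unfolding distrib_right abs_le_iff by linarith
    then show "P x" using * perk by blast
  qed
qed

lemma radial_increment_FTC:
  assumes F: "F holomorphic_on ball 0 1" and r: "0 \<le> a" "a \<le> r" "r < 1"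
  shows "F (of_real r * cis \<theta>) - F (of_real a * cis \<theta>) =
    (LINT x|lborel. indicator {a..r} x *\<^sub>R (cis \<theta> * deriv F (of_real x * cis \<theta>)))"
proof -
  have "((\<lambda>x. F (of_real x * cis \<theta>)) has_vector_derivative cis \<theta> * deriv F (of_real x * cis \<theta>)) (at x within {a..r})"
    if x: "a \<le> x" "x \<le> r" for x
  proof -
    have "((\<lambda>x. of_real x * cis \<theta>) has_vector_derivative 1 * cis \<theta>) (at x within {a..r})"
      using has_vector_derivative_mult_left[OF has_vector_derivative_of_real[OF DERIV_ident]] by simp
    moreover have "(F has_field_derivative deriv F (of_real x * cis \<theta>)) (at (of_real x * cis \<theta>))"
      using x r by (intro holomorphic_derivI[OF F]) (auto simp: norm_mult)
    ultimately have "(F \<circ> (\<lambda>x. of_real x * cis \<theta>) has_vector_derivative 1 * cis \<theta> * deriv F (of_real x * cis \<theta>)) (at x within {a..r})"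
      by (rule field_vector_diff_chain_within[OF _ has_field_derivative_at_within])
    then show ?thesis by (simp add: o_def)
  qed
  moreover have "continuous_on {a..r} (\<lambda>x. cis \<theta> * deriv F (of_real x * cis \<theta>))"
  proof (intro continuous_intros)
    have "deriv F holomorphic_on ball 0 1" using F by (intro holomorphic_intros) auto
    then show "continuous_on {a..r} (\<lambda>x. deriv F (of_real x * cis \<theta>))"
      using r by (intro continuous_on_compose2[OF holomorphic_on_imp_continuous_on, of "deriv F" "ball 0 1"] continuous_intros) (auto simp: norm_mult)
  qed
  ultimately show ?thesis using r by (subst integral_FTC_Icc) auto
qed

text \<open>Minkowski's inequality along the radius; the integral of
  \<open>(1 - x) powr (\<alpha> - 1)\<close> from \<open>a\<close> to \<open>r\<close> is at most
  \<open>(1 - a) powr \<alpha> / \<alpha>\<close>, independently of \<open>r\<close>.\<close>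

lemma deriv_bound_increment:
  fixes p \<alpha> :: real
  assumes p: "1 < p" and \<alpha>: "0 < \<alpha>" and F: "F holomorphic_on ball 0 1" and C: "0 < C"
    and b: "\<And>s. 0 \<le> s \<Longrightarrow> s < 1 \<Longrightarrow> Lp_le p (\<lambda>\<theta>. deriv F (of_real s * cis \<theta>)) (C * (1 - s) powr (\<alpha> - 1))"
    and r: "0 \<le> a" "a \<le> r" "r < 1"
  shows "Lp_le p (\<lambda>\<theta>. F (of_real r * cis \<theta>) - F (of_real a * cis \<theta>)) (C * (1 - a) powr \<alpha> / \<alpha>)"
proof -
  have dF: "continuous_on (ball 0 1) (deriv F)" using F by (intro holomorphic_on_imp_continuous_on holomorphic_intros) auto
  define \<phi> where "\<phi> x \<theta> = indicator {0..<1} x * cmod (deriv F (of_real x * cis \<theta>))" for x \<theta>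
  have \<phi>m [measurable]: "(\<lambda>z. \<phi> (fst z) (snd z)) \<in> borel_measurable (borel \<Otimes>\<^sub>M borel)"
    using measurable_polar[OF continuous_on_norm[OF dF]] by (simp add: \<phi>_def)
  have "(\<integral>\<^sup>+\<theta>. ennreal (cmod (F (of_real r * cis \<theta>) - F (of_real a * cis \<theta>)) powr p) \<partial>circ) \<le> ennreal ((C * (1 - a) powr \<alpha> / \<alpha>) powr p)"
  proof (rule minkowski_integral_finite[OF p finite_measure_ivl[of a r] circ.sigma_finite_measure_axioms,
        where W = "\<lambda>x. C * (1 - x) powr (\<alpha> - 1)" and \<phi> = \<phi>])
    have "(\<integral>\<^sup>+x. ennreal (C * (1 - x) powr (\<alpha> - 1)) \<partial>ivl a r) = ennreal C * (\<integral>\<^sup>+x. ennreal ((1 - x) powr (\<alpha> - 1)) * indicator {a..r} x \<partial>lborel)"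
      using C by (subst nn_integral_ivl) (auto simp: ennreal_mult mult.assoc nn_integral_cmult)
    also have "\<dots> \<le> ennreal C * ennreal ((1 - a) powr \<alpha> / \<alpha>)"
      using r \<alpha> by (intro mult_left_mono nn_integral_one_minus_powr_upper) auto
    finally show "(\<integral>\<^sup>+x. ennreal (C * (1 - x) powr (\<alpha> - 1)) \<partial>ivl a r) \<le> ennreal (C * (1 - a) powr \<alpha> / \<alpha>)"
      using C \<alpha> by (simp add: ennreal_mult[symmetric])
    show "AE x in ivl a r. (\<integral>\<^sup>+\<theta>. ennreal (\<phi> x \<theta> powr p) \<partial>circ) \<le> ennreal ((C * (1 - x) powr (\<alpha> - 1)) powr p)"
    proof (intro eventually_mono[OF AE_ivl])
      fix x assume "a \<le> x \<and> x \<le> r"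
      then show "(\<integral>\<^sup>+\<theta>. ennreal (\<phi> x \<theta> powr p) \<partial>circ) \<le> ennreal ((C * (1 - x) powr (\<alpha> - 1)) powr p)"
        using b[of x] r by (simp add: \<phi>_def Lp_le_def)
    qed
    show "AE \<theta> in circ. ennreal (cmod (F (of_real r * cis \<theta>) - F (of_real a * cis \<theta>))) \<le> (\<integral>\<^sup>+x. ennreal (\<phi> x \<theta>) \<partial>ivl a r)"
    proof (intro AE_I2)
      fix \<theta>
      have c: "continuous_on {a..r} (\<lambda>x. cis \<theta> * deriv F (of_real x * cis \<theta>))"
        using r by (intro continuous_intros continuous_on_compose2[OF dF]) (auto simp: norm_mult)
      have [measurable]: "(\<lambda>x. \<phi> x \<theta>) \<in> borel_measurable borel"
        using measurable_compose[OF measurable_Pair2'[of \<theta> borel borel] \<phi>m] by simp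
      have "ennreal (cmod (F (of_real r * cis \<theta>) - F (of_real a * cis \<theta>))) \<le>
         (\<integral>\<^sup>+x. norm (indicator {a..r} x *\<^sub>R (cis \<theta> * deriv F (of_real x * cis \<theta>))) \<partial>lborel)"
        unfolding radial_increment_FTC[OF F r] by (intro integral_norm_bound_ennreal borel_integrable_compact c) auto
      also have "\<dots> = (\<integral>\<^sup>+x. ennreal (\<phi> x \<theta>) \<partial>ivl a r)"
      proof (subst nn_integral_ivl)
        show "(\<integral>\<^sup>+x. norm (indicator {a..r} x *\<^sub>R (cis \<theta> * deriv F (of_real x * cis \<theta>))) \<partial>lborel) =
            (\<integral>\<^sup>+x. ennreal (\<phi> x \<theta>) * indicator {a..r} x \<partial>lborel)"
          using r by (intro nn_integral_cong) (auto simp: norm_mult \<phi>_def split: split_indicator)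
      qed measurable
      finally show "ennreal (cmod (F (of_real r * cis \<theta>) - F (of_real a * cis \<theta>))) \<le> (\<integral>\<^sup>+x. ennreal (\<phi> x \<theta>) \<partial>ivl a r)" .
    qed
    show "(\<lambda>(x, y). \<phi> x y) \<in> borel_measurable (ivl a r \<Otimes>\<^sub>M circ)" unfolding split_beta by measurable
  qed (use C \<alpha> in \<open>auto simp: \<phi>_def\<close>)
  then show ?thesis using C \<alpha> by (simp add: Lp_le_def)
qed

text \<open>The double integral of \<open>\<bar>F'\<bar>\<close> over radius and angle is finite, so
  \<open>F\<close> maps almost every radius to a curve of finite length, and integrability of the
  radial derivative gives the limit.\<close>

lemma deriv_bound_radial_limits:
  fixes p \<alpha> :: real
  assumes p: "1 < p" and \<alpha>: "0 < \<alpha>" and F: "F holomorphic_on ball 0 1" and C: "0 < C"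
    and b: "\<And>s. 0 \<le> s \<Longrightarrow> s < 1 \<Longrightarrow> Lp_le p (\<lambda>\<theta>. deriv F (of_real s * cis \<theta>)) (C * (1 - s) powr (\<alpha> - 1))"
  shows "has_boundary_values F"
proof -
  have dF: "continuous_on (ball 0 1) (deriv F)" using F by (intro holomorphic_on_imp_continuous_on holomorphic_intros) auto
  define \<phi> where "\<phi> x \<theta> = indicator {0..<1} x * cmod (deriv F (of_real x * cis \<theta>))" for x \<theta>
  have \<phi>m [measurable]: "(\<lambda>z. \<phi> (fst z) (snd z)) \<in> borel_measurable (borel \<Otimes>\<^sub>M borel)"
    using measurable_polar[OF continuous_on_norm[OF dF]] by (simp add: \<phi>_def)
  have \<phi>m' [measurable]: "(\<lambda>z. \<phi> (snd z) (fst z)) \<in> borel_measurable (borel \<Otimes>\<^sub>M borel)"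
  proof -
    have "(\<lambda>z. (snd z, fst z)) \<in> (borel \<Otimes>\<^sub>M borel) \<rightarrow>\<^sub>M (borel \<Otimes>\<^sub>M borel :: (real \<times> real) measure)" by measurable
    from measurable_compose[OF this \<phi>m] show ?thesis by simp
  qed
  interpret P: pair_sigma_finite lborel circ ..
  define I where "I \<theta> = (\<integral>\<^sup>+x. ennreal (\<phi> x \<theta>) \<partial>lborel)" for \<theta>
  have Im: "I \<in> borel_measurable borel" unfolding I_def by measurable
  have "(\<integral>\<^sup>+\<theta>. I \<theta> \<partial>circ) = (\<integral>\<^sup>+x. (\<integral>\<^sup>+\<theta>. ennreal (\<phi> x \<theta>) \<partial>circ) \<partial>lborel)"
    unfolding I_def by (rule P.Fubini') (unfold split_beta, measurable)
  also have "\<dots> \<le> (\<integral>\<^sup>+x. ennreal C * (ennreal ((1 - x) powr (\<alpha> - 1)) * indicator {0..1} x) \<partial>lborel)"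
  proof (intro nn_integral_mono)
    fix x
    show "(\<integral>\<^sup>+\<theta>. ennreal (\<phi> x \<theta>) \<partial>circ) \<le> ennreal C * (ennreal ((1 - x) powr (\<alpha> - 1)) * indicator {0..1} x)"
    proof (cases "0 \<le> x \<and> x < 1")
      case True
      have "continuous_on UNIV (\<lambda>\<theta>. deriv F (of_real x * cis \<theta>))"
        using True by (intro continuous_on_circle_radius dF) auto
      then have "(\<integral>\<^sup>+\<theta>. ennreal (cmod (deriv F (of_real x * cis \<theta>))) \<partial>circ) \<le> ennreal (C * (1 - x) powr (\<alpha> - 1))"
        using True by (intro Lp_le_L1[OF b p] borel_measurable_continuous_onI continuous_intros) auto
      then show ?thesis using True C by (simp add: \<phi>_def ennreal_mult)
    next
      case False
      then have "\<phi> x \<theta> = 0" for \<theta> by (auto simp: \<phi>_def)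
      then show ?thesis by simp
    qed
  qed
  also have "\<dots> = ennreal C * (\<integral>\<^sup>+x. ennreal ((1 - x) powr (\<alpha> - 1)) * indicator {0..1} x \<partial>lborel)"
    by (rule nn_integral_cmult) measurable
  also have "(\<integral>\<^sup>+x. ennreal ((1 - x) powr (\<alpha> - 1)) * indicator {0..1} x \<partial>lborel) = (\<integral>\<^sup>+u. ennreal (u powr (\<alpha> - 1)) * indicator {0..1} (1 - u) \<partial>lborel)"
    by (subst nn_integral_real_affine[where c = "-1" and t = 1]) auto
  also have "\<dots> = (\<integral>\<^sup>+u. ennreal (u powr (\<alpha> - 1)) * indicator {0..1} u \<partial>lborel)"
    by (intro nn_integral_cong) (auto split: split_indicator)
  also have "\<dots> = ennreal (1 powr (\<alpha> - 1 + 1) / (\<alpha> - 1 + 1))"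
    using \<alpha> by (intro nn_integral_has_integral_lebesgue' has_integral_powr_from_0) auto
  also have "ennreal C * ennreal (1 powr (\<alpha> - 1 + 1) / (\<alpha> - 1 + 1)) = ennreal (C * (1 / \<alpha>))"
    using C \<alpha> by (subst ennreal_mult) auto
  finally have "(\<integral>\<^sup>+\<theta>. I \<theta> \<partial>circ) \<noteq> \<infinity>"
    unfolding infinity_ennreal_def by (rule neq_top_trans[OF ennreal_neq_top])
  then have "AE \<theta> in circ. I \<theta> \<noteq> \<infinity>" using Im by (intro nn_integral_PInf_AE) auto
  then have "AE \<theta> in lborel. I \<theta> \<noteq> \<infinity>"
    by (rule AE_circ_periodic) (simp add: I_def \<phi>_def cis_mult[symmetric])
  then have "AE \<theta> in lborel. ((\<lambda>r. F (of_real r * cis \<theta>)) \<longlongrightarrow> boundary_value F \<theta>) (at_left 1)"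
  proof (rule eventually_mono)
    fix \<theta> assume fin: "I \<theta> \<noteq> \<infinity>"
    define g where "g x = indicator {0..<1} x *\<^sub>R (cis \<theta> * deriv F (of_real x * cis \<theta>))" for x :: real
    have "continuous_on {0..<1} (\<lambda>x. cis \<theta> * deriv F (of_real x * cis \<theta>))"
      by (intro continuous_intros continuous_on_compose2[OF dF]) (auto simp: norm_mult)
    then have [measurable]: "g \<in> borel_measurable borel"
      unfolding g_def by (intro borel_measurable_continuous_on_indicator) auto
    have ng: "norm (g x) = \<phi> x \<theta>" for x by (simp add: g_def \<phi>_def norm_mult)
    have gi: "integrable lborel g"
      using fin by (intro integrableI_bounded) (auto simp: ng I_def less_top)
    define L where "L = F 0 + (LINT x|lborel. g x)"
    have "((\<lambda>r. F (of_real r * cis \<theta>)) \<longlongrightarrow> L) (at_left 1)"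
    proof (rule tendsto_at_left_sequentially[of 0])
      fix S :: "nat \<Rightarrow> real" assume S: "\<And>n. S n < 1" "\<And>n. 0 < S n" "S \<longlonglongrightarrow> 1"
      have "(\<lambda>n. LINT x|lborel. indicator {0..S n} x *\<^sub>R g x) \<longlonglongrightarrow> (LINT x|lborel. g x)"
      proof (rule integral_dominated_convergence[where w = "\<lambda>x. norm (g x)"])
        show "AE x in lborel. (\<lambda>n. indicator {0..S n} x *\<^sub>R g x) \<longlonglongrightarrow> g x"
        proof (intro AE_I2)
          fix x :: real
          show "(\<lambda>n. indicator {0..S n} x *\<^sub>R g x) \<longlonglongrightarrow> g x"
          proof (cases "0 \<le> x \<and> x < 1")
            case True
            then have "eventually (\<lambda>n. x < S n) sequentially" using S(3) by (intro order_tendstoD) auto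
            then have "eventually (\<lambda>n. indicator {0..S n} x *\<^sub>R g x = g x) sequentially"
              by eventually_elim (use True in auto)
            then show ?thesis by (rule tendsto_eventually)
          qed (auto simp: g_def)
        qed
      qed (use gi in \<open>auto split: split_indicator\<close>)
      then have "(\<lambda>n. F 0 + (LINT x|lborel. indicator {0..S n} x *\<^sub>R g x)) \<longlonglongrightarrow> L"
        unfolding L_def by (intro tendsto_intros)
      moreover have "F 0 + (LINT x|lborel. indicator {0..S n} x *\<^sub>R g x) = F (of_real (S n) * cis \<theta>)" for n
      proof -
        have "(LINT x|lborel. indicator {0..S n} x *\<^sub>R g x) = (LINT x|lborel. indicator {0..S n} x *\<^sub>R (cis \<theta> * deriv F (of_real x * cis \<theta>)))"
          using S(1)[of n] by (intro Bochner_Integration.integral_cong) (auto simp: g_def split: split_indicator)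
        moreover have "F (of_real (S n) * cis \<theta>) - F 0 =
            (LINT x|lborel. indicator {0..S n} x *\<^sub>R (cis \<theta> * deriv F (of_real x * cis \<theta>)))"
          using radial_increment_FTC[OF F, of 0 "S n" \<theta>] S(1,2)[of n] by simp
        ultimately show ?thesis by (metis add.commute diff_add_cancel)
      qed
      ultimately show "(\<lambda>n. F (of_real (S n) * cis \<theta>)) \<longlonglongrightarrow> L" by simp
    qed simp
    then show "((\<lambda>r. F (of_real r * cis \<theta>)) \<longlongrightarrow> boundary_value F \<theta>) (at_left 1)"
      unfolding boundary_value_def by (simp add: tendsto_Lim)
  qed
  then show ?thesis unfolding has_boundary_values_def by (rule AE_completion)
qed

text \<open>The converse direction of the Hardy--Littlewood theorem: an increment by
  \<open>t\<close> is compared through the circle of radius \<open>1 - \<bar>t\<bar>\<close>. The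
  two radial increments are bounded by \<open>deriv_bound_increment\<close>, the angular one by the
  derivative bound on that circle, all of order \<open>\<bar>t\<bar> powr \<alpha>\<close>.\<close>

lemma mean_lipschitzI:
  fixes p \<alpha> :: real
  assumes p: "1 < p" and \<alpha>: "0 < \<alpha>" and F: "F holomorphic_on ball 0 1" and C: "0 < C"
    and b: "\<And>s. 0 \<le> s \<Longrightarrow> s < 1 \<Longrightarrow> Lp_le p (\<lambda>\<theta>. deriv F (of_real s * cis \<theta>)) (C * (1 - s) powr (\<alpha> - 1))"
  shows "F \<in> mean_lipschitz p \<alpha>"
proof -
  note incr = deriv_bound_increment[OF p \<alpha> F C b]
  have cont: "continuous_on UNIV (\<lambda>\<theta>. F (of_real r * cis \<theta>))" if "0 \<le> r" "r < 1" for r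
    using that by (intro continuous_on_circle_radius holomorphic_on_imp_continuous_on F)
  have H: "F \<in> hardy_space p"
  proof (rule hardy_spaceI(1)[OF F])
    fix r :: real assume r: "0 < r" "r < 1"
    have m: "(\<lambda>\<theta>. F (of_real r * cis \<theta>) - F (of_real 0 * cis \<theta>)) \<in> borel_measurable borel"
      using r by (intro borel_measurable_continuous_onI continuous_intros cont) auto
    show "Lp_le p (\<lambda>\<theta>. F (of_real r * cis \<theta>)) (4 * (C * (1 - 0) powr \<alpha> / \<alpha> + cmod (F 0)))"
    proof (rule Lp_le_add[OF incr[of 0 r] Lp_le_const[of "\<lambda>_. F 0"]])
      show "AE t in circ. cmod (F (of_real r * cis t)) \<le> cmod (F (of_real r * cis t) - F (of_real 0 * cis t)) + cmod (F 0)"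
        using norm_triangle_ineq2[of "F (of_real r * cis _)" "F 0"] by (intro AE_I2) (simp add: algebra_simps)
      show "(\<lambda>t. cmod (F (of_real r * cis t) - F (of_real 0 * cis t))) \<in> borel_measurable borel"
        using m by measurable
    qed (use r p in auto)
  qed (use p in simp)
  have bv: "has_boundary_values F" by (rule deriv_bound_radial_limits[OF p \<alpha> F C b])
  define R where "R n = 1 - 1 / (real n + 2)" for n :: nat
  have R: "0 < R n" "R n < 1" for n by (auto simp: R_def field_simps)
  have R1: "R \<longlonglongrightarrow> 1"
  proof -
    have "(\<lambda>n. inverse (real (Suc (Suc n)))) \<longlonglongrightarrow> 0"
      by (rule LIMSEQ_Suc[OF LIMSEQ_inverse_real_of_nat])
    then have "(\<lambda>n. 1 - inverse (real (Suc (Suc n)))) \<longlonglongrightarrow> 1 - 0" by (intro tendsto_intros)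
    then show ?thesis unfolding R_def by (simp add: inverse_eq_divide add.commute)
  qed
  have Rlim: "filterlim R (at_left 1) sequentially"
    using R1 R R(2)[THEN less_imp_neq] by (auto simp: filterlim_at)
  define B where "B \<theta> = lim (\<lambda>n. F (of_real (R n) * cis \<theta>))" for \<theta>
  have m [measurable]: "(\<lambda>\<theta>. F (of_real (R n) * cis \<theta>)) \<in> borel_measurable borel" for n
    using R[of n] by (intro borel_measurable_continuous_onI cont) auto
  have Bm [measurable]: "B \<in> borel_measurable borel" unfolding B_def by measurable
  have per: "B (\<theta> + 2 * pi) = B \<theta>" for \<theta> by (simp add: B_def cis_mult[symmetric])
  have bv': "AE \<theta> in lborel. ((\<lambda>r. F (of_real r * cis \<theta>)) \<longlongrightarrow> boundary_value F \<theta>) (at_left 1)"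
    using bv by (simp add: has_boundary_values_def AE_completion_iff)
  have lim0: "(\<lambda>n. F (of_real (R n) * cis \<theta>)) \<longlonglongrightarrow> B \<theta> \<and> boundary_value F \<theta> = B \<theta>"
    if "((\<lambda>r. F (of_real r * cis \<theta>)) \<longlongrightarrow> boundary_value F \<theta>) (at_left 1)" for \<theta>
    using filterlim_compose[OF that Rlim] by (auto simp: B_def limI)
  have lim: "AE \<theta> in circ. (\<lambda>n. F (of_real (R n) * cis \<theta>)) \<longlonglongrightarrow> B \<theta>"
    by (rule AE_circ_lborel, rule eventually_mono[OF bv']) (use lim0 in blast)
  have beq: "AE \<theta> in lborel. boundary_value F \<theta> = B \<theta>"
    by (rule eventually_mono[OF bv']) (use lim0 in blast)
  \<comment> \<open>\<open>deriv_bound_increment\<close> is uniform in the outer radius, so Fatou's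
    lemma carries it to the boundary function.\<close>
  have near: "Lp_le p (\<lambda>\<theta>. B \<theta> - F (of_real r * cis \<theta>)) (C * (1 - r) powr \<alpha> / \<alpha>)" if r: "0 \<le> r" "r < 1" for r
  proof -
    obtain n0 where n0: "\<And>n. n \<ge> n0 \<Longrightarrow> r \<le> R n"
      using order_tendstoD(1)[OF R1 r(2)] by (auto simp: eventually_sequentially intro: less_imp_le)
    have rm [measurable]: "(\<lambda>\<theta>. F (of_real r * cis \<theta>)) \<in> borel_measurable borel"
      using r by (intro borel_measurable_continuous_onI cont) auto
    show ?thesis
    proof (rule Lp_le_limit[where u = "\<lambda>n \<theta>. F (of_real (R (n + n0)) * cis \<theta>) - F (of_real r * cis \<theta>)"])
      show "AE t in circ. (\<lambda>n. F (of_real (R (n + n0)) * cis t) - F (of_real r * cis t)) \<longlonglongrightarrow> B t - F (of_real r * cis t)"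
        using lim by (rule eventually_mono) (intro tendsto_diff tendsto_const LIMSEQ_ignore_initial_segment)
      show "Lp_le p (\<lambda>\<theta>. F (of_real (R (n + n0)) * cis \<theta>) - F (of_real r * cis \<theta>)) (C * (1 - r) powr \<alpha> / \<alpha>)" for n
        using r R n0 by (intro incr) auto
      show "(\<lambda>t. cmod (F (of_real (R (n + n0)) * cis t) - F (of_real r * cis t))) \<in> borel_measurable borel" for n
        by measurable
    qed (use p in simp)
  qed
  \<comment> \<open>\<open>Lp_le_add\<close> is applied twice, each time with its factor 4.\<close>
  define K where "K = 4 * (4 * (C / \<alpha> + C) + C / \<alpha>)"
  have K: "0 < K" using C \<alpha> by (simp add: K_def add_pos_pos)
  have mod: "Lp_le p (\<lambda>\<theta>. B (\<theta> + t) - B \<theta>) (K * \<bar>t\<bar> powr \<alpha>)" if t: "t \<noteq> 0" "\<bar>t\<bar> \<le> 1 / 2" for t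
  proof -
    define r where "r = 1 - \<bar>t\<bar>"
    have r: "0 \<le> r" "r < 1" "1 - r = \<bar>t\<bar>" using t by (auto simp: r_def)
    have rm [measurable]: "(\<lambda>\<theta>. F (of_real r * cis (\<theta> + c))) \<in> borel_measurable borel" for c
      using r by (intro borel_measurable_continuous_onI continuous_on_compose2[OF cont[of r]] continuous_intros) auto
    have rm0 [measurable]: "(\<lambda>\<theta>. F (of_real r * cis \<theta>)) \<in> borel_measurable borel" using rm[of 0] by simp
    have 1: "Lp_le p (\<lambda>\<theta>. B (\<theta> + t) - F (of_real r * cis (\<theta> + t))) (C / \<alpha> * \<bar>t\<bar> powr \<alpha>)"
      using Lp_le_shift[OF near[OF r(1,2)], of t] r(3) per by (simp add: cis_mult[symmetric])
    have 2: "Lp_le p (\<lambda>\<theta>. F (of_real r * cis (\<theta> + t)) - F (of_real r * cis \<theta>)) (C * \<bar>t\<bar> powr \<alpha>)"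
    proof -
      have e: "Lp_le p (\<lambda>\<theta>. \<i> * euler_op F (of_real r * cis \<theta>)) (C * (1 - r) powr (\<alpha> - 1))"
      proof (rule Lp_le_mono[OF b[OF r(1,2)]])
        show "AE t in circ. cmod (\<i> * euler_op F (of_real r * cis t)) \<le> cmod (deriv F (of_real r * cis t))"
          using r by (intro AE_I2) (simp add: euler_op_def norm_mult mult_left_le_one_le)
      qed (use p in auto)
      have "Lp_le p (\<lambda>\<theta>. F (of_real r * cis (\<theta> + t)) - F (of_real r * cis \<theta>)) (\<bar>t\<bar> * (C * (1 - r) powr (\<alpha> - 1)))"
      proof (rule Lp_le_difference[OF p has_vector_derivative_angular[OF F r(1,2)] _ e])
        show "continuous_on UNIV (\<lambda>\<theta>. \<i> * euler_op F (of_real r * cis \<theta>))"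
          using r by (intro continuous_intros continuous_on_circle_radius holomorphic_on_imp_continuous_on holomorphic_euler_op F) auto
      qed (simp add: cis_mult[symmetric])
      moreover have "\<bar>t\<bar> * (C * (1 - r) powr (\<alpha> - 1)) = C * \<bar>t\<bar> powr \<alpha>"
        unfolding r(3) using t powr_add[of "\<bar>t\<bar>" 1 "\<alpha> - 1"] by simp
      ultimately show ?thesis by simp
    qed
    have 12: "Lp_le p (\<lambda>\<theta>. B (\<theta> + t) - F (of_real r * cis \<theta>)) (4 * (C / \<alpha> * \<bar>t\<bar> powr \<alpha> + C * \<bar>t\<bar> powr \<alpha>))"
    proof (rule Lp_le_add[OF 1 2])
      show "AE x in circ. cmod (B (x + t) - F (of_real r * cis x)) \<le>
         cmod (B (x + t) - F (of_real r * cis (x + t))) + cmod (F (of_real r * cis (x + t)) - F (of_real r * cis x))"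
      proof (rule AE_I2)
        fix x show "cmod (B (x + t) - F (of_real r * cis x)) \<le>
         cmod (B (x + t) - F (of_real r * cis (x + t))) + cmod (F (of_real r * cis (x + t)) - F (of_real r * cis x))"
          using norm_triangle_ineq[of "B (x + t) - F (of_real r * cis (x + t))" "F (of_real r * cis (x + t)) - F (of_real r * cis x)"] by simp
      qed
    qed (use p in simp, measurable)
    have "Lp_le p (\<lambda>\<theta>. B (\<theta> + t) - B \<theta>) (4 * (4 * (C / \<alpha> * \<bar>t\<bar> powr \<alpha> + C * \<bar>t\<bar> powr \<alpha>) + C / \<alpha> * \<bar>t\<bar> powr \<alpha>))"
    proof (rule Lp_le_add[OF 12])
      show "Lp_le p (\<lambda>\<theta>. B \<theta> - F (of_real r * cis \<theta>)) (C / \<alpha> * \<bar>t\<bar> powr \<alpha>)"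
        using near[OF r(1,2)] r(3) by simp
      show "AE x in circ. cmod (B (x + t) - B x) \<le> cmod (B (x + t) - F (of_real r * cis x)) + cmod (B x - F (of_real r * cis x))"
      proof (rule AE_I2)
        fix x show "cmod (B (x + t) - B x) \<le> cmod (B (x + t) - F (of_real r * cis x)) + cmod (B x - F (of_real r * cis x))"
          using norm_triangle_ineq4[of "B (x + t) - F (of_real r * cis x)" "B x - F (of_real r * cis x)"] by simp
      qed
    qed (use p in simp, measurable)
    then show ?thesis by (simp add: K_def algebra_simps)
  qed
  define T where "T t = (1 / (2 * pi) * (LINT \<theta>:{-pi..pi}|lebesgue.
     cmod (boundary_value F (\<theta> + t) - boundary_value F \<theta>) powr p)) powr (1 / p)" for t
  have T: "T t \<le> K * \<bar>t\<bar> powr \<alpha>" if t: "t \<noteq> 0" "\<bar>t\<bar> \<le> 1 / 2" for t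
  proof -
    have ae: "AE \<theta> in lborel. boundary_value F (\<theta> + t) = B (\<theta> + t) \<and> boundary_value F \<theta> = B \<theta>"
      using AE_lborel_shift[OF beq, of t] beq by auto
    define X where "X = (K * \<bar>t\<bar> powr \<alpha>) powr p"
    have "(LINT \<theta>:{-pi..pi}|lebesgue. cmod (boundary_value F (\<theta> + t) - boundary_value F \<theta>) powr p) \<le> 2 * pi * X"
      unfolding set_lebesgue_integral_def
    proof (rule integral_real_bounded)
      have "(\<integral>\<^sup>+\<theta>. ennreal (indicator {-pi..pi} \<theta> *\<^sub>R cmod (boundary_value F (\<theta> + t) - boundary_value F \<theta>) powr p) \<partial>lebesgue) =
        (\<integral>\<^sup>+\<theta>. ennreal (indicator {-pi..pi} \<theta> *\<^sub>R cmod (boundary_value F (\<theta> + t) - boundary_value F \<theta>) powr p) \<partial>lborel)"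
        by (rule nn_integral_completion)
      also have "\<dots> = (\<integral>\<^sup>+\<theta>. ennreal (cmod (B (\<theta> + t) - B \<theta>) powr p) * indicator {-pi..pi} \<theta> \<partial>lborel)"
        by (intro nn_integral_cong_AE eventually_mono[OF ae]) (auto split: split_indicator)
      also have "\<dots> = ennreal (2 * pi) * (ennreal (1 / (2 * pi)) * (\<integral>\<^sup>+\<theta>. ennreal (cmod (B (\<theta> + t) - B \<theta>) powr p) * indicator {-pi..pi} \<theta> \<partial>lborel))"
        by (simp add: mult.assoc[symmetric] ennreal_mult[symmetric])
      also have "\<dots> = ennreal (2 * pi) * (\<integral>\<^sup>+\<theta>. ennreal (cmod (B (\<theta> + t) - B \<theta>) powr p) \<partial>circ)"
        by (subst nn_integral_circ) auto
      also have "\<dots> \<le> ennreal (2 * pi) * ennreal X"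
        unfolding X_def using mod[OF t] by (intro mult_left_mono) (auto simp: Lp_le_def)
      also have "\<dots> = ennreal (2 * pi * X)" by (simp add: ennreal_mult X_def)
      finally show "(\<integral>\<^sup>+\<theta>. ennreal (indicator {-pi..pi} \<theta> *\<^sub>R cmod (boundary_value F (\<theta> + t) - boundary_value F \<theta>) powr p) \<partial>lebesgue) \<le> ennreal (2 * pi * X)" .
    qed (simp add: X_def)
    then have "1 / (2 * pi) * (LINT \<theta>:{-pi..pi}|lebesgue. cmod (boundary_value F (\<theta> + t) - boundary_value F \<theta>) powr p) \<le> X"
      by (simp add: field_simps)
    moreover have "0 \<le> (LINT \<theta>:{-pi..pi}|lebesgue. cmod (boundary_value F (\<theta> + t) - boundary_value F \<theta>) powr p)"
      unfolding set_lebesgue_integral_def by (intro integral_nonneg_AE AE_I2) auto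
    ultimately have "T t \<le> X powr (1 / p)" unfolding T_def using p by (intro powr_mono2) auto
    also have "\<dots> = K * \<bar>t\<bar> powr \<alpha>" using p K by (simp add: X_def powr_powr)
    finally show ?thesis .
  qed
  have mm: "norm (mean_modulus p \<delta> F) \<le> K * norm (\<delta> powr \<alpha>)" if \<delta>: "0 < \<delta>" "\<delta> < 1 / 2" for \<delta>
  proof -
    have TK: "T t \<le> K * \<delta> powr \<alpha>" if "t \<in> {t. 0 < \<bar>t\<bar> \<and> \<bar>t\<bar> \<le> \<delta>}" for t
    proof -
      have "T t \<le> K * \<bar>t\<bar> powr \<alpha>" using that \<delta> by (intro T) auto
      also have "\<dots> \<le> K * \<delta> powr \<alpha>" using that K \<alpha> by (intro mult_left_mono powr_mono2) auto
      finally show ?thesis .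
    qed
    have ne: "\<delta> \<in> {t. 0 < \<bar>t\<bar> \<and> \<bar>t\<bar> \<le> \<delta>}" using \<delta> by simp
    have eq: "mean_modulus p \<delta> F = (SUP t\<in>{t. 0 < \<bar>t\<bar> \<and> \<bar>t\<bar> \<le> \<delta>}. T t)" by (simp add: mean_modulus_def T_def)
    have "mean_modulus p \<delta> F \<le> K * \<delta> powr \<alpha>" unfolding eq using TK ne by (intro cSUP_least) auto
    \<comment> \<open>Nonnegativity is inherited from the single member \<open>T \<delta>\<close>,
      because the supremum is that of a bounded set.\<close>
    moreover have "0 \<le> mean_modulus p \<delta> F"
    proof -
      have "T \<delta> \<le> mean_modulus p \<delta> F" unfolding eq
        using ne by (intro cSUP_upper bdd_aboveI2[OF TK]) auto
      then show ?thesis by (rule order_trans[rotated]) (simp add: T_def)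
    qed
    ultimately show ?thesis by simp
  qed
  have "(\<lambda>\<delta>. mean_modulus p \<delta> F) \<in> O[at_right 0](\<lambda>\<delta>. \<delta> powr \<alpha>)"
    by (rule bigoI[where c = K]) (use mm in \<open>auto simp: eventually_at_right[of 0 1] intro!: exI[of _ "1/2"]\<close>)
  then show ?thesis using H bv by (simp add: mean_lipschitz_def)
qed

theorem theorem1:
  fixes \<eta> :: "nat \<Rightarrow> complex"
  shows
    "(\<forall>p::real. 1 < p \<longrightarrow> rhaly_bounded p \<eta> \<longrightarrow>
        analytic_in_disc (Abs_fps \<eta>) \<and>
        (\<lambda>r. integral_mean p r (deriv (symbol_fun \<eta>)))
          \<in> O[at_left 1](\<lambda>r. ln (1 / (1 - r)) / (1 - r) powr (1 - 1 / p))) \<and>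
     (\<forall>p::real. 1 < p \<and> p \<le> 2 \<longrightarrow> symbol_in \<eta> (mean_lipschitz p (1 / p)) \<longrightarrow>
        rhaly_bounded p \<eta>) \<and>
     (\<forall>p::real. 2 < p \<longrightarrow> (\<exists>q\<in>{2<..<p}. symbol_in \<eta> (mean_lipschitz q (1 / q))) \<longrightarrow>
        rhaly_bounded p \<eta>) \<and>
     (rhaly_bounded 2 \<eta> \<longleftrightarrow> symbol_in \<eta> (mean_lipschitz 2 (1 / 2)))"
proof -
  have sh: "symbol_fun \<eta> holomorphic_on ball 0 1" if "analytic_in_disc (Abs_fps \<eta>)"
    unfolding symbol_fun_def by (rule holomorphic_eval_fps_disc[OF that])
  have a: "(\<lambda>r. integral_mean p r (deriv (symbol_fun \<eta>)))
      \<in> O[at_left 1](\<lambda>r. ln (1 / (1 - r)) / (1 - r) powr (1 - 1 / p))"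
    if p: "1 < p" and R: "rhaly_bounded p \<eta>" for p :: real
  proof -
    have \<eta>: "analytic_in_disc (Abs_fps \<eta>)" using rhaly_bounded_imp_analytic[OF R] p by simp
    have dF: "deriv (symbol_fun \<eta>) holomorphic_on ball 0 1" using sh[OF \<eta>] by (intro holomorphic_intros) auto
    obtain C where C: "0 < C" "\<And>s. 0 \<le> s \<Longrightarrow> s < 1 \<Longrightarrow>
        Lp_le p (\<lambda>\<theta>. deriv (symbol_fun \<eta>) (of_real s * cis \<theta>)) (C * (1 - s) powr (1 / p - 1))"
      using rhaly_bounded_imp_deriv_bound[OF R p] by blast
    \<comment> \<open>From \<open>1 - exp (-1)\<close> on one has
      \<open>ln (1 / (1 - r)) \<ge> 1\<close>, so the bound without the logarithm implies the stated
      one.\<close>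
    have "norm (integral_mean p r (deriv (symbol_fun \<eta>))) \<le> C * norm (ln (1 / (1 - r)) / (1 - r) powr (1 - 1 / p))"
      if r: "1 - exp (-1) < r" "r < 1" for r
    proof -
      have "exp (- 1 :: real) \<le> 1" by simp
      with r have r0: "0 \<le> r" by linarith
      have "integral_mean p r (deriv (symbol_fun \<eta>)) \<le> C * (1 - r) powr (1 / p - 1)"
        using p r r0 by (intro integral_mean_le C continuous_on_circle_radius holomorphic_on_imp_continuous_on dF) auto
      also have "(1 - r) powr (1 / p - 1) = 1 / (1 - r) powr (1 - 1 / p)"
        using powr_minus_divide[of "1 - r" "1 - 1 / p"] by simp
      also have "C * (1 / (1 - r) powr (1 - 1 / p)) \<le> C * (ln (1 / (1 - r)) / (1 - r) powr (1 - 1 / p))"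
      proof (intro mult_left_mono divide_right_mono)
        have "ln (1 - r) \<le> ln (exp (-1))" using r by (subst ln_le_cancel_iff) auto
        then show "1 \<le> ln (1 / (1 - r))" using r by (simp add: ln_div)
      qed (use C in auto)
      finally have "integral_mean p r (deriv (symbol_fun \<eta>)) \<le> C * (ln (1 / (1 - r)) / (1 - r) powr (1 - 1 / p))" .
      also have "\<dots> \<le> C * norm (ln (1 / (1 - r)) / (1 - r) powr (1 - 1 / p))"
        using C by (intro mult_left_mono) (auto simp only: real_norm_def abs_ge_self less_imp_le)
      finally show ?thesis by (simp only: real_norm_def abs_of_nonneg integral_mean_nonneg)
    qed
    then show ?thesis
      by (intro bigoI[where c = C]) (auto simp: eventually_at_left[of 0 1] intro!: exI[of _ "1 - exp (-1)"])
  qed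
  have bound: "\<exists>C>0. \<forall>s. 0 \<le> s \<longrightarrow> s < 1 \<longrightarrow>
      Lp_le q (\<lambda>\<theta>. deriv (symbol_fun \<eta>) (of_real s * cis \<theta>)) (C * (1 - s) powr (1 / q - 1))"
    if q: "1 < q" and "symbol_in \<eta> (mean_lipschitz q (1 / q))" for q :: real
  proof -
    have "1 / q < 2" using q by (simp add: field_simps)
    moreover have "0 < 1 / q" using q by simp
    moreover have "symbol_fun \<eta> \<in> mean_lipschitz q (1 / q)" using that(2) by (simp add: symbol_in_def)
    ultimately obtain C where "0 < C" "\<And>s. 0 \<le> s \<Longrightarrow> s < 1 \<Longrightarrow>
        Lp_le q (\<lambda>\<theta>. deriv (symbol_fun \<eta>) (of_real s * cis \<theta>)) (C * (1 - s) powr (1 / q - 1))"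
      using lipschitz_deriv_bound[OF q] by blast
    then show ?thesis by blast
  qed
  have b: "rhaly_bounded p \<eta>" if "1 < p" "p \<le> 2" "symbol_in \<eta> (mean_lipschitz p (1 / p))" for p :: real
    using bound[OF that(1,3)] rhaly_bounded_le_2[OF that(1,2)] that(3) unfolding symbol_in_def by blast
  have c: "rhaly_bounded p \<eta>" if "2 < q" "q < p" "symbol_in \<eta> (mean_lipschitz q (1 / q))" for p q :: real
  proof -
    have "1 < q" using that by simp
    then show ?thesis
      using bound[OF _ that(3)] rhaly_bounded_gt[OF _ that(2)] that(3) unfolding symbol_in_def by blast
  qed
  have d: "symbol_in \<eta> (mean_lipschitz 2 (1 / 2))" if R: "rhaly_bounded 2 \<eta>"
  proof -
    have \<eta>: "analytic_in_disc (Abs_fps \<eta>)" using rhaly_bounded_imp_analytic[OF R] by simp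
    obtain C where C: "0 < C" "\<And>s. 0 \<le> s \<Longrightarrow> s < 1 \<Longrightarrow>
        Lp_le 2 (\<lambda>\<theta>. deriv (symbol_fun \<eta>) (of_real s * cis \<theta>)) (C * (1 - s) powr (1 / 2 - 1))"
      using rhaly_bounded_imp_deriv_bound[OF R] by auto
    have "symbol_fun \<eta> \<in> mean_lipschitz 2 (1 / 2)"
      by (rule mean_lipschitzI[OF _ _ sh[OF \<eta>] C]) auto
    then show ?thesis using \<eta> by (simp add: symbol_in_def)
  qed
  show ?thesis
  proof (intro conjI allI impI iffI; (elim conjE bexE)?)
    show "analytic_in_disc (Abs_fps \<eta>)" if "1 < p" "rhaly_bounded p \<eta>" for p :: real
      by (rule rhaly_bounded_imp_analytic[OF that(2)]) (use that(1) in simp)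
    show "rhaly_bounded p \<eta>" if "q \<in> {2<..<p}" "symbol_in \<eta> (mean_lipschitz q (1 / q))" for p q :: real
      using c[of q p] that by simp
    show "rhaly_bounded 2 \<eta>" if "symbol_in \<eta> (mean_lipschitz 2 (1 / 2))"
      using b[of 2] that by simp
  qed (use a b d in blast)+
qed

end
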